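(* Let $Z$ be a $\mathbb{Z}$-group (an elementary extension of $(\mathbb{Z},0,+,-,<)$ in the language $L=(0,+,-,<)$ of ordered abelian groups). Then the semiring homomorphism $\Phi\colon \mathrm{Sym}\, N_\infty \to K(Z)$, determined by $\Phi(a)=[[0,a)]$ for $a\in N_\infty$, is a semiring isomorphism. Moreover, $\Phi$ restricts to a semiring isomorphism $\mathrm{Sym}\, N \to K_b(Z)$.
   Context: Fix an elementary extension $\mathcal Z\succ Z$ which is $\kappa^+$-saturated for some $\kappa\ge |Z|$. "Definable" means $L$-definable in $\mathcal Z$ with parameters from $\mathcal Z$; "$Z$-definable" means definable with parameters from $Z$; definable sets are subsets of some $\mathcal Z^n$. For $a\le b$ in $\mathcal Z$, $[a,b)=\{x\in\mathcal Z: a\le x<b\}$, and $[0,\infty)=\{x\in \mathcal Z: x\ge 0\}$. Set $N=\{a\in Z: a\ge 0\}$ and $N_\infty=N\cup\{\infty\}$, a commutative monoid with $x+\infty=\infty$. A definable set is bounded if it is contained in $[-a,a)^n$ for some $a\in\mathcal Z$, $a\ge 0$. For a commutative monoid $G$ (written additively) with a monoid homomorphism $s\colon(\mathbb N,+)\to G$, $\mathrm{Sym}\, G$ denotes the commutative semiring (with $0$ and $1$) freely generated by symbols $[g]$, $g\in G$, modulo the relations $[g]+[g']=[g+g']$, $[0]=0$, $[s(1)]=1$. For $G=N$ and $G=N_\infty$, $s$ is the inclusion of $\mathbb N\subseteq \mathbb Z\subseteq Z$. The natural map $\mathrm{Sym}\,N\to\mathrm{Sym}\,N_\infty$ is injective,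 and $\mathrm{Sym}\,N$ is identified with its image; elements $a\in N_\infty$ are identified with $[a]$. $K(Z)$ is the Grothendieck semiring of $Z$-definable sets: it is generated as a commutative monoid by symbols $[X]$ for $Z$-definable sets $X$, with relations $[X_1\cup X_2]=[X_1]+[X_2]$ for disjoint $X_1,X_2$, and $[X_1]=[X_2]$ whenever there is a $Z$-definable bijection $X_1\to X_2$; multiplication is $[X_1]\cdot[X_2]=[X_1\times X_2]$. $K_b(Z)$ is the corresponding sub-semiring of bounded $Z$-definable sets. *)

theory Defs
  imports
    "HOL-Algebra.Ring"
    "HOL-Library.Multiset"
    "HOL-Library.Poly_Mapping"
    "HOL-Library.Extended"
begin

unbundle cardinal_syntax

section \<open>First-order logic in the language (0, +, -, <)\<close>

text \<open>
  Terms and formulas may contain parameters, namely elements of type \<open>'c\<close>. Variables are de Bruijn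
  indices: \<open>Ex\<close> binds index 0 and shifts the other ones. The symbol \<open>-\<close> is read as unary minus.
\<close>

datatype (params_tm: 'c) tm =
    Var nat | Par 'c | Zero | Add "'c tm" "'c tm" | Neg "'c tm"
  for map: map_tm

datatype (params: 'c) fm =
    Eq "'c tm" "'c tm" | Less "'c tm" "'c tm"
  | Not "'c fm" | And "'c fm" "'c fm" | Ex "'c fm"
  for map: map_fm

primrec fv_tm :: "'c tm \<Rightarrow> nat set" where
  "fv_tm (Var i) = {i}"
| "fv_tm (Par c) = {}"
| "fv_tm Zero = {}"
| "fv_tm (Add t u) = fv_tm t \<union> fv_tm u"
| "fv_tm (Neg t) = fv_tm t"

primrec fv :: "'c fm \<Rightarrow> nat set" where
  "fv (Eq t u) = fv_tm t \<union> fv_tm u"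
| "fv (Less t u) = fv_tm t \<union> fv_tm u"
| "fv (Not \<phi>) = fv \<phi>"
| "fv (And \<phi> \<psi>) = fv \<phi> \<union> fv \<psi>"
| "fv (Ex \<phi>) = {i. Suc i \<in> fv \<phi>}"

text \<open>
  An L-structure is (the universe of) a type with its operations. All structures considered
  are elementary extensions of the integers, hence linearly ordered abelian groups.
\<close>

primrec val :: "(nat \<Rightarrow> 'a::linordered_ab_group_add) \<Rightarrow> 'a tm \<Rightarrow> 'a" where
  "val e (Var i) = e i"
| "val e (Par c) = c"
| "val e Zero = 0"
| "val e (Add t u) = val e t + val e u"
| "val e (Neg t) = - val e t"

primrec sat :: "(nat \<Rightarrow> 'a::linordered_ab_group_add) \<Rightarrow> 'a fm \<Rightarrow> bool" where
  "sat e (Eq t u) \<longleftrightarrow> val e t = val e u"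
| "sat e (Less t u) \<longleftrightarrow> val e t < val e u"
| "sat e (Not \<phi>) \<longleftrightarrow> \<not> sat e \<phi>"
| "sat e (And \<phi> \<psi>) \<longleftrightarrow> sat e \<phi> \<and> sat e \<psi>"
| "sat e (Ex \<phi>) \<longleftrightarrow> (\<exists>x. sat (case_nat x e) \<phi>)"

definition elementary_embedding ::
    "('a::linordered_ab_group_add \<Rightarrow> 'b::linordered_ab_group_add) \<Rightarrow> bool" where
  "elementary_embedding j \<longleftrightarrow>
     (\<forall>(\<phi> :: 'a fm) (e :: nat \<Rightarrow> 'a). sat e \<phi> \<longleftrightarrow> sat (j \<circ> e) (map_fm j \<phi>))"

text \<open>
  \<open>\<kappa>\<close>-saturation of the structure \<open>'m\<close>: a set of formulas in one variable over fewer than \<open>\<kappa>\<close>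
  parameters that is finitely satisfiable in \<open>'m\<close> is realized in \<open>'m\<close>.
\<close>

definition saturated :: "'k rel \<Rightarrow> 'm::linordered_ab_group_add itself \<Rightarrow> bool" where
  "saturated \<kappa> (T :: 'm itself) \<longleftrightarrow>
     (\<forall>(A :: 'm set) (p :: 'm fm set).
        |A| <o \<kappa> \<longrightarrow>
        (\<forall>\<phi>\<in>p. params \<phi> \<subseteq> A \<and> fv \<phi> \<subseteq> {0}) \<longrightarrow>
        (\<forall>q. q \<subseteq> p \<longrightarrow> finite q \<longrightarrow> (\<exists>x. \<forall>\<phi>\<in>q. sat (\<lambda>_. x) \<phi>)) \<longrightarrow>
        (\<exists>x. \<forall>\<phi>\<in>p. sat (\<lambda>_. x) \<phi>))"


section \<open>Definable sets\<close>

text \<open>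
  The \<open>n\<close>-th power of \<open>'m\<close> is the set of lists of length \<open>n\<close>. Hence the Cartesian product is formed
  by appending lists, and the empty subsets of the various powers are the same object.
\<close>

definition definable_in :: "'m::linordered_ab_group_add set \<Rightarrow> nat \<Rightarrow> 'm list set \<Rightarrow> bool" where
  "definable_in A n X \<longleftrightarrow>
     (\<exists>\<phi>. params \<phi> \<subseteq> A \<and> fv \<phi> \<subseteq> {..<n} \<and> X = {xs. length xs = n \<and> sat (\<lambda>i. xs ! i) \<phi>})"

definition definable :: "'m::linordered_ab_group_add set \<Rightarrow> 'm list set \<Rightarrow> bool" where
  "definable A X \<longleftrightarrow> (\<exists>n. definable_in A n X)"

definition definable_bij ::
    "'m::linordered_ab_group_add set \<Rightarrow> 'm list set \<Rightarrow> 'm list set \<Rightarrow> bool" where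
  "definable_bij A X Y \<longleftrightarrow>
     (\<exists>f. bij_betw f X Y \<and> definable A {xs @ f xs | xs. xs \<in> X})"

definition set_prod :: "'m list set \<Rightarrow> 'm list set \<Rightarrow> 'm list set" where
  "set_prod X Y = {xs @ ys | xs ys. xs \<in> X \<and> ys \<in> Y}"

definition bounded_set :: "'m::linordered_ab_group_add list set \<Rightarrow> bool" where
  "bounded_set X \<longleftrightarrow> (\<exists>a\<ge>0. \<forall>xs\<in>X. \<forall>x\<in>set xs. - a \<le> x \<and> x < a)"


section \<open>Semiring homomorphisms\<close>

text \<open>\<^const>\<open>ring_hom\<close> does not mention zero, which for semirings has to be required.\<close>

definition semiring_hom :: "('a, 'x) ring_scheme \<Rightarrow> ('b, 'y) ring_scheme \<Rightarrow> ('a \<Rightarrow> 'b) set" where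
  "semiring_hom R S = {h \<in> ring_hom R S. h \<zero>\<^bsub>R\<^esub> = \<zero>\<^bsub>S\<^esub>}"

definition semiring_iso :: "('a, 'x) ring_scheme \<Rightarrow> ('b, 'y) ring_scheme \<Rightarrow> ('a \<Rightarrow> 'b) set" where
  "semiring_iso R S = {h \<in> semiring_hom R S. bij_betw h (carrier R) (carrier S)}"


section \<open>The semiring Sym G\<close>

text \<open>
  \<open>G\<close> is a submonoid of the ambient commutative monoid \<open>'g\<close>. The free commutative semiring on the
  symbols \<open>[g]\<close>, \<open>g \<in> G\<close>, is the semiring of polynomials with natural coefficients in these
  symbols; a monomial is a finite multiset of symbols.
\<close>

type_synonym 'g sym_poly = "'g multiset \<Rightarrow>\<^sub>0 nat"

definition sym_polys :: "'g set \<Rightarrow> 'g sym_poly set" where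
  "sym_polys G = {p. \<forall>m \<in> Poly_Mapping.keys p. set_mset m \<subseteq> G}"

definition symb :: "'g \<Rightarrow> 'g sym_poly" where
  "symb g = Poly_Mapping.single {#g#} 1"

inductive sym_eq :: "'g::comm_monoid_add set \<Rightarrow> (nat \<Rightarrow> 'g) \<Rightarrow> 'g sym_poly \<Rightarrow> 'g sym_poly \<Rightarrow> bool"
  for G s where
  refl: "p \<in> sym_polys G \<Longrightarrow> sym_eq G s p p"
| sym: "sym_eq G s p q \<Longrightarrow> sym_eq G s q p"
| trans: "sym_eq G s p q \<Longrightarrow> sym_eq G s q r \<Longrightarrow> sym_eq G s p r"
| add: "sym_eq G s p p' \<Longrightarrow> sym_eq G s q q' \<Longrightarrow> sym_eq G s (p + q) (p' + q')"
| mult: "sym_eq G s p p' \<Longrightarrow> sym_eq G s q q' \<Longrightarrow> sym_eq G s (p * q) (p' * q')"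
| symb_add: "g \<in> G \<Longrightarrow> g' \<in> G \<Longrightarrow> sym_eq G s (symb g + symb g') (symb (g + g'))"
| symb_zero: "sym_eq G s (symb 0) 0"
| symb_one: "sym_eq G s (symb (s 1)) 1"

definition sym_class :: "'g::comm_monoid_add set \<Rightarrow> (nat \<Rightarrow> 'g) \<Rightarrow> 'g sym_poly \<Rightarrow> 'g sym_poly set" where
  "sym_class G s p = {q. sym_eq G s p q}"

definition Sym :: "'g::comm_monoid_add set \<Rightarrow> (nat \<Rightarrow> 'g) \<Rightarrow> 'g sym_poly set ring" where
  "Sym G s =
     \<lparr>carrier = sym_class G s ` sym_polys G,
      monoid.mult = (\<lambda>C D. \<Union>p\<in>C. \<Union>q\<in>D. sym_class G s (p * q)),
      one = sym_class G s 1,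
      zero = sym_class G s 0,
      add = (\<lambda>C D. \<Union>p\<in>C. \<Union>q\<in>D. sym_class G s (p + q))\<rparr>"

text \<open>The natural map to \<open>Sym G'\<close> from \<open>Sym G\<close> for a submonoid \<open>G\<close> of \<open>G'\<close>.\<close>

definition sym_incl ::
    "'g::comm_monoid_add set \<Rightarrow> (nat \<Rightarrow> 'g) \<Rightarrow> 'g sym_poly set \<Rightarrow> 'g sym_poly set" where
  "sym_incl G' s C = (\<Union>p\<in>C. sym_class G' s p)"

text \<open>Both monoids live in the type \<^typ>\<open>'z extended\<close>, whose element \<^const>\<open>Minf\<close> is not used.\<close>

definition N :: "'z::linordered_ab_group_add extended set" where
  "N = {Fin a | a. 0 \<le> a}"

definition N_inf :: "'z::linordered_ab_group_add extended set" where
  "N_inf = N \<union> {Pinf}"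


section \<open>Grothendieck semirings of definable sets\<close>

text \<open>
  The free commutative monoid on the symbols \<open>[X]\<close> consists of the finite multisets of definable
  sets. The relation \<open>[X\<^sub>1 \<union> X\<^sub>2] = [X\<^sub>1] + [X\<^sub>2]\<close> is understood for disjoint unions of finite
  families, including the empty one: \<open>[{}] = 0\<close> does not follow from the binary case.
\<close>

inductive K_eq ::
    "'m::linordered_ab_group_add set \<Rightarrow> 'm list set multiset \<Rightarrow> 'm list set multiset \<Rightarrow> bool"
  for A where
  refl: "(\<forall>X \<in># M. definable A X) \<Longrightarrow> K_eq A M M"
| sym: "K_eq A M M' \<Longrightarrow> K_eq A M' M"
| trans: "K_eq A M M' \<Longrightarrow> K_eq A M' M'' \<Longrightarrow> K_eq A M M''"
| add: "K_eq A M M' \<Longrightarrow> K_eq A P P' \<Longrightarrow> K_eq A (M + P) (M' + P')"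
| empty: "K_eq A {#{}#} {#}"
| union: "definable_in A n X1 \<Longrightarrow> definable_in A n X2 \<Longrightarrow> X1 \<inter> X2 = {} \<Longrightarrow>
    K_eq A {#X1 \<union> X2#} {#X1, X2#}"
| bij: "definable A X1 \<Longrightarrow> definable A X2 \<Longrightarrow> definable_bij A X1 X2 \<Longrightarrow> K_eq A {#X1#} {#X2#}"

definition K_class ::
    "'m::linordered_ab_group_add set \<Rightarrow> 'm list set multiset \<Rightarrow> 'm list set multiset set" where
  "K_class A M = {M'. K_eq A M M'}"

definition mset_prod :: "'m list set multiset \<Rightarrow> 'm list set multiset \<Rightarrow> 'm list set multiset" where
  "mset_prod M P = (\<Sum>X\<in>#M. image_mset (set_prod X) P)"

text \<open>\<open>K A\<close> is built from the sets definable with parameters from \<open>A\<close>. Its unit is the class of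
  the point, i.e. of the zeroth power of \<open>'m\<close>.\<close>

definition K :: "'m::linordered_ab_group_add set \<Rightarrow> 'm list set multiset set ring" where
  "K A =
     \<lparr>carrier = K_class A ` {M. \<forall>X \<in># M. definable A X},
      monoid.mult = (\<lambda>C D. \<Union>M\<in>C. \<Union>P\<in>D. K_class A (mset_prod M P)),
      one = K_class A {#{[]}#},
      zero = K_class A {#},
      add = (\<lambda>C D. \<Union>M\<in>C. \<Union>P\<in>D. K_class A (M + P))\<rparr>"

definition K_b :: "'m::linordered_ab_group_add set \<Rightarrow> 'm list set multiset set ring" where
  "K_b A = (K A)\<lparr>carrier := K_class A ` {M. \<forall>X \<in># M. definable A X \<and> bounded_set X}\<rparr>"

text \<open>
  The subset \<open>[0, a)\<close> of the first power of \<open>'m\<close>, for \<open>a\<close> in \<^const>\<open>N_inf\<close> and an embedding \<open>j\<close>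
  into \<open>'m\<close>; the value at \<^const>\<open>Minf\<close> is irrelevant.
\<close>

fun init_interval :: "('z \<Rightarrow> 'm::linordered_ab_group_add) \<Rightarrow> 'z extended \<Rightarrow> 'm list set" where
  "init_interval j (Fin a) = {[x] | x. 0 \<le> x \<and> x < j a}"
| "init_interval j Pinf = {[x] | x. 0 \<le> x}"
| "init_interval j Minf = {}"

end

theory Submission
imports Defs "HOL-Computational_Algebra.Formal_Power_Series" "HOL-Computational_Algebra.Polynomial" "HOL-Library.Extended_Nat"
begin

text \<open>Quantifier elimination decomposes a definable set into images of products of simplices
and rays, which gives surjectivity. For injectivity on bounded sets, a derivation of an equality of
classes is specialized to the integers, where it becomes an equality of cardinalities, i.e. of values
of polynomials; translating the parameters by integers makes it a polynomial identity. In general,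
saturation provides generic points of boxes, so that every monomial of one side is dominated by one
of the other; monomials dominated by an unbounded one are absorbed, and the refinement property
reduces the remaining terms to the bounded case.\<close>

section \<open>Integer multiples in ordered abelian groups\<close>

text \<open>A simplex has the size of a binomial coefficient, and its denominator cannot be inverted
  in the Grothendieck semiring; therefore the length is first divided by \<open>k\<close> with
  remainder, and an identity of power series, in which \<open>k\<close> can be cancelled, is
  evaluated afterwards. Nor can summands be cancelled: a ray is the disjoint union of two copies of
  itself, so an equality of classes does not separate into bounded and unbounded parts, and the
  refinement property replaces cancellation.

  A derivation uses finitely many parameters, but integral relations between them restrict their
  specializations. They are therefore expressed through a basis of positive elements that contains
  the unit, with natural coefficients for the nonnegative ones; it comes from a Euclidean algorithm.
  Independence of the basis makes its translation by suitable integers harmless.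

  For unbounded sets the invariant is the set of definable closures of points. Definable bijections
  preserve closures, so a generic point of a box on one side has the closure of a point of a box on
  the other side.\<close>

definition smul :: "int => 'a::linordered_ab_group_add => 'a"  (infixr \<open>*.\<close> 75) where
 "k *. x = (if 0 <= k then ((+) x ^^ nat k) 0 else - ((+) x ^^ nat (- k)) 0)"

lemma smul_0 [simp]: "0 *. x = 0"
 by (simp add: smul_def)

lemma smul_step: "(k + 1) *. x = k *. x + x"
proof (cases "0 <= k")
 case True
 hence "nat (k + 1) = Suc (nat k)" by simp
 with True show ?thesis by (simp add: smul_def add.commute)
next
 case False
 hence "nat (- k) = Suc (nat (- (k + 1)))" by simp
 with False show ?thesis by (auto simp: smul_def algebra_simps)
qed

lemma smul_add_left: "(k + l) *. x = k *. x + l *. x"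
proof (induction l rule: int_induct[where k = 0])
 case (step1 i)
 thus ?case using smul_step[of "k + i" x] smul_step[of i x] by (simp add: algebra_simps)
next
 case (step2 i)
 thus ?case using smul_step[of "k + (i - 1)" x] smul_step[of "i - 1" x]
 by (simp add: algebra_simps)
qed simp

lemma smul_one [simp]: "1 *. x = x"
 using smul_step[of 0 x] by simp

lemma smul_minus_left [simp]: "(- k) *. x = - (k *. x)"
 using smul_add_left[of k "- k" x] by (simp add: eq_neg_iff_add_eq_0 add.commute)

lemma smul_diff_left: "(k - l) *. x = k *. x - l *. x"
 using smul_add_left[of k "- l" x] by simp

lemma smul_add_right: "k *. (x + y) = k *. x + k *. y"
proof (induction k rule: int_induct[where k = 0])
 case (step1 i)
 thus ?case by (simp only: smul_step) (simp add: algebra_simps)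
next
 case (step2 i)
 thus ?case by (simp only: smul_diff_left) (simp add: algebra_simps)
qed simp

lemma smul_0_right [simp]: "k *. 0 = 0"
 using smul_add_right[of k 0 0] by simp

lemma smul_minus_right [simp]: "k *. (- x) = - (k *. x)"
 using smul_add_right[of k x "- x"] by (simp add: eq_neg_iff_add_eq_0 add.commute)

lemma smul_diff_right: "k *. (x - y) = k *. x - k *. y"
 using smul_add_right[of k x "- y"] by simp

lemma smul_smul: "k *. l *. x = (k * l) *. x"
proof (induction k rule: int_induct[where k = 0])
 case (step1 i)
 thus ?case by (simp add: smul_step algebra_simps smul_add_left)
next
 case (step2 i)
 thus ?case by (simp add: smul_diff_left algebra_simps)
qed simp

lemma smul_sum_right: "k *. (\<Sum>i\<in>I. f i) = (\<Sum>i\<in>I. k *. f i)"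
 by (induction I rule: infinite_finite_induct) (simp_all add: smul_add_right)

lemma smul_sum_left: "(\<Sum>i\<in>I. f i) *. x = (\<Sum>i\<in>I. f i *. x)"
 by (induction I rule: infinite_finite_induct) (simp_all add: smul_add_left)

lemma smul_nonneg: "0 <= k ==> 0 <= x ==> 0 <= k *. x"
 by (induction k rule: int_ge_induct) (simp_all add: smul_step)

lemma smul_pos: "0 < k ==> 0 < x ==> 0 < k *. x"
proof (induction k rule: int_gr_induct)
 case (step i)
 thus ?case by (simp add: smul_step add_pos_pos)
qed simp

lemma smul_mono: "0 <= k ==> x <= y ==> k *. x <= k *. y"
 using smul_nonneg[of k "y - x"] by (simp add: smul_diff_right)

lemma smul_strict_mono: "0 < k ==> x < y ==> k *. x < k *. y"
 using smul_pos[of k "y - x"] by (simp add: smul_diff_right)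

lemma smul_le_iff [simp]: "0 < k ==> k *. x <= k *. y \<longleftrightarrow> x <= y"
 using smul_mono[of k x y] smul_strict_mono[of k y x] by (meson linorder_not_le order_less_imp_le)

lemma smul_less_iff [simp]: "0 < k ==> k *. x < k *. y \<longleftrightarrow> x < y"
 using smul_le_iff[of k y x] by (simp add: linorder_not_le[symmetric] del: smul_le_iff)

lemma smul_mono_left: "k <= l ==> 0 <= x ==> k *. x <= l *. x"
 using smul_nonneg[of "l - k" x] by (simp add: smul_diff_left)

lemma smul_less_left: "k < l ==> 0 < x ==> k *. x < l *. x"
 using smul_pos[of "l - k" x] by (simp add: smul_diff_left)

lemma smul_eq_0_iff: "k *. x = 0 \<longleftrightarrow> k = 0 | x = 0"
proof -
 have *: "k *. x = 0 \<longleftrightarrow> x = 0" if "0 < k" for k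
 using smul_pos[of k x] smul_pos[of k "- x"] that by (cases x "0 :: 'a" rule: linorder_cases) auto
 show ?thesis using *[of k] *[of "- k"] by (cases k "0 :: int" rule: linorder_cases) auto
qed

lemma smul_left_cancel [simp]: "k ~= 0 ==> k *. x = k *. y \<longleftrightarrow> x = y"
 using smul_eq_0_iff[of k "x - y"] by (simp add: smul_diff_right)

lemma smul_abs_bound:
 assumes "0 <= x" "x <= b"
 shows "- (\<bar>k\<bar> *. b) <= k *. x" and "k *. x <= \<bar>k\<bar> *. b"
proof -
 have "\<bar>k\<bar> *. x <= \<bar>k\<bar> *. b" using assms by (simp add: smul_mono)
 moreover have "k *. x <= \<bar>k\<bar> *. x" "(- k) *. x <= \<bar>k\<bar> *. x"
 using assms(1) by (intro smul_mono_left; simp)+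
 ultimately show "- (\<bar>k\<bar> *. b) <= k *. x" "k *. x <= \<bar>k\<bar> *. b"
 by (auto simp: minus_le_iff)
qed

lemma smul_int [simp]: "k *. (x :: int) = k * x"
 by (induction k rule: int_induct[where k = 0])
 (simp_all add: smul_step smul_diff_left algebra_simps)

definition mdvd :: "int => 'a::linordered_ab_group_add => bool" where
 "mdvd M x \<longleftrightarrow> (EX y. x = M *. y)"

lemma mdvd_0 [simp]: "mdvd M 0"
 unfolding mdvd_def by (metis smul_0_right)

lemma mdvd_one [simp]: "mdvd 1 x"
 unfolding mdvd_def by simp

lemma mdvd_smul_self [simp]: "mdvd M (M *. x)"
 unfolding mdvd_def by blast

lemma mdvd_add: "mdvd M x ==> mdvd M y ==> mdvd M (x + y)"
 unfolding mdvd_def by (metis smul_add_right)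

lemma mdvd_minus_iff [simp]: "mdvd M (- x) \<longleftrightarrow> mdvd M x"
 unfolding mdvd_def by (metis minus_minus smul_minus_right)

lemma mdvd_diff: "mdvd M x ==> mdvd M y ==> mdvd M (x - y)"
 using mdvd_add[of M x "- y"] by simp

lemma mdvd_diff_commute: "mdvd M (x - y) \<longleftrightarrow> mdvd M (y - x)"
 by (metis mdvd_minus_iff minus_diff_eq)

lemma mdvd_cong: "mdvd M (x - y) ==> mdvd M x \<longleftrightarrow> mdvd M y"
 by (metis mdvd_add mdvd_diff diff_add_cancel add_diff_cancel mdvd_diff_commute)

lemma mdvd_smul: "mdvd M x ==> mdvd M (k *. x)"
 unfolding mdvd_def by (metis smul_smul mult.commute)

lemma mdvd_mult_left: "mdvd (k * M) x ==> mdvd M x" and mdvd_mult_right: "mdvd (M * k) x ==> mdvd M x"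
 unfolding mdvd_def by (metis smul_smul mult.commute)+

lemma mdvd_mult_cancel [simp]: "k ~= 0 ==> mdvd (k * M) (k *. x) \<longleftrightarrow> mdvd M x"
 unfolding mdvd_def by (metis smul_smul smul_left_cancel)


section \<open>Presburger sets in a Z-group\<close>

text \<open>The axioms of Presburger arithmetic: \<open>one\<close> is the least positive element,
  and division by standard positive integers is possible. The remainder is bounded only by
  \<open>n *. one\<close>; discreteness makes it a standard multiple of \<open>one\<close>.\<close>

locale zgroup =
 fixes one :: "'a::linordered_ab_group_add"
 assumes one_pos: "0 < one"
 and one_least: "0 < x ==> one <= x"
 and division: "0 < n ==> EX y. n *. y <= x & x < n *. y + n *. one"
begin

lemma less_iff_add_one: "x < y \<longleftrightarrow> x + one <= y"
proof
 assume "x < y"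
 thus "x + one <= y" using one_least[of "y - x"] by (simp add: algebra_simps)
next
 assume "x + one <= y"
 moreover have "x < x + one" using one_pos by simp
 ultimately show "x < y" by (rule less_le_trans[rotated])
qed

lemma smul_one_inject [simp]: "k *. one = l *. one \<longleftrightarrow> k = l"
 using smul_eq_0_iff[of "k - l" one] one_pos by (auto simp: smul_diff_left)

lemma smul_one_le [simp]: "k *. one <= l *. one \<longleftrightarrow> k <= l"
 using smul_less_left[of l k one] smul_mono_left[of k l one] one_pos
 by (metis linorder_not_less order_less_imp_le)

lemma smul_one_less [simp]: "k *. one < l *. one \<longleftrightarrow> k < l"
 by (simp add: less_le)

text \<open>Induction on \<open>n\<close>: by discreteness nothing lies strictly between
  \<open>i *. one\<close> and its successor. Used whenever an element at bounded distance from a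
  known one has to be recognized as an integral translate of it.\<close>

lemma bounded_multiple_of_one:
 assumes "0 <= x" "x < n *. one"
 shows "EX r. 0 <= r & r < n & x = r *. one"
proof -
 have "0 < n" using assms smul_mono_left[of n 0 one] one_pos by (fastforce simp: not_less)
 thus ?thesis using assms
 proof (induction n rule: int_gr_induct)
 case base
 thus ?case using one_least[of x] by (intro exI[of _ 0]) (force simp: order.order_iff_strict not_less[symmetric])
 next
 case (step i)
 show ?case
 proof (cases "x < i *. one")
 case True
 thus ?thesis using step by fastforce
 next
 case False
 have "x < i *. one + one" using step by (simp add: smul_step)
 hence "x <= i *. one" using less_iff_add_one[of "i *. one" x] by (auto simp: not_less)
 thus ?thesis using False step by (intro exI[of _ i]) auto
 qed
 qed
qed

lemma residue: "0 < n ==> EX y r. 0 <= r & r < n & x = n *. y + r *. one"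
proof -
 assume n: "0 < n"
 then obtain y where "n *. y <= x" "x < n *. y + n *. one" using division by blast
 hence "0 <= x - n *. y" "x - n *. y < n *. one" by (simp_all add: diff_less_eq add.commute)
 from bounded_multiple_of_one[OF this] obtain r where "0 <= r" "r < n" "x - n *. y = r *. one" by blast
 thus ?thesis by (metis add.commute diff_add_cancel)
qed

lemma residue_mdvd: "0 < n ==> EX r. 0 <= r & r < n & mdvd n (x - r *. one)"
 using residue[of n x] unfolding mdvd_def by (metis add_diff_cancel_right')

text \<open>Dividing \<open>r\<close> by \<open>n\<close> leaves a multiple \<open>n *. z\<close>
  whose value is \<open>r mod n\<close> units and so lies in \<open>[0, n *. one)\<close>; since
  \<open>one\<close> is the least positive element, \<open>z\<close> is zero.\<close>

lemma mdvd_one_iff: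
 assumes "0 < n" shows "mdvd n (r *. one) \<longleftrightarrow> n dvd r"
proof
 assume "mdvd n (r *. one)"
 then obtain y where "r *. one = n *. y" by (auto simp: mdvd_def)
 hence w: "n *. (y - (r div n) *. one) = (r mod n) *. one"
 by (simp add: smul_diff_right smul_smul smul_diff_left minus_mult_div_eq_mod[symmetric])
 have "y - (r div n) *. one = 0"
 proof (rule ccontr)
 assume "y - (r div n) *. one ~= 0"
 then consider "one <= y - (r div n) *. one" | "y - (r div n) *. one < 0"
 using one_least by (meson linorder_neqE)
 thus False
 proof cases
 case 1
 hence "n *. one <= (r mod n) *. one" using w assms by (metis smul_le_iff)
 thus False using assms by simp (meson leD pos_mod_bound)
 next
 case 2
 hence "(r mod n) *. one < 0" using w assms smul_less_iff[of n _ 0] by (metis smul_0_right)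
 moreover have "0 <= (r mod n) *. one" using assms one_pos by (intro smul_nonneg) auto
 ultimately show False by (meson leD)
 qed
 qed
 with w have "(r mod n) *. one = 0 *. one" by simp
 thus "n dvd r" by (simp only: smul_one_inject) auto
next
 assume "n dvd r"
 thus "mdvd n (r *. one)" by (metis dvd_def smul_smul mdvd_smul_self)
qed

end

text \<open>An abstraction of an elementary substructure: a pure subgroup containing
  \<open>one\<close>. Purity keeps the quotient of a parameter by an integer, when it exists, among
  the parameters.\<close>

locale zgroup_params = zgroup one
 for one :: "'a::linordered_ab_group_add" +
 fixes A :: "'a set"
 assumes one_in: "one : A"
 and diff_in: "a : A ==> b : A ==> a - b : A"
 and pure: "0 < d ==> d *. t : A ==> t : A"
begin

lemma zero_in: "0 : A"
 using diff_in[OF one_in one_in] by simp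

lemma minus_in: "a : A ==> - a : A"
 using diff_in[OF zero_in] by simp

lemma add_in: "a : A ==> b : A ==> a + b : A"
 using diff_in[of a "- b"] minus_in by simp

lemma smul_in: "a : A ==> k *. a : A"
 by (induction k rule: int_induct[where k = 0])
 (simp_all add: zero_in smul_step smul_diff_left add_in diff_in)

lemma sum_in: "(!!i. i : I ==> f i : A) ==> sum f I : A"
 by (induction I rule: infinite_finite_induct) (simp_all add: zero_in add_in)

section \<open>Affine functions and affine maps with constants in the parameter group\<close>

definition AF :: "nat => ('a list => 'a) => bool" where
 "AF n f \<longleftrightarrow> (EX k c. c : A & (ALL xs. length xs = n --> f xs = c + (\<Sum>i<n. k i *. xs ! i)))"

lemma AF_cong: "(!!xs. length xs = n ==> f xs = g xs) ==> AF n f = AF n g"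
 unfolding AF_def by simp

lemma AF_const: "c : A ==> AF n (%xs. c)"
 unfolding AF_def by (intro exI[of _ "%_. 0"] exI[of _ c]) simp

lemma AF_nth: "i < n ==> AF n (%xs. xs ! i)"
 unfolding AF_def
proof (intro exI[of _ "%j. if j = i then 1 else 0"] exI[of _ 0] conjI allI impI zero_in)
 fix xs :: "'a list" assume "i < n"
 have "(\<Sum>j<n. (if j = i then 1 else 0) *. xs ! j) = (\<Sum>j<n. if j = i then xs ! j else 0)"
 by (rule sum.cong) auto
 thus "xs ! i = 0 + (\<Sum>j<n. (if j = i then 1 else 0) *. xs ! j)"
 using \<open>i < n\<close> by simp
qed

lemma AF_add: assumes "AF n f" "AF n g" shows "AF n (%xs. f xs + g xs)"
proof -
 from assms obtain k c l d where
 "c : A" "ALL xs. length xs = n --> f xs = c + (\<Sum>i<n. k i *. xs ! i)"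
 "d : A" "ALL xs. length xs = n --> g xs = d + (\<Sum>i<n. l i *. xs ! i)"
 unfolding AF_def by blast
 thus ?thesis unfolding AF_def
 by (intro exI[of _ "%i. k i + l i"] exI[of _ "c + d"])
 (simp add: smul_add_left sum.distrib algebra_simps add_in)
qed

lemma AF_smul: assumes "AF n f" shows "AF n (%xs. m *. f xs)"
proof -
 from assms obtain k c where
 "c : A" "ALL xs. length xs = n --> f xs = c + (\<Sum>i<n. k i *. xs ! i)"
 unfolding AF_def by blast
 thus ?thesis unfolding AF_def
 by (intro exI[of _ "%i. m * k i"] exI[of _ "m *. c"])
 (simp add: smul_add_right smul_sum_right smul_smul smul_in)
qed

lemma AF_minus: "AF n f ==> AF n (%xs. - f xs)"
 using AF_smul[of n f "-1"] by simp

lemma AF_diff: "AF n f ==> AF n g ==> AF n (%xs. f xs - g xs)"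
 using AF_add[of n f "%xs. - g xs"] AF_minus[of n g] by simp

lemma AF_sum: "(!!i. i : I ==> AF n (f i)) ==> AF n (%xs. \<Sum>i\<in>I. f i xs)"
 by (induction I rule: infinite_finite_induct) (simp_all add: AF_const zero_in AF_add)

lemmas AF_intros = AF_const AF_nth AF_add AF_smul AF_minus AF_diff AF_sum zero_in one_in add_in
 minus_in diff_in smul_in

definition AM :: "nat => nat => ('a list => 'a list) => bool" where
 "AM n m G \<longleftrightarrow> (ALL xs. length xs = n --> length (G xs) = m) & (\<forall>i<m. AF n (%xs. G xs ! i))"

lemma AM_length: "AM n m G ==> length xs = n ==> length (G xs) = m"
 by (simp add: AM_def)

lemma AF_comp: assumes "AF m f" "AM n m G" shows "AF n (%xs. f (G xs))"
proof -
 from assms(1) obtain k c where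
 f: "c : A" "ALL xs. length xs = m --> f xs = c + (\<Sum>i<m. k i *. xs ! i)"
 unfolding AF_def by blast
 have "AF n (%xs. c + (\<Sum>i<m. k i *. G xs ! i))"
 using assms(2) f(1) unfolding AM_def by (intro AF_intros) auto
 thus ?thesis using f(2) assms(2) by (subst AF_cong) (auto simp: AM_def)
qed

lemma AM_comp: "AM m l H ==> AM n m G ==> AM n l (%xs. H (G xs))"
 using AF_comp[of m "%xs. H xs ! _" n G] unfolding AM_def by auto

lemma AM_map: "(!!i. i < m ==> AF n (f i)) ==> AM n m (%xs. map (%i. f i xs) [0..<m])"
 unfolding AM_def by simp

lemma AM_Nil: "AM n 0 (%xs. [])"
 unfolding AM_def by simp

lemma AM_Cons: "AF n f ==> AM n m G ==> AM n (Suc m) (%xs. f xs # G xs)"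
 unfolding AM_def
proof (intro conjI allI impI)
 fix i assume *: "AF n f" "(ALL xs. length xs = n --> length (G xs) = m) & (\<forall>i<m. AF n (%xs. G xs ! i))" "i < Suc m"
 thus "AF n (%xs. (f xs # G xs) ! i)" by (cases i) auto
qed auto

lemma AM_append:
 assumes "AM n m G" "AM n l H" shows "AM n (m + l) (%xs. G xs @ H xs)"
proof -
 have "AF n (%xs. (G xs @ H xs) ! i)" if "i < m + l" for i
 proof (cases "i < m")
 case True
 have "AF n (%xs. G xs ! i)" using assms True by (auto simp: AM_def)
 thus ?thesis using assms True by (subst AF_cong) (auto simp: AM_def nth_append)
 next
 case False
 have "AF n (%xs. H xs ! (i - m))" using assms False that by (auto simp: AM_def)
 thus ?thesis using assms False by (subst AF_cong) (auto simp: AM_def nth_append)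
 qed
 thus ?thesis using assms by (simp add: AM_def)
qed

lemma AM_id: "AM n n (%xs. xs)"
 unfolding AM_def by (simp add: AF_nth)

lemma AM_take: "m <= n ==> AM n m (take m)"
 unfolding AM_def by (simp add: AF_nth)

lemma AM_drop: "m <= n ==> AM n (n - m) (drop m)"
proof -
 assume "m <= n"
 have "AF n (%xs. drop m xs ! i)" if "i < n - m" for i
 using AF_nth[of "m + i" n] that AF_cong[of n "%xs. xs ! (m + i)" "%xs. drop m xs ! i"] by simp
 thus ?thesis by (simp add: AM_def)
qed

lemma AM_tl: "AM (Suc n) n tl"
 using AM_drop[of 1 "Suc n"] by (simp add: drop_Suc[abs_def])

lemma AM_cong: "(!!xs. length xs = n ==> G xs = H xs) ==> AM n m G = AM n m H"
proof -
 assume *: "!!xs. length xs = n ==> G xs = H xs"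
 hence "AF n (%xs. G xs ! i) = AF n (%xs. H xs ! i)" for i by (intro AF_cong) simp
 with * show ?thesis unfolding AM_def by simp
qed

lemma AF_Suc_split:
 assumes "AF (Suc n) f"
 obtains k h where "AF n h" "!!t e. length e = n ==> f (t # e) = k *. t + h e"
proof -
 from assms obtain k c where
 f: "c : A" "ALL xs. length xs = Suc n --> f xs = c + (\<Sum>i<Suc n. k i *. xs ! i)"
 unfolding AF_def by blast
 show thesis
 proof (rule that[of "%e. c + (\<Sum>i<n. k (Suc i) *. e ! i)" "k 0"])
 show "AF n (%e. c + (\<Sum>i<n. k (Suc i) *. e ! i))" using f by (intro AF_intros) auto
 show "f (t # e) = k 0 *. t + (c + (\<Sum>i<n. k (Suc i) *. e ! i))" if "length e = n" for t e
 using f that by (simp add: sum.lessThan_Suc_shift del: sum.lessThan_Suc)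
 qed
qed

lemma AF_append_split:
 assumes "AF (n + m) f"
 obtains g h where "AF n g" "AF m h"
 "!!xs ys. length xs = n ==> length ys = m ==> f (xs @ ys) = g xs + h ys"
proof -
 from assms obtain k c where
 f: "c : A" "ALL xs. length xs = n + m --> f xs = c + (\<Sum>i<n + m. k i *. xs ! i)"
 unfolding AF_def by blast
 have eq: "(\<Sum>i<n + m. k i *. (xs @ ys) ! i) = (\<Sum>i<n. k i *. xs ! i) + (\<Sum>i<m. k (n + i) *. ys ! i)"
 if "length xs = n" "length ys = m" for xs ys
 proof -
 have "(\<Sum>i<n + m. k i *. (xs @ ys) ! i) =
 (\<Sum>i<n. k i *. (xs @ ys) ! i) + (\<Sum>i<m. k (n + i) *. (xs @ ys) ! (n + i))"
 by (induction m) (simp_all add: add.assoc)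
 thus ?thesis using that by (simp add: nth_append)
 qed
 show thesis
 proof (rule that[of "%e. c + (\<Sum>i<n. k i *. e ! i)" "%e. (\<Sum>i<m. k (n + i) *. e ! i)"])
 show "AF n (%e. c + (\<Sum>i<n. k i *. e ! i))" using f by (intro AF_intros) auto
 show "AF m (%e. (\<Sum>i<m. k (n + i) *. e ! i))" by (intro AF_intros) auto
 qed (simp add: f eq add.assoc)
qed

text \<open>The atoms that remain after quantifier elimination: weak affine inequalities and
  congruences. Equations and strict inequalities are Boolean combinations of them.\<close>

definition LT :: "nat => ('a list => bool) => bool" where
 "LT n l \<longleftrightarrow> (EX f. AF n f & (l = (%xs. 0 <= f xs) | (\<exists>M>0. l = (%xs. mdvd M (f xs)))))"

lemma LT_le: "AF n f ==> LT n (%xs. 0 <= f xs)"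
 unfolding LT_def by (rule exI[of _ f]) simp

lemma LT_mdvd: "AF n f ==> 0 < M ==> LT n (%xs. mdvd M (f xs))"
 unfolding LT_def by (rule exI[of _ f], rule conjI, assumption, rule disjI2, rule exI[of _ M], simp)

lemma LT_comp: assumes "LT m l" "AM n m G" shows "LT n (%xs. l (G xs))"
proof -
 from assms(1) obtain f where f: "AF m f" "l = (%xs. 0 <= f xs) | (\<exists>M>0. l = (%xs. mdvd M (f xs)))"
 unfolding LT_def by blast
 from f(2) show ?thesis
 proof (elim disjE exE conjE)
 assume "l = (%xs. 0 <= f xs)"
 thus ?thesis using LT_le[OF AF_comp[OF f(1) assms(2)]] by simp
 next
 fix M :: int assume "0 < M" "l = (%xs. mdvd M (f xs))"
 thus ?thesis using LT_mdvd[OF AF_comp[OF f(1) assms(2)]] by simp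
 qed
qed

text \<open>A relation is Presburger if it depends only on the truth values of finitely many literals;
 in this form all closure properties except projection are immediate.\<close>

definition D :: "nat => ('a list => bool) => bool" where
 "D n P \<longleftrightarrow> (EX L. finite L & (\<forall>l\<in>L. LT n l) &
 (ALL xs ys. length xs = n --> length ys = n --> (\<forall>l\<in>L. l xs = l ys) --> P xs --> P ys))"

lemma D_E:
 assumes "D n P"
 obtains L where "finite L" "\<forall>l\<in>L. LT n l"
 "!!xs ys. length xs = n ==> length ys = n ==> \<forall>l\<in>L. l xs = l ys ==> P xs = P ys"
proof -
 from assms obtain L where L: "finite L" "\<forall>l\<in>L. LT n l"
 "ALL xs ys. length xs = n --> length ys = n --> (\<forall>l\<in>L. l xs = l ys) --> P xs --> P ys"
 unfolding D_def by (elim exE conjE)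
 show thesis
 proof (rule that[OF L(1,2)])
 fix xs ys :: "'a list" assume *: "length xs = n" "length ys = n" "\<forall>l\<in>L. l xs = l ys"
 hence "\<forall>l\<in>L. l ys = l xs" by metis
 with * show "P xs = P ys" using L(3)[rule_format, of xs ys] L(3)[rule_format, of ys xs] by blast
 qed
qed

lemma D_I:
 assumes "finite L" "!!l. l : L ==> LT n l"
 "!!xs ys. length xs = n ==> length ys = n ==> \<forall>l\<in>L. l xs = l ys ==> P xs ==> P ys"
 shows "D n P"
 unfolding D_def by (rule exI[of _ L], intro conjI allI impI ballI) (fact assms | rule assms(3), assumption+)+

lemma D_cong: "(!!xs. length xs = n ==> P xs = Q xs) ==> D n P = D n Q"
 unfolding D_def by simp

lemma D_LT: "LT n l ==> D n l"
 by (rule D_I[of "{l}"]) auto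

lemma D_const: "D n (%xs. b)"
 by (rule D_I[of "{}"]) auto

lemma D_not: assumes "D n P" shows "D n (%xs. ~ P xs)"
proof -
 obtain L where "finite L" "\<forall>l\<in>L. LT n l"
 "!!xs ys. length xs = n ==> length ys = n ==> \<forall>l\<in>L. l xs = l ys ==> P xs = P ys"
 using D_E[OF assms] by metis
 thus ?thesis by (intro D_I[of L]) blast+
qed

lemma D_conj: assumes "D n P" "D n Q" shows "D n (%xs. P xs & Q xs)"
proof -
 obtain L where L: "finite L" "\<forall>l\<in>L. LT n l"
 "!!xs ys. length xs = n ==> length ys = n ==> \<forall>l\<in>L. l xs = l ys ==> P xs = P ys"
 using D_E[OF assms(1)] by metis
 obtain L' where L': "finite L'" "\<forall>l\<in>L'. LT n l"
 "!!xs ys. length xs = n ==> length ys = n ==> \<forall>l\<in>L'. l xs = l ys ==> Q xs = Q ys"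
 using D_E[OF assms(2)] by metis
 show ?thesis
 proof (rule D_I[of "L Un L'"])
 fix xs ys :: "'a list" assume *: "length xs = n" "length ys = n" "\<forall>l\<in>L Un L'. l xs = l ys"
 hence "P xs = P ys" "Q xs = Q ys" by (intro L(3) L'(3); simp)+
 thus "P xs & Q xs ==> P ys & Q ys" by blast
 qed (use L L' in auto)
qed

lemma D_disj: "D n P ==> D n Q ==> D n (%xs. P xs | Q xs)"
proof -
 assume "D n P" "D n Q"
 hence "D n (%xs. ~ (~ P xs & ~ Q xs))" by (intro D_not D_conj)
 thus ?thesis by simp
qed

lemma D_Ball: "finite I ==> (!!i. i : I ==> D n (P i)) ==> D n (%xs. \<forall>i\<in>I. P i xs)"
 by (induction I rule: finite_induct) (simp_all add: D_const D_conj)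

lemma D_le: "AF n f ==> AF n g ==> D n (%xs. f xs <= g xs)"
 using D_LT[OF LT_le[OF AF_diff, of n g f]] by simp

lemma D_less: "AF n f ==> AF n g ==> D n (%xs. f xs < g xs)"
 unfolding not_le[symmetric] by (intro D_not D_le)

lemma D_eq: "AF n f ==> AF n g ==> D n (%xs. f xs = g xs)"
 unfolding order_eq_iff by (intro D_conj D_le)

lemma D_comp: assumes "D m P" "AM n m G" shows "D n (%xs. P (G xs))"
proof -
 obtain L where L: "finite L" "\<forall>l\<in>L. LT m l"
 "!!xs ys. length xs = m ==> length ys = m ==> \<forall>l\<in>L. l xs = l ys ==> P xs = P ys"
 using D_E[OF assms(1)] by metis
 show ?thesis
 proof (rule D_I[of "(%l xs. l (G xs)) ` L"])
 show "P (G ys)"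
 if "length xs = n" "length ys = n" "\<forall>l\<in>(%l xs. l (G xs)) ` L. l xs = l ys" "P (G xs)" for xs ys
 proof -
 have "P (G xs) = P (G ys)" using that(1-3) by (intro L(3)) (simp_all add: AM_length[OF assms(2)])
 thus ?thesis using that(4) by blast
 qed
 qed (use L LT_comp[OF _ assms(2)] in auto)
qed

text \<open>The truth values of finitely many literals at \<open>t # e\<close> are determined by literals in \<open>e\<close>,
 the position of \<open>lam *. t\<close> relative to finitely many affine functions of \<open>e\<close>, and a residue of \<open>t\<close>.\<close>

definition separates :: "nat => int => int => ('a list => 'a) set => ('a list => bool) set =>
 ('a list => bool) set => bool" where
 "separates n lam M Fs L0 L \<longleftrightarrow> 0 < lam & 0 < M & finite Fs & (\<forall>f\<in>Fs. AF n f) & finite L0 &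
 (\<forall>l\<in>L0. LT n l) &
 (ALL t t' e e'. length e = n --> length e' = n --> (\<forall>l\<in>L0. l e = l e') -->
 (\<forall>f\<in>Fs. (f e <= lam *. t) = (f e' <= lam *. t')) --> mdvd M (t - t') -->
 (\<forall>l\<in>L. l (t # e) = l (t' # e')))"

lemma separates_D:
 assumes "separates n lam M Fs L0 L" "length e = n" "length e' = n" "\<forall>l\<in>L0. l e = l e'"
 "\<forall>f\<in>Fs. (f e <= lam *. t) = (f e' <= lam *. t')" "mdvd M (t - t')" "l : L"
 shows "l (t # e) = l (t' # e')"
proof -
 from assms(1) have "ALL t t' e e'. length e = n --> length e' = n --> (\<forall>l\<in>L0. l e = l e') -->
 (\<forall>f\<in>Fs. (f e <= lam *. t) = (f e' <= lam *. t')) --> mdvd M (t - t') -->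
 (\<forall>l\<in>L. l (t # e) = l (t' # e'))"
 unfolding separates_def by (elim conjE)
 from this[THEN spec, THEN spec, THEN spec, THEN spec, THEN mp, OF assms(2), THEN mp, OF assms(3),
 THEN mp, OF assms(4), THEN mp, OF assms(5), THEN mp, OF assms(6)]
 show ?thesis using assms(7) by (rule bspec)
qed

section \<open>Elimination of one quantifier\<close>

lemma residues_agree:
 assumes "0 < M" "!!r. 0 <= r ==> r < M ==> mdvd M (x - r *. one) = mdvd M (y - r *. one)"
 shows "mdvd M (x - y)"
proof -
 obtain r where r: "0 <= r" "r < M" "mdvd M (x - r *. one)" using residue_mdvd[OF assms(1)] by blast
 hence "mdvd M (x - r *. one - (y - r *. one))" using assms(2) by (intro mdvd_diff[of M "x - r *. one"]) auto
 thus ?thesis by simp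
qed

lemma separates_single:
 assumes "LT (Suc n) l"
 shows "EX lam M Fs L0. separates n lam M Fs L0 {l}"
proof -
 from assms obtain f where f: "AF (Suc n) f"
 "l = (%xs. 0 <= f xs) | (\<exists>M>0. l = (%xs. mdvd M (f xs)))" unfolding LT_def by blast
 from AF_Suc_split[OF f(1)] obtain k h where h: "AF n h"
 "!!t e. length e = n ==> f (t # e) = k *. t + h e" by metis
 from f(2) show ?thesis
 proof (elim disjE exE conjE)
 assume l: "l = (%xs. 0 <= f xs)"
 consider "k = 0" | "0 < k" | "k < 0" by linarith
 thus ?thesis
 proof cases
 case 1
 hence "separates n 1 1 {} {%e. 0 <= h e} {l}"
 using h l by (simp add: separates_def LT_le)
 thus ?thesis by blast
 next
 case 2
 hence "separates n k 1 {%e. - h e} {} {l}"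
 using h l AF_minus[OF h(1)] diff_le_eq[of 0 "h _"] by (simp add: separates_def)
 thus ?thesis by blast
 next
 case 3
 \<comment> \<open>A negative coefficient turns the literal into an upper bound for
   \<open>(- k) *. t\<close>; discreteness rewrites it as the negation of a lower bound, with the
   threshold raised by \<open>one\<close>.\<close>
 have eq: "l (t # e) \<longleftrightarrow> ~ h e + one <= (- k) *. t" if "length e = n" for t :: 'a and e
 proof -
 have "l (t # e) \<longleftrightarrow> (- k) *. t <= h e" using h(2)[OF that] l diff_le_eq[of 0 "k *. t" "h e"]
 by (simp add: add.commute)
 thus ?thesis by (simp add: less_iff_add_one[symmetric] not_less)
 qed
 have "separates n (- k) 1 {%e. h e + one} {} {l}"
 using 3 eq AF_add[OF h(1) AF_const[OF one_in]] by (simp add: separates_def)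
 thus ?thesis by blast
 qed
 next
 fix M :: int assume M: "0 < M" and l: "l = (%xs. mdvd M (f xs))"
 let ?L0 = "(%r e. mdvd M (h e - r *. one)) ` {0..<M}"
 have "separates n 1 M {} ?L0 {l}"
 unfolding separates_def
 proof (intro conjI allI impI ballI M)
 fix l' assume "l' : ?L0"
 thus "LT n l'" using M h by (auto intro!: LT_mdvd AF_intros)
 next
 fix t t' :: 'a and e e' l' assume *: "length e = n" "length e' = n" "\<forall>l\<in>?L0. l e = l e'" "mdvd M (t - t')"
 and l': "l' : {l}"
 have "mdvd M (h e - h e')" using residues_agree[OF M, of "h e" "h e'"] * by auto
 hence "mdvd M (f (t # e) - f (t' # e'))"
 using mdvd_add[OF mdvd_smul[OF *(4), of k], of "h e - h e'"] * h
 by (simp add: smul_diff_right algebra_simps)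
 thus "l' (t # e) = l' (t' # e')" using l l' mdvd_cong by auto
 qed auto
 thus ?thesis by blast
 qed
qed

text \<open>Both families of thresholds are rescaled to the common factor \<open>lam * lam'\<close>,
  and \<open>M * M'\<close> is a common multiple of the two moduli.\<close>

lemma separates_union:
 assumes "separates n lam M Fs L0 L" "separates n lam' M' Fs' L0' L'"
 shows "separates n (lam * lam') (M * M') ((%f e. lam' *. f e) ` Fs Un (%f e. lam *. f e) ` Fs')
 (L0 Un L0') (L Un L')"
 unfolding separates_def
proof (intro conjI allI impI ballI)
 fix t t' e e' l
 assume *: "length e = n" "length e' = n" "\<forall>l\<in>L0 Un L0'. l e = l e'"
 "\<forall>f\<in>(%f e. lam' *. f e) ` Fs Un (%f e. lam *. f e) ` Fs'.
 (f e <= (lam * lam') *. t) = (f e' <= (lam * lam') *. t')" "mdvd (M * M') (t - t')"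
 and l: "l : L Un L'"
 have pos: "0 < lam" "0 < lam'" using assms by (auto simp: separates_def)
 have eq: "(lam * lam') *. t = lam *. lam' *. t" "(lam * lam') *. t = lam' *. lam *. t" for t :: 'a
 by (simp_all add: smul_smul mult.commute)
 have 1: "(f e <= lam *. t) = (f e' <= lam *. t')" if "f : Fs" for f
 proof -
 have "(lam' *. f e <= (lam * lam') *. t) = (lam' *. f e' <= (lam * lam') *. t')"
 using bspec[OF *(4), of "%e. lam' *. f e"] that by (simp del: smul_le_iff)
 thus ?thesis unfolding eq(2) using pos by simp
 qed
 have 2: "(f e <= lam' *. t) = (f e' <= lam' *. t')" if "f : Fs'" for f
 proof -
 have "(lam *. f e <= (lam * lam') *. t) = (lam *. f e' <= (lam * lam') *. t')"
 using bspec[OF *(4), of "%e. lam *. f e"] that by (simp del: smul_le_iff)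
 thus ?thesis unfolding eq(1) using pos by simp
 qed
 have 3: "mdvd M (t - t')" "mdvd M' (t - t')" using *(5) mdvd_mult_left mdvd_mult_right by blast+
 have 4: "\<forall>l\<in>L0. l e = l e'" "\<forall>l\<in>L0'. l e = l e'"
 by (rule conjunct1[OF *(3)[unfolded ball_Un]], rule conjunct2[OF *(3)[unfolded ball_Un]])
 show "l (t # e) = l (t' # e')"
 proof (cases "l : L")
 case True
 show ?thesis by (rule separates_D[OF assms(1) *(1,2) 4(1) _ 3(1) True]) (use 1 in blast)
 next
 case False
 hence "l : L'" using l by blast
 show ?thesis by (rule separates_D[OF assms(2) *(1,2) 4(2) _ 3(2) \<open>l : L'\<close>]) (use 2 in blast)
 qed
qed (use assms in \<open>auto simp: separates_def intro: AF_smul\<close>)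

lemma separates_exists:
 assumes "finite L" "\<forall>l\<in>L. LT (Suc n) l"
 shows "EX lam M Fs L0. separates n lam M Fs L0 L"
 using assms
proof (induction L rule: finite_induct)
 case empty
 have "separates n 1 1 {} {} {}" by (simp add: separates_def)
 thus ?case by blast
next
 case (insert l L)
 then obtain lam M Fs L0 where "separates n lam M Fs L0 L" by blast
 moreover obtain lam' M' Fs' L0' where "separates n lam' M' Fs' L0' {l}"
 using separates_single[of n l] insert by blast
 ultimately show ?case using separates_union[of n lam' M' Fs' L0' "{l}"] by fastforce
qed

text \<open>What has to be known about \<open>e\<close> in order to place a new element: the
  differences of the thresholds, measured up to \<open>b\<close>, and their residues modulo
  \<open>b\<close>. A gap of length \<open>b\<close> already meets every residue class, so larger
  gaps need not be distinguished.\<close>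

definition order_lits :: "int => ('a list => 'a) set => ('a list => bool) set" where
 "order_lits b Fs = (%(f, f', d) e. 0 <= f' e - f e - d *. one) ` (Fs \<times> Fs \<times> {0..b}) \<union>
 (%(f, r) e. mdvd b (f e - r *. one)) ` (Fs \<times> {0..<b})"

lemma finite_order_lits: "finite Fs ==> finite (order_lits b Fs)"
 by (simp add: order_lits_def)

lemma LT_order_lits: "0 < b ==> \<forall>f\<in>Fs. AF n f ==> l : order_lits b Fs ==> LT n l"
 unfolding order_lits_def by (auto simp del: diff_ge_0_iff_ge intro!: LT_le LT_mdvd AF_intros)

lemma order_lits_agree:
 assumes "0 < b" "\<forall>l\<in>order_lits b Fs. l e = l e'" "f : Fs"
 shows "mdvd b (f e - f e')"
 and "f' : Fs ==> 0 <= d ==> d <= b ==> f e + d *. one <= f' e \<longleftrightarrow> f e' + d *. one <= f' e'"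
proof -
 have "mdvd b (f e - r *. one) = mdvd b (f e' - r *. one)" if "0 <= r" "r < b" for r
 proof -
 have "(%e. mdvd b (f e - r *. one)) : order_lits b Fs"
 using that assms(3) unfolding order_lits_def by force
 from bspec[OF assms(2) this] show ?thesis .
 qed
 thus "mdvd b (f e - f e')" by (rule residues_agree[OF assms(1)])
next
 assume *: "f' : Fs" "0 <= d" "d <= b"
 have "(%e. 0 <= f' e - f e - d *. one) : order_lits b Fs"
 using * assms(3) unfolding order_lits_def by force
 from bspec[OF assms(2) this]
 have "(0 <= f' e - f e - d *. one) = (0 <= f' e' - f e' - d *. one)" .
 thus "f e + d *. one <= f' e \<longleftrightarrow> f e' + d *. one <= f' e'" by (simp add: algebra_simps)
qed

lemma finite_argmax:
 fixes g :: "'b => 'a"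
 assumes "finite T" "T ~= {}" obtains f where "f : T" "!!h. h : T ==> g h <= g f"
proof -
 have "Max (g ` T) : g ` T" using assms by simp
 then obtain f where "f : T" "g f = Max (g ` T)" by (metis imageE)
 thus thesis using that assms by (metis Max_ge finite_imageI imageI)
qed

lemma finite_argmin:
 fixes g :: "'b => 'a"
 assumes "finite T" "T ~= {}" obtains f where "f : T" "!!h. h : T ==> g f <= g h"
 using finite_argmax[OF assms, of "%h. - g h"] by auto

text \<open>The new element keeps cut and residue: \<open>lam *. t'\<close> is put above the value
  at \<open>e'\<close> of the largest threshold below \<open>lam *. t\<close>, at the same distance
  reduced modulo \<open>lam * M\<close>. Reduction only lowers the distance, and agreement on gaps
  up to \<open>lam * M\<close> ensures that the next threshold is not reached.\<close>

lemma back_and_forth: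
 assumes pos: "0 < lam" "0 < M" and "finite Fs"
 and agree: "\<forall>l\<in>order_lits (lam * M) Fs. l e = l e'"
 shows "EX t'. (\<forall>f\<in>Fs. (f e <= lam *. t) = (f e' <= lam *. t')) & mdvd M (t - t')"
proof -
 let ?b = "lam * M"
 have b: "0 < ?b" using pos by simp
 note res = order_lits_agree(1)[OF b agree] and ord = order_lits_agree(2)[OF b agree]
 \<comment> \<open>The target \<open>f e' + d *. one\<close> is congruent to \<open>lam *. t\<close>
   modulo \<open>lam * M\<close>, because \<open>f\<close> has equal residues at \<open>e\<close>
   and \<open>e'\<close>; a correction of \<open>t\<close> by a multiple of \<open>M\<close>
   therefore reaches it.\<close>
 have lift: "EX t'. lam *. t' = f e' + d *. one & mdvd M (t - t')"
 if "f : Fs" "mdvd ?b (lam *. t - f e - d *. one)" for f d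
 proof -
 have "mdvd ?b (lam *. t - (f e' + d *. one))"
 using mdvd_add[OF that(2) res[OF that(1)]] by (simp add: algebra_simps)
 then obtain y where y: "lam *. t - (f e' + d *. one) = ?b *. y" by (auto simp: mdvd_def)
 have "lam *. (t - M *. y) = f e' + d *. one"
 using y by (simp add: smul_diff_right smul_smul algebra_simps)
 thus ?thesis by (intro exI[of _ "t - M *. y"]) simp
 qed
 define T where "T = {f\<in>Fs. f e <= lam *. t}"
 have "finite T" using \<open>finite Fs\<close> by (simp add: T_def)
 consider "T ~= {}" | "Fs = {}" | "T = {}" "Fs ~= {}" by blast
 thus ?thesis
 proof cases
 case 1
 from finite_argmax[OF \<open>finite T\<close> 1, of "%f. f e"]
 obtain f where f: "f : T" "!!h. h : T ==> h e <= f e" by blast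
 obtain y d where d: "0 <= d" "d < ?b" "lam *. t - f e = ?b *. y + d *. one"
 using residue[OF b] by blast
 have y: "0 <= y"
 proof (rule ccontr)
 assume "~ 0 <= y"
 hence "y + one <= 0" using less_iff_add_one[of y 0] by auto
 hence "?b *. y + ?b *. one <= 0" using smul_mono[of ?b "y + one" 0] b by (simp add: smul_add_right)
 moreover have "d *. one < ?b *. one" using d by simp
 ultimately have "?b *. y + d *. one < 0"
 by (meson add_strict_left_mono less_le_trans)
 hence "lam *. t < f e" using d(3) by (metis diff_less_0_iff_less)
 thus False using f(1) by (auto simp: T_def)
 qed
 have "mdvd ?b (lam *. t - f e - d *. one)" using d by (auto simp: mdvd_def)
 then obtain t' where t': "lam *. t' = f e' + d *. one" "mdvd M (t - t')"
 using lift f(1) by (auto simp: T_def)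
 have "(h e <= lam *. t) = (h e' <= lam *. t')" if h: "h : Fs" for h
 proof (cases "h : T")
 case True
 hence "h e' <= f e'" using ord[of h f 0] f h d(1,2) by (auto simp: T_def)
 moreover have "f e' <= lam *. t'" using t'(1) d(1) one_pos by (simp add: smul_nonneg)
 ultimately show ?thesis using True by (auto simp: T_def)
 next
 case False
 hence "lam *. t + one <= h e" using h by (simp add: T_def less_iff_add_one[symmetric])
 moreover have "f e + d *. one <= lam *. t"
 using d(3) smul_nonneg[of ?b y] y b by (simp add: algebra_simps)
 ultimately have "f e + (d + 1) *. one <= h e"
 by (simp add: smul_step) (metis add.assoc add_right_mono order_trans)
 hence "f e' + (d + 1) *. one <= h e'" using ord[of f h "d + 1"] f h d by (auto simp: T_def)
 hence "lam *. t' < h e'" using t'(1) by (simp add: smul_step less_iff_add_one add.assoc)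
 thus ?thesis using False h by (auto simp: T_def)
 qed
 thus ?thesis using t' by blast
 next
 case 2
 thus ?thesis by (intro exI[of _ t]) simp
 next
 case 3
 \<comment> \<open>No threshold lies below \<open>lam *. t\<close>, so any place below the least
   threshold will do; \<open>- r - 1\<close> is a negative offset with the required residue.\<close>
 from finite_argmin[OF \<open>finite Fs\<close> 3(2), of "%f. f e"]
 obtain f where f: "f : Fs" "!!h. h : Fs ==> f e <= h e" by blast
 obtain r where r: "0 <= r" "r < ?b" "mdvd ?b (f e - lam *. t - one - r *. one)"
 using residue_mdvd[OF b] by blast
 hence "mdvd ?b (lam *. t - f e - (- r - 1) *. one)"
 by (subst (asm) mdvd_minus_iff[symmetric]) (simp add: smul_diff_left algebra_simps)
 then obtain t' where t': "lam *. t' = f e' + (- r - 1) *. one" "mdvd M (t - t')"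
 using lift f(1) by blast
 have "lam *. t' < h e'" if "h : Fs" for h
 proof -
 have "f e' <= h e'" using ord[of f h 0] f that b by auto
 moreover have "lam *. t' < f e'"
 proof -
 have "(- r - 1) *. one < 0" using r smul_one_less[of "- r - 1" 0] by simp
 thus ?thesis unfolding t'(1) by (metis add.right_neutral add_strict_left_mono)
 qed
 ultimately show ?thesis by simp
 qed
 moreover have "lam *. t < h e" if "h : Fs" for h using 3(1) that by (auto simp: T_def)
 ultimately show ?thesis using t'(2) by (meson linorder_not_less)
 qed
qed

text \<open>Quantifier elimination: a witness \<open>t\<close> over \<open>e\<close> is transported
  to a witness over \<open>e'\<close> as soon as the literals in \<open>L0\<close> and those of
  \<open>order_lits\<close> agree, so these literals determine the projection.\<close>

lemma D_Ex: assumes "D (Suc n) P" shows "D n (%e. EX t. P (t # e))"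
proof -
 obtain L where L: "finite L" "\<forall>l\<in>L. LT (Suc n) l"
 "!!xs ys. length xs = Suc n ==> length ys = Suc n ==> \<forall>l\<in>L. l xs = l ys ==> P xs = P ys"
 using D_E[OF assms] by metis
 from separates_exists[OF L(1,2)] obtain lam M Fs L0 where sep: "separates n lam M Fs L0 L" by blast
 hence sep': "0 < lam" "0 < M" "finite Fs" "\<forall>f\<in>Fs. AF n f" "finite L0" "\<forall>l\<in>L0. LT n l"
 by (auto simp: separates_def)
 let ?L = "L0 Un order_lits (lam * M) Fs"
 have half: "EX t'. P (t' # e')"
 if *: "length e = n" "length e' = n" "\<forall>l\<in>?L. l e = l e'" "P (t # e)" for e e' t
 proof -
 obtain t' where t': "\<forall>f\<in>Fs. (f e <= lam *. t) = (f e' <= lam *. t')" "mdvd M (t - t')"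
 using back_and_forth[OF sep'(1-3) conjunct2[OF *(3)[unfolded ball_Un]]] by metis
 have "\<forall>l\<in>L0. l e = l e'" by (rule conjunct1[OF *(3)[unfolded ball_Un]])
 hence "\<forall>l\<in>L. l (t # e) = l (t' # e')"
 using separates_D[OF sep *(1,2) _ t'] by blast
 hence "P (t # e) = P (t' # e')" using *(1,2) by (intro L(3)) simp_all
 thus ?thesis using *(4) by blast
 qed
 show ?thesis
 proof (rule D_I[of ?L])
 show "LT n l" if "l : ?L" for l
 using that sep' LT_order_lits[of "lam * M" Fs n l] by auto
 show "EX t. P (t # e')" if "length e = n" "length e' = n" "\<forall>l\<in>?L. l e = l e'" "EX t. P (t # e)" for e e'
 using half[OF that(1-3)] that(4) by blast
 qed (use sep' finite_order_lits in auto)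
qed

lemma D_Ex_list: "D (k + n) P ==> D n (%e. EX ys. length ys = k & P (ys @ e))"
proof (induction k arbitrary: P)
 case (Suc k)
 hence "D (k + n) (%e. EX t. P (t # e))" using D_Ex[of "k + n" P] by simp
 from Suc.IH[OF this] have "D n (%e. EX ys. length ys = k & (EX t. P (t # ys @ e)))" .
 moreover have "(EX ys. length ys = k & (EX t. P (t # ys @ e))) = (EX ys. length ys = Suc k & P (ys @ e))" for e
 by (metis append_Cons length_Suc_conv)
 ultimately show ?case by simp
qed simp

section \<open>Definable sets are Presburger\<close>

lemma AF_val: "params_tm t <= A ==> fv_tm t <= {..<n} ==> AF n (%xs. val ((!) xs) t)"
 by (induction t) (auto intro: AF_intros)

lemma D_sat: "params ph <= A ==> fv ph <= {..<n} ==> D n (%xs. sat ((!) xs) ph)"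
proof (induction ph arbitrary: n)
 case (Ex ph)
 have "fv ph <= {..<Suc n}" using Ex.prems(2) by (auto simp: subset_iff) (metis less_Suc_eq_0_disj not0_implies_Suc)
 hence "D n (%e. EX t. sat ((!) (t # e)) ph)" using Ex by (intro D_Ex) auto
 moreover have "case_nat x ((!) xs) = (!) (x # xs)" for x :: 'a and xs
 by (auto simp: nth_Cons split: nat.splits)
 ultimately show ?case by simp
qed (auto intro: D_eq D_less D_not D_conj AF_val)

text \<open>The offset \<open>p\<close> leaves room for a bound variable at index 0, which is used
  when a divisibility literal is written with an existential quantifier.\<close>

lemma exists_tm:
 assumes "AF n f"
 shows "EX t. params_tm t <= A & fv_tm t <= {p..<p + n} &
 (ALL xs e. length xs = n --> (\<forall>i<n. e (p + i) = xs ! i) --> val e t = f xs)"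
proof -
 have smul: "EX t'. params_tm t' <= params_tm t & fv_tm t' <= fv_tm t & (ALL e. val e t' = k *. val e t)"
 for k and t :: "'a tm"
 proof -
 have pos: "EX t'. params_tm t' <= params_tm t & fv_tm t' <= fv_tm t & (ALL e. val e t' = k *. val e t)"
 if "0 <= k" for k using that
 proof (induction k rule: int_ge_induct)
 case base
 show ?case by (intro exI[of _ Zero]) simp
 next
 case (step i)
 then obtain t' where "params_tm t' <= params_tm t & fv_tm t' <= fv_tm t & (ALL e. val e t' = i *. val e t)" by blast
 thus ?case by (intro exI[of _ "Add t' t"]) (simp add: smul_step)
 qed
 show ?thesis
 proof (cases "0 <= k")
 case False
 then obtain t' where "params_tm t' <= params_tm t & fv_tm t' <= fv_tm t & (ALL e. val e t' = (- k) *. val e t)"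
 using pos[of "- k"] by auto
 thus ?thesis by (intro exI[of _ "Neg t'"]) simp
 qed (rule pos)
 qed
 from assms obtain k c where
 f: "c : A" "ALL xs. length xs = n --> f xs = c + (\<Sum>i<n. k i *. xs ! i)"
 unfolding AF_def by blast
 have "EX t. params_tm t <= A & fv_tm t <= {p..<p + m} & (ALL e. val e t = c + (\<Sum>i<m. k i *. e (p + i)))" for m
 proof (induction m)
 case 0
 show ?case by (intro exI[of _ "Par c"]) (simp add: f)
 next
 case (Suc m)
 then obtain t where t: "params_tm t <= A" "fv_tm t <= {p..<p + m}" "ALL e. val e t = c + (\<Sum>i<m. k i *. e (p + i))" by blast
 obtain t' where "params_tm t' <= params_tm (Var (p + m) :: 'a tm)" "fv_tm t' <= fv_tm (Var (p + m) :: 'a tm)"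
 "ALL e. val e t' = k m *. val e (Var (p + m))" using smul by blast
 with t show ?case by (intro exI[of _ "Add t t'"]) (auto simp: algebra_simps)
 qed
 from this[of n] obtain t where "params_tm t <= A" "fv_tm t <= {p..<p + n}"
 "ALL e. val e t = c + (\<Sum>i<n. k i *. e (p + i))" by blast
 thus ?thesis using f by (intro exI[of _ t]) simp
qed

lemma exists_fm_LT:
 assumes "LT n l"
 shows "EX ph. params ph <= A & fv ph <= {..<n} & (ALL xs. length xs = n --> sat ((!) xs) ph = l xs)"
proof -
 from assms obtain f where f: "AF n f"
 "l = (%xs. 0 <= f xs) | (\<exists>M>0. l = (%xs. mdvd M (f xs)))" unfolding LT_def by blast
 from f(2) show ?thesis
 proof (elim disjE exE conjE)
 assume l: "l = (%xs. 0 <= f xs)"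
 obtain t where t: "params_tm t <= A" "fv_tm t <= {0..<0 + n}"
 "ALL xs e. length xs = n --> (\<forall>i<n. e (0 + i) = xs ! i) --> val e t = f xs"
 using exists_tm[OF f(1)] by meson
 hence "sat ((!) xs) (Not (Less t Zero)) = l xs" if "length xs = n" for xs
 using that by (simp add: l not_less)
 thus ?thesis using t by (intro exI[of _ "Not (Less t Zero)"]) auto
 next
 fix M :: int assume M: "0 < M" and l: "l = (%xs. mdvd M (f xs))"
 obtain t where t: "params_tm t <= A" "fv_tm t <= {1..<1 + n}"
 "ALL xs e. length xs = n --> (\<forall>i<n. e (1 + i) = xs ! i) --> val e t = f xs"
 using exists_tm[OF f(1)] by meson
 have "AF 1 (%xs. M *. xs ! 0)" by (intro AF_intros) simp
 from exists_tm[OF this] obtain u where u: "params_tm u <= A" "fv_tm u <= {0..<0 + 1}"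
 "ALL xs e. length xs = 1 --> (\<forall>i<1. e (0 + i) = xs ! i) --> val e u = M *. xs ! 0" by meson
 have u': "val e u = M *. e 0" for e using u(3)[rule_format, of "[e 0]" e] by simp
 have "sat ((!) xs) (Ex (Eq t u)) = l xs" if "length xs = n" for xs
 proof -
 have "val (case_nat x ((!) xs)) t = f xs" for x using t(3) that by simp
 thus ?thesis by (simp add: u' l mdvd_def)
 qed
 moreover have "fv (Ex (Eq t u)) <= {..<n}" using t(2) u(2) by (auto dest!: subsetD)
 ultimately show ?thesis using t u by (intro exI[of _ "Ex (Eq t u)"]) auto
 qed
qed

text \<open>Case distinction on the truth value of one literal removes it from the set. Together
  with \<open>D_sat\<close> this allows definability to be treated as dependence on
  literals.\<close>

lemma exists_fm:
 assumes "D n P"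
 shows "EX ph. params ph <= A & fv ph <= {..<n} & (ALL xs. length xs = n --> sat ((!) xs) ph = P xs)"
proof -
 obtain L where "finite L" "\<forall>l\<in>L. LT n l"
 "!!xs ys. length xs = n ==> length ys = n ==> \<forall>l\<in>L. l xs = l ys ==> P xs = P ys"
 using D_E[OF assms] by metis
 thus ?thesis
 proof (induction L arbitrary: P rule: finite_induct)
 case empty
 have "P xs = P (replicate n 0)" if "length xs = n" for xs using that by (intro empty.prems(2)) simp_all
 thus ?case
 by (cases "P (replicate n 0)")
 (intro exI[of _ "Eq Zero Zero"], simp, intro exI[of _ "Not (Eq Zero Zero)"], simp)
 next
 case (insert l L)
 \<comment> \<open>\<open>P' b\<close> coincides with \<open>P\<close> where \<open>l\<close> has
   the value \<open>b\<close>, and it depends only on the literals in \<open>L\<close>, so the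
   induction hypothesis applies to it.\<close>
 define P' where "P' b xs = (EX ys. length ys = n & (\<forall>l'\<in>L. l' ys = l' xs) & l ys = b & P ys)" for b xs
 have ex: "EX ph. params ph <= A & fv ph <= {..<n} & (ALL xs. length xs = n --> sat ((!) xs) ph = P' b xs)" for b
 proof (rule insert.IH)
 show "\<forall>l\<in>L. LT n l" using insert.prems(1) by blast
 show "P' b xs = P' b ys" if "length xs = n" "length ys = n" "\<forall>l\<in>L. l xs = l ys" for xs ys
 proof -
 have "(\<forall>l'\<in>L. l' zs = l' xs) = (\<forall>l'\<in>L. l' zs = l' ys)" for zs using that(3) by metis
 thus ?thesis unfolding P'_def by (simp only:)
 qed
 qed
 from ex[of True] obtain ph where ph: "params ph <= A & fv ph <= {..<n} &
 (ALL xs. length xs = n --> sat ((!) xs) ph = P' True xs)" by (rule exE)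
 from ex[of False] obtain ph' where ph': "params ph' <= A & fv ph' <= {..<n} &
 (ALL xs. length xs = n --> sat ((!) xs) ph' = P' False xs)" by (rule exE)
 have "LT n l" using insert.prems(1) by simp
 from exists_fm_LT[OF this] obtain ps where ps: "params ps <= A & fv ps <= {..<n} &
 (ALL xs. length xs = n --> sat ((!) xs) ps = l xs)" by (rule exE)
 have P: "P xs = P' (l xs) xs" if "length xs = n" for xs
 proof -
 have "P xs = P ys" if "length ys = n" "\<forall>l'\<in>L. l' ys = l' xs" "l ys = l xs" for ys
 using that \<open>length xs = n\<close> by (intro insert.prems(2)) auto
 thus ?thesis using that unfolding P'_def by blast
 qed
 let ?ch = "And (Not (And ps (Not ph))) (Not (And (Not ps) (Not ph')))"
 have "sat ((!) xs) ?ch = P xs" if "length xs = n" for xs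
 proof -
 have "sat ((!) xs) ph = P' True xs" "sat ((!) xs) ph' = P' False xs" "sat ((!) xs) ps = l xs"
 using ph ph' ps that by blast+
 thus ?thesis unfolding P[OF that] by (cases "l xs") simp_all
 qed
 moreover have "params ?ch <= A" "fv ?ch <= {..<n}" using ph ph' ps by simp_all
 ultimately show ?case by blast
 qed
qed

lemma definable_in_iff: "definable_in A n X \<longleftrightarrow> X <= {xs. length xs = n} & D n (%xs. xs : X)"
proof
 assume "definable_in A n X"
 then obtain ph where ph: "params ph <= A" "fv ph <= {..<n}" "X = {xs. length xs = n & sat ((!) xs) ph}"
 unfolding definable_in_def by blast
 have "D n (%xs. sat ((!) xs) ph) = D n (%xs. xs : X)" using ph(3) by (intro D_cong) simp
 thus "X <= {xs. length xs = n} & D n (%xs. xs : X)" using D_sat[OF ph(1,2)] ph(3) by auto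
next
 assume *: "X <= {xs. length xs = n} & D n (%xs. xs : X)"
 then obtain ph where "params ph <= A" "fv ph <= {..<n}" "ALL xs. length xs = n --> sat ((!) xs) ph = (xs : X)"
 using exists_fm[of n "%xs. xs : X"] by blast
 thus "definable_in A n X" unfolding definable_in_def using * by (intro exI[of _ ph]) auto
qed

end

section \<open>Calculus in the Grothendieck semiring\<close>

lemma set_prodI: "xs : X ==> ys : Y ==> xs @ ys : set_prod X Y"
 unfolding set_prod_def by blast

lemma set_prodE: assumes "z : set_prod X Y" obtains xs ys where "z = xs @ ys" "xs : X" "ys : Y"
 using assms unfolding set_prod_def by blast

context zgroup_params
begin

lemma definable_in_I: "(!!xs. xs : X ==> length xs = n) ==> D n (%xs. xs : X) ==> definable_in A n X"
 by (auto simp: definable_in_iff)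

lemma definable_in_length: "definable_in A n X ==> xs : X ==> length xs = n"
 by (auto simp: definable_in_iff)

lemma definable_in_D: "definable_in A n X ==> D n (%xs. xs : X)"
 by (simp add: definable_in_iff)

lemma definable_inI: "definable_in A n X ==> definable A X"
 unfolding definable_def by blast

lemma definable_in_Collect: "D n P ==> definable_in A n {xs. length xs = n & P xs}"
proof (rule definable_in_I)
 assume "D n P"
 moreover have "D n (%xs. xs : {xs. length xs = n & P xs}) = D n P" by (rule D_cong) simp
 ultimately show "D n (%xs. xs : {xs. length xs = n & P xs})" by simp
qed simp

lemma definable_in_empty: "definable_in A n {}"
 by (rule definable_in_I) (simp_all add: D_const)

lemma definable_in_Un: "definable_in A n X ==> definable_in A n Y ==> definable_in A n (X Un Y)"
 unfolding definable_in_iff by (simp add: D_disj)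

lemma definable_in_Int: "definable_in A n X ==> definable_in A n Y ==> definable_in A n (X Int Y)"
 unfolding definable_in_iff by (auto simp: D_conj)

lemma definable_in_UN:
 "finite I ==> (!!i. i : I ==> definable_in A n (X i)) ==> definable_in A n (\<Union>i\<in>I. X i)"
 by (induction I rule: finite_induct) (simp_all add: definable_in_empty definable_in_Un)

lemma definable_in_unit: "definable_in A 0 {[]}"
 using definable_in_Collect[OF D_const, of 0 True] by simp

lemma definable_in_unique:
 "definable_in A n X ==> definable_in A m Y ==> xs : X ==> xs : Y ==> n = m"
 using definable_in_length by blast

lemma D_eq_AM: assumes "AM n m G" "AM n m H" shows "D n (%xs. G xs = H xs)"
proof -
 have "D n (%xs. \<forall>i\<in>{..<m}. G xs ! i = H xs ! i)"
 using assms by (intro D_Ball D_eq) (auto simp: AM_def)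
 moreover have "D n (%xs. G xs = H xs) = D n (%xs. \<forall>i\<in>{..<m}. G xs ! i = H xs ! i)"
 using assms by (intro D_cong) (simp add: AM_length list_eq_iff_nth_eq Ball_def)
 ultimately show ?thesis by simp
qed

lemma definable_in_set_prod:
 assumes "definable_in A n X" "definable_in A m Y"
 shows "definable_in A (n + m) (set_prod X Y)"
proof (rule definable_in_I)
 show "length zs = n + m" if "zs : set_prod X Y" for zs
 using that assms by (auto simp: set_prod_def definable_in_length)
 have "D (n + m) (%zs. take n zs : X & drop n zs : Y)"
 using D_comp[OF definable_in_D[OF assms(1)] AM_take[of n "n + m"]]
 D_comp[OF definable_in_D[OF assms(2)], of "n + m" "drop n"] AM_drop[of n "n + m"]
 by (intro D_conj) simp_all
 moreover have "zs : set_prod X Y \<longleftrightarrow> take n zs : X & drop n zs : Y" for zs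
 proof
 assume "zs : set_prod X Y"
 then obtain xs ys where "zs = xs @ ys" "xs : X" "ys : Y" by (auto simp: set_prod_def)
 thus "take n zs : X & drop n zs : Y" using definable_in_length[OF assms(1)] by auto
 next
 assume "take n zs : X & drop n zs : Y"
 thus "zs : set_prod X Y" unfolding set_prod_def
 by (intro CollectI exI[of _ "take n zs"] exI[of _ "drop n zs"]) simp
 qed
 ultimately show "D (n + m) (%xs. xs : set_prod X Y)" by simp
qed

lemma definable_in_image:
 assumes "definable_in A n X" "AM n m G"
 shows "definable_in A m (G ` X)"
proof (rule definable_in_I)
 show "length ys = m" if "ys : G ` X" for ys
 using that definable_in_length[OF assms(1)] AM_length[OF assms(2)] by auto
 have 1: "D (n + m) (%zs. take n zs : X & drop n zs = G (take n zs))"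
 proof (intro D_conj)
 show "D (n + m) (%zs. take n zs : X)"
 using D_comp[OF definable_in_D[OF assms(1)] AM_take[of n "n + m"]] by simp
 show "D (n + m) (%zs. drop n zs = G (take n zs))"
 using D_eq_AM[of "n + m" m "drop n"] AM_drop[of n "n + m"] AM_comp[OF assms(2) AM_take[of n "n + m"]]
 by simp
 qed
 have eq: "ys : G ` X \<longleftrightarrow> (EX xs. length xs = n & (take n (xs @ ys) : X & drop n (xs @ ys) = G (take n (xs @ ys))))" for ys
 proof
 assume "ys : G ` X"
 then obtain xs where xs: "xs : X" "ys = G xs" by blast
 thus "EX xs. length xs = n & (take n (xs @ ys) : X & drop n (xs @ ys) = G (take n (xs @ ys)))"
 using definable_in_length[OF assms(1)] by (intro exI[of _ xs]) simp
 next
 assume "EX xs. length xs = n & (take n (xs @ ys) : X & drop n (xs @ ys) = G (take n (xs @ ys)))"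
 thus "ys : G ` X" by (elim exE conjE) (simp add: image_eqI)
 qed
 show "D m (%ys. ys : G ` X)" unfolding eq using D_Ex_list[OF 1] .
qed

declare K_eq.trans [trans]

lemma definable_empty: "definable A {}"
 using definable_in_empty definable_inI by blast

lemma K_eq_definable: "K_eq A M M' ==> (\<forall>X\<in>#M. definable A X) & (\<forall>X\<in>#M'. definable A X)"
proof (induction rule: K_eq.induct)
 case (union n X1 X2)
 thus ?case using definable_inI[OF definable_in_Un[of n X1 X2]] definable_inI[of n] by simp
qed (simp_all add: definable_empty ball_Un)

lemma K_refl_single: "definable_in A n X ==> K_eq A {#X#} {#X#}"
 using definable_inI by (intro K_eq.refl) auto

lemma K_affine:
 assumes "definable_in A n X" "AM n m G" "inj_on G X"
 shows "K_eq A {#X#} {#G ` X#}"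
proof (rule K_eq.bij)
 have "{xs @ G xs |xs. xs : X} = (%xs. xs @ G xs) ` X" by blast
 moreover have "definable_in A (n + m) ((%xs. xs @ G xs) ` X)"
 by (intro definable_in_image[OF assms(1)] AM_append AM_id assms(2))
 ultimately show "definable_bij A X (G ` X)" unfolding definable_bij_def
 using assms(3) definable_inI[of "n + m"] by (intro exI[of _ G]) (simp add: bij_betw_def)
 show "definable A X" "definable A (G ` X)"
 using definable_inI[OF assms(1)] definable_inI[OF definable_in_image[OF assms(1,2)]] by simp_all
qed

lemma K_UN:
 assumes "finite I" "!!i. i : I ==> definable_in A n (X i)" "!!i j. i : I ==> j : I ==> i ~= j ==> X i Int X j = {}"
 shows "K_eq A {#\<Union>i\<in>I. X i#} (\<Sum>i\<in>I. {#X i#})"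
 using assms
proof (induction I rule: finite_induct)
 case empty
 show ?case by (simp add: K_eq.empty)
next
 case (insert i I)
 have "X i Int X k = {}" if "k : I" for k
 using insert.hyps(2) that by (intro insert.prems(2)) auto
 hence "X i Int (\<Union>i\<in>I. X i) = {}" by blast
 hence 1: "K_eq A {#X i Un (\<Union>i\<in>I. X i)#} ({#X i#} + {#\<Union>i\<in>I. X i#})"
 using insert.hyps(1) insert.prems(1) K_eq.union[of A n "X i" "\<Union>i\<in>I. X i"]
 by (simp add: definable_in_UN add_mset_commute)
 have 2: "K_eq A ({#X i#} + {#\<Union>i\<in>I. X i#}) ({#X i#} + (\<Sum>i\<in>I. {#X i#}))"
 by (intro K_eq.add K_refl_single[where n = n] insert.IH insert.prems) simp_all
 from K_eq.trans[OF 1 2] show ?case using insert.hyps by simp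
qed

lemma mset_prod_empty [simp]: "mset_prod {#} P = {#}" "mset_prod M {#} = {#}"
 by (simp_all add: mset_prod_def)

lemma mset_prod_add_left: "mset_prod (M + M') P = mset_prod M P + mset_prod M' P"
 by (simp add: mset_prod_def)

lemma mset_prod_add_right: "mset_prod M (P + P') = mset_prod M P + mset_prod M P'"
 by (induction M) (simp_all add: mset_prod_def)

lemma mset_prod_single_right: "mset_prod M {#Y#} = {#set_prod X Y. X :# M#}"
 by (induction M) (simp_all add: mset_prod_def)

lemma mset_prod_single_left: "mset_prod {#X#} P = {#set_prod X Y. Y :# P#}"
 by (simp add: mset_prod_def)

lemma set_prod_assoc: "set_prod (set_prod X Y) W = set_prod X (set_prod Y W)"
 unfolding set_prod_def by (auto simp: append_assoc[symmetric] simp del: append_assoc) (metis append_assoc)+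

lemma set_prod_unit [simp]: "set_prod {[]} X = X" "set_prod X {[]} = X"
 unfolding set_prod_def by auto

lemma set_prod_empty [simp]: "set_prod {} X = {}" "set_prod X {} = {}"
 unfolding set_prod_def by auto

lemma definable_mset_prod:
 "\<forall>X\<in>#M. definable A X ==> \<forall>X\<in>#P. definable A X ==> \<forall>X\<in>#mset_prod M P. definable A X"
proof (induction M)
 case (add X M)
 hence "\<forall>W\<in>#mset_prod {#X#} P. definable A W"
 proof -
 from add.prems obtain n where n: "definable_in A n X" unfolding definable_def by auto
 have "definable A (set_prod X Y)" if "Y :# P" for Y
 proof -
 from add.prems that obtain m where "definable_in A m Y" unfolding definable_def by auto
 from definable_inI[OF definable_in_set_prod[OF n this]] show ?thesis .
 qed
 thus ?thesis unfolding mset_prod_single_left by auto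
 qed
 with add show ?case by (metis add_mset_add_single mset_prod_add_left union_iff insert_iff set_mset_add_mset_insert)
qed simp

text \<open>The graph of \<open>f\<close> times the identity of \<open>Y\<close> is the product of
  the graph of \<open>f\<close> with \<open>Y\<close>, with its coordinates rearranged and those of
  \<open>Y\<close> repeated.\<close>

lemma definable_bij_set_prod:
 assumes "definable_bij A X1 X2" "definable_in A n X1" "definable_in A n' X2" "definable_in A m Y" "X1 ~= {}"
 shows "definable_bij A (set_prod X1 Y) (set_prod X2 Y)"
proof -
 from assms obtain f N where f: "bij_betw f X1 X2" "definable_in A N {xs @ f xs |xs. xs : X1}"
 unfolding definable_bij_def definable_def by blast
 let ?\<Gamma> = "{xs @ f xs |xs. xs : X1}"
 have len: "length xs = n" "length (f xs) = n'" if "xs : X1" for xs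
 using definable_in_length[OF assms(2) that] definable_in_length[OF assms(3) bij_betwE[OF f(1), rule_format, OF that]]
 by simp_all
 \<comment> \<open>A point of \<open>X1\<close> determines the arity of the graph; an empty graph
   would be definable in every arity.\<close>
 have N: "N = n + n'"
 proof -
 obtain xs where "xs : X1" using assms(5) by blast
 hence "xs @ f xs : ?\<Gamma>" by blast
 from definable_in_length[OF f(2) this] show ?thesis using len[OF \<open>xs : X1\<close>] by simp
 qed
 define h where "h zs = f (take n zs) @ drop n zs" for zs
 have h: "h (xs @ ys) = f xs @ ys" if "xs : X1" for xs ys using len[OF that] by (simp add: h_def)
 have "bij_betw h (set_prod X1 Y) (set_prod X2 Y)"
 unfolding bij_betw_def
 proof
 show "inj_on h (set_prod X1 Y)"
 proof (rule inj_onI)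
 fix z z' assume "z : set_prod X1 Y" "z' : set_prod X1 Y" "h z = h z'"
 then obtain xs ys xs' ys' where *: "z = xs @ ys" "z' = xs' @ ys'" "xs : X1" "xs' : X1" "f xs @ ys = f xs' @ ys'"
 using h by (auto simp: set_prod_def)
 hence "f xs = f xs'" "ys = ys'" using len by auto
 thus "z = z'" using * f(1) by (auto simp: bij_betw_def inj_on_def)
 qed
 show "h ` set_prod X1 Y = set_prod X2 Y"
 proof (intro equalityI subsetI)
 fix z assume "z : h ` set_prod X1 Y"
 thus "z : set_prod X2 Y" using h f(1) by (auto simp: set_prod_def bij_betw_def)
 next
 fix z assume "z : set_prod X2 Y"
 then obtain xs ys where *: "z = f xs @ ys" "xs : X1" "ys : Y"
 using f(1) by (auto simp: set_prod_def bij_betw_def)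
 hence "h (xs @ ys) = z" "xs @ ys : set_prod X1 Y" using h by (auto simp: set_prod_def)
 thus "z : h ` set_prod X1 Y" by blast
 qed
 qed
 moreover have "definable_in A (n + m + (n' + m)) {zs @ h zs |zs. zs : set_prod X1 Y}"
 proof -
 let ?G = "%ws. take n ws @ drop (n + n') ws @ take n' (drop n ws) @ drop (n + n') ws"
 have "AM (n + n' + m) (n + (m + (n' + m))) ?G"
 using AM_comp[OF AM_take[of n' "n' + m"] AM_drop[of n "n + n' + m", simplified], simplified]
 AM_drop[of "n + n'" "n + n' + m"]
 by (intro AM_append AM_take) (simp_all add: ac_simps)
 moreover have "{zs @ h zs |zs. zs : set_prod X1 Y} = ?G ` set_prod ?\<Gamma> Y"
 proof (intro equalityI subsetI)
 fix z assume "z : {zs @ h zs |zs. zs : set_prod X1 Y}"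
 then obtain xs ys where "z = xs @ ys @ f xs @ ys" "xs : X1" "ys : Y"
 using h by (auto simp: set_prod_def)
 moreover from this have "(xs @ f xs) @ ys : set_prod ?\<Gamma> Y" by (intro set_prodI) auto
 ultimately have "z = ?G ((xs @ f xs) @ ys)" "(xs @ f xs) @ ys : set_prod ?\<Gamma> Y"
 using len by auto
 thus "z : ?G ` set_prod ?\<Gamma> Y" by blast
 next
 fix z assume "z : ?G ` set_prod ?\<Gamma> Y"
 then obtain xs ys where *: "z = ?G ((xs @ f xs) @ ys)" "xs : X1" "ys : Y"
 by (auto simp: set_prod_def)
 hence "z = (xs @ ys) @ h (xs @ ys)" using len h by simp
 with set_prodI[OF *(2,3)] show "z : {zs @ h zs |zs. zs : set_prod X1 Y}" by blast
 qed
 ultimately show ?thesis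
 using definable_in_image[OF definable_in_set_prod[OF f(2) assms(4)], of "n + (m + (n' + m))" ?G] N
 by (simp add: add.assoc)
 qed
 ultimately show ?thesis unfolding definable_bij_def using definable_inI by blast
qed

lemma K_eq_set_prod:
 assumes "K_eq A M M'" "definable A Y"
 shows "K_eq A (mset_prod M {#Y#}) (mset_prod M' {#Y#})"
 using assms(1)
proof (induction rule: K_eq.induct)
 case (refl M)
 thus ?case using assms(2) by (intro K_eq.refl definable_mset_prod) auto
next
 case (add M M' P P')
 thus ?case by (simp add: mset_prod_add_left K_eq.add)
next
 case (union n X1 X2)
 from assms(2) obtain m where "definable_in A m Y" by (auto simp: definable_def)
 moreover have "set_prod X1 Y Int set_prod X2 Y = {}"
 proof (rule ccontr)
 assume "set_prod X1 Y Int set_prod X2 Y ~= {}"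
 then obtain z where "z : set_prod X1 Y" "z : set_prod X2 Y" by blast
 then obtain xs ys xs' ys' where "z = xs @ ys" "z = xs' @ ys'" "xs : X1" "xs' : X2"
 by (elim set_prodE)
 hence "xs = xs'" using union definable_in_length by (metis append_eq_append_conv)
 thus False using \<open>xs : X1\<close> \<open>xs' : X2\<close> union(3) by blast
 qed
 moreover have "set_prod (X1 Un X2) Y = set_prod X1 Y Un set_prod X2 Y" by (auto simp: set_prod_def)
 ultimately show ?case
 using K_eq.union[of A "n + m" "set_prod X1 Y" "set_prod X2 Y"] union
 by (simp add: mset_prod_single_right definable_in_set_prod)
next
 case (bij X1 X2)
 from assms(2) bij obtain n n' m where *: "definable_in A n X1" "definable_in A n' X2" "definable_in A m Y"
 by (auto simp: definable_def)
 show ?case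
 proof (cases "X1 = {}")
 case True
 hence "X2 = {}" using bij by (auto simp: definable_bij_def bij_betw_def)
 with True show ?thesis by (auto simp: mset_prod_single_right intro!: K_eq.refl definable_empty)
 next
 case False
 show ?thesis unfolding mset_prod_single_right image_mset_single
 using definable_bij_set_prod[OF bij(3) * False] definable_inI[OF definable_in_set_prod[OF *(1,3)]]
 definable_inI[OF definable_in_set_prod[OF *(2,3)]]
 by (intro K_eq.bij)
 qed
next
 case (trans M M' M'')
 thus ?case by (meson K_eq.trans)
qed (simp_all add: mset_prod_single_right K_eq.empty K_eq.sym)

lemma K_eq_prod_left:
 assumes "K_eq A M M'" "\<forall>X\<in>#P. definable A X"
 shows "K_eq A (mset_prod M P) (mset_prod M' P)"
 using assms(2)
proof (induction P)
 case empty
 show ?case by (simp add: K_eq.refl)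
next
 case (add Y P)
 hence "K_eq A (mset_prod M {#Y#}) (mset_prod M' {#Y#})" "K_eq A (mset_prod M P) (mset_prod M' P)"
 using K_eq_set_prod[OF assms(1)] by auto
 hence "K_eq A (mset_prod M {#Y#} + mset_prod M P) (mset_prod M' {#Y#} + mset_prod M' P)"
 by (rule K_eq.add)
 thus ?case using mset_prod_add_right[of M "{#Y#}" P] mset_prod_add_right[of M' "{#Y#}" P] by simp
qed

lemma K_swap:
 assumes "definable_in A n X" "definable_in A m Y"
 shows "K_eq A {#set_prod X Y#} {#set_prod Y X#}"
proof -
 let ?G = "%zs. drop n zs @ take n zs"
 have "AM (n + m) (m + n) ?G" using AM_drop[of n "n + m"] by (intro AM_append AM_take) simp_all
 moreover have "inj_on ?G (set_prod X Y)"
 proof (rule inj_onI)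
 fix z z' assume "z : set_prod X Y" "z' : set_prod X Y" and eq: "?G z = ?G z'"
 hence "length z = n + m" "length z' = n + m"
 using definable_in_length[OF definable_in_set_prod[OF assms]] by blast+
 with eq have "drop n z = drop n z'" "take n z = take n z'" by (auto simp: append_eq_append_conv)
 thus "z = z'" by (metis append_take_drop_id)
 qed
 moreover have "?G ` set_prod X Y = set_prod Y X"
 proof (intro equalityI subsetI)
 fix z assume "z : ?G ` set_prod X Y"
 then obtain xs ys where "z = ?G (xs @ ys)" "xs : X" "ys : Y" by (auto elim: set_prodE)
 thus "z : set_prod Y X" using definable_in_length[OF assms(1)] by (simp add: set_prodI)
 next
 fix z assume "z : set_prod Y X"
 then obtain xs ys where *: "z = ys @ xs" "xs : X" "ys : Y" by (auto simp: set_prod_def)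
 hence "z = ?G (xs @ ys)" "xs @ ys : set_prod X Y"
 using definable_in_length[OF assms(1)] by (auto simp: set_prod_def)
 thus "z : ?G ` set_prod X Y" by blast
 qed
 ultimately show ?thesis using K_affine[OF definable_in_set_prod[OF assms], of "m + n" ?G] by simp
qed

lemma K_eq_prod_commute:
 assumes "\<forall>X\<in>#M. definable A X" "\<forall>X\<in>#P. definable A X"
 shows "K_eq A (mset_prod M P) (mset_prod P M)"
 using assms(1)
proof (induction M)
 case empty
 show ?case by (simp add: K_eq.refl)
next
 case (add X M)
 have "K_eq A (mset_prod {#X#} P) (mset_prod P {#X#})" using assms(2)
 proof (induction P)
 case empty
 show ?case by (simp add: K_eq.refl)
 next
 case (add Y P)
 obtain n m where "definable_in A n X" "definable_in A m Y"
 using add.prems \<open>\<forall>X\<in>#add_mset X M. definable A X\<close> by (auto simp: definable_def)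
 hence "K_eq A (mset_prod {#X#} {#Y#}) (mset_prod {#Y#} {#X#})"
 using K_swap by (simp add: mset_prod_single_left)
 moreover have "K_eq A (mset_prod {#X#} P) (mset_prod P {#X#})" using add by simp
 ultimately have "K_eq A (mset_prod {#X#} {#Y#} + mset_prod {#X#} P) (mset_prod {#Y#} {#X#} + mset_prod P {#X#})"
 by (rule K_eq.add)
 thus ?case using mset_prod_add_right[of "{#X#}" "{#Y#}" P] mset_prod_add_left[of "{#Y#}" P "{#X#}"]
 by simp
 qed
 moreover have "K_eq A (mset_prod M P) (mset_prod P M)" using add by simp
 ultimately have "K_eq A (mset_prod {#X#} P + mset_prod M P) (mset_prod P {#X#} + mset_prod P M)"
 by (rule K_eq.add)
 thus ?case using mset_prod_add_left[of "{#X#}" M P] mset_prod_add_right[of P "{#X#}" M]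
 by simp
qed

text \<open>Invariance in the second factor comes from invariance in the first by commuting twice.
  Commutativity holds only up to the congruence, since products are formed by appending
  lists.\<close>

lemma K_eq_prod:
 assumes "K_eq A M M'" "K_eq A P P'"
 shows "K_eq A (mset_prod M P) (mset_prod M' P')"
proof -
 note d = K_eq_definable[OF assms(1)] K_eq_definable[OF assms(2)]
 have "K_eq A (mset_prod M P) (mset_prod M' P)" using d by (intro K_eq_prod_left assms(1)) blast
 also have "K_eq A (mset_prod M' P) (mset_prod P M')" using d by (intro K_eq_prod_commute) blast+
 also have "K_eq A (mset_prod P M') (mset_prod P' M')" using d by (intro K_eq_prod_left assms(2)) blast
 also have "K_eq A (mset_prod P' M') (mset_prod M' P')" using d by (intro K_eq_prod_commute) blast+
 finally show ?thesis .
qed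

end

section \<open>Polynomials as multisets of monomials\<close>

abbreviation lookup where "lookup \<equiv> Poly_Mapping.lookup"

text \<open>A polynomial with natural coefficients is a finite multiset of monomials. In this form
  induction on the number of terms is available, and evaluation is a map over a multiset.\<close>

definition poly_of :: "'g multiset multiset => 'g sym_poly" where
 "poly_of Q = (\<Sum>m\<in>#Q. Poly_Mapping.single m 1)"

lemma poly_of_empty [simp]: "poly_of {#} = 0"
 and poly_of_add: "poly_of (Q + Q') = poly_of Q + poly_of Q'"
 and poly_of_add_mset: "poly_of (add_mset m Q) = Poly_Mapping.single m 1 + poly_of Q"
 by (simp_all add: poly_of_def)

lemma poly_of_single: "poly_of {#m#} = Poly_Mapping.single m 1"
 by (simp add: poly_of_def)

lemma lookup_poly_of: "lookup (poly_of Q) m = count Q m"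
 by (induction Q) (auto simp: poly_of_add_mset lookup_add lookup_single)

lemma keys_poly_of: "Poly_Mapping.keys (poly_of Q) = set_mset Q"
 by (auto simp: in_keys_iff lookup_poly_of)

lemma poly_of_surj: "EX Q. p = poly_of Q"
proof
 let ?Q = "Abs_multiset (lookup p)"
 have "{m. 0 < lookup p m} = Poly_Mapping.keys p" by (auto simp: in_keys_iff)
 hence "count ?Q = lookup p" by (intro Abs_multiset_inverse) simp
 thus "p = poly_of ?Q" by (intro poly_mapping_eqI) (simp add: lookup_poly_of)
qed

lemma poly_of_in_sym_polys: "poly_of Q : sym_polys G \<longleftrightarrow> (\<forall>m\<in>#Q. set_mset m <= G)"
 by (simp add: sym_polys_def keys_poly_of)

lemma sym_polys_poly_of: assumes "p : sym_polys G" obtains Q where "p = poly_of Q" "\<forall>m\<in>#Q. set_mset m <= G"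
 using assms poly_of_surj[of p] poly_of_in_sym_polys by metis

lemma poly_of_mult_single: "Poly_Mapping.single m 1 * poly_of Q = poly_of (image_mset ((+) m) Q)"
 by (induction Q) (simp_all add: poly_of_add_mset distrib_left mult_single del: One_nat_def)

lemma poly_of_mult: "poly_of Q * poly_of Q' = poly_of (\<Sum>m\<in>#Q. image_mset ((+) m) Q')"
 by (induction Q) (simp_all add: poly_of_add_mset distrib_right poly_of_mult_single poly_of_add del: One_nat_def)

lemma poly_of_unit: "poly_of {#{#}#} = 1"
 by (simp add: poly_of_single del: One_nat_def)

lemma symb_poly_of: "symb g = poly_of {#{#g#}#}"
 by (simp add: symb_def poly_of_single)

lemma sym_polys_0 [simp]: "0 : sym_polys G" and sym_polys_1 [simp]: "1 : sym_polys G"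
 by (simp_all add: sym_polys_def)

lemma sym_polys_symb: "g : G ==> symb g : sym_polys G"
 by (simp add: sym_polys_def symb_def)

lemma sym_polys_add: "p : sym_polys G ==> q : sym_polys G ==> p + q : sym_polys G"
 using keys_add[of p q] by (auto simp: sym_polys_def)

lemma sym_polys_mult: assumes "p : sym_polys G" "q : sym_polys G" shows "p * q : sym_polys G"
proof -
 obtain Q Q' where "p = poly_of Q" "\<forall>m\<in>#Q. set_mset m <= G" "q = poly_of Q'" "\<forall>m\<in>#Q'. set_mset m <= G"
 using assms sym_polys_poly_of by metis
 thus ?thesis by (fastforce simp: poly_of_mult poly_of_in_sym_polys)
qed

lemma sym_polys_mono: "G <= G' ==> sym_polys G <= sym_polys G'"
 by (auto simp: sym_polys_def)

lemma sym_polys_induct [consumes 1, case_names zero one add symb]: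
 assumes "p : sym_polys G" "P 0" "P 1"
 "!!p q. p : sym_polys G ==> q : sym_polys G ==> P p ==> P q ==> P (p + q)"
 "!!g p. g : G ==> p : sym_polys G ==> P p ==> P (symb g * p)"
 shows "P p"
proof -
 obtain Q where Q: "p = poly_of Q" "\<forall>m\<in>#Q. set_mset m <= G" using assms(1) sym_polys_poly_of by metis
 have mono: "P (poly_of {#m#})" if "set_mset m <= G" for m using that
 proof (induction m)
 case empty
 thus ?case using assms(3) by (simp add: poly_of_unit)
 next
 case (add g m)
 hence "P (symb g * poly_of {#m#})"
 by (intro assms(5)) (auto simp: poly_of_in_sym_polys)
 thus ?case by (simp add: symb_poly_of poly_of_mult)
 qed
 show ?thesis unfolding Q(1) using Q(2)
 proof (induction Q)
 case (add m Q)
 hence "P (poly_of {#m#} + poly_of Q)"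
 by (intro assms(4) mono) (auto simp: poly_of_in_sym_polys)
 thus ?case by (simp add: poly_of_add_mset poly_of_single)
 qed (simp add: assms(2))
qed

section \<open>Evaluation of polynomials in the Grothendieck semiring\<close>

definition box_list :: "('g => 'a list set) => 'g list => 'a list set" where
 "box_list v gs = foldr (%g. set_prod (v g)) gs {[]}"

text \<open>The factors of a monomial are unordered while a product of sets is not, so an
  enumeration is chosen; another one gives the same class when the factors are definable.\<close>

definition box :: "('g => 'a list set) => 'g multiset => 'a list set" where
 "box v m = box_list v (SOME gs. mset gs = m)"

definition ev :: "('g => 'a list set) => 'g sym_poly => 'a list set multiset" where
 "ev v p = image_mset (box v) (Abs_multiset (lookup p))"

lemma ev_poly_of: "ev v (poly_of Q) = image_mset (box v) Q"
proof -
 have "lookup (poly_of Q) = count Q" by (simp add: lookup_poly_of fun_eq_iff)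
 thus ?thesis by (simp add: ev_def count_inverse)
qed

lemma ev_0 [simp]: "ev v 0 = {#}"
 using ev_poly_of[of v "{#}"] by simp

lemma ev_add: "ev v (p + q) = ev v p + ev v q"
 using poly_of_surj[of p] poly_of_surj[of q] by (auto simp: ev_poly_of poly_of_add[symmetric])

lemma box_list_simps [simp]: "box_list v [] = {[]}" "box_list v (g # gs) = set_prod (v g) (box_list v gs)"
 by (simp_all add: box_list_def)

lemma box_eq: obtains gs where "mset gs = m" "box v m = box_list v gs"
 using someI_ex[OF ex_mset[of m]] by (auto simp: box_def)

context zgroup_params
begin

lemma box_empty [simp]: "box v {#} = {[]}"
 using box_eq[of "{#}" v] by (metis box_list_simps(1) mset_zero_iff)

lemma box_single [simp]: "box v {#g#} = v g"
 using box_eq[of "{#g#}" v] by (metis box_list_simps mset_single_iff set_prod_unit(2))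

lemma ev_1: "ev v 1 = {#{[]}#}"
 by (simp add: poly_of_unit[symmetric] ev_poly_of)

lemma ev_symb: "ev v (symb g) = {#v g#}"
 by (simp add: symb_poly_of ev_poly_of)

lemma box_list_append: "box_list v (gs @ hs) = set_prod (box_list v gs) (box_list v hs)"
 by (induction gs) (simp_all add: set_prod_assoc)

lemma definable_box_list: "\<forall>g\<in>set gs. definable A (v g) ==> definable A (box_list v gs)"
proof (induction gs)
 case (Cons g gs)
 then obtain n m where "definable_in A n (v g)" "definable_in A m (box_list v gs)"
 unfolding definable_def by auto
 thus ?case using definable_inI[OF definable_in_set_prod] by simp
qed (use definable_in_unit definable_inI in simp)

lemma definable_box: "\<forall>g\<in>#m. definable A (v g) ==> definable A (box v m)"
 using definable_box_list[of _ v] box_eq[of m v] by (metis set_mset_mset)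

text \<open>The head \<open>g\<close> is located in \<open>hs\<close> and swapped past the block
  \<open>h1\<close> in front of it.\<close>

lemma K_eq_box_list_perm:
 assumes "mset gs = mset hs" "\<forall>g\<in>set gs. definable A (v g)"
 shows "K_eq A {#box_list v gs#} {#box_list v hs#}"
 using assms
proof (induction gs arbitrary: hs)
 case Nil
 thus ?case using definable_inI[OF definable_in_unit] by (auto intro: K_eq.refl)
next
 case (Cons g gs)
 have "g : set hs" using Cons.prems(1) by (metis list.set_intros(1) set_mset_mset)
 then obtain h1 h2 where hs: "hs = h1 @ g # h2" by (meson split_list)
 have eq: "mset gs = mset (h1 @ h2)" using Cons.prems(1) hs by simp
 hence "set gs = set (h1 @ h2)" by (metis set_mset_mset)
 hence "\<forall>x\<in>set h1. definable A (v x)" "\<forall>x\<in>set h2. definable A (v x)" "definable A (v g)"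
 using Cons.prems(2) by auto
 hence d: "definable A (box_list v h1)" "definable A (box_list v h2)" "definable A (v g)"
 by (simp_all add: definable_box_list)
 have "K_eq A {#box_list v gs#} {#box_list v (h1 @ h2)#}"
 using Cons eq by (intro Cons.IH) auto
 from K_eq_prod[OF K_eq.refl[of "{#v g#}"] this]
 have 1: "K_eq A {#box_list v (g # gs)#} {#set_prod (v g) (set_prod (box_list v h1) (box_list v h2))#}"
 using d by (simp add: mset_prod_single_left box_list_append)
 obtain n m where "definable_in A n (v g)" "definable_in A m (box_list v h1)"
 using d by (auto simp: definable_def)
 from K_eq_prod[OF K_swap[OF this] K_eq.refl[of "{#box_list v h2#}"]]
 have "K_eq A {#set_prod (v g) (set_prod (box_list v h1) (box_list v h2))#} {#box_list v hs#}"
 using d by (simp add: mset_prod_single_left box_list_append set_prod_assoc hs)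
 with 1 show ?case by (rule K_eq.trans)
qed

lemma K_eq_box_list: "\<forall>g\<in>set gs. definable A (v g) ==> K_eq A {#box v (mset gs)#} {#box_list v gs#}"
 using box_eq[of "mset gs" v] K_eq_box_list_perm[of _ gs v] by (metis set_mset_mset)

lemma K_eq_box_add:
 assumes "\<forall>g\<in>#m. definable A (v g)" "\<forall>g\<in>#m'. definable A (v g)"
 shows "K_eq A {#box v (m + m')#} {#set_prod (box v m) (box v m')#}"
proof -
 obtain gs hs where "mset gs = m" "box v m = box_list v gs" "mset hs = m'" "box v m' = box_list v hs"
 by (metis box_eq)
 thus ?thesis using K_eq_box_list[of "gs @ hs" v] assms
 by (simp add: box_list_append ball_Un) (metis set_mset_mset)
qed

lemma definable_ev:
 assumes "p : sym_polys G" "\<forall>g\<in>G. definable A (v g)" shows "\<forall>X\<in>#ev v p. definable A X"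
proof -
 obtain Q where "p = poly_of Q" "\<forall>m\<in>#Q. set_mset m <= G" using assms(1) sym_polys_poly_of by metis
 thus ?thesis using assms(2) definable_box[of _ v] by (auto simp: ev_poly_of subset_iff)
qed

lemma K_eq_ev_mult:
 assumes "p : sym_polys G" "q : sym_polys G" and v: "\<forall>g\<in>G. definable A (v g)"
 shows "K_eq A (ev v (p * q)) (mset_prod (ev v p) (ev v q))"
proof -
 obtain Q Q' where Q: "p = poly_of Q" "\<forall>m\<in>#Q. set_mset m <= G" "q = poly_of Q'" "\<forall>m\<in>#Q'. set_mset m <= G"
 using assms(1,2) sym_polys_poly_of by metis
 have 1: "K_eq A (image_mset (box v) (image_mset ((+) m) Q')) (mset_prod {#box v m#} (image_mset (box v) Q'))"
 if "set_mset m <= G" for m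
 using Q(4)
 proof (induction Q')
 case empty
 show ?case by (simp add: K_eq.refl)
 next
 case (add m' Q')
 have "K_eq A {#box v (m + m')#} {#set_prod (box v m) (box v m')#}"
 using v that add.prems by (intro K_eq_box_add) auto
 moreover have "K_eq A (image_mset (box v) (image_mset ((+) m) Q')) (mset_prod {#box v m#} (image_mset (box v) Q'))"
 using add by auto
 ultimately have "K_eq A ({#box v (m + m')#} + image_mset (box v) (image_mset ((+) m) Q'))
 ({#set_prod (box v m) (box v m')#} + mset_prod {#box v m#} (image_mset (box v) Q'))" by (rule K_eq.add)
 thus ?case by (simp add: mset_prod_single_left)
 qed
 show ?thesis unfolding Q(1,3) poly_of_mult ev_poly_of using Q(2)
 proof (induction Q)
 case empty
 show ?case by (simp add: K_eq.refl)
 next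
 case (add m Q)
 hence "K_eq A (image_mset (box v) (image_mset ((+) m) Q') + image_mset (box v) (\<Sum>m\<in>#Q. image_mset ((+) m) Q'))
 (mset_prod {#box v m#} (image_mset (box v) Q') + mset_prod (image_mset (box v) Q) (image_mset (box v) Q'))"
 by (intro K_eq.add 1) auto
 thus ?case
 using mset_prod_add_left[of "{#box v m#}" "image_mset (box v) Q" "image_mset (box v) Q'"] by simp
 qed
qed

lemma sym_eq_carrier:
 fixes G :: "'g::comm_monoid_add set"
 assumes "sym_eq G s p q" "0 : G" "s 1 : G" "!!g h. g : G ==> h : G ==> g + h : G"
 shows "p : sym_polys G & q : sym_polys G"
 using assms(1)
 by (induction rule: sym_eq.induct)
 (use assms(2-) in \<open>auto intro: sym_polys_add sym_polys_mult sym_polys_symb\<close>)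

text \<open>Induction on the derivation in \<open>Sym\<close>: only the three relations between
  generators have to be checked in the Grothendieck semiring, the other rules being congruence rules
  on both sides.\<close>

lemma sym_eq_ev:
 fixes G :: "'g::comm_monoid_add set"
 assumes "sym_eq G s p q" and v: "\<forall>g\<in>G. definable A (v g)"
 and G: "0 : G" "s 1 : G" "!!g h. g : G ==> h : G ==> g + h : G"
 and add: "!!g g'. g : G ==> g' : G ==> K_eq A {#v g, v g'#} {#v (g + g')#}"
 and zero: "K_eq A {#v 0#} {#}" and unit: "K_eq A {#v (s 1)#} {#{[]}#}"
 shows "K_eq A (ev v p) (ev v q)"
 using assms(1)
proof (induction rule: sym_eq.induct)
 case (refl p)
 thus ?case using definable_ev[OF _ v] by (intro K_eq.refl)
next
 case (mult p p' q q')
 have s: "p : sym_polys G" "p' : sym_polys G" "q : sym_polys G" "q' : sym_polys G"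
 using sym_eq_carrier[OF mult(1) G] sym_eq_carrier[OF mult(2) G] by auto
 show ?case
 by (rule K_eq.trans[OF K_eq_ev_mult[OF s(1,3) v]
 K_eq.trans[OF K_eq_prod[OF mult(3,4)] K_eq.sym[OF K_eq_ev_mult[OF s(2,4) v]]]])
next
 case (symb_add g g')
 thus ?case using add[of g g'] by (simp add: ev_add ev_symb add_mset_commute[of "v g'"])
next
 case (trans p q r)
 thus ?case by (meson K_eq.trans)
qed (simp_all add: ev_add ev_symb ev_1 zero unit K_eq.sym K_eq.add del: One_nat_def)

text \<open>The classes in the image of evaluation at polynomials over \<open>G\<close>.
  Surjectivity is obtained from closure properties of this predicate.\<close>

definition Rep :: "('g => 'a list set) => 'g set => 'a list set multiset => bool" where
 "Rep v G M \<longleftrightarrow> (\<exists>p\<in>sym_polys G. K_eq A M (ev v p))"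

lemma Rep_K_eq: "Rep v G M ==> K_eq A M' M ==> Rep v G M'"
 unfolding Rep_def by (meson K_eq.trans)

lemma Rep_add: "Rep v G M ==> Rep v G M' ==> Rep v G (M + M')"
 unfolding Rep_def by (metis K_eq.add ev_add sym_polys_add)

lemma Rep_prod: "Rep v G M ==> Rep v G M' ==> \<forall>g\<in>G. definable A (v g) ==> Rep v G (mset_prod M M')"
 unfolding Rep_def
proof (elim bexE)
 fix p q assume pq: "p : sym_polys G" "q : sym_polys G" "K_eq A M (ev v p)" "K_eq A M' (ev v q)"
 and v: "\<forall>g\<in>G. definable A (v g)"
 show "\<exists>p\<in>sym_polys G. K_eq A (mset_prod M M') (ev v p)"
 by (rule bexI[of _ "p * q"], rule K_eq.trans[OF K_eq_prod[OF pq(3,4)] K_eq.sym[OF K_eq_ev_mult[OF pq(1,2) v]]])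
 (rule sym_polys_mult[OF pq(1,2)])
qed

lemma Rep_empty: "Rep v G {#}"
 unfolding Rep_def by (metis K_eq.refl empty_iff ev_0 set_mset_empty sym_polys_0)

lemma Rep_sum: "(!!i. i : I ==> Rep v G (M i)) ==> Rep v G (\<Sum>i\<in>I. M i)"
 by (induction I rule: infinite_finite_induct) (simp_all add: Rep_empty Rep_add)

lemma Rep_unit: "Rep v G {#{[]}#}"
 unfolding Rep_def using definable_inI[OF definable_in_unit]
 by (intro bexI[of _ 1]) (simp_all add: ev_1 K_eq.refl)

lemma Rep_gen: "g : G ==> definable A (v g) ==> Rep v G {#v g#}"
 unfolding Rep_def by (intro bexI[of _ "symb g"]) (simp_all add: ev_symb K_eq.refl sym_polys_symb)

lemma Rep_mono: "Rep v G M ==> G <= G' ==> Rep v G' M"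
 unfolding Rep_def using sym_polys_mono by blast

end

section \<open>Decomposition of definable sets into affine images of shapes\<close>

context zgroup_params
begin

text \<open>A discrete simplex with \<open>k\<close> vertices, hence with \<open>k - 1\<close> free
  coordinates. Keeping the redundant coordinate lets all vertices play the same role.\<close>

definition bset :: "nat => 'a => 'a list set" where
 "bset k a = {u. length u = k & (\<forall>i<k. 0 <= u ! i) & (\<Sum>i<k. u ! i) = a}"

definition ray :: "'a list set" where
 "ray = {[x] | x. 0 <= x}"

text \<open>The Boolean parameter tells whether rays are allowed as factors.\<close>

inductive shape :: "bool => nat => 'a list set => bool" where
 unit: "shape b 0 {[]}"
| bset: "shape b q S ==> a : A ==> 0 <= a ==> 0 < k ==> shape b (k + q) (set_prod (bset k a) S)"
| ray: "shape True q S ==> shape True (1 + q) (set_prod ray S)"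

lemma sum_append:
 assumes "length xs = n" "length ys = m"
 shows "(\<Sum>i<n + m. k i *. (xs @ ys) ! i) = (\<Sum>i<n. k i *. xs ! i) + (\<Sum>i<m. k (n + i) *. ys ! i)"
proof -
 have "(\<Sum>i<n + m. k i *. (xs @ ys) ! i) =
 (\<Sum>i<n. k i *. (xs @ ys) ! i) + (\<Sum>i<m. k (n + i) *. (xs @ ys) ! (n + i))"
 by (induction m) (simp_all add: add.assoc)
 thus ?thesis using assms by (simp add: nth_append)
qed

lemma shape_length: "shape b q S ==> u : S ==> length u = q"
 by (induction arbitrary: u rule: shape.induct) (auto simp: bset_def ray_def elim!: set_prodE)

lemma shape_nonneg: "shape b q S ==> u : S ==> i < q ==> 0 <= u ! i"
 by (induction arbitrary: u i rule: shape.induct)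
 (auto simp: bset_def ray_def nth_append nth_Cons split: nat.splits elim!: set_prodE)

lemma definable_in_bset: "a : A ==> definable_in A k (bset k a)"
proof -
 assume a: "a : A"
 have "D k (%u. (\<forall>i\<in>{..<k}. 0 <= u ! i) & (\<Sum>i<k. u ! i) = a)"
 using a by (intro D_conj D_Ball D_le D_eq AF_intros) auto
 from definable_in_Collect[OF this] show ?thesis by (simp add: bset_def Ball_def)
qed

lemma definable_in_ray: "definable_in A 1 ray"
proof -
 have "D 1 (%u. 0 <= u ! 0)" by (intro D_le AF_intros) simp
 moreover have "{u. length u = 1 & 0 <= u ! 0} = ray" by (auto simp: ray_def length_Suc_conv)
 ultimately show ?thesis using definable_in_Collect by metis
qed

lemma definable_in_shape: "shape b q S ==> definable_in A q S"
 by (induction rule: shape.induct)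
 (simp_all only: definable_in_unit definable_in_set_prod definable_in_bset definable_in_ray)

lemma shape_prod: "shape b q S ==> shape b q' S' ==> shape b (q + q') (set_prod S S')"
proof (induction rule: shape.induct)
 case (unit b)
 thus ?case by simp
next
 case (bset b q S a k)
 hence "shape b (k + (q + q')) (set_prod (bset k a) (set_prod S S'))" by (intro shape.bset) auto
 thus ?case by (simp add: set_prod_assoc add.assoc)
next
 case (ray q S)
 hence "shape True (1 + (q + q')) (set_prod ray (set_prod S S'))" by (intro shape.ray) auto
 thus ?case by (simp add: set_prod_assoc)
qed

lemma shape_bset: "a : A ==> 0 <= a ==> 0 < k ==> shape b k (bset k a)"
 using shape.bset[OF shape.unit, of a k b] by simp

lemma shape_ray: "shape True 1 ray"
 using shape.ray[OF shape.unit] by simp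

text \<open>Normal form of an affine function on a shape: its constant coefficient is a value of the function,
 and the values of the other coefficients can be observed on the shape.\<close>

definition NF :: "nat => 'a list set => ('a list => 'a) => 'a => (nat => int) => bool" where
 "NF q S f c kp \<longleftrightarrow> c : A & (\<forall>u\<in>S. f u = c + (\<Sum>i<q. kp i *. u ! i)) & (\<exists>u\<in>S. f u = c) &
 (\<forall>i<q. (0 <= kp i & (kp i = 0 | (\<exists>u\<in>S. f u = c + kp i *. one))) \<or>
 (\<forall>t\<ge>0. \<exists>u\<in>S. f u = c + kp i *. t))"

lemma sum_two_points:
 fixes i0 i k :: nat
 assumes "i0 < k" "i < k" "i ~= i0"
 shows "(\<Sum>j<k. kp j *. (if j = i0 then x else if j = i then y else 0)) = kp i0 *. x + kp i *. y"
proof -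
 have "(\<Sum>j<k. kp j *. (if j = i0 then x else if j = i then y else 0)) =
 (\<Sum>j<k. (if j = i0 then kp i0 *. x else 0) + (if j = i then kp i *. y else 0))"
 using assms(3) by (intro sum.cong) auto
 thus ?thesis using assms by (simp add: sum.distrib)
qed

text \<open>The coordinates add up to \<open>a\<close>, so the smallest coefficient may be
  subtracted from all coefficients and moved into the constant. The constant is then the value at
  the vertex \<open>i0\<close>, and moving one unit from \<open>i0\<close> to \<open>i\<close>
  exhibits the coefficient of \<open>i\<close>.\<close>

lemma NF_bset:
 assumes "AF k f" "a : A" "0 <= a" "0 < k"
 shows "EX c kp. NF k (bset k a) f c kp"
proof -
 obtain kp c where c: "c : A" and f: "!!u. length u = k ==> f u = c + (\<Sum>i<k. kp i *. u ! i)"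
 using assms(1) unfolding AF_def by blast
 show ?thesis
 proof (cases "a = 0")
 \<comment> \<open>The simplex is a single point here, and all coefficients may be taken to be
   zero.\<close>
 case True
 have z: "u ! i = 0" if "u : bset k a" "i < k" for u i
 using that True sum_nonneg_eq_0_iff[of "{..<k}" "%i. u ! i"] by (auto simp: bset_def)
 have "f u = c" if "u : bset k a" for u
 proof -
 have "(\<Sum>i<k. kp i *. u ! i) = 0" using z[OF that] by (intro sum.neutral) simp
 thus ?thesis using f[of u] that by (simp add: bset_def)
 qed
 moreover have "replicate k 0 : bset k a" using True by (simp add: bset_def)
 ultimately show ?thesis using c unfolding NF_def
 by (intro exI[of _ c] exI[of _ "%_. 0"]) auto
 next
 case False
 have "\<exists>i0<k. \<forall>i<k. kp i0 <= kp i"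
 proof -
 have "Min (kp ` {..<k}) : kp ` {..<k}" using assms(4) by (intro Min_in) auto
 then obtain i0 where "i0 < k" "kp i0 = Min (kp ` {..<k})" by fastforce
 thus ?thesis by (intro exI[of _ i0]) simp
 qed
 then obtain i0 where i0: "i0 < k" "!!i. i < k ==> kp i0 <= kp i" by blast
 define c' where "c' = c + kp i0 *. a"
 \<comment> \<open>For \<open>x + y = a\<close> these are the points of the edge that joins the
   vertices \<open>i0\<close> and \<open>i\<close>.\<close>
 define P where "P i x y = map (%j. if j = i0 then x else if j = i then y else 0) [0..<k]" for i :: nat and x y :: 'a
 have fP: "f (P i x y) = c + (kp i0 *. x + kp i *. y)" if "i < k" "i ~= i0" for i x y
 proof -
 have "(\<Sum>j<k. kp j *. P i x y ! j) = (\<Sum>j<k. kp j *. (if j = i0 then x else if j = i then y else 0))"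
 by (intro sum.cong) (simp_all add: P_def)
 thus ?thesis using f[of "P i x y"] sum_two_points[OF i0(1) that, of kp] by (simp add: P_def)
 qed
 have PB: "P i x y : bset k a" if "i < k" "i ~= i0" "0 <= x" "0 <= y" "x + y = a" for i x y
 proof -
 have "(\<Sum>j<k. P i x y ! j) = (\<Sum>j<k. 1 *. (if j = i0 then x else if j = i then y else 0))"
 by (intro sum.cong) (simp_all add: P_def)
 thus ?thesis using sum_two_points[OF i0(1) that(1,2), of "%_. 1" x y] that
 by (simp add: P_def bset_def)
 qed
 have eq: "f u = c' + (\<Sum>i<k. (kp i - kp i0) *. u ! i)" if "u : bset k a" for u
 proof -
 have "(\<Sum>i<k. (kp i - kp i0) *. u ! i) = (\<Sum>i<k. kp i *. u ! i) - kp i0 *. (\<Sum>i<k. u ! i)"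
 by (simp add: smul_diff_left sum_subtractf smul_sum_right)
 thus ?thesis using that f[of u] by (simp add: bset_def c'_def)
 qed
 let ?v = "map (%j. if j = i0 then a else 0) [0..<k]"
 have v: "?v : bset k a" using assms(3) i0(1) by (simp add: bset_def)
 have fv: "f ?v = c'"
 proof -
 have "(\<Sum>i<k. kp i *. ?v ! i) = (\<Sum>i<k. if i = i0 then kp i0 *. a else 0)" by (intro sum.cong) auto
 thus ?thesis using f[of ?v] i0(1) by (simp add: c'_def)
 qed
 have one: "kp i - kp i0 = 0 | (\<exists>u\<in>bset k a. f u = c' + (kp i - kp i0) *. one)" if "i < k" for i
 proof (cases "i = i0")
 case False
 have "0 <= a - one" using one_least[of a] \<open>a ~= 0\<close> assms(3) by simp
 hence "P i (a - one) one : bset k a" using PB[OF that False] one_pos by simp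
 moreover have "f (P i (a - one) one) = c' + (kp i - kp i0) *. one"
 using fP[OF that False] by (simp add: c'_def smul_diff_left smul_diff_right)
 ultimately show ?thesis by blast
 qed simp
 have "NF k (bset k a) f c' (%i. kp i - kp i0)"
 unfolding NF_def
 proof (intro conjI ballI allI impI)
 show "c' : A" using c assms(2) by (simp add: c'_def add_in smul_in)
 show "f u = c' + (\<Sum>i<k. (kp i - kp i0) *. u ! i)" if "u : bset k a" for u using eq[OF that] .
 show "\<exists>u\<in>bset k a. f u = c'" using v fv by blast
 fix i assume "i < k"
 from i0(2)[OF this] have "0 <= kp i - kp i0" by simp
 with one[OF \<open>i < k\<close>] show "0 <= kp i - kp i0 & (kp i - kp i0 = 0 | (\<exists>u\<in>bset k a. f u = c' + (kp i - kp i0) *. one)) \<or>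
 (\<forall>t\<ge>0. \<exists>u\<in>bset k a. f u = c' + (kp i - kp i0) *. t)" by blast
 qed
 thus ?thesis by blast
 qed
qed

lemma NF_prod:
 assumes "NF k T g c kp" "NF q S h d \<mu>" "!!u v. u : T ==> v : S ==> f (u @ v) = g u + h v"
 "!!u. u : T ==> length u = k" "!!v. v : S ==> length v = q"
 shows "NF (k + q) (set_prod T S) f (c + d) (%i. if i < k then kp i else \<mu> (i - k))"
proof -
 let ?\<nu> = "%i. if i < k then kp i else \<mu> (i - k)"
 note nf = assms(1)[unfolded NF_def] assms(2)[unfolded NF_def]
 obtain u0 where u0: "u0 : T" "g u0 = c" using nf(1)[THEN conjunct2, THEN conjunct2, THEN conjunct1] by (elim bexE)
 obtain v0 where v0: "v0 : S" "h v0 = d" using nf(2)[THEN conjunct2, THEN conjunct2, THEN conjunct1] by (elim bexE)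
 have left: "\<exists>w\<in>set_prod T S. f w = c + d + x" if "\<exists>u\<in>T. g u = c + x" for x
 proof -
 from that obtain u where u: "u : T" "g u = c + x" by (elim bexE)
 have "f (u @ v0) = c + d + x" unfolding assms(3)[OF u(1) v0(1)] u(2) v0(2) by (simp add: algebra_simps)
 thus ?thesis using set_prodI[OF u(1) v0(1)] by (rule bexI)
 qed
 have right: "\<exists>w\<in>set_prod T S. f w = c + d + x" if "\<exists>v\<in>S. h v = d + x" for x
 proof -
 from that obtain v where v: "v : S" "h v = d + x" by (elim bexE)
 have "f (u0 @ v) = c + d + x" unfolding assms(3)[OF u0(1) v(1)] v(2) u0(2) by (simp add: algebra_simps)
 thus ?thesis using set_prodI[OF u0(1) v(1)] by (rule bexI)
 qed
 have 1: "f w = c + d + (\<Sum>i<k + q. ?\<nu> i *. w ! i)" if "w : set_prod T S" for w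
 proof -
 from that obtain u v where w: "w = u @ v" "u : T" "v : S" by (elim set_prodE)
 have g: "g u = c + (\<Sum>i<k. kp i *. u ! i)" by (rule nf(1)[THEN conjunct2, THEN conjunct1, THEN bspec, OF w(2)])
 have h: "h v = d + (\<Sum>i<q. \<mu> i *. v ! i)" by (rule nf(2)[THEN conjunct2, THEN conjunct1, THEN bspec, OF w(3)])
 show ?thesis
 unfolding w(1) assms(3)[OF w(2,3)] g h sum_append[OF assms(4)[OF w(2)] assms(5)[OF w(3)], of ?\<nu>]
 by (simp add: algebra_simps)
 qed
 have 2: "\<exists>w\<in>set_prod T S. f w = c + d" using left[of 0] u0 by auto
 have 3: "(0 <= ?\<nu> i & (?\<nu> i = 0 | (\<exists>u\<in>set_prod T S. f u = c + d + ?\<nu> i *. one))) \<or>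
 (\<forall>t\<ge>0. \<exists>u\<in>set_prod T S. f u = c + d + ?\<nu> i *. t)" if "i < k + q" for i
 proof (cases "i < k")
 case True
 have ex: "\<exists>w\<in>set_prod T S. f w = c + d + kp i *. t" if "\<exists>u\<in>T. g u = c + kp i *. t" for t
 using left[OF that] .
 have \<nu>: "?\<nu> i = kp i" using True by simp
 have "(0 <= kp i & (kp i = 0 | (\<exists>u\<in>T. g u = c + kp i *. one))) | (\<forall>t\<ge>0. \<exists>u\<in>T. g u = c + kp i *. t)"
 by (rule nf(1)[THEN conjunct2, THEN conjunct2, THEN conjunct2, rule_format]) (use True that in simp)
 thus ?thesis unfolding \<nu>
 proof (elim disjE conjE)
 assume "0 <= kp i" "kp i = 0"
 thus "0 <= kp i & (kp i = 0 | (\<exists>w\<in>set_prod T S. f w = c + d + kp i *. one)) \<or>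
 (\<forall>t\<ge>0. \<exists>w\<in>set_prod T S. f w = c + d + kp i *. t)" by (intro disjI1 conjI)
 next
 assume "0 <= kp i" "\<exists>u\<in>T. g u = c + kp i *. one"
 thus "0 <= kp i & (kp i = 0 | (\<exists>w\<in>set_prod T S. f w = c + d + kp i *. one)) \<or>
 (\<forall>t\<ge>0. \<exists>w\<in>set_prod T S. f w = c + d + kp i *. t)" by (intro disjI1 conjI disjI2 ex)
 next
 assume all: "\<forall>t\<ge>0. \<exists>u\<in>T. g u = c + kp i *. t"
 show "0 <= kp i & (kp i = 0 | (\<exists>w\<in>set_prod T S. f w = c + d + kp i *. one)) \<or>
 (\<forall>t\<ge>0. \<exists>w\<in>set_prod T S. f w = c + d + kp i *. t)"
 by (intro disjI2 allI impI ex) (rule all[rule_format])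
 qed
 next
 case False
 have ex: "\<exists>w\<in>set_prod T S. f w = c + d + \<mu> (i - k) *. t" if "\<exists>u\<in>S. h u = d + \<mu> (i - k) *. t" for t
 using right[OF that] .
 have \<nu>: "?\<nu> i = \<mu> (i - k)" using False by simp
 have "(0 <= \<mu> (i - k) & (\<mu> (i - k) = 0 | (\<exists>u\<in>S. h u = d + \<mu> (i - k) *. one))) | (\<forall>t\<ge>0. \<exists>u\<in>S. h u = d + \<mu> (i - k) *. t)"
 by (rule nf(2)[THEN conjunct2, THEN conjunct2, THEN conjunct2, rule_format]) (use False that in simp)
 thus ?thesis unfolding \<nu>
 proof (elim disjE conjE)
 assume "0 <= \<mu> (i - k)" "\<mu> (i - k) = 0"
 thus "0 <= \<mu> (i - k) & (\<mu> (i - k) = 0 | (\<exists>w\<in>set_prod T S. f w = c + d + \<mu> (i - k) *. one)) \<or>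
 (\<forall>t\<ge>0. \<exists>w\<in>set_prod T S. f w = c + d + \<mu> (i - k) *. t)" by (intro disjI1 conjI)
 next
 assume "0 <= \<mu> (i - k)" "\<exists>u\<in>S. h u = d + \<mu> (i - k) *. one"
 thus "0 <= \<mu> (i - k) & (\<mu> (i - k) = 0 | (\<exists>w\<in>set_prod T S. f w = c + d + \<mu> (i - k) *. one)) \<or>
 (\<forall>t\<ge>0. \<exists>w\<in>set_prod T S. f w = c + d + \<mu> (i - k) *. t)" by (intro disjI1 conjI disjI2 ex)
 next
 assume all: "\<forall>t\<ge>0. \<exists>u\<in>S. h u = d + \<mu> (i - k) *. t"
 show "0 <= \<mu> (i - k) & (\<mu> (i - k) = 0 | (\<exists>w\<in>set_prod T S. f w = c + d + \<mu> (i - k) *. one)) \<or>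
 (\<forall>t\<ge>0. \<exists>w\<in>set_prod T S. f w = c + d + \<mu> (i - k) *. t)"
 by (intro disjI2 allI impI ex) (rule all[rule_format])
 qed
 qed
 have 4: "c + d : A" using nf by (simp add: add_in)
 show ?thesis unfolding NF_def by (intro conjI ballI allI impI 1 2 3 4)
qed

lemma NF_D:
 assumes "NF q S f c kp"
 shows "c : A" and "u : S ==> f u = c + (\<Sum>i<q. kp i *. u ! i)" and "\<exists>u\<in>S. f u = c"
 and "i < q ==> (0 <= kp i & (kp i = 0 | (\<exists>u\<in>S. f u = c + kp i *. one))) \<or>
 (\<forall>t\<ge>0. \<exists>u\<in>S. f u = c + kp i *. t)"
proof -
 note nf = assms[unfolded NF_def]
 show "c : A" by (rule nf[THEN conjunct1])
 show "u : S ==> f u = c + (\<Sum>i<q. kp i *. u ! i)"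
 by (rule nf[THEN conjunct2, THEN conjunct1, THEN bspec])
 show "\<exists>u\<in>S. f u = c" by (rule nf[THEN conjunct2, THEN conjunct2, THEN conjunct1])
 show "i < q ==> (0 <= kp i & (kp i = 0 | (\<exists>u\<in>S. f u = c + kp i *. one))) \<or>
 (\<forall>t\<ge>0. \<exists>u\<in>S. f u = c + kp i *. t)"
 by (rule nf[THEN conjunct2, THEN conjunct2, THEN conjunct2, THEN spec, THEN mp])
qed

lemma shape_NF: "shape b q S ==> AF q f ==> EX c kp. NF q S f c kp"
proof (induction arbitrary: f rule: shape.induct)
 case (unit b)
 then obtain c where "c : A" "f [] = c" unfolding AF_def by auto
 hence "NF 0 {[]} f c (%_. 0)" by (simp add: NF_def)
 thus ?case by blast
next
 case (bset b q S a k)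
 show ?case
 proof (rule AF_append_split[OF bset.prems])
 fix g h assume gh: "AF k g" "AF q h" "!!xs ys. length xs = k ==> length ys = q ==> f (xs @ ys) = g xs + h ys"
 from NF_bset[OF gh(1) bset(2-4)] obtain c kp where 1: "NF k (bset k a) g c kp" by (elim exE)
 from bset.IH[OF gh(2)] obtain d \<mu> where 2: "NF q S h d \<mu>" by (elim exE)
 have "NF (k + q) (set_prod (bset k a) S) f (c + d) (%i. if i < k then kp i else \<mu> (i - k))"
 proof (rule NF_prod[OF 1 2])
 show len: "length u = k" if "u : bset k a" for u using that by (simp add: bset_def)
 show len': "length v = q" if "v : S" for v using shape_length[OF bset(1) that] .
 show "f (u @ v) = g u + h v" if "u : bset k a" "v : S" for u v
 by (rule gh(3)[OF len[OF that(1)] len'[OF that(2)]])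
 qed
 thus ?thesis by (intro exI)
 qed
next
 case (ray q S)
 show ?case
 proof (rule AF_append_split[OF ray.prems])
 fix g h assume gh: "AF 1 g" "AF q h" "!!xs ys. length xs = 1 ==> length ys = q ==> f (xs @ ys) = g xs + h ys"
 obtain k c where c: "c : A" and k: "ALL xs. length xs = 1 --> g xs = c + (\<Sum>i<1. k i *. xs ! i)"
 using gh(1) unfolding AF_def by (elim exE conjE)
 have g: "g [t] = c + k 0 *. t" for t using k[rule_format, of "[t]"] by simp
 have 1: "NF 1 ray g c k" unfolding NF_def
 proof (intro conjI)
 show "\<forall>u\<in>ray. g u = c + (\<Sum>i<1. k i *. u ! i)" by (auto simp: ray_def g)
 have "[0] : ray" by (simp add: ray_def)
 thus "\<exists>u\<in>ray. g u = c" using g[of 0] by (intro bexI[of _ "[0]"]) simp_all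
 have "\<exists>u\<in>ray. g u = c + k 0 *. t" if "0 <= t" for t
 using g[of t] that by (intro bexI[of _ "[t]"]) (simp_all add: ray_def)
 thus "\<forall>i<1. 0 <= k i & (k i = 0 | (\<exists>u\<in>ray. g u = c + k i *. one)) | (\<forall>t\<ge>0. \<exists>u\<in>ray. g u = c + k i *. t)"
 by simp
 qed (rule c)
 from ray.IH[OF gh(2)] obtain d \<mu> where 2: "NF q S h d \<mu>" by (elim exE)
 have "NF (1 + q) (set_prod ray S) f (c + d) (%i. if i < 1 then k i else \<mu> (i - 1))"
 proof (rule NF_prod[OF 1 2])
 show len: "length u = 1" if "u : ray" for u using that by (auto simp: ray_def)
 show len': "length v = q" if "v : S" for v using shape_length[OF ray(1) that] .
 show "f (u @ v) = g u + h v" if "u : ray" "v : S" for u v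
 by (rule gh(3)[OF len[OF that(1)] len'[OF that(2)]])
 qed
 thus ?thesis by (intro exI)
 qed
qed

text \<open>The constant of the normal form is a value of \<open>f\<close>, and so is its sum with
  each nonzero coefficient times \<open>one\<close>. Hence \<open>d\<close> divides the constant and
  all coefficients, and purity puts the divided constant into \<open>A\<close>.\<close>

lemma shape_divide:
 assumes "shape b q S" "AF q f" "0 < d" "!!u. u : S ==> mdvd d (f u)"
 shows "EX g. AF q g & (\<forall>u\<in>S. f u = d *. g u)"
proof -
 from shape_NF[OF assms(1,2)] obtain c kp where nf: "NF q S f c kp" by (elim exE)
 have dvd: "mdvd d x" if "\<exists>u\<in>S. f u = x" for x
 proof -
 from that obtain u where u: "u : S" "f u = x" by (elim bexE)
 from assms(4)[OF u(1)] show ?thesis unfolding u(2) .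
 qed
 have "mdvd d c" by (rule dvd[OF NF_D(3)[OF nf]])
 then obtain c' where c': "c = d *. c'" unfolding mdvd_def by (elim exE)
 have "c' : A" by (rule pure[OF assms(3)], fold c', rule NF_D(1)[OF nf])
 have kp: "d * (kp i div d) = kp i" if "i < q" for i
 proof -
 have "kp i = 0 | (\<exists>u\<in>S. f u = c + kp i *. one)"
 using NF_D(4)[OF nf that] order_less_imp_le[OF one_pos] by blast
 hence "d dvd kp i"
 proof
 assume "\<exists>u\<in>S. f u = c + kp i *. one"
 from dvd[OF this] have "mdvd d (kp i *. one)"
 using mdvd_diff[of d "c + kp i *. one" c] \<open>mdvd d c\<close> by simp
 thus ?thesis by (simp only: mdvd_one_iff[OF assms(3)])
 qed simp
 thus ?thesis by simp
 qed
 let ?g = "%u. c' + (\<Sum>i<q. (kp i div d) *. u ! i)"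
 have "AF q ?g" using \<open>c' : A\<close> by (intro AF_intros) auto
 moreover have "f u = d *. ?g u" if "u : S" for u
 proof -
 have "d *. ?g u = c + (\<Sum>i<q. (d * (kp i div d)) *. u ! i)"
 unfolding c' smul_add_right smul_sum_right smul_smul ..
 also have "(\<Sum>i<q. (d * (kp i div d)) *. u ! i) = (\<Sum>i<q. kp i *. u ! i)"
 by (intro sum.cong) (simp_all only: kp lessThan_iff)
 finally show ?thesis using NF_D(2)[OF nf that] by (simp only:)
 qed
 ultimately show ?thesis by blast
qed

text \<open>Coefficients from simplices are nonnegative by the normal form, and a negative
  coefficient along a ray would make the function negative far out.\<close>

lemma shape_min:
 assumes "shape b q S" "AF q f" "!!u. u : S ==> 0 <= f u"
 shows "EX c kp. c : A & 0 <= c & (\<forall>i<q. 0 <= kp i) & (\<forall>u\<in>S. f u = c + (\<Sum>i<q. kp i *. u ! i))"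
proof -
 from shape_NF[OF assms(1,2)] obtain c kp where nf: "NF q S f c kp" by (elim exE)
 have nonneg: "0 <= x" if "\<exists>u\<in>S. f u = x" for x
 proof -
 from that obtain u where u: "u : S" "f u = x" by (elim bexE)
 from assms(3)[OF u(1)] show ?thesis unfolding u(2) .
 qed
 have c: "0 <= c" by (rule nonneg[OF NF_D(3)[OF nf]])
 have "0 <= kp i" if "i < q" for i
 proof (rule ccontr)
 assume neg: "~ 0 <= kp i"
 hence all: "\<forall>t\<ge>0. \<exists>u\<in>S. f u = c + kp i *. t" using NF_D(4)[OF nf that] by blast
 have "0 <= c + one" using c one_pos by simp
 \<comment> \<open>At distance \<open>c + one\<close> along the ray a coefficient of at most
   \<open>-1\<close> brings the value down to \<open>- one\<close> or less.\<close>
 have "0 <= c + kp i *. (c + one)" by (rule nonneg[OF all[rule_format, OF \<open>0 <= c + one\<close>]])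
 moreover have "kp i *. (c + one) <= (- 1) *. (c + one)"
 using neg \<open>0 <= c + one\<close> by (intro smul_mono_left) auto
 hence "c + kp i *. (c + one) <= - one"
 using add_left_mono[of "kp i *. (c + one)" "- (c + one)" c] by simp
 ultimately have "0 <= - one" by (rule order_trans)
 thus False using one_pos by simp
 qed
 thus ?thesis using NF_D(1)[OF nf] NF_D(2)[OF nf] c by (intro exI[of _ c] exI[of _ kp] conjI allI impI ballI)
qed

text \<open>Cell decompositions adapted to \<open>L\<close>: the cells are disjoint, and each
  condition in \<open>L\<close> is constant on a cell. For empty \<open>L\<close> this is mere
  decomposability into affine images of shapes.\<close>

inductive PU :: "nat => ('a list => bool) set => 'a list set => bool" for n L where
 empty: "PU n L {}"
| piece: "shape True q S ==> AM q n G ==> inj_on G S ==>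
 (!!l u v. l : L ==> u : S ==> v : S ==> l (G u) ==> l (G v)) ==> PU n L (G ` S)"
| union: "PU n L X ==> PU n L Y ==> X Int Y = {} ==> PU n L (X Un Y)"

lemma PU_length: "PU n L X ==> x : X ==> length x = n"
 by (induction arbitrary: x rule: PU.induct) (auto dest: shape_length AM_length)

lemma PU_definable: "PU n L X ==> definable_in A n X"
 by (induction rule: PU.induct)
 (auto intro: definable_in_empty definable_in_Un definable_in_image definable_in_shape)

lemma PU_UN:
 "finite I ==> (!!i. i : I ==> PU n L (X i)) ==>
 (!!i j. i : I ==> j : I ==> i ~= j ==> X i Int X j = {}) ==> PU n L (\<Union>i\<in>I. X i)"
proof (induction I rule: finite_induct)
 case (insert i I)
 have "X i Int X k = {}" if "k : I" for k
 using insert.hyps(2) that by (intro insert.prems(2)) auto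
 hence "X i Int (\<Union>i\<in>I. X i) = {}" by blast
 moreover have "PU n L (\<Union>i\<in>I. X i)" by (intro insert.IH insert.prems) simp_all
 moreover have "PU n L (X i)" by (intro insert.prems) simp
 ultimately show ?case using PU.union by simp
qed (simp add: PU.empty)

abbreviation "SH n \<equiv> PU n {}"

lemma SH_shape: "shape True q S ==> SH q S"
 using PU.piece[of q S q "%x. x" "{}"] AM_id by (simp add: inj_on_def)

lemma PU_const:
 assumes "SH n X" "!!l x y. l : L ==> x : X ==> y : X ==> l x ==> l y"
 shows "PU n L X"
 using assms
proof (induction rule: PU.induct)
 case (piece q S G)
 show ?case
 proof (rule PU.piece[OF piece(1-3)])
 fix l u v assume "l : L" "u : S" "v : S" "l (G u)"
 thus "l (G v)" by (intro piece.prems[of l "G u" "G v"]) simp_all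
 qed
next
 case (union X Y)
 have "PU n L X" by (rule union.IH(1)) (rule union.prems, simp_all)
 moreover have "PU n L Y" by (rule union.IH(2)) (rule union.prems, simp_all)
 ultimately show ?case using PU.union union.hyps(3) by blast
qed (simp add: PU.empty)

lemma SH_image: "SH n X ==> AM n m H ==> inj_on H X ==> SH m (H ` X)"
proof (induction rule: PU.induct)
 case (piece q S G)
 have "SH m ((%u. H (G u)) ` S)"
 proof (rule PU.piece[OF piece(1)])
 show "AM q m (%u. H (G u))" using AM_comp[OF piece.prems(1) piece(2)] .
 show "inj_on (%u. H (G u)) S" using comp_inj_on[OF piece(3) piece.prems(2)] by (simp add: o_def)
 qed simp
 thus ?case by (simp add: image_image)
next
 case (union X Y)
 have "inj_on H X" "inj_on H Y" using union.prems(2) by (auto intro: inj_on_subset)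
 moreover have "H ` X Int H ` Y = {}"
 using union.hyps(3) inj_on_image_Int[OF union.prems(2), of X Y] by simp
 ultimately show ?case unfolding image_Un using union by (intro PU.union) auto
qed (simp add: PU.empty)

lemma set_prod_Un: "set_prod (X Un Y) S = set_prod X S Un set_prod Y S" "set_prod S (X Un Y) = set_prod S X Un set_prod S Y"
 unfolding set_prod_def by blast+

lemma set_prod_disjoint:
 assumes "X Int Y = {}" "!!x. x : X ==> length x = n" "!!x. x : Y ==> length x = n"
 shows "set_prod X S Int set_prod Y S = {}"
proof (rule ccontr)
 assume "set_prod X S Int set_prod Y S ~= {}"
 then obtain z where "z : set_prod X S" "z : set_prod Y S" by blast
 then obtain xs ys xs' ys' where "z = xs @ ys" "z = xs' @ ys'" "xs : X" "xs' : Y"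
 by (elim set_prodE)
 hence "xs = xs'" using assms(2,3) by (metis append_eq_append_conv)
 thus False using \<open>xs : X\<close> \<open>xs' : Y\<close> assms(1) by blast
qed

lemma SH_prod_shape: assumes "SH n X" "shape True q S" shows "SH (n + q) (set_prod X S)"
 using assms(1)
proof (induction rule: PU.induct)
 case (piece q' T G)
 let ?H = "%z. G (take q' z) @ drop q' z"
 have "SH (n + q) (?H ` set_prod T S)"
 proof (rule PU.piece[OF shape_prod[OF piece(1) assms(2)]])
 show "AM (q' + q) (n + q) ?H"
 using AM_drop[of q' "q' + q"] AM_comp[OF piece(2) AM_take[of q' "q' + q"]]
 by (intro AM_append) simp_all
 show "inj_on ?H (set_prod T S)"
 proof (rule inj_onI)
 fix z z' assume "z : set_prod T S" "z' : set_prod T S" and eq: "?H z = ?H z'"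
 then obtain u v u' v' where *: "z = u @ v" "z' = u' @ v'" "u : T" "u' : T" by (elim set_prodE)
 hence len: "length u = q'" "length u' = q'" using shape_length[OF piece(1)] by auto
 hence "length (G u) = length (G u')" using AM_length[OF piece(2)] by simp
 hence "G u = G u'" "v = v'" using eq * len by auto
 thus "z = z'" using * piece(3) by (auto simp: inj_on_def)
 qed
 qed simp
 moreover have "?H ` set_prod T S = set_prod (G ` T) S"
 proof (intro equalityI subsetI)
 fix z assume "z : ?H ` set_prod T S"
 then obtain u v where "z = ?H (u @ v)" "u : T" "v : S" by (auto elim: set_prodE)
 thus "z : set_prod (G ` T) S" using shape_length[OF piece(1)] by (simp add: set_prodI)
 next
 fix z assume "z : set_prod (G ` T) S"
 then obtain u v where *: "z = G u @ v" "u : T" "v : S" by (auto elim: set_prodE)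
 hence "z = ?H (u @ v)" using shape_length[OF piece(1)] by simp
 thus "z : ?H ` set_prod T S" using set_prodI[OF *(2,3)] by blast
 qed
 ultimately show ?case by simp
next
 case (union X Y)
 thus ?case unfolding set_prod_Un
 by (intro PU.union set_prod_disjoint[of X Y n]) (auto dest: PU_length)
qed (simp add: PU.empty)

lemma SH_swap: assumes "SH (n + m) (set_prod X Y)" "!!x. x : X ==> length x = n" "!!y. y : Y ==> length y = m"
 shows "SH (m + n) (set_prod Y X)"
proof -
 let ?G = "%zs. drop n zs @ take n zs"
 have "AM (n + m) (m + n) ?G" using AM_drop[of n "n + m"] by (intro AM_append AM_take) simp_all
 moreover have "inj_on ?G (set_prod X Y)"
 proof (rule inj_onI)
 fix z z' assume "z : set_prod X Y" "z' : set_prod X Y" and eq: "?G z = ?G z'"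
 hence "length z = n + m" "length z' = n + m"
 using PU_length[OF assms(1)] by blast+
 with eq have "drop n z = drop n z'" "take n z = take n z'" by (auto simp: append_eq_append_conv)
 thus "z = z'" by (metis append_take_drop_id)
 qed
 moreover have "?G ` set_prod X Y = set_prod Y X"
 proof (intro equalityI subsetI)
 fix z assume "z : ?G ` set_prod X Y"
 then obtain xs ys where "z = ?G (xs @ ys)" "xs : X" "ys : Y" by (auto elim: set_prodE)
 thus "z : set_prod Y X" using assms(2) by (simp add: set_prodI)
 next
 fix z assume "z : set_prod Y X"
 then obtain xs ys where *: "z = ys @ xs" "xs : X" "ys : Y" by (auto elim: set_prodE)
 hence "z = ?G (xs @ ys)" using assms(2) by simp
 thus "z : ?G ` set_prod X Y" using set_prodI[OF *(2,3)] by blast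
 qed
 ultimately show ?thesis using SH_image[OF assms(1)] by metis
qed

lemma SH_shape_prod: assumes "shape True q S" "SH n X" shows "SH (q + n) (set_prod S X)"
 using SH_swap[OF SH_prod_shape[OF assms(2,1)] PU_length[OF assms(2)] shape_length[OF assms(1)]] by simp

section \<open>The region below an affine function on a shape\<close>

definition under :: "'a list set => ('a list => 'a) => 'a list set" where
 "under S f = {u @ [y] | u y. u : S & 0 <= y & y < f u}"

lemma underI: "u : S ==> 0 <= y ==> y < f u ==> u @ [y] : under S f"
 unfolding under_def by blast

lemma underE: assumes "z : under S f" obtains u y where "z = u @ [y]" "u : S" "0 <= y" "y < f u"
 using assms unfolding under_def by blast

lemma under_cong: "(!!u. u : S ==> f u = g u) ==> under S f = under S g"
 unfolding under_def by force

text \<open>A coordinate \<open>u ! i\<close> with some \<open>y\<close> below it splits into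
  \<open>y\<close>, the nonnegative rest \<open>u ! i - y - one\<close>, and one unit. So the region
  is a simplex with one more vertex and with sum \<open>a - one\<close>.\<close>

lemma SH_under_bset:
 assumes "a : A" "0 <= a" "0 < k" "i < k"
 shows "SH (Suc k) (under (bset k a) (%u. u ! i))"
proof (cases "a = 0")
 case True
 have "under (bset k a) (%u. u ! i) = {}"
 proof (rule ccontr)
 assume "under (bset k a) (%u. u ! i) ~= {}"
 then obtain u y where *: "u : bset k a" "0 <= y" "y < u ! i" by (auto simp: under_def)
 hence "u ! i = 0" using True assms(4) sum_nonneg_eq_0_iff[of "{..<k}" "%i. u ! i"]
 by (auto simp: bset_def)
 thus False using * by simp
 qed
 thus ?thesis by (simp add: PU.empty)
next
 case False
 hence a: "0 <= a - one" using one_least[of a] assms(2) by simp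
 let ?H = "%w. map (%j. if j = i then w ! i + w ! k + one else w ! j) [0..<Suc k]"
 have AM: "AM (Suc k) (Suc k) ?H"
 proof (rule AM_map)
 fix j assume "j < Suc k"
 thus "AF (Suc k) (%w. if j = i then w ! i + w ! k + one else w ! j)"
 using assms(4) by (cases "j = i") (auto intro!: AF_intros)
 qed
 have inj: "inj_on ?H (bset (Suc k) (a - one))"
 proof (rule inj_onI)
 fix w w' assume *: "w : bset (Suc k) (a - one)" "w' : bset (Suc k) (a - one)" and eq: "?H w = ?H w'"
 have nth: "?H w ! j = ?H w' ! j" for j using eq by (rule arg_cong)
 have "w ! j = w' ! j" if "j < Suc k" "j ~= i" for j using nth[of j] that by (simp del: upt_Suc)
 moreover have "w ! i = w' ! i" using nth[of i] calculation[of k] assms(4) by (simp del: upt_Suc)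
 ultimately show "w = w'" using * by (intro nth_equalityI) (auto simp: bset_def)
 qed
 have "?H ` bset (Suc k) (a - one) = under (bset k a) (%u. u ! i)"
 proof (intro equalityI subsetI)
 fix z assume "z : ?H ` bset (Suc k) (a - one)"
 then obtain w where w: "w : bset (Suc k) (a - one)" "z = ?H w" by blast
 let ?u = "map (%j. if j = i then w ! i + w ! k + one else w ! j) [0..<k]"
 have z: "z = ?u @ [w ! k]" using w(2) assms(4) by simp
 have "(\<Sum>j<k. ?u ! j) = (\<Sum>j<k. w ! j + (if j = i then w ! k + one else 0))"
 by (intro sum.cong) (auto simp: algebra_simps)
 also have "\<dots> = a" using w(1) assms(4) by (simp add: sum.distrib bset_def eq_diff_eq add.assoc)
 finally have "?u : bset k a" using w(1) assms(4) one_pos by (simp add: bset_def)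
 moreover have "w ! k < ?u ! i"
 proof -
 have "0 <= w ! i" using w(1) assms(4) by (simp add: bset_def)
 hence "0 < w ! i + one" using one_pos by (rule add_nonneg_pos)
 from add_strict_left_mono[OF this, of "w ! k"] show ?thesis using assms(4) by (simp add: algebra_simps)
 qed
 moreover have "0 <= w ! k" using w(1) by (simp add: bset_def)
 ultimately show "z : under (bset k a) (%u. u ! i)" unfolding z by (intro underI)
 next
 fix z assume "z : under (bset k a) (%u. u ! i)"
 then obtain u y where *: "z = u @ [y]" "u : bset k a" "0 <= y" "y < u ! i" by (elim underE)
 let ?w = "u[i := u ! i - y - one] @ [y]"
 have len: "length u = k" using *(2) by (simp add: bset_def)
 have pos: "0 <= u ! i - y - one" using *(4) by (simp add: less_iff_add_one algebra_simps)
 have "(\<Sum>j<k. ?w ! j) = (\<Sum>j<k. u ! j - (if j = i then y + one else 0))"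
 using len by (intro sum.cong) (auto simp: nth_append algebra_simps)
 also have "\<dots> = a - y - one" using *(2) assms(4) by (simp add: sum_subtractf bset_def)
 finally have sum: "(\<Sum>j<k. ?w ! j) = a - y - one" .
 have "?w : bset (Suc k) (a - one)"
 proof -
 have "0 <= ?w ! j" if "j < Suc k" for j
 proof (cases "j = k")
 case True
 thus ?thesis using len *(3) by (simp add: nth_append)
 next
 case False
 thus ?thesis using len pos that *(2) by (cases "j = i") (simp_all add: nth_append bset_def)
 qed
 thus ?thesis using sum len by (simp add: bset_def nth_append)
 qed
 moreover have "?H ?w = z" using len assms(4) *(1)
 by (intro nth_equalityI) (auto simp: nth_append less_Suc_eq simp del: upt_Suc)
 ultimately show "z : ?H ` bset (Suc k) (a - one)" by (intro image_eqI[of z ?H ?w]) (simp only:)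
 qed
 thus ?thesis
 using SH_image[OF SH_shape[OF shape_bset] AM inj] a assms(1) one_in by (simp add: diff_in)
qed

text \<open>The same splitting as for a simplex: \<open>x\<close> is the sum of \<open>y\<close>, a
  nonnegative rest and \<open>one\<close>, which leaves two independent rays.\<close>

lemma SH_under_ray: "SH 2 (under ray (%u. u ! 0))"
proof -
 let ?H = "%w. [w ! 0 + w ! 1 + one, w ! 1]"
 have rr: "w : set_prod ray ray \<longleftrightarrow> (EX x y. w = [x, y] & 0 <= x & 0 <= y)" for w
 proof
 assume "w : set_prod ray ray"
 thus "EX x y. w = [x, y] & 0 <= x & 0 <= y" by (auto simp: ray_def elim!: set_prodE)
 next
 assume "EX x y. w = [x, y] & 0 <= x & 0 <= y"
 then obtain x y where "w = [x] @ [y]" "[x] : ray" "[y] : ray" by (auto simp: ray_def)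
 thus "w : set_prod ray ray" by (simp only: set_prodI)
 qed
 have ur: "z : under ray (%u. u ! 0) \<longleftrightarrow> (EX x y. z = [x, y] & 0 <= y & y < x)" for z
 proof
 assume "z : under ray (%u. u ! 0)"
 then obtain u y where "z = u @ [y]" "u : ray" "0 <= y" "y < u ! 0" by (elim underE)
 thus "EX x y. z = [x, y] & 0 <= y & y < x" unfolding ray_def by auto
 next
 assume "EX x y. z = [x, y] & 0 <= y & y < x"
 then obtain x y where *: "z = [x] @ [y]" "0 <= y" "y < x" by auto
 hence "[x] : ray" by (simp add: ray_def)
 thus "z : under ray (%u. u ! 0)" unfolding *(1) using *(2,3) by (intro underI) simp_all
 qed
 have "?H ` set_prod ray ray = under ray (%u. u ! 0)"
 proof (intro equalityI subsetI)
 fix z assume "z : ?H ` set_prod ray ray"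
 then obtain w where "w : set_prod ray ray" "z = ?H w" by (elim imageE)
 then obtain x y where *: "z = [x + y + one, y]" "0 <= x" "0 <= y" unfolding rr by auto
 have pos: "0 < x + one" using *(2) one_pos by (rule add_nonneg_pos)
 have "y < x + y + one" using add_strict_left_mono[OF pos, of y] by (simp add: algebra_simps)
 thus "z : under ray (%u. u ! 0)" unfolding ur using * by blast
 next
 fix z assume "z : under ray (%u. u ! 0)"
 then obtain x y where *: "z = [x, y]" "0 <= y" "y < x" unfolding ur by (elim exE conjE)
 have "0 <= x - y - one" using *(3) by (simp add: less_iff_add_one algebra_simps)
 hence "[x - y - one, y] : set_prod ray ray" unfolding rr using *(2) by blast
 moreover have "z = ?H [x - y - one, y]" using *(1) by simp
 ultimately show "z : ?H ` set_prod ray ray" by (rule image_eqI[rotated])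
 qed
 moreover have "AM 2 2 ?H"
 proof -
 have "AM 2 (Suc (Suc 0)) ?H" by (intro AM_Cons AM_Nil AF_intros) simp_all
 thus ?thesis by (simp add: numeral_2_eq_2)
 qed
 moreover have "inj_on ?H (set_prod ray ray)"
 proof (rule inj_onI)
 fix w w' assume "w : set_prod ray ray" "w' : set_prod ray ray" "?H w = ?H w'"
 thus "w = w'" unfolding rr by (elim exE conjE) simp
 qed
 moreover have "SH 2 (set_prod ray ray)"
 using SH_shape[OF shape_prod[OF shape_ray shape_ray]] by (simp add: numeral_2_eq_2)
 ultimately show ?thesis using SH_image[of 2 "set_prod ray ray" 2 ?H] by simp
qed

lemma SH_under_prod_left:
 assumes "SH (Suc k) (under T (%u. u ! i))" "i < k" "shape True q S" "!!u. u : T ==> length u = k"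
 shows "SH (Suc (k + q)) (under (set_prod T S) (%u. u ! i))"
proof -
 let ?X = "set_prod (under T (%u. u ! i)) S"
 let ?H = "%z. take k z @ drop (Suc k) z @ [z ! k]"
 have H: "?H ((u @ [y]) @ v) = (u @ v) @ [y]" if "length u = k" for u v y using that by (simp add: nth_append)
 have AM: "AM (Suc k + q) (k + (q + 1)) ?H"
 using AM_drop[of "Suc k" "Suc k + q"] AM_Cons[OF AF_nth AM_Nil, of k "Suc k + q"]
 by (intro AM_append AM_take) simp_all
 have inj: "inj_on ?H ?X"
 proof (rule inj_onI)
 fix z z' assume "z : ?X" "z' : ?X" and eq: "?H z = ?H z'"
 then obtain u y v u' y' v' where *: "z = (u @ [y]) @ v" "z' = (u' @ [y']) @ v'" "u : T" "u' : T"
 by (elim set_prodE underE) blast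
 have "(u @ v) @ [y] = (u' @ v') @ [y']" using eq unfolding *(1,2) H[OF assms(4)[OF *(3)]] H[OF assms(4)[OF *(4)]] .
 thus "z = z'" using *(1,2) assms(4)[OF *(3)] assms(4)[OF *(4)] by simp
 qed
 have img: "?H ` ?X = under (set_prod T S) (%u. u ! i)"
 proof (intro equalityI subsetI)
 fix z assume "z : ?H ` ?X"
 then obtain u y v where *: "z = ?H ((u @ [y]) @ v)" "u : T" "0 <= y" "y < u ! i" "v : S"
 by (elim imageE set_prodE underE) blast
 show "z : under (set_prod T S) (%u. u ! i)" unfolding *(1) H[OF assms(4)[OF *(2)]]
 proof (intro underI set_prodI)
 show "y < (u @ v) ! i" using *(4) assms(2) assms(4)[OF *(2)] by (simp add: nth_append)
 qed (fact *)+
 next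
 fix z assume "z : under (set_prod T S) (%u. u ! i)"
 then obtain u v y where *: "z = (u @ v) @ [y]" "u : T" "v : S" "0 <= y" "y < (u @ v) ! i"
 by (elim set_prodE underE) blast
 have "(u @ [y]) @ v : ?X"
 proof (intro underI set_prodI)
 show "y < u ! i" using *(5) assms(2) assms(4)[OF *(2)] by (simp add: nth_append)
 qed (fact *)+
 moreover have "z = ?H ((u @ [y]) @ v)" unfolding H[OF assms(4)[OF *(2)]] by (rule *(1))
 ultimately show "z : ?H ` ?X" by (rule image_eqI[rotated])
 qed
 from SH_image[OF SH_prod_shape[OF assms(1,3)] AM inj] show ?thesis unfolding img by simp
qed

lemma SH_under_prod_right:
 assumes "SH (Suc q) (under S (%u. u ! i))" "shape True k T"
 shows "SH (Suc (k + q)) (under (set_prod T S) (%u. u ! (k + i)))"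
proof -
 have "set_prod T (under S (%u. u ! i)) = under (set_prod T S) (%u. u ! (k + i))"
 proof (intro equalityI subsetI)
 fix z assume "z : set_prod T (under S (%u. u ! i))"
 then obtain u v y where *: "z = u @ v @ [y]" "u : T" "v : S" "0 <= y" "y < v ! i"
 by (elim set_prodE underE) blast
 have "(u @ v) @ [y] : under (set_prod T S) (%u. u ! (k + i))"
 proof (intro underI set_prodI)
 show "y < (u @ v) ! (k + i)" using *(5) shape_length[OF assms(2) *(2)] by (simp add: nth_append)
 qed (fact *)+
 thus "z : under (set_prod T S) (%u. u ! (k + i))" unfolding *(1) by simp
 next
 fix z assume "z : under (set_prod T S) (%u. u ! (k + i))"
 then obtain u v y where *: "z = (u @ v) @ [y]" "u : T" "v : S" "0 <= y" "y < (u @ v) ! (k + i)"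
 by (elim set_prodE underE) blast
 have "u @ v @ [y] : set_prod T (under S (%u. u ! i))"
 proof (intro underI set_prodI)
 show "y < v ! i" using *(5) shape_length[OF assms(2) *(2)] by (simp add: nth_append)
 qed (fact *)+
 thus "z : set_prod T (under S (%u. u ! i))" unfolding *(1) by simp
 qed
 thus ?thesis using SH_shape_prod[OF assms(2,1)] by simp
qed

lemma SH_under_coordinate:
 "shape b q S ==> i < q ==> b = True ==> SH (Suc q) (under S (%u. u ! i))"
proof (induction arbitrary: i rule: shape.induct)
 case (bset b q S a k)
 show ?case
 proof (cases "i < k")
 case True
 show ?thesis
 proof (rule SH_under_prod_left[OF SH_under_bset[OF bset(2-4) True] True])
 show "shape True q S" using bset by simp
 show "length u = k" if "u : bset k a" for u using that by (simp add: bset_def)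
 qed
 next
 case False
 hence "SH (Suc q) (under S (%u. u ! (i - k)))" using bset by simp
 from SH_under_prod_right[OF this shape_bset[OF bset(2-4)]] show ?thesis using False by simp
 qed
next
 case (ray q S)
 show ?case
 proof (cases "i < 1")
 case True
 have "SH (Suc 1) (under ray (%u. u ! i))" using SH_under_ray True by (simp add: numeral_2_eq_2)
 moreover have "length u = 1" if "u : ray" for u using that by (auto simp: ray_def)
 ultimately show ?thesis using SH_under_prod_left[OF _ True ray(1)] by blast
 next
 case False
 hence "SH (Suc q) (under S (%u. u ! (i - 1)))" using ray by simp
 from SH_under_prod_right[OF this shape_ray] show ?thesis using False by simp
 qed
qed simp

text \<open>An element below \<open>c\<close> and its complement to \<open>c - one\<close> form a
  point of a simplex with two vertices.\<close>

lemma SH_interval: assumes "c : A" "0 <= c" shows "SH 1 {[y] | y. 0 <= y & y < c}"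
proof (cases "c = 0")
 case True
 hence eq: "{[y] | y. 0 <= y & y < c} = {}" by auto
 show ?thesis unfolding eq by (rule PU.empty)
next
 case False
 hence c: "0 <= c - one" using one_least[of c] assms(2) by simp
 let ?H = "%w. [w ! 0]"
 have "?H ` bset 2 (c - one) = {[y] | y. 0 <= y & y < c}"
 proof (intro equalityI subsetI)
 fix z assume "z : ?H ` bset 2 (c - one)"
 then obtain w where w: "z = [w ! 0]" "0 <= w ! 0" "0 <= w ! 1" "w ! 0 + w ! 1 = c - one"
 by (auto simp: bset_def numeral_2_eq_2)
 have "w ! 0 <= w ! 0 + w ! 1" using w(3) by simp
 hence "w ! 0 + one <= c" unfolding w(4) by (simp add: le_diff_eq)
 thus "z : {[y] | y. 0 <= y & y < c}" using w by (simp add: less_iff_add_one)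
 next
 fix z assume "z : {[y] | y. 0 <= y & y < c}"
 then obtain y where y: "z = [y]" "0 <= y" "y < c" by blast
 hence "[y, c - one - y] : bset 2 (c - one)"
 by (auto simp: bset_def numeral_2_eq_2 less_iff_add_one algebra_simps less_Suc_eq)
 moreover have "z = ?H [y, c - one - y]" using y by simp
 ultimately show "z : ?H ` bset 2 (c - one)" by blast
 qed
 moreover have "AM 2 1 ?H" using AM_Cons[OF AF_nth AM_Nil, of 0 2] by simp
 moreover have "inj_on ?H (bset 2 (c - one))"
 proof (rule inj_onI)
 fix w w' assume *: "w : bset 2 (c - one)" "w' : bset 2 (c - one)" "?H w = ?H w'"
 hence "w ! 0 + w ! 1 = w' ! 0 + w' ! 1" by (auto simp: bset_def numeral_2_eq_2)
 moreover have "w ! 0 = w' ! 0" using *(3) by simp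
 ultimately have "w ! 1 = w' ! 1" by simp
 with \<open>w ! 0 = w' ! 0\<close> show "w = w'" using *(1,2)
 by (intro nth_equalityI) (auto simp: bset_def numeral_2_eq_2 less_Suc_eq)
 qed
 moreover have "SH 2 (bset 2 (c - one))" using c assms(1) one_in by (intro SH_shape shape_bset) (auto simp: diff_in)
 ultimately show ?thesis using SH_image by metis
qed

text \<open>Induction on the sum \<open>m\<close> of the coefficients. Taking one unit off a
  positive coefficient leaves a function \<open>?f\<close>; the points below
  \<open>?f u + u ! i\<close> are those below \<open>?f u\<close> together with the points below
  \<open>u ! i\<close> lifted by \<open>?f u\<close>.\<close>

lemma SH_under_linear:
 assumes S: "shape True q S" and c: "c : A" "0 <= c"
 shows "(!!i. i < q ==> 0 <= kp i) ==> m = (\<Sum>i<q. nat (kp i)) ==>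
 SH (Suc q) (under S (%u. c + (\<Sum>i<q. kp i *. u ! i)))"
proof (induction m arbitrary: kp)
 case 0
 hence "\<forall>i\<in>{..<q}. nat (kp i) = 0" by (subst sum_eq_0_iff[symmetric]) simp_all
 hence "kp i = 0" if "i < q" for i using that 0(1)[of i] by (force intro: antisym)
 hence "(\<Sum>i<q. kp i *. u ! i) = 0" for u :: "'a list" by (intro sum.neutral) simp
 hence "under S (%u. c + (\<Sum>i<q. kp i *. u ! i)) = under S (%u. c)" by simp
 also have "under S (%u. c) = set_prod S {[y] | y. 0 <= y & y < c}"
 unfolding under_def set_prod_def by blast
 finally have "under S (%u. c + (\<Sum>i<q. kp i *. u ! i)) = set_prod S {[y] | y. 0 <= y & y < c}" .
 thus ?case using SH_shape_prod[OF S SH_interval[OF c]] by simp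
next
 case (Suc m)
 have "\<exists>i<q. 0 < kp i"
 proof (rule ccontr)
 assume "~ (\<exists>i<q. 0 < kp i)"
 hence "kp i <= 0" if "i < q" for i using that by (meson not_less)
 hence "(\<Sum>i<q. nat (kp i)) = 0" by (intro sum.neutral) simp
 thus False using Suc.prems(2) by simp
 qed
 then obtain i where i: "i < q" "0 < kp i" by blast
 define kp' where "kp' = kp(i := kp i - 1)"
 let ?f = "%u. c + (\<Sum>i<q. kp' i *. u ! i)"
 have f: "c + (\<Sum>i<q. kp i *. u ! i) = ?f u + u ! i" for u :: "'a list"
 proof -
 have "(\<Sum>j<q. kp j *. u ! j) = (\<Sum>j<q. kp' j *. u ! j + (if j = i then u ! i else 0))"
 by (intro sum.cong) (auto simp: kp'_def smul_diff_left)
 thus ?thesis using i(1) by (simp add: sum.distrib add.assoc)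
 qed
 have "(\<Sum>j<q. nat (kp j)) = (\<Sum>j<q. nat (kp' j) + (if j = i then 1 else 0))"
 using i(2) by (intro sum.cong) (auto simp: kp'_def)
 hence "m = (\<Sum>j<q. nat (kp' j))" using Suc.prems(2) i(1) by (simp add: sum.distrib)
 moreover have "0 <= kp' j" if "j < q" for j using Suc.prems(1) i that by (simp add: kp'_def)
 ultimately have 1: "SH (Suc q) (under S ?f)" using Suc.IH by blast
 have f_nonneg: "0 <= ?f u" if "u : S" for u
 using c shape_nonneg[OF S that] \<open>!!j. j < q ==> 0 <= kp' j\<close>
 by (intro add_nonneg_nonneg sum_nonneg smul_nonneg) auto
 have AF: "AF q ?f" using c by (intro AF_intros) auto
 let ?H = "%z. take q z @ [?f (take q z) + z ! q]"
 have H: "?H (u @ [y]) = u @ [?f u + y]" if "u : S" for u y using shape_length[OF S that] by (simp add: nth_append)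
 have "AM (Suc q) (Suc q) ?H"
 using AM_append[OF AM_take AM_Cons[OF AF_add[OF AF_comp[OF AF AM_take[of q]] AF_nth] AM_Nil], of q "Suc q" q] by simp
 moreover have "inj_on ?H (under S (%u. u ! i))"
 proof (rule inj_onI)
 fix z z' assume "z : under S (%u. u ! i)" "z' : under S (%u. u ! i)" and eq: "?H z = ?H z'"
 then obtain u y u' y' where *: "z = u @ [y]" "z' = u' @ [y']" "u : S" "u' : S" by (elim underE)
 have eq': "u @ [?f u + y] = u' @ [?f u' + y']" using eq unfolding *(1,2) H[OF *(3)] H[OF *(4)] .
 hence "u = u'" by simp
 moreover from this eq' have "y = y'" by simp
 ultimately show "z = z'" using *(1,2) by simp
 qed
 moreover have "SH (Suc q) (under S (%u. u ! i))" using SH_under_coordinate[OF S i(1)] by simp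
 ultimately have 2: "SH (Suc q) (?H ` under S (%u. u ! i))" using SH_image by blast
 have mem: "z : ?H ` under S (%u. u ! i) \<longleftrightarrow> (EX u y. z = u @ [y] & u : S & ?f u <= y & y < ?f u + u ! i)" for z
 proof
 assume "z : ?H ` under S (%u. u ! i)"
 then obtain u y where *: "u : S" "0 <= y" "y < u ! i" "z = ?H (u @ [y])" by (elim imageE underE) blast
 have "z = u @ [?f u + y]" unfolding *(4) H[OF *(1)] ..
 with *(1-3) show "EX u y. z = u @ [y] & u : S & ?f u <= y & y < ?f u + u ! i"
 by (intro exI[of _ u] exI[of _ "?f u + y"]) simp
 next
 assume "EX u y. z = u @ [y] & u : S & ?f u <= y & y < ?f u + u ! i"
 then obtain u y where *: "z = u @ [y]" "u : S" "?f u <= y" "y < ?f u + u ! i" by blast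
 have "u @ [y - ?f u] : under S (%u. u ! i)"
 using * by (intro underI) (simp_all add: diff_less_eq add.commute)
 moreover have "z = ?H (u @ [y - ?f u])" unfolding H[OF *(2)] *(1) by simp
 ultimately show "z : ?H ` under S (%u. u ! i)" by (intro image_eqI[of z ?H "u @ [y - ?f u]"])
 qed
 have "under S (%u. c + (\<Sum>i<q. kp i *. u ! i)) = under S ?f Un ?H ` under S (%u. u ! i)"
 unfolding f
 proof (intro equalityI subsetI)
 fix z assume "z : under S (%u. ?f u + u ! i)"
 then obtain u y where *: "z = u @ [y]" "u : S" "0 <= y" "y < ?f u + u ! i" by (elim underE)
 show "z : under S ?f Un ?H ` under S (%u. u ! i)"
 proof (cases "y < ?f u")
 case True
 thus ?thesis using * underI[of u S y ?f] by blast
 next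
 case False
 hence "EX u y. z = u @ [y] & u : S & ?f u <= y & y < ?f u + u ! i"
 using * by (intro exI[of _ u] exI[of _ y]) simp
 thus ?thesis using mem[of z] by (intro UnI2) (rule iffD2)
 qed
 next
 fix z assume "z : under S ?f Un ?H ` under S (%u. u ! i)"
 then consider "z : under S ?f" | "EX u y. z = u @ [y] & u : S & ?f u <= y & y < ?f u + u ! i"
 using mem[of z] by blast
 thus "z : under S (%u. ?f u + u ! i)"
 proof cases
 case 1
 then obtain u y where *: "z = u @ [y]" "u : S" "0 <= y" "y < ?f u" by (elim underE)
 have "0 <= u ! i" using shape_nonneg[OF S *(2) i(1)] .
 hence "y < ?f u + u ! i" using *(4) by (meson add_increasing2 less_le_trans order_refl)
 thus ?thesis unfolding *(1) using * by (intro underI)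
 next
 case 2
 then obtain u y where *: "z = u @ [y]" "u : S" "?f u <= y" "y < ?f u + u ! i" by blast
 hence "0 <= y" using f_nonneg[OF *(2)] by (meson order_trans)
 thus ?thesis unfolding *(1) using * by (intro underI)
 qed
 qed
 moreover have "under S ?f Int ?H ` under S (%u. u ! i) = {}"
 proof (rule ccontr)
 assume "under S ?f Int ?H ` under S (%u. u ! i) ~= {}"
 then obtain z where z: "z : under S ?f" "EX u y. z = u @ [y] & u : S & ?f u <= y & y < ?f u + u ! i"
 using mem by blast
 from z(1) obtain u y where "z = u @ [y]" "y < ?f u" by (elim underE)
 with z(2) show False by (metis append1_eq_conv not_less)
 qed
 ultimately show ?case using PU.union[OF 1 2] by simp
qed

lemma SH_under:
 assumes "shape True q S" "AF q f" "!!u. u : S ==> 0 <= f u"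
 shows "SH (Suc q) (under S f)"
proof -
 obtain c kp where c: "c : A" "0 <= c" "\<forall>i<q. 0 <= kp i"
 and eq: "\<forall>u\<in>S. f u = c + (\<Sum>i<q. kp i *. u ! i)"
 proof -
 from shape_min[OF assms(1,2)] assms(3)
 have "EX c kp. c : A & 0 <= c & (\<forall>i<q. 0 <= kp i) & (\<forall>u\<in>S. f u = c + (\<Sum>i<q. kp i *. u ! i))"
 by simp
 with that show thesis by (elim exE conjE)
 qed
 have "under S f = under S (%u. c + (\<Sum>i<q. kp i *. u ! i))" by (rule under_cong) (rule bspec[OF eq])
 thus ?thesis using SH_under_linear[OF assms(1) c(1,2), of kp, OF c(3)[rule_format] HOL.refl] by (simp only:)
qed

section \<open>Decomposing the fibres over a cell\<close>

lemma separates_data: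
 assumes "separates n lam M Fs L0 L"
 shows "0 < lam" "0 < M" "finite Fs" "\<forall>f\<in>Fs. AF n f" "finite L0" "\<forall>l\<in>L0. LT n l"
proof -
 note s = assms[unfolded separates_def]
 show "0 < lam" by (rule s[THEN conjunct1])
 note s = s[THEN conjunct2]
 show "0 < M" by (rule s[THEN conjunct1])
 note s = s[THEN conjunct2]
 show "finite Fs" by (rule s[THEN conjunct1])
 note s = s[THEN conjunct2]
 show "\<forall>f\<in>Fs. AF n f" by (rule s[THEN conjunct1])
 note s = s[THEN conjunct2]
 show "finite L0" by (rule s[THEN conjunct1])
 note s = s[THEN conjunct2]
 show "\<forall>l\<in>L0. LT n l" by (rule s[THEN conjunct1])
qed

lemma separates_insert:
 assumes "separates n lam M Fs L0 L" "AF n f"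
 shows "separates n lam M (insert f Fs) L0 L"
 unfolding separates_def
proof (intro conjI allI impI ballI)
 fix t t' e e' l
 assume *: "length e = n" "length e' = n" "\<forall>l\<in>L0. l e = l e'"
 "\<forall>f\<in>insert f Fs. (f e <= lam *. t) = (f e' <= lam *. t')" "mdvd M (t - t')" "l : L"
 show "l (t # e) = l (t' # e')"
 by (rule separates_D[OF assms(1) *(1-3) _ *(5,6)]) (rule ballI, rule bspec[OF *(4)], rule insertI2)
next
 show "AF n g" if "g : insert f Fs" for g using that separates_data(4)[OF assms(1)] assms(2) by blast
qed (use separates_data[OF assms(1)] in simp_all)

lemma shape_nonempty: "shape b q S ==> S ~= {}"
proof (induction rule: shape.induct)
 case (bset b q S a k)
 have "(\<Sum>i<k. (a # replicate (k - 1) 0) ! i) = a"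
 using bset(4) by (cases k) (simp_all add: sum.lessThan_Suc_shift del: sum.lessThan_Suc)
 hence "a # replicate (k - 1) 0 : bset k a"
 using bset(3,4) by (auto simp: bset_def nth_Cons split: nat.splits)
 thus ?case using bset.IH set_prodI by blast
next
 case (ray q S)
 have "[0] : ray" by (simp add: ray_def)
 thus ?case using ray.IH set_prodI by blast
qed simp

lemma smul_less_smul_add:
 assumes "0 < b" "0 <= r" "r < b" shows "0 <= b *. s + r *. one \<longleftrightarrow> 0 <= s"
proof
 assume "0 <= b *. s + r *. one"
 show "0 <= s"
 proof (rule ccontr)
 assume "~ 0 <= s"
 hence "s + one <= 0" by (simp add: less_iff_add_one[symmetric])
 hence "b *. s + b *. one <= 0" using smul_mono[of b "s + one" 0] assms by (simp add: smul_add_right)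
 moreover have "b *. s + r *. one < b *. s + b *. one" using assms by simp
 ultimately show False using \<open>0 <= b *. s + r *. one\<close> by (meson less_le_trans not_less)
 qed
next
 assume "0 <= s"
 thus "0 <= b *. s + r *. one" using assms one_pos by (intro add_nonneg_nonneg smul_nonneg) auto
qed

text \<open>The part of the fibre over the piece \<open>G ` S\<close> on which \<open>t\<close> has residue \<open>r\<close> and \<open>lam *. t\<close> lies above
 exactly the functions in \<open>T\<close>.\<close>

definition strip :: "int => int => ('a list => 'a) set => 'a list set => ('a list => 'a) set => int => 'a list set" where
 "strip lam M Fs C T r = {t # e | t e. e : C & (\<forall>f\<in>Fs. f e <= lam *. t \<longleftrightarrow> f : T) & mdvd M (t - r *. one)}"

text \<open>The order of the thresholds is the same over all of \<open>S\<close>, so only the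
  largest threshold in \<open>T\<close> and the least one outside \<open>T\<close> matter. After
  rounding to the residue class the fibre is an upward ray, a downward ray or a segment; the
  segments form the region under an affine function, the difference of the two rounded
  thresholds.\<close>

lemma SH_strip:
 assumes S: "shape True q S" and G: "AM q n G" "inj_on G S"
 and const: "!!l u v. l : order_lits (lam * M) Fs ==> u : S ==> v : S ==> l (G u) = l (G v)"
 and pos: "0 < lam" "0 < M" and Fs: "finite Fs" "!!f. f : Fs ==> AF n f" "Fs ~= {}" and T: "T <= Fs"
 shows "SH (Suc n) (strip lam M Fs (G ` S) T r)"
proof -
 let ?b = "lam * M" and ?X = "strip lam M Fs (G ` S) T r"
 have b: "0 < ?b" using pos by simp
 obtain u0 where u0: "u0 : S" using shape_nonempty[OF S] by blast
 have agree: "\<forall>l\<in>order_lits ?b Fs. l (G u) = l (G v)" if "u : S" "v : S" for u v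
 by (rule ballI) (rule const[OF _ that])
 note res = order_lits_agree(1)[OF b agree] and ord = order_lits_agree(2)[OF b agree]
 have AFG: "AF q (%u. f (G u))" if "f : Fs" for f using AF_comp[OF Fs(2)[OF that] G(1)] .
 have T_fin: "finite T" using T Fs(1) by (rule finite_subset)
 \<comment> \<open>The residue of \<open>f (G u)\<close> does not depend on \<open>u\<close>, so \<open>f (G u)\<close> can be rounded up to the admissible class.\<close>
 have round: "EX d g. 0 <= d & d < ?b & AF q g & (\<forall>u\<in>S. f (G u) + d *. one = lam *. r *. one + ?b *. g u)"
 if f: "f : Fs" for f
 proof -
 obtain d where d: "0 <= d" "d < ?b" "mdvd ?b (lam *. r *. one - f (G u0) - d *. one)"
 using residue_mdvd[OF b] by blast
 have "mdvd ?b (f (G u) + d *. one - lam *. r *. one)" if "u : S" for u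
 using mdvd_diff[OF res[OF that u0 f] d(3)] by (simp add: algebra_simps)
 moreover have "AF q (%u. f (G u) + d *. one - lam *. r *. one)" using AFG[OF f] by (intro AF_intros)
 ultimately have "EX g. AF q g & (\<forall>u\<in>S. f (G u) + d *. one - lam *. r *. one = ?b *. g u)"
 by (intro shape_divide[OF S _ b])
 then obtain g where g: "AF q g" "\<forall>u\<in>S. f (G u) + d *. one - lam *. r *. one = ?b *. g u" by (elim exE conjE)
 have "f (G u) + d *. one = lam *. r *. one + ?b *. g u" if "u : S" for u
 using bspec[OF g(2) that] by (simp add: diff_eq_eq add.commute)
 with d g(1) show ?thesis by (intro exI[of _ d] exI[of _ g]) simp
 qed
 \<comment> \<open>For \<open>t = r + M y\<close>, comparing \<open>lam *. t\<close> with \<open>f\<close> is comparing \<open>y\<close> with the rounded quotient \<open>g\<close>.\<close>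
 have cmp: "f (G u) <= lam *. (r *. one + M *. y) \<longleftrightarrow> g u <= y"
 if "0 <= d" "d < ?b" "f (G u) + d *. one = lam *. r *. one + ?b *. g u" for f d g u y
 proof -
 have "f (G u) <= lam *. (r *. one + M *. y) \<longleftrightarrow> 0 <= lam *. (r *. one + M *. y) - f (G u)" by simp
 also have "lam *. (r *. one + M *. y) - f (G u) = ?b *. (y - g u) + d *. one"
 using that(3) by (simp add: smul_add_right smul_diff_right smul_smul[of lam M] algebra_simps)
 also have "0 <= ?b *. (y - g u) + d *. one \<longleftrightarrow> 0 <= y - g u" by (rule smul_less_smul_add[OF b that(1,2)])
 finally show ?thesis by simp
 qed
 \<comment> \<open>A common parametrization of the three cases: the last coordinate counts steps of
   size \<open>M\<close> from a rounded threshold, upwards for \<open>k = 1\<close> and downwards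
   for \<open>k = -1\<close>.\<close>
 have image: "SH (Suc n) ((%z. (r *. one + M *. (g (take q z) + k *. z ! q)) # G (take q z)) ` Y)"
 if Y: "SH (Suc q) Y" "!!z. z : Y ==> take q z : S" and g: "AF q g" and k: "k ~= 0" for g k Y
 proof (rule SH_image[OF Y(1)])
 show "AM (Suc q) (Suc n) (%z. (r *. one + M *. (g (take q z) + k *. z ! q)) # G (take q z))"
 using AM_comp[OF G(1) AM_take[of q "Suc q"]] AF_comp[OF g AM_take[of q "Suc q"]]
 by (intro AM_Cons AF_intros) simp_all
 show "inj_on (%z. (r *. one + M *. (g (take q z) + k *. z ! q)) # G (take q z)) Y"
 proof (rule inj_onI)
 fix z z' assume z: "z : Y" "z' : Y" and "(r *. one + M *. (g (take q z) + k *. z ! q)) # G (take q z) =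
 (r *. one + M *. (g (take q z') + k *. z' ! q)) # G (take q z')"
 hence eq: "M *. (g (take q z) + k *. z ! q) = M *. (g (take q z') + k *. z' ! q)" "G (take q z) = G (take q z')"
 by simp_all
 have tk: "take q z = take q z'" using inj_onD[OF G(2) eq(2) Y(2)[OF z(1)] Y(2)[OF z(2)]] .
 have "z ! q = z' ! q" using eq(1) pos k by (simp add: tk)
 have len: "length z = Suc q" "length z' = Suc q" using z PU_length[OF Y(1)] by auto
 thus "z = z'" using tk \<open>z ! q = z' ! q\<close> take_Suc_conv_app_nth[of q z] take_Suc_conv_app_nth[of q z'] by simp
 qed
 qed
 have memI: "(r *. one + M *. y) # G u : ?X" if "u : S" "!!f. f : Fs ==> f (G u) <= lam *. (r *. one + M *. y) \<longleftrightarrow> f : T" for u y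
 proof -
 have "mdvd M (r *. one + M *. y - r *. one)" by simp
 with that show ?thesis unfolding strip_def by (intro CollectI exI conjI ballI) auto
 qed
 have memE: "EX u y. z = (r *. one + M *. y) # G u & u : S & (\<forall>f\<in>Fs. f (G u) <= lam *. (r *. one + M *. y) \<longleftrightarrow> f : T)"
 if "z : ?X" for z
 proof -
 from that obtain t u where tu: "z = t # G u" "u : S" "\<forall>f\<in>Fs. f (G u) <= lam *. t \<longleftrightarrow> f : T" "mdvd M (t - r *. one)"
 unfolding strip_def by blast
 from tu(4) obtain y where "t - r *. one = M *. y" unfolding mdvd_def by (elim exE)
 hence "t = r *. one + M *. y" by (simp add: diff_eq_eq add.commute)
 with tu show ?thesis by (intro exI[of _ u] exI[of _ y]) simp
 qed
 show ?thesis
 proof (cases "?X = {}")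
 case True
 show ?thesis unfolding True by (rule PU.empty)
 next
 case False
 then obtain z0 where "z0 : ?X" by blast
 from memE[OF this] obtain u1 y1 where u1: "u1 : S"
 "\<forall>f\<in>Fs. f (G u1) <= lam *. (r *. one + M *. y1) \<longleftrightarrow> f : T" by (elim exE conjE)
 have lower: "\<exists>f0\<in>T. \<forall>u\<in>S. \<forall>h\<in>T. h (G u) <= f0 (G u)" if "T ~= {}"
 proof -
 from finite_argmax[OF T_fin that, of "%f. f (G u0)"] obtain f0 where
 f0: "f0 : T" "!!h. h : T ==> h (G u0) <= f0 (G u0)" by blast
 have "h (G u) <= f0 (G u)" if "u : S" "h : T" for u h
 using ord[OF u0 that(1), of h f0 0] f0 that(2) T b by auto
 with f0(1) show ?thesis by blast
 qed
 have upper: "\<exists>f1\<in>Fs - T. \<forall>u\<in>S. \<forall>h\<in>Fs - T. f1 (G u) <= h (G u)" if "Fs - T ~= {}"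
 proof -
 have "finite (Fs - T)" using Fs(1) by simp
 from finite_argmin[OF this that, of "%f. f (G u0)"] obtain f1 where
 f1: "f1 : Fs - T" "!!h. h : Fs - T ==> f1 (G u0) <= h (G u0)" by blast
 have "f1 (G u) <= h (G u)" if "u : S" "h : Fs - T" for u h
 using ord[OF u0 that(1), of f1 h 0] f1 that(2) b by auto
 with f1(1) show ?thesis by blast
 qed
 have SS: "SH (Suc q) (set_prod S ray)" using SH_shape[OF shape_prod[OF S shape_ray]] by simp
 have SSmem: "take q z : S" "0 <= z ! q" if "z : set_prod S ray" for z
 proof -
 from that obtain u x where "z = u @ [x]" "u : S" "0 <= x" by (auto simp: ray_def elim!: set_prodE)
 thus "take q z : S" "0 <= z ! q" using shape_length[OF S] by (auto simp: nth_append)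
 qed
 consider "T ~= {}" "Fs - T = {}" | "T = {}" | "T ~= {}" "Fs - T ~= {}" by blast
 thus ?thesis
 proof cases
 case 1
 hence TF: "T = Fs" using T by blast
 from lower[OF 1(1)] obtain f0 where f0: "f0 : T" "\<forall>u\<in>S. \<forall>h\<in>T. h (G u) <= f0 (G u)" by (elim bexE)
 have "f0 : Fs" using f0(1) T by blast
 from round[OF this] obtain d g where g: "0 <= d" "d < ?b" "AF q g"
 "\<forall>u\<in>S. f0 (G u) + d *. one = lam *. r *. one + ?b *. g u" by (elim exE conjE)
 note cmp0 = cmp[of d f0 _ g, OF g(1,2) bspec[OF g(4)]]
 have "?X = (%z. (r *. one + M *. (g (take q z) + 1 *. z ! q)) # G (take q z)) ` set_prod S ray"
 proof (intro equalityI subsetI)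
 fix z assume "z : ?X"
 from memE[OF this] obtain u y where uy: "z = (r *. one + M *. y) # G u" "u : S"
 "\<forall>f\<in>Fs. f (G u) <= lam *. (r *. one + M *. y) \<longleftrightarrow> f : T" by (elim exE conjE)
 hence "g u <= y" using cmp0[OF uy(2), of y] f0(1) \<open>f0 : Fs\<close> by blast
 hence "u @ [y - g u] : set_prod S ray" using uy(2) by (intro set_prodI) (simp_all add: ray_def)
 moreover have "take q (u @ [y - g u]) = u" "(u @ [y - g u]) ! q = y - g u"
 using shape_length[OF S uy(2)] by (simp_all add: nth_append)
 ultimately show "z : (%z. (r *. one + M *. (g (take q z) + 1 *. z ! q)) # G (take q z)) ` set_prod S ray"
 by (intro image_eqI[of _ _ "u @ [y - g u]"]) (simp_all add: uy(1))
 next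
 fix z assume "z : (%z. (r *. one + M *. (g (take q z) + 1 *. z ! q)) # G (take q z)) ` set_prod S ray"
 then obtain w where w: "w : set_prod S ray" "z = (r *. one + M *. (g (take q w) + 1 *. w ! q)) # G (take q w)"
 by (elim imageE)
 have le: "f0 (G (take q w)) <= lam *. (r *. one + M *. (g (take q w) + 1 *. w ! q))"
 using cmp0[OF SSmem(1)[OF w(1)]] SSmem(2)[OF w(1)] by simp
 show "z : ?X" unfolding w(2)
 proof (rule memI[OF SSmem(1)[OF w(1)]])
 fix f assume "f : Fs"
 hence "f (G (take q w)) <= f0 (G (take q w))" using f0(2) SSmem(1)[OF w(1)] TF by blast
 with le \<open>f : Fs\<close> show "f (G (take q w)) <= lam *. (r *. one + M *. (g (take q w) + 1 *. w ! q)) \<longleftrightarrow> f : T"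
 using TF by (meson order_trans)
 qed
 qed
 thus ?thesis using image[OF SS SSmem(1) g(3), of 1] by simp
 next
 case 2
 hence "Fs - T ~= {}" using Fs(3) by simp
 from upper[OF this] obtain f1 where f1: "f1 : Fs - T" "\<forall>u\<in>S. \<forall>h\<in>Fs - T. f1 (G u) <= h (G u)" by (elim bexE)
 have "f1 : Fs" using f1(1) by blast
 from round[OF this] obtain d g where g: "0 <= d" "d < ?b" "AF q g"
 "\<forall>u\<in>S. f1 (G u) + d *. one = lam *. r *. one + ?b *. g u" by (elim exE conjE)
 note cmp1 = cmp[of d f1 _ g, OF g(1,2) bspec[OF g(4)]]
 \<comment> \<open>The largest admissible \<open>y\<close> lies one unit below the rounded
   threshold, and the ray runs downwards from there.\<close>
 let ?g = "%u. g u - one"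
 have g': "AF q ?g" using g(3) by (intro AF_intros)
 have "?X = (%z. (r *. one + M *. (?g (take q z) + (- 1) *. z ! q)) # G (take q z)) ` set_prod S ray"
 proof (intro equalityI subsetI)
 fix z assume "z : ?X"
 from memE[OF this] obtain u y where uy: "z = (r *. one + M *. y) # G u" "u : S"
 "\<forall>f\<in>Fs. f (G u) <= lam *. (r *. one + M *. y) \<longleftrightarrow> f : T" by (elim exE conjE)
 hence "~ g u <= y" using cmp1[OF uy(2), of y] f1(1) by blast
 hence "0 <= g u - one - y" by (simp add: not_le less_iff_add_one algebra_simps)
 hence "u @ [g u - one - y] : set_prod S ray" using uy(2) by (intro set_prodI) (simp_all add: ray_def)
 moreover have "take q (u @ [g u - one - y]) = u" "(u @ [g u - one - y]) ! q = g u - one - y"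
 using shape_length[OF S uy(2)] by (simp_all add: nth_append)
 ultimately show "z : (%z. (r *. one + M *. (?g (take q z) + (- 1) *. z ! q)) # G (take q z)) ` set_prod S ray"
 by (intro image_eqI[of _ _ "u @ [g u - one - y]"]) (simp_all add: uy(1))
 next
 fix z assume "z : (%z. (r *. one + M *. (?g (take q z) + (- 1) *. z ! q)) # G (take q z)) ` set_prod S ray"
 then obtain w where w: "w : set_prod S ray" "z = (r *. one + M *. (?g (take q w) + (- 1) *. w ! q)) # G (take q w)"
 by (elim imageE)
 have "?g (take q w) + (- 1) *. w ! q < g (take q w)"
 proof -
 have "?g (take q w) + (- 1) *. w ! q <= ?g (take q w)" using SSmem(2)[OF w(1)] by simp
 also have "\<dots> < g (take q w)" using one_pos by simp
 finally show ?thesis .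
 qed
 hence le: "~ f1 (G (take q w)) <= lam *. (r *. one + M *. (?g (take q w) + (- 1) *. w ! q))"
 using cmp1[OF SSmem(1)[OF w(1)]] by (simp only: not_le)
 show "z : ?X" unfolding w(2)
 proof (rule memI[OF SSmem(1)[OF w(1)]])
 fix f assume "f : Fs"
 hence "f1 (G (take q w)) <= f (G (take q w))" using f1(2) SSmem(1)[OF w(1)] 2 by blast
 with le 2 show "f (G (take q w)) <= lam *. (r *. one + M *. (?g (take q w) + (- 1) *. w ! q)) \<longleftrightarrow> f : T"
 by (metis empty_iff order_trans)
 qed
 qed
 thus ?thesis using image[OF SS SSmem(1) g', of "- 1"] by simp
 next
 case 3
 from lower[OF 3(1)] obtain f0 where f0: "f0 : T" "\<forall>u\<in>S. \<forall>h\<in>T. h (G u) <= f0 (G u)" by (elim bexE)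
 from upper[OF 3(2)] obtain f1 where f1: "f1 : Fs - T" "\<forall>u\<in>S. \<forall>h\<in>Fs - T. f1 (G u) <= h (G u)" by (elim bexE)
 have Fs01: "f0 : Fs" "f1 : Fs" using f0(1) f1(1) T by blast+
 from round[OF Fs01(1)] obtain d g where g: "0 <= d" "d < ?b" "AF q g"
 "\<forall>u\<in>S. f0 (G u) + d *. one = lam *. r *. one + ?b *. g u" by (elim exE conjE)
 from round[OF Fs01(2)] obtain d' h where h: "0 <= d'" "d' < ?b" "AF q h"
 "\<forall>u\<in>S. f1 (G u) + d' *. one = lam *. r *. one + ?b *. h u" by (elim exE conjE)
 note cmp0 = cmp[of d f0 _ g, OF g(1,2) bspec[OF g(4)]]
 and cmp1 = cmp[of d' f1 _ h, OF h(1,2) bspec[OF h(4)]]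
 have AFhg: "AF q (%u. h u - g u)" using g(3) h(3) by (rule AF_diff[rotated])
 have "g u1 <= y1" "~ h u1 <= y1"
 using cmp0[OF u1(1), of y1] cmp1[OF u1(1), of y1] u1(2) f0(1) f1(1) Fs01 by blast+
 hence "g u1 < h u1" by simp
 \<comment> \<open>The strip contains a point over \<open>u1\<close>, so \<open>f1\<close> exceeds
   \<open>f0\<close> there by at least \<open>d + 1\<close> units. Since \<open>d + 1\<close> is at
   most \<open>lam * M\<close>, this is one of the gaps recorded in \<open>order_lits\<close>, and
   it persists over every \<open>u\<close>.\<close>
 have hg: "0 <= h u - g u" if "u : S" for u
 proof -
 have 1: "f0 (G u1) + (d + 1) *. one <= f1 (G u1)"
 proof -
 have "~ f1 (G u1) <= lam *. (r *. one + M *. g u1)" using cmp1[OF u1(1), of "g u1"] \<open>g u1 < h u1\<close> by simp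
 moreover have "lam *. (r *. one + M *. g u1) = f0 (G u1) + d *. one"
 using bspec[OF g(4) u1(1)] by (simp add: smul_add_right smul_smul[of lam M])
 ultimately show ?thesis by (simp add: not_le less_iff_add_one smul_step add.assoc)
 qed
 hence "f0 (G u) + (d + 1) *. one <= f1 (G u)" using ord[OF u1(1) that Fs01, of "d + 1"] g(1,2) by simp
 hence "lam *. (r *. one + M *. g u) < f1 (G u)"
 using bspec[OF g(4) that]
 by (simp add: less_iff_add_one smul_step add.assoc[symmetric] smul_add_right smul_smul[of lam M])
 hence "~ f1 (G u) <= lam *. (r *. one + M *. g u)" by (simp only: not_le)
 hence "~ h u <= g u" by (simp only: cmp1[OF that] not_False_eq_True)
 thus ?thesis by simp
 qed
 have un: "SH (Suc q) (under S (%u. h u - g u))" by (rule SH_under[OF S AFhg hg])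
 have unmem: "take q z : S" "0 <= z ! q" "z ! q < h (take q z) - g (take q z)" if "z : under S (%u. h u - g u)" for z
 proof -
 from that obtain u x where "z = u @ [x]" "u : S" "0 <= x" "x < h u - g u" by (elim underE)
 thus "take q z : S" "0 <= z ! q" "z ! q < h (take q z) - g (take q z)"
 using shape_length[OF S] by (auto simp: nth_append)
 qed
 have "?X = (%z. (r *. one + M *. (g (take q z) + 1 *. z ! q)) # G (take q z)) ` under S (%u. h u - g u)"
 proof (intro equalityI subsetI)
 fix z assume "z : ?X"
 from memE[OF this] obtain u y where uy: "z = (r *. one + M *. y) # G u" "u : S"
 "\<forall>f\<in>Fs. f (G u) <= lam *. (r *. one + M *. y) \<longleftrightarrow> f : T" by (elim exE conjE)
 have "g u <= y" "~ h u <= y"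
 using cmp0[OF uy(2), of y] cmp1[OF uy(2), of y] uy(3) f0(1) f1(1) Fs01 by blast+
 hence "u @ [y - g u] : under S (%u. h u - g u)" using uy(2) by (intro underI) simp_all
 moreover have "take q (u @ [y - g u]) = u" "(u @ [y - g u]) ! q = y - g u"
 using shape_length[OF S uy(2)] by (simp_all add: nth_append)
 ultimately show "z : (%z. (r *. one + M *. (g (take q z) + 1 *. z ! q)) # G (take q z)) ` under S (%u. h u - g u)"
 by (intro image_eqI[of _ _ "u @ [y - g u]"]) (simp_all add: uy(1))
 next
 fix z assume "z : (%z. (r *. one + M *. (g (take q z) + 1 *. z ! q)) # G (take q z)) ` under S (%u. h u - g u)"
 then obtain w where w: "w : under S (%u. h u - g u)" "z = (r *. one + M *. (g (take q w) + 1 *. w ! q)) # G (take q w)"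
 by (elim imageE)
 note wm = unmem[OF w(1)]
 have le: "f0 (G (take q w)) <= lam *. (r *. one + M *. (g (take q w) + 1 *. w ! q))"
 using cmp0[OF wm(1)] wm(2) by simp
 have "g (take q w) + 1 *. w ! q < h (take q w)" using wm(3) by (simp add: less_diff_eq add.commute)
 hence nle: "~ f1 (G (take q w)) <= lam *. (r *. one + M *. (g (take q w) + 1 *. w ! q))"
 using cmp1[OF wm(1)] by (simp only: not_le)
 show "z : ?X" unfolding w(2)
 proof (rule memI[OF wm(1)])
 fix f assume f: "f : Fs"
 show "f (G (take q w)) <= lam *. (r *. one + M *. (g (take q w) + 1 *. w ! q)) \<longleftrightarrow> f : T"
 proof (cases "f : T")
 case True
 hence "f (G (take q w)) <= f0 (G (take q w))" using f0(2) wm(1) by blast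
 thus ?thesis using le True by (meson order_trans)
 next
 case False
 hence "f1 (G (take q w)) <= f (G (take q w))" using f1(2) wm(1) f by blast
 thus ?thesis using nle False by (meson order_trans)
 qed
 qed
 qed
 thus ?thesis using image[OF un unmem(1) g(3), of 1] by simp
 qed
 qed
qed

text \<open>Over each cell the fibres split into finitely many strips, indexed by the set
  \<open>T\<close> of thresholds below and by a residue modulo \<open>M\<close>; on a strip all
  literals of \<open>L\<close> are constant by separation.\<close>

lemma PU_fibre:
 assumes sep: "separates n lam M Fs L0 L" and ne: "Fs ~= {}"
 and X: "PU n (L0 Un order_lits (lam * M) Fs) X"
 shows "PU (Suc n) L {t # e | t e. e : X}"
 using X
proof (induction rule: PU.induct)
 case empty
 have "{t # e | t e. e : ({} :: 'a list set)} = {}" by blast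
 thus ?case by (simp add: PU.empty)
next
 case (union X Y)
 have "{t # e | t e. e : X Un Y} = {t # e | t e. e : X} Un {t # e | t e. e : Y}" by blast
 moreover have "{t # e | t e. e : X} Int {t # e | t e. e : Y} = {}" using union.hyps(3) by blast
 ultimately show ?case using PU.union[OF union.IH] by simp
next
 case (piece q S G)
 have sep': "0 < lam" "0 < M" "finite Fs" "!!f. f : Fs ==> AF n f" using separates_data(1-4)[OF sep] by blast+
 let ?I = "Pow Fs \<times> {0..<M}" and ?X = "%(T, r). strip lam M Fs (G ` S) T r"
 have const: "l (G u) = l (G v)" if "l : L0 Un order_lits (lam * M) Fs" "u : S" "v : S" for l u v
 using piece(4)[OF that] piece(4)[OF that(1,3,2)] by (rule iffI)
 have eq: "{t # e | t e. e : G ` S} = (\<Union>i\<in>?I. ?X i)"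
 proof (intro equalityI subsetI)
 fix z assume "z : {t # e | t e. e : G ` S}"
 then obtain t e where z: "z = t # e" "e : G ` S" by blast
 obtain r where r: "0 <= r" "r < M" "mdvd M (t - r *. one)" using residue_mdvd[OF sep'(2)] by blast
 have "z : ?X ({f\<in>Fs. f e <= lam *. t}, r)" unfolding z(1) strip_def using z(2) r(3) by auto
 thus "z : (\<Union>i\<in>?I. ?X i)" using r by (intro UN_I[of "({f\<in>Fs. f e <= lam *. t}, r)"]) auto
 next
 fix z assume "z : (\<Union>i\<in>?I. ?X i)"
 then obtain T r where "z : strip lam M Fs (G ` S) T r" by auto
 thus "z : {t # e | t e. e : G ` S}" unfolding strip_def by blast
 qed
 show ?case unfolding eq
 proof (rule PU_UN)
 show "finite ?I" using sep'(3) by simp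
 next
 fix i assume "i : ?I"
 then obtain T r where i: "i = (T, r)" "T <= Fs" by blast
 have "PU (Suc n) L (strip lam M Fs (G ` S) T r)"
 proof (rule PU_const)
 show "SH (Suc n) (strip lam M Fs (G ` S) T r)"
 by (rule SH_strip[OF piece(1-3) const sep' ne i(2)]) (rule UnI2)
 next
 fix l x y assume l: "l : L" and xy: "x : strip lam M Fs (G ` S) T r" "y : strip lam M Fs (G ` S) T r" and "l x"
 from xy(1) obtain t u where x: "x = t # G u" "u : S" "\<forall>f\<in>Fs. f (G u) <= lam *. t \<longleftrightarrow> f : T" "mdvd M (t - r *. one)"
 unfolding strip_def by blast
 from xy(2) obtain t' u' where y: "y = t' # G u'" "u' : S" "\<forall>f\<in>Fs. f (G u') <= lam *. t' \<longleftrightarrow> f : T" "mdvd M (t' - r *. one)"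
 unfolding strip_def by blast
 have "l (t # G u) = l (t' # G u')"
 proof (rule separates_D[OF sep _ _ _ _ _ l])
 show "length (G u) = n" "length (G u') = n"
 using AM_length[OF piece(2)] shape_length[OF piece(1)] x(2) y(2) by auto
 show "\<forall>l\<in>L0. l (G u) = l (G u')" by (rule ballI, rule const[OF UnI1 x(2) y(2)])
 show "\<forall>f\<in>Fs. (f (G u) <= lam *. t) = (f (G u') <= lam *. t')"
 proof
 fix f assume "f : Fs"
 from bspec[OF x(3) this] bspec[OF y(3) this] show "(f (G u) <= lam *. t) = (f (G u') <= lam *. t')" by (rule HOL.trans[OF _ HOL.sym])
 qed
 show "mdvd M (t - t')" using mdvd_diff[OF x(4) y(4)] by simp
 qed
 with \<open>l x\<close> show "l y" unfolding x(1) y(1) by (rule iffD1[rotated])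
 qed
 thus "PU (Suc n) L (?X i)" by (simp add: i(1))
 next
 fix i i' assume ii: "i : ?I" "i' : ?I" "i ~= i'"
 show "?X i Int ?X i' = {}"
 proof (rule ccontr)
 assume "?X i Int ?X i' ~= {}"
 then obtain z where z: "z : ?X i" "z : ?X i'" by blast
 obtain T r T' r' where i: "i = (T, r)" "i' = (T', r')" by (cases i, cases i')
 have sub: "T <= Fs" "T' <= Fs" "0 <= r" "r < M" "0 <= r'" "r' < M" using ii i by auto
 from z(1) obtain t e where 1: "z = t # e" "\<forall>f\<in>Fs. f e <= lam *. t \<longleftrightarrow> f : T" "mdvd M (t - r *. one)"
 unfolding i strip_def by blast
 from z(2) have 2: "\<forall>f\<in>Fs. f e <= lam *. t \<longleftrightarrow> f : T'" "mdvd M (t - r' *. one)"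
 unfolding i strip_def 1(1) by blast+
 have "T = T'" using 1(2) 2(1) sub(1,2) by blast
 have "mdvd M ((r' - r) *. one)" using mdvd_diff[OF 1(3) 2(2)] by (simp add: smul_diff_left)
 hence "M dvd r' - r" by (simp only: mdvd_one_iff[OF sep'(2)])
 hence "r = r'" using sub(3-6) by (metis mod_eq_dvd_iff mod_pos_pos_trivial)
 with \<open>T = T'\<close> show False using ii(3) i by simp
 qed
 qed
qed

lemma PU_UNIV: "finite L ==> \<forall>l\<in>L. LT n l ==> PU n L {xs. length xs = n}"
proof (induction n arbitrary: L)
 case 0
 have "PU 0 L ((%u. u) ` {[]})"
 by (rule PU.piece[OF shape.unit AM_id]) simp_all
 thus ?case by simp
next
 case (Suc n)
 obtain lam M Fs L0 where sep0: "separates n lam M Fs L0 L" using separates_exists[OF Suc.prems] by blast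
 \<comment> \<open>Without a threshold the fibre would be a line unbounded in both directions; the
   threshold 0 cuts it into rays.\<close>
 have sep: "separates n lam M (insert (%_. 0) Fs) L0 L"
 by (rule separates_insert[OF sep0 AF_const[OF zero_in]])
 note 1 = separates_data[OF sep]
 have "PU n (L0 Un order_lits (lam * M) (insert (%_. 0) Fs)) {xs. length xs = n}"
 proof (rule Suc.IH)
 show "finite (L0 Un order_lits (lam * M) (insert (%_. 0) Fs))" using 1(3,5) finite_order_lits by blast
 show "\<forall>l\<in>L0 Un order_lits (lam * M) (insert (%_. 0) Fs). LT n l"
 using 1(6) LT_order_lits[OF _ 1(4), of "lam * M" ] 1(1,2) by (auto simp only: ball_Un mult_pos_pos)
 qed
 from PU_fibre[OF sep insert_not_empty this]
 have "PU (Suc n) L {t # e | t e. e : {xs. length xs = n}}" .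
 moreover have "{t # e | t e. e : {xs. length xs = n}} = {xs :: 'a list. length xs = Suc n}"
 by (auto simp: length_Suc_conv)
 ultimately show ?case by simp
qed

text \<open>Membership in the set is constant on the cells of a decomposition adapted to the
  literals that determine it, so the set is a union of such cells.\<close>

theorem definable_SH: assumes "definable_in A n X" shows "SH n X"
proof -
 obtain L where L: "finite L" "\<forall>l\<in>L. LT n l"
 "!!xs ys. length xs = n ==> length ys = n ==> \<forall>l\<in>L. l xs = l ys ==> (xs : X) = (ys : X)"
 using D_E[OF definable_in_D[OF assms]] by metis
 have "SH n (Y Int X)" if "PU n L Y" for Y using that
 proof (induction rule: PU.induct)
 case empty
 show ?case by (simp add: PU.empty)
 next
 case (piece q S G)
 have all: "(G u : X) = (G v : X)" if "u : S" "v : S" for u v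
 proof (rule L(3))
 show "length (G u) = n" "length (G v) = n"
 using AM_length[OF piece(2)] shape_length[OF piece(1)] that by auto
 show "\<forall>l\<in>L. l (G u) = l (G v)"
 proof
 fix l assume l: "l : L"
 show "l (G u) = l (G v)" using piece(4)[OF l that] piece(4)[OF l that(2,1)] by (rule iffI)
 qed
 qed
 have SH: "SH n (G ` S)" by (rule PU.piece[OF piece(1-3)]) simp
 show ?case
 proof (cases "\<exists>u\<in>S. G u : X")
 case True
 hence "G ` S Int X = G ` S" using all by blast
 thus ?thesis using SH by simp
 next
 case False
 hence "G ` S Int X = {}" by blast
 thus ?thesis by (simp add: PU.empty)
 qed
 next
 case (union Y Y')
 have "(Y Un Y') Int X = (Y Int X) Un (Y' Int X)" by blast
 moreover have "(Y Int X) Int (Y' Int X) = {}" using union.hyps(3) by blast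
 ultimately show ?case using PU.union[OF union.IH] by simp
 qed
 from this[OF PU_UNIV[OF L(1,2)]] have "SH n ({xs. length xs = n} Int X)" .
 moreover have "{xs. length xs = n} Int X = X" using definable_in_length[OF assms] by blast
 ultimately show ?thesis by simp
qed

end

section \<open>Simplices are represented by polynomials in intervals\<close>

context zgroup_params
begin

definition ivl :: "'a => 'a list set" where
 "ivl c = {[y] | y. 0 <= y & y < c}"

text \<open>The \<open>k\<close>-element subsets of \<open>[0, c)\<close>, listed in increasing
  order: the counterpart of the binomial coefficient \<open>c\<close> over \<open>k\<close>.\<close>

definition SS :: "nat => 'a => 'a list set" where
 "SS k c = {xs. length xs = k & sorted_wrt (<) xs & (\<forall>x\<in>set xs. 0 <= x & x < c)}"

lemma definable_in_SS: "c : A ==> definable_in A k (SS k c)"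
proof -
 assume c: "c : A"
 have "D k (%xs. (\<forall>i\<in>{..<k}. \<forall>j\<in>{i<..<k}. xs ! i < xs ! j) & (\<forall>i\<in>{..<k}. 0 <= xs ! i & xs ! i < c))"
 using c by (intro D_conj D_Ball D_le D_less AF_intros) simp_all
 from definable_in_Collect[OF this] show ?thesis
 by (rule back_subst) (auto simp: SS_def sorted_wrt_iff_nth_less all_set_conv_all_nth)
qed

lemma SS_length: "xs : SS k c ==> length xs = k"
 by (simp add: SS_def)

lemma SS_0: "SS 0 c = {[]}"
 by (auto simp: SS_def)

lemma SS_1: "SS (Suc 0) c = ivl c"
 by (auto simp: SS_def ivl_def length_Suc_conv)

lemma SS_zero: "SS (Suc k) 0 = {}"
 by (auto simp: SS_def length_Suc_conv)

lemma SS_one: assumes "2 <= k" shows "SS k one = {}"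
proof (rule ccontr)
 assume "SS k one ~= {}"
 then obtain xs where xs: "xs : SS k one" by blast
 hence "xs ! 0 < xs ! 1" "0 <= xs ! 0" "xs ! 1 < one"
 using assms by (auto simp: SS_def sorted_wrt_iff_nth_less)
 thus False using one_least[of "xs ! 1"] by (meson leD le_less_trans)
qed

lemma length_filter_append:
 assumes "\<forall>x\<in>set ys. P x" "\<forall>x\<in>set zs. ~ P x"
 shows "length (filter P (ys @ zs)) = length ys"
 using assms by (simp add: filter_id_conv filter_empty_conv[THEN iffD2])

lemma sorted_dropWhile:
 assumes "sorted_wrt (<) xs" "x : set (dropWhile (%x. x < a) xs)"
 shows "(a :: 'a) <= x"
 using assms
proof (induction xs)
 case (Cons y xs)
 thus ?case by (cases "y < a") (auto simp: not_less intro: order_trans less_imp_le)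
qed simp

lemma K_eq_sum:
 "(!!i. i : I ==> K_eq A (M i) (M' i)) ==> K_eq A (\<Sum>i\<in>I. M i) (\<Sum>i\<in>I. M' i)"
proof (induction I rule: infinite_finite_induct)
 case (insert i I)
 have "K_eq A (M i) (M' i)" by (rule insert.prems) simp
 moreover have "K_eq A (\<Sum>i\<in>I. M i) (\<Sum>i\<in>I. M' i)" by (rule insert.IH, rule insert.prems) simp
 ultimately show ?case using insert.hyps K_eq.add by simp
qed (simp_all add: K_eq.refl)

text \<open>Vandermonde's identity: a subset of \<open>[0, a + b)\<close> is cut at
  \<open>a\<close>, and its upper part is translated down by \<open>a\<close>. The number
  \<open>i\<close> of elements below \<open>a\<close> keeps the pieces disjoint.\<close>

lemma SS_add:
 assumes "a : A" "b : A" "0 <= a" "0 <= b"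
 shows "K_eq A {#SS k (a + b)#} (\<Sum>i\<le>k. {#set_prod (SS i a) (SS (k - i) b)#})"
proof -
 let ?H = "%i w. take i w @ map ((+) a) (drop i w)"
 let ?S = "%i. set_prod (SS i a) (SS (k - i) b)"
 have d: "definable_in A k (?S i)" if "i <= k" for i
 using definable_in_set_prod[OF definable_in_SS definable_in_SS, OF assms(1,2), of i "k - i"] that by simp
 have AM: "AM k k (?H i)" if "i <= k" for i
 proof -
 have "AM k (i + (k - i)) (%w. take i w @ map (%l. a + w ! (i + l)) [0..<k - i])"
 using that assms(1) by (intro AM_append AM_take AM_map AF_intros) simp_all
 moreover have "take i w @ map (%l. a + w ! (i + l)) [0..<k - i] = ?H i w" if "length w = k" for w
 using that by (intro arg_cong2[of _ _ _ _ "(@)"] nth_equalityI) simp_all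
 ultimately show ?thesis using that AM_cong[of k "%w. take i w @ map (%l. a + w ! (i + l)) [0..<k - i]" "?H i" k]
 by simp
 qed
 have H: "?H i (ys @ zs) = ys @ map ((+) a) zs" if "length ys = i" for i ys zs using that by simp
 have inj: "inj_on (?H i) (?S i)" if "i <= k" for i
 proof (rule inj_onI)
 fix w w' assume "w : ?S i" "w' : ?S i" and eq: "?H i w = ?H i w'"
 then obtain ys zs ys' zs' where *: "w = ys @ zs" "w' = ys' @ zs'" "ys : SS i a" "ys' : SS i a"
 by (elim set_prodE)
 have "ys @ map ((+) a) zs = ys' @ map ((+) a) zs'"
 using eq unfolding *(1,2) H[OF SS_length[OF *(3)]] H[OF SS_length[OF *(4)]] .
 hence "ys = ys'" "map ((+) a) zs = map ((+) a) zs'"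
 using SS_length[OF *(3)] SS_length[OF *(4)] by simp_all
 thus "w = w'" using *(1,2) by (simp add: inj_map_eq_map)
 qed
 have small: "length (filter (%x. x < a) w) = i" if "w : ?H i ` ?S i" for w i
 proof -
 from that obtain ys zs where *: "w = ?H i (ys @ zs)" "ys : SS i a" "zs : SS (k - i) b"
 by (elim imageE set_prodE) blast
 have "w = ys @ map ((+) a) zs" unfolding *(1) H[OF SS_length[OF *(2)]] ..
 moreover have "\<forall>x\<in>set ys. x < a" "\<forall>x\<in>set (map ((+) a) zs). ~ x < a"
 using *(2,3) by (auto simp: SS_def)
 ultimately show ?thesis using length_filter_append[of ys "%x. x < a" "map ((+) a) zs"] SS_length[OF *(2)] by simp
 qed
 have "SS k (a + b) = (\<Union>i\<in>{..k}. ?H i ` ?S i)"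
 proof (intro equalityI subsetI)
 fix xs assume xs: "xs : SS k (a + b)"
 define ys where "ys = takeWhile (%x. x < a) xs"
 define zs where "zs = map (%x. x - a) (dropWhile (%x. x < a) xs)"
 have s: "sorted_wrt (<) (ys @ dropWhile (%x. x < a) xs)" using xs by (simp add: ys_def SS_def)
 have "ys : SS (length ys) a"
 proof -
 have "sorted_wrt (<) ys" using s by (simp only: sorted_wrt_append)
 moreover have "0 <= x & x < a" if "x : set ys" for x
 using set_takeWhileD[of x "%x. x < a" xs] that xs by (simp add: ys_def SS_def)
 ultimately show ?thesis by (simp add: SS_def)
 qed
 moreover have "zs : SS (k - length ys) b"
 proof -
 have "length xs = length ys + length zs"
 unfolding zs_def ys_def length_map length_append[symmetric] takeWhile_dropWhile_id ..
 hence "length zs = k - length ys" using SS_length[OF xs] by simp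
 moreover have "sorted_wrt (<) zs" using s by (simp add: zs_def sorted_wrt_append sorted_wrt_map)
 moreover have "0 <= x - a & x - a < b" if "x : set (dropWhile (%x. x < a) xs)" for x
 proof -
 have "x : set xs" using set_dropWhileD[OF that] .
 hence "x < a + b" using xs by (simp add: SS_def)
 moreover have "a <= x" using sorted_dropWhile[OF _ that] xs by (simp add: SS_def)
 ultimately show ?thesis by (simp add: diff_less_eq add.commute)
 qed
 hence "\<forall>x\<in>set zs. 0 <= x & x < b" by (simp add: zs_def)
 ultimately show ?thesis by (simp add: SS_def)
 qed
 ultimately have "ys @ zs : ?S (length ys)" by (rule set_prodI)
 moreover have "?H (length ys) (ys @ zs) = xs"
 proof -
 have "map ((+) a) zs = dropWhile (%x. x < a) xs" by (simp add: zs_def o_def)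
 thus ?thesis by (simp add: ys_def)
 qed
 moreover have "length ys <= k" using xs length_takeWhile_le[of "%x. x < a" xs] by (simp add: ys_def SS_def)
 ultimately show "xs : (\<Union>i\<in>{..k}. ?H i ` ?S i)"
 by (intro UN_I[of "length ys"] image_eqI[of _ _ "ys @ zs"]) simp_all
 next
 fix xs assume "xs : (\<Union>i\<in>{..k}. ?H i ` ?S i)"
 then obtain i ys zs where *: "i <= k" "xs = ?H i (ys @ zs)" "ys : SS i a" "zs : SS (k - i) b"
 by (elim UN_E imageE set_prodE) (simp only: atMost_iff)
 have xs: "xs = ys @ map ((+) a) zs" unfolding *(2) H[OF SS_length[OF *(3)]] ..
 have z: "a <= x" "x < a + b" if "x : set (map ((+) a) zs)" for x using *(4) that by (auto simp: SS_def)
 have y: "0 <= x" "x < a" if "x : set ys" for x using *(3) that by (auto simp: SS_def)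
 have "sorted_wrt (<) xs" unfolding xs sorted_wrt_append
 proof (intro conjI ballI)
 show "sorted_wrt (<) (map ((+) a) zs)" using *(4) by (simp add: SS_def sorted_wrt_map)
 show "x < x'" if "x : set ys" "x' : set (map ((+) a) zs)" for x x'
 using y(2)[OF that(1)] z(1)[OF that(2)] by (rule less_le_trans)
 qed (use *(3) in \<open>simp add: SS_def\<close>)
 moreover have "0 <= x & x < a + b" if "x : set xs" for x
 proof (cases "x : set ys")
 case True
 have "x < a + b" using y(2)[OF True] assms(4) by (meson add_increasing2 less_le_trans order_refl)
 thus ?thesis using y(1)[OF True] by simp
 next
 case False
 hence "x : set (map ((+) a) zs)" using that xs by auto
 from z[OF this] assms(3) show ?thesis by (meson order_trans)
 qed
 moreover have "length xs = k" using xs *(1) SS_length[OF *(3)] SS_length[OF *(4)] by simp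
 ultimately show "xs : SS k (a + b)" by (simp add: SS_def)
 qed
 moreover have "K_eq A {#\<Union>i\<in>{..k}. ?H i ` ?S i#} (\<Sum>i\<in>{..k}. {#?H i ` ?S i#})"
 proof (rule K_UN)
 show "definable_in A k (?H i ` ?S i)" if "i : {..k}" for i
 using that definable_in_image[OF d AM] by simp
 show "?H i ` ?S i Int ?H i' ` ?S i' = {}" if "i ~= i'" for i i'
 proof (rule ccontr)
 assume "?H i ` ?S i Int ?H i' ` ?S i' ~= {}"
 then obtain w where "w : ?H i ` ?S i" "w : ?H i' ` ?S i'" by blast
 thus False using small[of w i] small[of w i'] that by simp
 qed
 qed simp
 moreover have "K_eq A (\<Sum>i\<in>{..k}. {#?H i ` ?S i#}) (\<Sum>i\<in>{..k}. {#?S i#})"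
 proof (rule K_eq_sum)
 show "K_eq A {#?H i ` ?S i#} {#?S i#}" if "i : {..k}" for i
 using that by (intro K_eq.sym[OF K_affine[OF d AM inj]]) simp_all
 qed
 ultimately show ?thesis using K_eq.trans by simp
qed

text \<open>Counts the subsets of \<open>k + 1\<close> elements with a marked element, the identity
  between \<open>c\<close> times (\<open>c - 1\<close> over \<open>k\<close>) and
  \<open>k + 1\<close> times (\<open>c\<close> over \<open>k + 1\<close>). The elements above the
  marked one move down by one to close the gap; the position \<open>i\<close> of the marked element
  is the number of remaining elements below it.\<close>

lemma SS_mark:
 assumes "c : A" "one <= c"
 shows "K_eq A {#set_prod (ivl c) (SS k (c - one))#} (\<Sum>i\<le>k. {#SS (Suc k) c#})"
proof -
 let ?H = "%i xs. xs ! i # take i xs @ map (%x. x - one) (drop (Suc i) xs)"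
 let ?S = "SS (Suc k) c"
 note d = definable_in_SS[OF assms(1), of "Suc k"]
 have AM: "AM (Suc k) (Suc k) (?H i)" if "i <= k" for i
 proof -
 have "AM (Suc k) (Suc (i + (k - i))) (%w. w ! i # take i w @ map (%l. w ! (Suc i + l) - one) [0..<k - i])"
 using that by (intro AM_Cons AM_append AM_take AM_map AF_intros) simp_all
 moreover have "map (%l. w ! (Suc i + l) - one) [0..<k - i] = map (%x. x - one) (drop (Suc i) w)"
 if "length w = Suc k" for w
 by (rule nth_equalityI) (use that in simp_all)
 hence "AM (Suc k) (Suc k) (%w. w ! i # take i w @ map (%l. w ! (Suc i + l) - one) [0..<k - i])
 = AM (Suc k) (Suc k) (?H i)"
 by (intro AM_cong) (simp only:)
 ultimately show ?thesis using that by simp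
 qed
 have H: "?H (length ys) (ys @ p # zs) = p # ys @ map (%x. x - one) zs" for ys p zs
 by (simp add: nth_append)
 have split: "EX ys p zs. xs = ys @ p # zs & length ys = i" if "xs : ?S" "i <= k" for xs i
 proof (intro exI conjI)
 have "i < length xs" using that(2) SS_length[OF that(1)] by simp
 thus "xs = take i xs @ xs ! i # drop (Suc i) xs" by (rule id_take_nth_drop)
 show "length (take i xs) = i" using \<open>i < length xs\<close> by simp
 qed
 have inj: "inj_on (?H i) ?S" if "i <= k" for i
 proof (rule inj_onI)
 fix w w' assume w: "w : ?S" "w' : ?S" and eq: "?H i w = ?H i w'"
 from split[OF w(1) that] obtain ys p zs where 1: "w = ys @ p # zs" "length ys = i" by (elim exE conjE)
 from split[OF w(2) that] obtain ys' p' zs' where 2: "w' = ys' @ p' # zs'" "length ys' = i" by (elim exE conjE)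
 have "p # ys @ map (%x. x - one) zs = p' # ys' @ map (%x. x - one) zs'"
 using eq H[of ys p zs] H[of ys' p' zs'] unfolding 1(1) 2(1) 1(2) 2(2) by (simp only:)
 hence "p = p'" "ys = ys'" "map (%x. x - one) zs = map (%x. x - one) zs'" using 1(2) 2(2) by auto
 moreover have "inj (%x. x - one)" by (simp add: inj_def)
 ultimately show "w = w'" using 1(1) 2(1) by (simp add: inj_map_eq_map)
 qed
 have bounds: "(\<forall>x\<in>set ys. x < p) & (\<forall>x\<in>set zs. p < x)" if "ys @ p # zs : ?S" for ys p zs
 using that by (auto simp: SS_def sorted_wrt_append)
 have mem: "(p # ys @ map (%x. x - one) zs) : set_prod (ivl c) (SS k (c - one))" if s: "ys @ p # zs : ?S" for ys p zs
 proof -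
 have z: "p <= x - one" "x - one < c - one" if "x : set zs" for x
 using bounds[OF s] s that by (auto simp: less_iff_add_one[of p] le_diff_eq SS_def)
 have "sorted_wrt (<) (ys @ map (%x. x - one) zs)"
 unfolding sorted_wrt_append using s bounds[OF s] z(1)
 by (auto simp: SS_def sorted_wrt_append sorted_wrt_map intro: less_le_trans)
 moreover have "0 <= x & x < c - one" if x: "x : set (ys @ map (%x. x - one) zs)" for x
 proof (cases "x : set ys")
 case True
 hence "x + one <= p" "p < c" "0 <= x" using bounds[OF s] s by (auto simp: less_iff_add_one[symmetric] SS_def)
 hence "x + one < c" by (meson le_less_trans)
 thus ?thesis using \<open>0 <= x\<close> by (simp add: less_diff_eq)
 next
 case False
 then obtain y where "y : set zs" "x = y - one" using x by auto
 moreover have "0 <= p" using s by (simp add: SS_def)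
 ultimately show ?thesis using z by (meson order_trans)
 qed
 moreover have "length ys + length zs = k" using SS_length[OF s] by simp
 ultimately have "ys @ map (%x. x - one) zs : SS k (c - one)" by (simp add: SS_def)
 moreover have "[p] : ivl c" using s by (simp add: ivl_def SS_def)
 ultimately have "[p] @ (ys @ map (%x. x - one) zs) : set_prod (ivl c) (SS k (c - one))" by (intro set_prodI)
 thus ?thesis by simp
 qed
 have small: "length (filter (%x. x < hd w) (tl w)) = i" if "w : ?H i ` ?S" "i <= k" for w i
 proof -
 from that(1) obtain xs where xs: "xs : ?S" "w = ?H i xs" by (elim imageE)
 from split[OF xs(1) that(2)] obtain ys p zs where 1: "xs = ys @ p # zs" "length ys = i" by (elim exE conjE)
 have w: "w = p # ys @ map (%x. x - one) zs" using xs(2) H[of ys p zs] unfolding 1(1) 1(2) by (simp only:)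
 have "\<forall>x\<in>set ys. x < p" "\<forall>x\<in>set (map (%x. x - one) zs). ~ x < p"
 using bounds[of ys p zs] xs(1) 1(1) by (auto simp: not_less le_diff_eq less_iff_add_one[symmetric])
 from length_filter_append[OF this] show ?thesis using w 1(2) by simp
 qed
 have "set_prod (ivl c) (SS k (c - one)) = (\<Union>i\<in>{..k}. ?H i ` ?S)"
 proof (intro equalityI subsetI)
 fix w assume "w : set_prod (ivl c) (SS k (c - one))"
 then obtain p us where w: "w = p # us" "0 <= p" "p < c" "us : SS k (c - one)"
 by (elim set_prodE) (auto simp: ivl_def)
 define ys where "ys = takeWhile (%x. x < p) us"
 define vs where "vs = dropWhile (%x. x < p) us"
 define zs where "zs = map (%x. x + one) vs"
 have us: "us = ys @ vs" by (simp add: ys_def vs_def)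
 have s: "sorted_wrt (<) (ys @ vs)" using w(4) us by (simp add: SS_def)
 have y: "x < p" if "x : set ys" for x using that by (auto simp: ys_def dest: set_takeWhileD)
 have v: "p <= x" if "x : set vs" for x
 using sorted_dropWhile[of us x p] that w(4) by (simp add: vs_def SS_def)
 have z: "p < x" if "x : set zs" for x using that v unfolding zs_def by (auto simp: less_iff_add_one)
 have "sorted_wrt (<) (ys @ p # zs)" unfolding sorted_wrt_append using s y z
 by (auto simp: sorted_wrt_append zs_def sorted_wrt_map intro: less_trans)
 moreover have "0 <= x & x < c" if x: "x : set (ys @ p # zs)" for x
 proof -
 consider "x : set ys" | "x = p" | "x : set zs" using x by auto
 thus ?thesis
 proof cases
 case 1
 hence "0 <= x" using w(4) us by (auto simp: SS_def)
 thus ?thesis using y[OF 1] w(3) by (meson less_trans)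
 next
 case 3
 then obtain x' where "x' : set vs" "x = x' + one" by (auto simp: zs_def)
 moreover have "x' < c - one" using \<open>x' : set vs\<close> w(4) us by (auto simp: SS_def)
 ultimately show ?thesis using z[OF 3] w(2) by (auto simp: less_diff_eq)
 qed (use w in simp)
 qed
 moreover have "length ys + length vs = k" using SS_length[OF w(4)] us by simp
 ultimately have "ys @ p # zs : ?S" by (simp add: SS_def zs_def)
 moreover have "?H (length ys) (ys @ p # zs) = w" unfolding H using w(1) us by (simp add: zs_def o_def)
 ultimately show "w : (\<Union>i\<in>{..k}. ?H i ` ?S)"
 using \<open>length ys + length vs = k\<close> by (intro UN_I[of "length ys"] image_eqI[of _ _ "ys @ p # zs"]) simp_all
 next
 fix w assume "w : (\<Union>i\<in>{..k}. ?H i ` ?S)"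
 then obtain i xs where xs: "i <= k" "xs : ?S" "w = ?H i xs" by (elim UN_E imageE) (simp only: atMost_iff)
 from split[OF xs(2,1)] obtain ys p zs where 1: "xs = ys @ p # zs" "length ys = i" by (elim exE conjE)
 have "w = p # ys @ map (%x. x - one) zs" using xs(3) H[of ys p zs] unfolding 1(1) 1(2) by (simp only:)
 thus "w : set_prod (ivl c) (SS k (c - one))" using mem[of ys p zs] xs(2) 1(1) by simp
 qed
 moreover have "K_eq A {#\<Union>i\<in>{..k}. ?H i ` ?S#} (\<Sum>i\<in>{..k}. {#?H i ` ?S#})"
 proof (rule K_UN)
 show "definable_in A (Suc k) (?H i ` ?S)" if "i : {..k}" for i
 using that definable_in_image[OF d AM] by simp
 show "?H i ` ?S Int ?H i' ` ?S = {}" if "i : {..k}" "i' : {..k}" "i ~= i'" for i i'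
 proof (rule ccontr)
 assume "?H i ` ?S Int ?H i' ` ?S ~= {}"
 then obtain w where "w : ?H i ` ?S" "w : ?H i' ` ?S" by blast
 thus False using small[of w i] small[of w i'] that by simp
 qed
 qed simp
 moreover have "K_eq A (\<Sum>i\<in>{..k}. {#?H i ` ?S#}) (\<Sum>i\<in>{..k}. {#?S#})"
 proof (rule K_eq_sum)
 show "K_eq A {#?H i ` ?S#} {#?S#}" if "i : {..k}" for i
 using that by (intro K_eq.sym[OF K_affine[OF d AM inj]]) simp_all
 qed
 ultimately show ?thesis using K_eq.trans by simp
qed

lemma ev_sum: "finite I ==> ev v (\<Sum>i\<in>I. p i) = (\<Sum>i\<in>I. ev v (p i))"
 by (induction I rule: finite_induct) (simp_all add: ev_add)

end

text \<open>The coefficient identity that replaces a division by \<open>k\<close>: it may be cancelled in the torsion-free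
 semiring of polynomials, and then be evaluated in the Grothendieck semiring.\<close>

lemma fps_power_coeff_deriv:
 fixes G :: "'g sym_poly fps"
 assumes "0 < k"
 shows "fps_nth (G ^ k) k = (\<Sum>i<k. of_nat (Suc i) * fps_nth G (Suc i) * fps_nth (G ^ (k - 1)) (k - 1 - i))"
proof -
 have cancel: "p = q" if "of_nat k * p = of_nat k * q" for p q :: "'g sym_poly"
 proof (rule poly_mapping_eqI)
 fix m
 have lk: "lookup (of_nat n * p) m = n * lookup p m" for n and p :: "'g sym_poly"
 by (induction n) (simp_all add: distrib_right lookup_add)
 have "k * lookup p m = k * lookup q m" by (metis that lk)
 thus "lookup p m = lookup q m" using assms by simp
 qed
 have "fps_nth (fps_deriv (G ^ k)) (k - 1) = of_nat k * fps_nth (G ^ k) k"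
 using assms by (simp add: fps_deriv_nth)
 moreover have "fps_deriv (G ^ k) = fps_const (of_nat k) * (fps_deriv G * G ^ (k - 1))"
 unfolding fps_deriv_power by (simp add: mult.assoc)
 ultimately have "of_nat k * fps_nth (G ^ k) k = of_nat k * fps_nth (fps_deriv G * G ^ (k - 1)) (k - 1)"
 by simp
 hence "fps_nth (G ^ k) k = fps_nth (fps_deriv G * G ^ (k - 1)) (k - 1)" by (rule cancel)
 also have "\<dots> = (\<Sum>i=0..k - 1. fps_nth (fps_deriv G) i * fps_nth (G ^ (k - 1)) (k - 1 - i))"
 by (rule fps_mult_nth)
 also have "{0..k - 1} = {..<k}" using assms by auto
 finally show ?thesis by (simp add: mult.assoc)
qed

context zgroup_params
begin

text \<open>Iterated Vandermonde: the generating series for the subsets of \<open>m\<close>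
  consecutive copies of \<open>[0, c)\<close> is the \<open>m\<close>-th power of the one for
  \<open>[0, c)\<close>. The coefficients are formal symbols, so that identities of power series can
  be applied before evaluation.\<close>

lemma SS_power:
 assumes "c : A" "0 <= c"
 shows "K_eq A {#SS k (int m *. c)#} (ev (%i. SS i c) (fps_nth (Abs_fps symb ^ m) k))"
proof (induction m arbitrary: k)
 case 0
 show ?case
 proof (cases k)
 case 0
 thus ?thesis using definable_in_unit definable_inI by (simp add: SS_0 ev_1 K_refl_single[of 0])
 next
 case (Suc l)
 thus ?thesis by (simp add: SS_zero K_eq.empty)
 qed
next
 case (Suc m)
 let ?v = "%i. SS i c" and ?G = "Abs_fps symb :: nat sym_poly fps"
 have c: "int m *. c : A" "0 <= int m *. c" using assms by (simp_all add: smul_in smul_nonneg)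
 have v: "\<forall>g\<in>UNIV. definable A (?v g)" using definable_in_SS[OF assms(1)] definable_inI by blast
 have P: "p : sym_polys UNIV" for p :: "nat sym_poly" by (simp add: sym_polys_def)
 have 1: "K_eq A {#set_prod (SS i c) (SS (k - i) (int m *. c))#} (ev ?v (symb i * fps_nth (?G ^ m) (k - i)))" for i
 proof -
 have "K_eq A {#SS i c#} {#SS i c#}" by (rule K_refl_single[OF definable_in_SS[OF assms(1)]])
 from K_eq_prod[OF this Suc.IH[of "k - i"]]
 have "K_eq A {#set_prod (SS i c) (SS (k - i) (int m *. c))#} (mset_prod (ev ?v (symb i)) (ev ?v (fps_nth (?G ^ m) (k - i))))"
 by (simp add: mset_prod_single_left ev_symb)
 from K_eq.trans[OF this K_eq.sym[OF K_eq_ev_mult[OF P P v]]] show ?thesis .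
 qed
 have "int (Suc m) *. c = c + int m *. c" using smul_step[of "int m" c] by (simp add: add.commute)
 hence "K_eq A {#SS k (int (Suc m) *. c)#} (\<Sum>i\<le>k. {#set_prod (SS i c) (SS (k - i) (int m *. c))#})"
 using SS_add[OF assms(1) c(1) assms(2) c(2), of k] by simp
 moreover have "K_eq A (\<Sum>i\<le>k. {#set_prod (SS i c) (SS (k - i) (int m *. c))#})
 (\<Sum>i\<le>k. ev ?v (symb i * fps_nth (?G ^ m) (k - i)))"
 by (rule K_eq_sum) (rule 1)
 moreover have "(\<Sum>i\<le>k. ev ?v (symb i * fps_nth (?G ^ m) (k - i))) = ev ?v (fps_nth (?G ^ Suc m) k)"
 by (simp add: fps_mult_nth ev_sum atLeast0AtMost)
 ultimately show ?case using K_eq.trans by simp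
qed

text \<open>The derivative identity for coefficients, combined with the marking of an element. Apart
  from the interval itself the right-hand side only involves subsets with fewer than
  \<open>k\<close> elements, which makes an induction on \<open>k\<close> possible.\<close>

lemma SS_multiple:
 assumes "c : A" "0 < c" "0 < k"
 shows "K_eq A {#SS k (int k *. c)#}
 (\<Sum>i<k. {#set_prod (set_prod (ivl c) (SS i (c - one))) (SS (k - 1 - i) (int (k - 1) *. c))#})"
proof -
 let ?v = "%i. SS i c" and ?G = "Abs_fps symb :: nat sym_poly fps"
 have c: "0 <= c" "one <= c" using assms(2) one_least by (auto simp: less_imp_le)
 have v: "\<forall>g\<in>UNIV. definable A (?v g)" using definable_in_SS[OF assms(1)] definable_inI by blast
 have P: "p : sym_polys UNIV" for p :: "nat sym_poly" by (simp add: sym_polys_def)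
 have summand: "K_eq A (ev ?v (of_nat (Suc i) * fps_nth ?G (Suc i) * fps_nth (?G ^ (k - 1)) (k - 1 - i)))
 {#set_prod (set_prod (ivl c) (SS i (c - one))) (SS (k - 1 - i) (int (k - 1) *. c))#}" for i
 proof -
 have rep: "ev ?v (of_nat n * symb (Suc i)) = (\<Sum>l<n. {#SS (Suc i) c#})" for n
 by (induction n) (simp_all add: distrib_right ev_add ev_symb)
 have 1: "K_eq A (ev ?v (of_nat (Suc i) * fps_nth ?G (Suc i))) {#set_prod (ivl c) (SS i (c - one))#}"
 using K_eq.sym[OF SS_mark[OF assms(1) c(2), of i]] rep[of "Suc i"]
 by (simp add: lessThan_Suc_atMost del: sum.lessThan_Suc of_nat_Suc)
 show ?thesis
 using K_eq.trans[OF K_eq_ev_mult[OF P P v] K_eq_prod[OF 1 K_eq.sym[OF SS_power[OF assms(1) c(1)]]]]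
 by (simp add: mset_prod_single_left del: of_nat_Suc)
 qed
 have "K_eq A {#SS k (int k *. c)#} (ev ?v (fps_nth (?G ^ k) k))" by (rule SS_power[OF assms(1) c(1)])
 also have "ev ?v (fps_nth (?G ^ k) k) =
 (\<Sum>i<k. ev ?v (of_nat (Suc i) * fps_nth ?G (Suc i) * fps_nth (?G ^ (k - 1)) (k - 1 - i)))"
 unfolding fps_power_coeff_deriv[OF assms(3)] by (rule ev_sum) simp
 also have "K_eq A \<dots> (\<Sum>i<k. {#set_prod (set_prod (ivl c) (SS i (c - one))) (SS (k - 1 - i) (int (k - 1) *. c))#})"
 by (rule K_eq_sum) (rule summand)
 finally show ?thesis .
qed

lemma Rep_prod_single:
 assumes "Rep v G {#X#}" "Rep v G {#Y#}" "\<forall>g\<in>G. definable A (v g)"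
 shows "Rep v G {#set_prod X Y#}"
 using Rep_prod[OF assms] by (simp add: mset_prod_single_left)

text \<open>Induction on \<open>k\<close>, with \<open>a\<close> divided by \<open>k\<close>: for a
  multiple \<open>int k *. c\<close> the class reduces to smaller subsets. The \<open>r\<close>
  remaining units are added one at a time, where the summands are simple because an interval of
  length \<open>one\<close> has no subset of two elements.\<close>

lemma Rep_SS:
 assumes v: "\<forall>g\<in>G. definable A (v g)" and gen: "!!c. c : A ==> 0 <= c ==> Rep v G {#ivl c#}"
 shows "a : A ==> 0 <= a ==> Rep v G {#SS k a#}"
proof (induction k arbitrary: a rule: less_induct)
 case (less k)
 show ?case
 proof (cases "k = 0")
 case True
 thus ?thesis by (simp add: SS_0 Rep_unit)
 next
 case False
 hence k: "0 < int k" by simp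
 obtain c r where cr: "0 <= r" "r < int k" "a = int k *. c + r *. one" using residue[OF k] by blast
 have "int k *. c = a - r *. one" using cr(3) by simp
 hence cA: "c : A" using pure[OF k, of c] less.prems(1) by (simp add: diff_in smul_in one_in)
 have c0: "0 <= c"
 proof (rule ccontr)
 assume "~ 0 <= c"
 hence "c + one <= 0" by (simp add: less_iff_add_one[symmetric])
 hence "int k *. c + int k *. one <= 0" using smul_mono[of "int k" "c + one" 0] by (simp add: smul_add_right)
 moreover have "int k *. c + r *. one < int k *. c + int k *. one" using cr(2) by simp
 ultimately have "a < 0" unfolding cr(3) by (rule less_le_trans[rotated])
 thus False using less.prems(2) by simp
 qed
 have base: "Rep v G {#SS k (int k *. c)#}"
 proof (cases "c = 0")
 case True
 thus ?thesis using False Rep_K_eq[OF Rep_empty K_eq.empty] by (cases k) (simp_all add: SS_zero)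
 next
 case False
 hence c: "0 < c" using c0 by simp
 hence c1: "c - one : A" "0 <= c - one" using one_least[of c] cA one_in by (simp_all add: diff_in)
 have ck: "int (k - 1) *. c : A" "0 <= int (k - 1) *. c" using cA c0 by (simp_all add: smul_in smul_nonneg)
 have "Rep v G (\<Sum>i<k. {#set_prod (set_prod (ivl c) (SS i (c - one))) (SS (k - 1 - i) (int (k - 1) *. c))#})"
 proof (rule Rep_sum)
 fix i assume "i : {..<k}"
 thus "Rep v G {#set_prod (set_prod (ivl c) (SS i (c - one))) (SS (k - 1 - i) (int (k - 1) *. c))#}"
 using c1 ck by (intro Rep_prod_single v gen less.IH cA c0) auto
 qed
 thus ?thesis by (rule Rep_K_eq) (rule SS_multiple[OF cA c], use k in simp)
 qed
 have one: "Rep v G {#SS l one#}" for l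
 proof -
 consider "l = 0" | "l = Suc 0" | "2 <= l" by linarith
 thus ?thesis
 proof cases
 case 1
 thus ?thesis by (simp add: SS_0 Rep_unit)
 next
 case 2
 thus ?thesis using gen[OF one_in] one_pos by (simp add: SS_1)
 next
 case 3
 thus ?thesis by (simp add: SS_one Rep_K_eq[OF Rep_empty K_eq.empty])
 qed
 qed
 have "Rep v G {#SS k (int k *. c + int n *. one)#}" for n
 proof (induction n)
 case 0
 thus ?case using base by simp
 next
 case (Suc n)
 let ?b = "int k *. c + int n *. one"
 have b: "?b : A" "0 <= ?b" using cA c0 one_in one_pos
 by (auto intro!: add_in smul_in add_nonneg_nonneg smul_nonneg)
 have "Rep v G (\<Sum>i\<le>k. {#set_prod (SS i ?b) (SS (k - i) one)#})"
 proof (rule Rep_sum)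
 fix i assume "i : {..k}"
 hence "i < k | i = k" by auto
 hence "Rep v G {#SS i ?b#}" using Suc.IH less.IH[OF _ b] by blast
 thus "Rep v G {#set_prod (SS i ?b) (SS (k - i) one)#}" by (intro Rep_prod_single v one)
 qed
 hence "Rep v G {#SS k (?b + one)#}"
 by (rule Rep_K_eq) (rule SS_add[OF b(1) one_in b(2) less_imp_le[OF one_pos]])
 moreover have "?b + one = int k *. c + int (Suc n) *. one"
 using smul_step[of "int n" one] by (simp add: algebra_simps)
 ultimately show ?case by simp
 qed
 from this[of "nat r"] show ?thesis using cr by simp
 qed
qed

text \<open>Stars and bars: the partial sums of a point of the simplex, with the index added to make
  them strictly increasing, form a subset of \<open>n\<close> elements.\<close>

lemma K_eq_bset_SS:
 assumes "a : A" "0 <= a"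
 shows "K_eq A {#bset (Suc n) a#} {#SS n (a + int n *. one)#}"
proof -
 let ?s = "%u i. \<Sum>l<i. u ! l"
 let ?H = "%u. map (%i. ?s u (Suc i) + int i *. one) [0..<n]"
 have AM: "AM (Suc n) n ?H"
 proof (rule AM_map)
 fix i assume i: "i < n"
 have "AF (Suc n) (%u. ?s u (Suc i))" by (rule AF_sum, rule AF_nth) (use i in auto)
 thus "AF (Suc n) (%u. ?s u (Suc i) + int i *. one)" by (intro AF_add AF_const smul_in one_in)
 qed
 have inj: "inj_on ?H (bset (Suc n) a)"
 proof (rule inj_onI)
 fix u u' assume u: "u : bset (Suc n) a" "u' : bset (Suc n) a" and eq: "?H u = ?H u'"
 have s: "?s u i = ?s u' i" if "i <= Suc n" for i
 proof -
 show ?thesis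
 proof (cases i)
 case (Suc i')
 show ?thesis
 proof (cases "i' = n")
 case True
 thus ?thesis using u Suc by (simp add: bset_def del: sum.lessThan_Suc)
 next
 case False
 hence "i' < n" using that Suc by simp
 moreover have "?H u ! i' = ?H u' ! i'" using eq by (rule arg_cong)
 ultimately show ?thesis using Suc by (simp del: sum.lessThan_Suc)
 qed
 qed simp
 qed
 have "u ! i = u' ! i" if "i < Suc n" for i
 using s[of i] s[of "Suc i"] that by simp
 thus "u = u'" using u by (intro nth_equalityI) (simp_all add: bset_def)
 qed
 have "?H ` bset (Suc n) a = SS n (a + int n *. one)"
 proof (intro equalityI subsetI)
 fix xs assume "xs : ?H ` bset (Suc n) a"
 then obtain u where u: "u : bset (Suc n) a" "xs = ?H u" by (elim imageE)
 have mono: "?s u i <= ?s u i'" if "i <= i'" "i' <= Suc n" for i i'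
 using u(1) that by (intro sum_mono2) (auto simp: bset_def)
 have nonneg: "0 <= ?s u i" if "i <= Suc n" for i using mono[of 0 i] that by simp
 have le: "?s u i <= a" if "i <= Suc n" for i
 using mono[OF that order_refl] u(1) by (simp add: bset_def del: sum.lessThan_Suc)
 have lt: "int i *. one < int i' *. one" if "i < i'" for i i' using that by simp
 have "sorted_wrt (<) xs" unfolding sorted_wrt_iff_nth_less
 proof (intro allI impI)
 fix i i' assume ii: "i < i'" "i' < length xs"
 hence "i' < n" using u(2) by simp
 have "?s u (Suc i) + int i *. one < ?s u (Suc i') + int i' *. one"
 using mono[of "Suc i" "Suc i'"] lt[OF ii(1)] ii(1) \<open>i' < n\<close> by (intro add_le_less_mono) simp_all
 thus "xs ! i < xs ! i'" using u(2) ii \<open>i' < n\<close> by (simp del: sum.lessThan_Suc)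
 qed
 moreover have "0 <= xs ! i & xs ! i < a + int n *. one" if "i < n" for i
 proof -
 have "xs ! i = ?s u (Suc i) + int i *. one" using u(2) that by (simp del: sum.lessThan_Suc)
 moreover have "0 <= int i *. one" using one_pos by (simp add: smul_nonneg)
 ultimately show ?thesis using nonneg[of "Suc i"] le[of "Suc i"] lt[OF that] that
 by (simp del: sum.lessThan_Suc add: add_le_less_mono)
 qed
 moreover have "length xs = n" using u(2) by simp
 ultimately show "xs : SS n (a + int n *. one)" by (auto simp: SS_def in_set_conv_nth)
 next
 fix xs assume xs: "xs : SS n (a + int n *. one)"
 \<comment> \<open>The partial sums recovered from \<open>xs\<close>, completed by 0 at the
   beginning and by \<open>a\<close> at the end.\<close>
 define y where "y i = (if i = 0 then 0 else if i <= n then xs ! (i - 1) - int (i - 1) *. one else a)" for i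
 let ?u = "map (%i. y (Suc i) - y i) [0..<Suc n]"
 have len: "length xs = n" using xs by (simp add: SS_def)
 have s: "?s ?u i = y i" if "i <= Suc n" for i
 proof -
 have "?s ?u i = (\<Sum>l<i. y (Suc l) - y l)" using that by (intro sum.cong) (simp_all del: upt_Suc)
 also have "\<dots> = y i - y 0" by (rule sum_lessThan_telescope)
 also have "y 0 = 0" by (simp add: y_def)
 finally show ?thesis by simp
 qed
 have "0 <= y (Suc i) - y i" if i: "i < Suc n" for i
 proof -
 consider "i = 0" "n = 0" | "i = 0" "0 < n" | "0 < i" "i < n" | "0 < i" "i = n" using i by (metis less_SucE gr0I)
 thus ?thesis
 proof cases
 case 1
 thus ?thesis using assms by (simp add: y_def)
 next
 case 2
 thus ?thesis using xs len by (simp add: y_def SS_def)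
 next
 case 3
 hence "xs ! (i - 1) < xs ! i" using xs len by (simp add: SS_def sorted_wrt_iff_nth_less)
 moreover have "int i *. one = int (i - 1) *. one + one" using 3 smul_step[of "int (i - 1)" one] by (simp add: of_nat_diff)
 ultimately show ?thesis using 3 by (simp add: y_def less_iff_add_one algebra_simps)
 next
 case 4
 hence "xs ! (n - 1) < a + int n *. one" using xs len by (simp add: SS_def)
 moreover have "int n *. one = int (n - 1) *. one + one" using 4 smul_step[of "int (n - 1)" one] by (simp add: of_nat_diff)
 ultimately show ?thesis using 4 by (simp add: y_def less_iff_add_one algebra_simps)
 qed
 qed
 moreover have "?s ?u (Suc n) = a" using s[of "Suc n"] by (simp add: y_def del: upt_Suc sum.lessThan_Suc)
 ultimately have "?u : bset (Suc n) a" by (simp add: bset_def del: upt_Suc sum.lessThan_Suc)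
 moreover have "?H ?u = xs"
 proof (rule nth_equalityI)
 show "?H ?u ! i = xs ! i" if "i < length (?H ?u)" for i
 using that s[of "Suc i"] by (simp add: y_def del: upt_Suc sum.lessThan_Suc)
 qed (simp add: len)
 ultimately show "xs : ?H ` bset (Suc n) a" by (intro image_eqI[of xs ?H ?u]) (simp only:)
 qed
 thus ?thesis using K_affine[OF definable_in_bset[OF assms(1)] AM inj] by (simp only:)
qed

lemma Rep_shape:
 assumes v: "\<forall>g\<in>G. definable A (v g)" and gen: "!!c. c : A ==> 0 <= c ==> Rep v G {#ivl c#}"
 and ray: "b ==> Rep v G {#ray#}"
 shows "shape b q S ==> Rep v G {#S#}"
proof -
 assume "shape b q S"
 thus ?thesis using ray
 proof (induction rule: shape.induct)
 case (unit b)
 show ?case by (rule Rep_unit)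
 next
 case (bset b q S a k)
 obtain n where n: "k = Suc n" using bset(4) by (cases k) auto
 have "a + int n *. one : A" "0 <= a + int n *. one"
 using bset(2,3) one_in one_pos by (auto intro!: add_in smul_in add_nonneg_nonneg smul_nonneg)
 from Rep_K_eq[OF Rep_SS[OF v gen this] K_eq_bset_SS[OF bset(2,3)]]
 have "Rep v G {#bset k a#}" unfolding n .
 thus ?case using bset by (intro Rep_prod_single v) auto
 next
 case (ray q S)
 thus ?case by (intro Rep_prod_single v) auto
 qed
qed

text \<open>The predicate \<open>P\<close>, inherited by subsets, is going to be trivial or
  boundedness; in the second case it excludes rays from the pieces.\<close>

lemma Rep_PU:
 assumes v: "\<forall>g\<in>G. definable A (v g)" and gen: "!!c. c : A ==> 0 <= c ==> Rep v G {#ivl c#}"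
 and PU: "SH n X" and P: "P X" "!!Y Y'. P Y ==> Y' <= Y ==> P Y'"
 and shape: "!!q S G'. shape True q S ==> AM q n G' ==> inj_on G' S ==> P (G' ` S) ==> Rep v G {#S#}"
 shows "Rep v G {#X#}"
 using PU P(1)
proof (induction rule: PU.induct)
 case empty
 show ?case by (rule Rep_K_eq[OF Rep_empty K_eq.empty])
next
 case (piece q S G')
 show ?case
 by (rule Rep_K_eq[OF shape[OF piece(1-3) piece.prems]])
 (rule K_eq.sym[OF K_affine[OF definable_in_shape[OF piece(1)] piece(2,3)]])
next
 case (union X Y)
 have "Rep v G ({#X#} + {#Y#})" using union P(2) by (intro Rep_add union.IH) blast+
 moreover have "K_eq A {#X Un Y#} ({#X#} + {#Y#})"
 using K_eq.union[OF PU_definable[OF union(1)] PU_definable[OF union(2)] union(3)]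
 by (simp add: add_mset_commute)
 ultimately show ?case by (rule Rep_K_eq)
qed

lemma shape_bounded:
 "shape b q S ==> shape False q S | (\<exists>u\<in>S. \<exists>i<q. \<forall>t\<ge>0. u[i := t] : S)"
proof (induction rule: shape.induct)
 case (unit b)
 thus ?case by (simp add: shape.unit)
next
 case (bset b q S a k)
 from bset.IH show ?case
 proof
 assume "shape False q S"
 thus ?thesis using shape.bset[OF _ bset(2-4)] by blast
 next
 assume "\<exists>u\<in>S. \<exists>i<q. \<forall>t\<ge>0. u[i := t] : S"
 then obtain u i where u: "u : S" "i < q" "!!t. 0 <= t ==> u[i := t] : S" by blast
 obtain w where w: "w : bset k a" using shape_nonempty[OF shape_bset[OF bset(2-4)]] by blast
 hence "length w = k" by (simp add: bset_def)
 hence "(w @ u)[k + i := t] = w @ u[i := t]" for t by (simp add: list_update_append)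
 hence "\<forall>t\<ge>0. (w @ u)[k + i := t] : set_prod (bset k a) S" using set_prodI[OF w u(3)] by simp
 thus ?thesis using set_prodI[OF w u(1)] u(2) by (intro disjI2 bexI[of _ "w @ u"] exI[of _ "k + i"]) auto
 qed
next
 case (ray q S)
 obtain u where u: "u : S" using shape_nonempty[OF ray(1)] by blast
 have r: "[t] : ray" if "0 <= t" for t using that by (simp add: ray_def)
 have "([0] @ u)[0 := t] = [t] @ u" for t by simp
 hence "\<forall>t\<ge>0. ([0] @ u)[0 := t] : set_prod ray S" using set_prodI[OF r u] by (simp del: append_Cons)
 thus ?case using set_prodI[OF r u, of 0] by (intro disjI2 bexI[of _ "[0] @ u"] exI[of _ 0]) auto
qed

text \<open>Along a ray an affine map with bounded values has slope zero in every coordinate, which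
  contradicts injectivity.\<close>

lemma shape_of_bounded_image:
 assumes S: "shape True q S" and G: "AM q n G" "inj_on G S" and bd: "bounded_set (G ` S)"
 shows "shape False q S"
proof (rule ccontr)
 assume "~ shape False q S"
 with shape_bounded[OF S] have "\<exists>u\<in>S. \<exists>i<q. \<forall>t\<ge>0. u[i := t] : S" by (simp only: simp_thms)
 then obtain u i where u: "u : S" "i < q" and "\<forall>t\<ge>0. u[i := t] : S" by (elim bexE exE conjE)
 hence u3: "u[i := t] : S" if "0 <= t" for t using that by simp
 note u = u u3
 from bd obtain a where a0: "0 <= a" and aS: "\<forall>xs\<in>G ` S. \<forall>x\<in>set xs. - a <= x & x < a"
 unfolding bounded_set_def by (elim exE conjE)
 have a2: "- a <= x & x < a" if "xs : G ` S" "x : set xs" for xs x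
 by (rule bspec[OF bspec[OF aS that(1)] that(2)])
 note a = a0 a2
 have lenu: "length u = q" by (rule shape_length[OF S u(1)])
 have lenG: "length (G (u[i := t])) = n" for t using AM_length[OF G(1)] lenu by simp
 have lin: "EX kp. ALL t. G (u[i := t]) ! l = G (u[i := 0]) ! l + kp *. t" if "l < n" for l
 proof -
 have "AF q (%u. G u ! l)" using G(1) that by (simp add: AM_def)
 then obtain k c where "ALL xs. length xs = q --> G xs ! l = c + (\<Sum>i<q. k i *. xs ! i)"
 unfolding AF_def by (elim exE conjE)
 hence eq: "G (u[i := t]) ! l = c + (\<Sum>i'<q. k i' *. u[i := t] ! i')" for t using lenu by simp
 have s: "(\<Sum>i'<q. k i' *. u[i := t] ! i') = (\<Sum>i'<q. k i' *. u[i := 0] ! i' + (if i' = i then k i *. t else 0))" for t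
 using lenu by (intro sum.cong) (auto simp: nth_list_update)
 have "(\<Sum>i'<q. k i' *. u[i := t] ! i') = (\<Sum>i'<q. k i' *. u[i := 0] ! i') + k i *. t" for t
 unfolding s[of t] sum.distrib using u(2) by simp
 hence "G (u[i := t]) ! l = G (u[i := 0]) ! l + k i *. t" for t
 unfolding eq add.assoc by (rule arg_cong)
 thus ?thesis by (intro exI allI)
 qed
 have range: "- a <= G (u[i := t]) ! l & G (u[i := t]) ! l < a" if "0 <= t" "l < n" for t l
 proof (rule a(2))
 show "G (u[i := t]) : G ` S" using u(3)[OF that(1)] by (rule imageI)
 show "G (u[i := t]) ! l : set (G (u[i := t]))" using lenG that(2) by (intro nth_mem) simp
 qed
 have "G (u[i := one]) ! l = G (u[i := 0]) ! l" if l: "l < n" for l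
 proof -
 from lin[OF l] obtain kp where kp: "ALL t. G (u[i := t]) ! l = G (u[i := 0]) ! l + kp *. t" by (elim exE)
 \<comment> \<open>All values lie in an interval of length \<open>a + a\<close>, so a nonzero slope
   leaves it at this argument.\<close>
 let ?t = "a + a"
 have t: "0 <= ?t" using a(1) by simp
 have r0: "- a <= G (u[i := 0]) ! l" "G (u[i := 0]) ! l < a" using range[OF order_refl l] by simp_all
 have rt: "- a <= G (u[i := 0]) ! l + kp *. ?t" "G (u[i := 0]) ! l + kp *. ?t < a"
 using range[OF t l] kp[rule_format, of ?t] by simp_all
 have "kp = 0"
 proof (rule ccontr)
 assume "kp ~= 0"
 then consider "1 <= kp" | "kp <= - 1" by linarith
 thus False
 proof cases
 case 1
 hence "?t <= kp *. ?t" using smul_mono_left[OF 1 t] by simp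
 hence "- a + ?t <= G (u[i := 0]) ! l + kp *. ?t" using r0(1) by (rule add_mono[rotated])
 thus False using rt(2) by simp
 next
 case 2
 hence "kp *. ?t <= - ?t" using smul_mono_left[OF 2 t] by simp
 hence "G (u[i := 0]) ! l + kp *. ?t < a + - ?t" using r0(2) by (intro add_less_le_mono)
 thus False using rt(1) by (simp add: not_le[symmetric])
 qed
 qed
 thus ?thesis using kp[rule_format, of one] by simp
 qed
 hence "G (u[i := one]) = G (u[i := 0])" using lenG by (intro nth_equalityI) simp_all
 hence "u[i := one] = u[i := 0]" using inj_onD[OF G(2)] u(3) one_pos by (simp add: less_imp_le)
 hence "one = 0" using u(2) lenu by (metis nth_list_update_eq)
 thus False using one_pos by simp
qed

theorem definable_Rep:
 assumes v: "\<forall>g\<in>G. definable A (v g)" and gen: "!!c. c : A ==> 0 <= c ==> Rep v G {#ivl c#}"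
 and ray: "Rep v G {#ray#}" and X: "definable A X"
 shows "Rep v G {#X#}"
proof -
 obtain n where "definable_in A n X" using X by (auto simp: definable_def)
 hence n: "SH n X" by (rule definable_SH)
 show ?thesis
 proof (rule Rep_PU[OF v gen n, of "%_. True"])
 show "Rep v G {#S#}" if "shape True q S" for q S
 by (rule Rep_shape[OF v gen ray that])
 qed simp_all
qed

theorem bounded_Rep:
 assumes v: "\<forall>g\<in>G. definable A (v g)" and gen: "!!c. c : A ==> 0 <= c ==> Rep v G {#ivl c#}"
 and X: "definable A X" "bounded_set X"
 shows "Rep v G {#X#}"
proof -
 obtain n where n: "definable_in A n X" using X by (auto simp: definable_def)
 show ?thesis
 proof (rule Rep_PU[OF v gen definable_SH[OF n], of bounded_set])
 show "bounded_set Y'" if "bounded_set Y" "Y' <= Y" for Y Y' :: "'a list set"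
 using that unfolding bounded_set_def by blast
 show "Rep v G {#S#}" if "shape True q S" "AM q n G'" "inj_on G' S" "bounded_set (G' ` S)" for q S G'
 by (rule Rep_shape[OF v gen _ shape_of_bounded_image[OF that]]) (assumption | erule FalseE)+
 qed (assumption | rule X)+
qed

end

section \<open>Definable closure as an invariant of classes\<close>

context zgroup_params
begin

text \<open>Rational affine combinations of \<open>xs\<close> with constants from \<open>A\<close>,
  as far as they exist in the group. By \<open>definable_function_dcl\<close> they include
  everything definable from \<open>xs\<close>.\<close>

definition dcl :: "'a list => 'a set" where
 "dcl xs = {t. EX d f. 0 < d & AF (length xs) f & d *. t = f xs}"

lemma dclI: "0 < d ==> AF (length xs) f ==> d *. t = f xs ==> t : dcl xs"
 unfolding dcl_def by blast

lemma dclE: assumes "t : dcl xs" obtains d f where "0 < d" "AF (length xs) f" "d *. t = f xs"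
 using assms unfolding dcl_def by blast

lemma dcl_const: "c : A ==> c : dcl xs"
 by (rule dclI[of 1 xs "%_. c"]) (simp_all add: AF_const)

lemma dcl_nth: "i < length xs ==> xs ! i : dcl xs"
 by (rule dclI[of 1 xs "%xs. xs ! i"]) (simp_all add: AF_nth)

lemma dcl_add: assumes "s : dcl xs" "t : dcl xs" shows "s + t : dcl xs"
proof -
 obtain d f where 1: "0 < d" "AF (length xs) f" "d *. s = f xs" using assms(1) by (rule dclE)
 obtain d' f' where 2: "0 < d'" "AF (length xs) f'" "d' *. t = f' xs" using assms(2) by (rule dclE)
 show ?thesis
 proof (rule dclI[of "d * d'" xs "%xs. d' *. f xs + d *. f' xs"])
 show "(d * d') *. (s + t) = d' *. f xs + d *. f' xs"
 unfolding 1(3)[symmetric] 2(3)[symmetric] smul_smul smul_add_right by (simp add: mult.commute)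
 qed (use 1 2 in \<open>auto intro: AF_add AF_smul\<close>)
qed

lemma dcl_smul: assumes "t : dcl xs" shows "k *. t : dcl xs"
proof -
 obtain d f where 1: "0 < d" "AF (length xs) f" "d *. t = f xs" using assms by (rule dclE)
 show ?thesis
 proof (rule dclI[of d xs "%xs. k *. f xs"])
 show "d *. k *. t = k *. f xs" unfolding 1(3)[symmetric] smul_smul by (simp add: mult.commute)
 qed (use 1 in \<open>auto intro: AF_smul\<close>)
qed

lemma dcl_sum: "(!!i. i : I ==> f i : dcl xs) ==> sum f I : dcl xs"
 by (induction I rule: infinite_finite_induct) (simp_all add: dcl_const zero_in dcl_add)

lemma dcl_divide: assumes "d *. t : dcl xs" "0 < d" shows "t : dcl xs"
proof -
 obtain d' f where 1: "0 < d'" "AF (length xs) f" "d' *. d *. t = f xs" using assms(1) by (rule dclE)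
 thus ?thesis using assms(2) by (intro dclI[of "d' * d" xs f]) (simp_all add: smul_smul)
qed

lemma dcl_subset: assumes "!!i. i < length ys ==> ys ! i : dcl xs" shows "dcl ys <= dcl xs"
proof
 fix t assume "t : dcl ys"
 then obtain d f where 1: "0 < d" "AF (length ys) f" "d *. t = f ys" by (rule dclE)
 from 1(2) obtain k c where "c : A" "ALL zs. length zs = length ys --> f zs = c + (\<Sum>i<length ys. k i *. zs ! i)"
 unfolding AF_def by (elim exE conjE)
 hence "d *. t = c + (\<Sum>i<length ys. k i *. ys ! i)" using 1(3) by simp
 moreover have "c + (\<Sum>i<length ys. k i *. ys ! i) : dcl xs"
 by (intro dcl_add dcl_sum dcl_smul assms dcl_const \<open>c : A\<close>) simp
 ultimately show "t : dcl xs" using dcl_divide[OF _ 1(1)] by simp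
qed

text \<open>If no threshold separated \<open>t\<close> from \<open>t - M *. one\<close>, both
  elements would satisfy \<open>P\<close>. So some threshold lies fewer than \<open>lam * M\<close>
  units below \<open>lam *. t\<close> or at it, and the distance is a standard multiple of
  \<open>one\<close>.\<close>

lemma definable_function_dcl:
 assumes "D (Suc n) P" "length e = n" "P (t # e)" "!!t'. P (t' # e) ==> t' = t"
 shows "t : dcl e"
proof -
 obtain L where L: "finite L" "\<forall>l\<in>L. LT (Suc n) l"
 "!!xs ys. length xs = Suc n ==> length ys = Suc n ==> \<forall>l\<in>L. l xs = l ys ==> P xs = P ys"
 using D_E[OF assms(1)] by metis
 from separates_exists[OF L(1,2)] obtain lam M Fs L0 where sep: "separates n lam M Fs L0 L" by (elim exE)
 note sd = separates_data[OF sep]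
 define t' where "t' = t - M *. one"
 have less: "t' < t" using smul_pos[OF sd(2) one_pos] by (simp add: t'_def)
 have "\<exists>f\<in>Fs. (f e <= lam *. t) ~= (f e <= lam *. t')"
 proof (rule ccontr)
 assume "~ (\<exists>f\<in>Fs. (f e <= lam *. t) ~= (f e <= lam *. t'))"
 hence *: "\<forall>f\<in>Fs. (f e <= lam *. t) = (f e <= lam *. t')" by blast
 have md: "mdvd M (t - t')" by (simp add: t'_def)
 have "\<forall>l\<in>L. l (t # e) = l (t' # e)"
 by (rule ballI, rule separates_D[OF sep assms(2,2) _ * md]) (rule ballI, rule HOL.refl)
 hence "P (t # e) = P (t' # e)" using assms(2) by (intro L(3)) simp_all
 hence "t' = t" using assms(3,4) by blast
 thus False using less by simp
 qed
 then obtain f where f: "f : Fs" "(f e <= lam *. t) ~= (f e <= lam *. t')" by (elim bexE)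
 have "lam *. t' <= lam *. t" using less sd(1) by simp
 hence "f e <= lam *. t" "lam *. t' < f e" using f(2) by auto
 hence "0 <= lam *. t - f e" "lam *. t - f e < (lam * M) *. one"
 by (simp_all add: t'_def smul_diff_right smul_smul algebra_simps)
 from bounded_multiple_of_one[OF this] obtain r where "lam *. t - f e = r *. one" by blast
 hence "lam *. t = f e + r *. one" by (simp add: diff_eq_eq add.commute)
 moreover have "AF (length e) (%e. f e + r *. one)"
 using bspec[OF sd(4) f(1)] assms(2) by (intro AF_add AF_const smul_in one_in) simp
 ultimately show ?thesis by (intro dclI[OF sd(1)])
qed

text \<open>Each coordinate of \<open>f xs\<close> is definable from \<open>xs\<close>, and
  conversely by injectivity.\<close>

lemma definable_bij_dcl:
 assumes bij: "bij_betw f X Y" and graph: "definable_in A nn {xs @ f xs | xs. xs : X}"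
 and X: "definable_in A n X" and Y: "definable_in A m Y" and xs: "xs : X"
 shows "dcl (f xs) = dcl xs"
proof -
 let ?\<Gamma> = "{xs @ f xs | xs. xs : X}"
 have len: "length xs = n" "length (f xs) = m" if "xs : X" for xs
 using definable_in_length[OF X that] definable_in_length[OF Y bij_betwE[OF bij, rule_format, OF that]]
 by simp_all
 have "xs @ f xs : ?\<Gamma>" using xs by blast
 from definable_in_length[OF graph this] have nn: "nn = n + m" using len[OF xs] by simp
 have \<Gamma>: "us @ vs : ?\<Gamma> \<longleftrightarrow> us : X & vs = f us" if "length us = n" for us vs
 proof
 assume "us @ vs : ?\<Gamma>"
 then obtain us' where "us @ vs = us' @ f us'" "us' : X" by blast
 thus "us : X & vs = f us" using len[of us'] that by simp
 qed blast
 have inj: "us = us'" if "us : X" "us' : X" "f us = f us'" for us us'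
 using bij that by (auto simp: bij_betw_def inj_on_def)
 have D\<Gamma>: "D (n + m) (%z. z : ?\<Gamma>)" using definable_in_D[OF graph] nn by simp
 have 1: "f xs ! l : dcl xs" if "l < m" for l
 proof -
 let ?Q = "%z. drop (Suc m) z @ take m z : ?\<Gamma> & z ! l = z ! m"
 have "AM (m + Suc n) (n + m) (%z. drop (Suc m) z @ take m z)"
 using AM_drop[of "Suc m" "m + Suc n"] by (intro AM_append AM_take) simp_all
 hence "D (m + Suc n) ?Q"
 using D_comp[OF D\<Gamma>] that by (intro D_conj D_eq AF_nth) simp_all
 from D_Ex_list[OF this] have DQ: "D (Suc n) (%e. EX ys. length ys = m & ?Q (ys @ e))" .
 have Q: "?Q (ys @ t # xs) \<longleftrightarrow> ys = f xs & t = ys ! l" if "length ys = m" for ys t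
 proof -
 have "?Q (ys @ t # xs) \<longleftrightarrow> xs @ ys : ?\<Gamma> & ys ! l = t" using that \<open>l < m\<close> by (simp add: nth_append)
 thus ?thesis unfolding \<Gamma>[OF len(1)[OF xs]] using xs by blast
 qed
 show ?thesis
 proof (rule definable_function_dcl[OF DQ len(1)[OF xs]])
 show "EX ys. length ys = m & ?Q (ys @ f xs ! l # xs)"
 using len(2)[OF xs] by (intro exI[of _ "f xs"] conjI iffD2[OF Q]) simp_all
 fix t' assume "EX ys. length ys = m & ?Q (ys @ t' # xs)"
 then obtain ys where "length ys = m & ?Q (ys @ t' # xs)" by (elim exE)
 thus "t' = f xs ! l" using Q[of ys t'] by (simp only: simp_thms)
 qed
 qed
 have 2: "xs ! l : dcl (f xs)" if "l < n" for l
 proof -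
 let ?Q = "%z. take n z @ drop (Suc n) z : ?\<Gamma> & z ! l = z ! n"
 have "AM (n + Suc m) (n + m) (%z. take n z @ drop (Suc n) z)"
 using AM_drop[of "Suc n" "n + Suc m"] by (intro AM_append AM_take) simp_all
 hence "D (n + Suc m) ?Q"
 using D_comp[OF D\<Gamma>] that by (intro D_conj D_eq AF_nth) simp_all
 from D_Ex_list[OF this] have DQ: "D (Suc m) (%e. EX ys. length ys = n & ?Q (ys @ e))" .
 have Q: "?Q (ys @ t # f xs) \<longleftrightarrow> ys = xs & t = ys ! l" if "length ys = n" for ys t
 proof -
 have "?Q (ys @ t # f xs) \<longleftrightarrow> ys @ f xs : ?\<Gamma> & ys ! l = t" using that \<open>l < n\<close> by (simp add: nth_append)
 also have "ys @ f xs : ?\<Gamma> \<longleftrightarrow> ys = xs" unfolding \<Gamma>[OF that] using inj[of ys xs] xs by metis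
 finally show ?thesis by blast
 qed
 show ?thesis
 proof (rule definable_function_dcl[OF DQ len(2)[OF xs]])
 show "EX ys. length ys = n & ?Q (ys @ xs ! l # f xs)"
 using len(1)[OF xs] by (intro exI[of _ xs] conjI iffD2[OF Q]) simp_all
 fix t' assume "EX ys. length ys = n & ?Q (ys @ t' # f xs)"
 then obtain ys where "length ys = n & ?Q (ys @ t' # f xs)" by (elim exE)
 thus "t' = xs ! l" using Q[of ys t'] by (simp only: simp_thms)
 qed
 qed
 show ?thesis
 by (rule equalityI; rule dcl_subset) (simp_all add: 1 2 len[OF xs])
qed

text \<open>An invariant of classes: multiplicities are forgotten, and of each point only its
  closure is kept, which definable bijections preserve.\<close>

definition dcls :: "'a list set multiset => 'a set set" where
 "dcls M = {dcl xs | X xs. X :# M & xs : X}"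

lemma dcls_add: "dcls (M + M') = dcls M Un dcls M'"
 unfolding dcls_def by auto

lemma dcls_simps [simp]: "dcls {#} = {}" "dcls (add_mset X M) = dcl ` X Un dcls M"
 unfolding dcls_def by auto

lemma K_eq_dcls: "K_eq A M M' ==> dcls M = dcls M'"
proof (induction rule: K_eq.induct)
 case (bij X1 X2)
 obtain f nn where f: "bij_betw f X1 X2" "definable_in A nn {xs @ f xs |xs. xs : X1}"
 using bij(3) unfolding definable_bij_def definable_def by blast
 obtain n m where nm: "definable_in A n X1" "definable_in A m X2" using bij(1,2) unfolding definable_def by blast
 note eq = definable_bij_dcl[OF f nm]
 have "X2 = f ` X1" using f(1) by (simp add: bij_betw_def)
 thus ?case using eq by (simp add: image_image)
qed (simp_all add: dcls_add image_Un)

section \<open>Generic points of boxes\<close>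

text \<open>A bound \<open>None\<close> stands for infinity.\<close>

definition below :: "'a => 'a option => bool" where
 "below x b \<longleftrightarrow> 0 <= x & (ALL a. b = Some a --> x < a)"

text \<open>Infinitesimal in comparison with \<open>b\<close>; every element qualifies when
  \<open>b\<close> is infinite.\<close>

definition small :: "'a => 'a option => bool" where
 "small c b \<longleftrightarrow> (ALL a. b = Some a --> (ALL n. n *. c < a))"

text \<open>Stronger than independence of \<open>W\<close>: no positive multiple of \<open>x\<close>
  comes within a parameter distance of \<open>W\<close> that is infinitesimal against
  \<open>b\<close>. This margin allows small coordinates to be neglected later.\<close>

definition generic :: "'a set => 'a option => 'a => bool" where
 "generic W b x \<longleftrightarrow> below x b &
 (ALL r w c. 0 < r --> w : W --> c : A --> 0 <= c --> small c b --> ~ (w - c <= r *. x & r *. x <= w + c))"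

text \<open>Among the points \<open>x t\<close>, one more than there are strips, two would lie in
  the same strip. They are at least \<open>3 *. d\<close> apart, while a strip for
  \<open>r *. x\<close> has width at most \<open>d + d\<close>.\<close>

lemma avoid_strips:
 fixes T :: "(int \<times> 'a \<times> 'a) set"
 assumes T: "finite T" "!!r w c. (r, w, c) : T ==> 0 < r & 0 <= c & small c b" and one: "small one b"
 shows "EX x. below x b & (\<forall>(r, w, c)\<in>T. ~ (w - c <= r *. x & r *. x <= w + c))"
proof -
 let ?C = "insert one ((%(r, w, c). c) ` T)"
 define d where "d = Max ?C"
 have fin: "finite ?C" using T(1) by simp
 have "d : ?C" unfolding d_def using fin by (intro Max_in) auto
 hence small: "small d b" using T(2) one by auto
 have "one <= d" unfolding d_def using fin by simp
 hence d0: "0 < d" using one_pos by simp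
 have dc: "c <= d" if "(r, w, c) : T" for r w c
 proof -
 have "c : ?C" using that by force
 thus ?thesis unfolding d_def using fin by (rule Max_ge[rotated])
 qed
 define x where "x t = (3 * int t) *. d" for t :: nat
 have x0: "0 <= x t" for t using d0 by (simp add: x_def smul_nonneg)
 have bel: "below (x t) b" for t using x0 small by (auto simp: below_def small_def x_def)
 show ?thesis
 proof (rule ccontr)
 assume "~ ?thesis"
 hence "~ (\<forall>(r, w, c)\<in>T. ~ (w - c <= r *. x t & r *. x t <= w + c))" for t using bel[of t] by blast
 hence "\<exists>s\<in>T. fst (snd s) - snd (snd s) <= fst s *. x t & fst s *. x t <= fst (snd s) + snd (snd s)" for t
 by (fastforce simp: case_prod_beta)
 then obtain ta where ta: "!!t. ta t : T" "!!t. fst (snd (ta t)) - snd (snd (ta t)) <= fst (ta t) *. x t &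
 fst (ta t) *. x t <= fst (snd (ta t)) + snd (snd (ta t))"
 by (metis (no_types, lifting))
 have "~ inj_on ta {..card T}"
 proof
 assume "inj_on ta {..card T}"
 hence "card {..card T} <= card T" using ta(1) T(1) by (intro card_inj_on_le[of ta]) auto
 thus False by simp
 qed
 then obtain s0 t0 where "s0 ~= t0" "ta s0 = ta t0" unfolding inj_on_def by blast
 then obtain s t where st: "s < t" "ta s = ta t" by (metis nat_neq_iff)
 obtain r w c where rwc: "ta t = (r, w, c)" by (cases "ta t")
 hence rT: "(r, w, c) : T" using ta(1)[of t] by simp
 have 1: "w - c <= r *. x s" "r *. x t <= w + c" using ta(2)[of s] ta(2)[of t] st(2) rwc by simp_all
 have 3: "3 *. d <= x t - x s" unfolding x_def smul_diff_left[symmetric] using st(1) d0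
 by (intro smul_mono_left) auto
 have "0 <= 3 *. d" using d0 by (intro smul_nonneg) simp_all
 hence "0 <= x t - x s" using 3 by (rule order_trans)
 hence "1 *. (x t - x s) <= r *. (x t - x s)"
 using T(2)[OF rT] by (intro smul_mono_left) simp_all
 with 3 have "3 *. d <= r *. (x t - x s)" unfolding smul_one by (rule order_trans)
 also have "\<dots> <= c + c" using diff_mono[OF 1(2) 1(1)] by (simp add: smul_diff_right)
 also have "\<dots> <= d + d" using dc[OF rT] by (intro add_mono)
 finally have "3 *. d <= d + d" .
 moreover have "3 *. d = d + d + d" using smul_step[of 2 d] smul_step[of 1 d] by simp
 ultimately show False using d0 by simp
 qed
qed

primrec mult_tm :: "nat => 'b tm" where
 "mult_tm 0 = Zero"
| "mult_tm (Suc n) = Add (mult_tm n) (Var 0)"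

lemma mult_tm_simps [simp]: "params_tm (mult_tm n) = {}" "fv_tm (mult_tm n) <= {0}"
 by (induction n) auto

lemma val_mult_tm: "val e (mult_tm n) = int n *. e 0"
 by (induction n) (simp_all add: smul_add_left add.commute)

text \<open>The conditions form a type over \<open>W\<close>, finitely satisfiable because finitely
  many strips do not cover the side, and saturation realizes it. Closure of \<open>W\<close> under
  adding and subtracting parameters keeps the constants \<open>w + c\<close> and
  \<open>w - c\<close> in \<open>W\<close>.\<close>

lemma generic_exists:
 assumes sat: "saturated (cardSuc kp) TYPE('a)" and kp: "Card_order kp" and W: "|W| \<le>o kp" "A <= W"
 "!!w c. w : W ==> c : A ==> w + c : W & w - c : W" and one: "small one b"
 and b: "!!a. b = Some a ==> a : A"
 shows "EX x. generic W b x"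
proof -
 let ?S = "{(r :: nat, w, c). 0 < r & w : W & c : A & 0 <= c & small c b}"
 let ?ph = "%(r, w, c). Not (And (Not (Less (mult_tm r) (Par (w - c)))) (Not (Less (Par (w + c)) (mult_tm r))))"
 let ?B = "insert (Not (Less (Var 0) Zero)) {Less (Var 0) (Par a) | a. b = Some a}"
 let ?p = "?B Un ?ph ` ?S"
 have satB: "(\<forall>ps\<in>?B. sat (%_. x) ps) \<longleftrightarrow> below x b" for x
 by (auto simp: below_def not_less)
 have satph: "sat (%_. x) (?ph (r, w, c)) \<longleftrightarrow> ~ (w - c <= int r *. x & int r *. x <= w + c)" for x r w c
 by (simp add: val_mult_tm not_less)
 have "|W| <o cardSuc kp" by (rule ordLeq_ordLess_trans[OF W(1) cardSuc_greater[OF kp]])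
 moreover have "\<forall>ps\<in>?p. params ps <= W & fv ps <= {0}"
 proof
 fix ps assume "ps : ?p"
 thus "params ps <= W & fv ps <= {0}"
 proof (rule UnE)
 assume "ps : ?B"
 thus ?thesis using b W(2) by auto
 next
 assume "ps : ?ph ` ?S"
 then obtain rwc where ps: "ps = ?ph rwc" and mem: "rwc : ?S" by (rule imageE)
 obtain r w c where rwc: "rwc = (r, w, c)" by (cases rwc)
 have "w + c : W" "w - c : W" using W(3)[of w c] mem unfolding rwc by auto
 thus ?thesis unfolding ps rwc using mult_tm_simps(2)[of r] by simp
 qed
 qed
 moreover have "EX x. \<forall>ps\<in>q. sat (%_. x) ps" if q: "q <= ?p" "finite q" for q
 proof -
 have "finite (q - ?B)" "q - ?B <= ?ph ` ?S" using q by auto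
 from finite_subset_image[OF this] obtain T where T: "T <= ?S" "finite T" "q - ?B = ?ph ` T" by blast
 let ?T = "(%(r, w, c). (int r, w, c)) ` T"
 have "EX x. below x b & (\<forall>(r, w, c)\<in>?T. ~ (w - c <= r *. x & r *. x <= w + c))"
 proof (rule avoid_strips[OF _ _ one])
 show "finite ?T" using T(2) by simp
 show "0 < r & 0 <= c & small c b" if "(r, w, c) : ?T" for r w c using that T(1) by auto
 qed
 then obtain x where x: "below x b" "\<forall>(r, w, c)\<in>?T. ~ (w - c <= r *. x & r *. x <= w + c)" by blast
 have "sat (%_. x) ps" if "ps : q" for ps
 proof (cases "ps : ?B")
 case True
 thus ?thesis using satB[of x] x(1) by blast
 next
 case False
 hence "ps : ?ph ` T" unfolding T(3)[symmetric] using that by simp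
 then obtain s where s: "s : T" "ps = ?ph s" by (elim imageE)
 obtain r w c where "s = (r, w, c)" by (cases s)
 with s have rwc: "(r, w, c) : T" "ps = ?ph (r, w, c)" by (simp_all only:)
 hence "(int r, w, c) : ?T" by force
 from bspec[OF x(2) this] show ?thesis unfolding rwc(2) satph by simp
 qed
 thus ?thesis by blast
 qed
 ultimately have "EX x. \<forall>ps\<in>?p. sat (%_. x) ps"
 using sat[unfolded saturated_def, THEN spec, of W, THEN spec, of ?p] by simp
 then obtain x where x: "\<forall>ps\<in>?p. sat (%_. x) ps" by (elim exE)
 have "below x b" using x satB[of x] by blast
 moreover have "~ (w - c <= r *. x & r *. x <= w + c)"
 if "0 < r" "w : W" "c : A" "0 <= c" "small c b" for r w c
 proof -
 have "(nat r, w, c) : ?S" using that by simp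
 hence "?ph (nat r, w, c) : ?p" by (intro UnI2 imageI)
 from bspec[OF x this] have "~ (w - c <= int (nat r) *. x & int (nat r) *. x <= w + c)" unfolding satph .
 thus ?thesis using that(1) by simp
 qed
 ultimately show ?thesis unfolding generic_def by (intro exI[of _ x]) blast
qed

definition span :: "'a list => 'a set" where
 "span xs = {f xs | f. AF (length xs) f}"

lemma spanI: "AF (length xs) f ==> f xs : span xs"
 unfolding span_def by blast

lemma spanE: assumes "w : span xs" obtains f where "AF (length xs) f" "w = f xs"
 using assms unfolding span_def by blast

lemma A_subset_span: "A <= span xs"
 using spanI[OF AF_const] by blast

lemma span_add: "w : span xs ==> w' : span xs ==> w + w' : span xs"
 by (elim spanE) (simp add: spanI[OF AF_add])

lemma span_smul: "w : span xs ==> k *. w : span xs"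
 by (elim spanE) (simp add: spanI[OF AF_smul])

lemma span_minus: "w : span xs ==> - w : span xs"
 using span_smul[of w xs "-1"] by simp

lemma span_sum: "(!!i. i : I ==> f i : span xs) ==> sum f I : span xs"
 using A_subset_span zero_in by (induction I rule: infinite_finite_induct) (auto intro: span_add)

lemma span_nth: "i < length xs ==> xs ! i : span xs"
 using spanI[OF AF_nth] .

lemma span_snoc: "span (xs @ [x]) <= (%(w, k). w + k *. x) ` (span xs \<times> UNIV)"
proof
 fix w assume "w : span (xs @ [x])"
 then obtain f where f: "AF (length xs + 1) f" "w = f (xs @ [x])" by (auto elim: spanE)
 then obtain k c where c: "c : A" "ALL zs. length zs = length xs + 1 --> f zs = c + (\<Sum>i<length xs + 1. k i *. zs ! i)"
 unfolding AF_def by (elim exE conjE)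
 have "w = c + ((\<Sum>i<length xs. k i *. xs ! i) + k (length xs) *. x)"
 using c(2) f(2) by (simp add: nth_append)
 moreover have "c + (\<Sum>i<length xs. k i *. xs ! i) : span xs"
 using A_subset_span c(1) by (intro span_add span_sum span_smul span_nth) auto
 ultimately show "w : (%(w, k). w + k *. x) ` (span xs \<times> UNIV)"
 by (intro image_eqI[of _ _ "(c + (\<Sum>i<length xs. k i *. xs ! i), k (length xs))"]) (simp_all add: add.assoc)
qed

lemma card_of_span:
 assumes kp: "Card_order kp" and A: "|A| \<le>o kp"
 shows "|span xs| \<le>o kp"
proof -
 have "inj_on (%k. k *. one) (UNIV :: int set)" by (simp add: inj_on_def)
 hence int: "|UNIV :: int set| \<le>o |A|" by (rule card_of_ordLeqI) (simp add: smul_in one_in)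
 hence intkp: "|UNIV :: int set| \<le>o kp" using A by (rule ordLeq_transitive)
 \<comment> \<open>The integral multiples of \<open>one\<close> embed into \<open>A\<close>, so
   \<open>kp\<close> is infinite and absorbs a product with the integers.\<close>
 have inf: "infinite (Field kp)"
 proof
 assume "finite (Field kp)"
 moreover have "|UNIV :: int set| \<le>o |Field kp|"
 using ordLeq_ordIso_trans[OF intkp ordIso_symmetric[OF card_of_Field_ordIso[OF kp]]] .
 ultimately have "finite (UNIV :: int set)" by (rule card_of_ordLeq_finite[rotated])
 thus False using infinite_UNIV_int by simp
 qed
 show ?thesis
 proof (induction xs rule: rev_induct)
 case Nil
 have "span [] <= A"
 proof
 fix w assume "w : span []"
 then obtain f where f: "AF 0 f" "w = f []" by (auto elim: spanE)
 thus "w : A" unfolding AF_def by auto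
 qed
 thus ?case using card_of_mono1 ordLeq_transitive A by blast
 next
 case (snoc x xs)
 have "|span xs \<times> (UNIV :: int set)| \<le>o kp"
 by (rule card_of_Times_ordLeq_infinite_Field[OF inf snoc intkp kp])
 thus ?case
 by (rule ordLeq_transitive[OF ordLeq_transitive[OF card_of_mono1[OF span_snoc] card_of_image]])
 qed
qed

text \<open>The coordinates are chosen successively, each generic over the span of its predecessors,
  which still has at most \<open>kp\<close> elements.\<close>

lemma generic_list_exists:
 assumes sat: "saturated (cardSuc kp) TYPE('a)" and kp: "Card_order kp" and A: "|A| \<le>o kp"
 and bs: "\<forall>b\<in>set bs. small one b & (ALL a. b = Some a --> a : A)"
 shows "EX xs. length xs = length bs & (\<forall>i<length bs. generic (span (take i xs)) (bs ! i) (xs ! i))"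
 using bs
proof (induction bs rule: rev_induct)
 case (snoc b bs)
 then obtain xs where xs: "length xs = length bs" "\<forall>i<length bs. generic (span (take i xs)) (bs ! i) (xs ! i)"
 by auto
 have "EX x. generic (span xs) b x"
 proof (rule generic_exists[OF sat kp card_of_span[OF kp A] A_subset_span])
 show "w + c : span xs & w - c : span xs" if "w : span xs" "c : A" for w c
 proof -
 have "c : span xs" using that(2) A_subset_span by blast
 thus ?thesis using span_add[OF that(1)] span_add[OF that(1) span_minus] by simp
 qed
 qed (use snoc.prems in auto)
 then obtain x where x: "generic (span xs) b x" by (elim exE)
 have "generic (span (take i (xs @ [x]))) ((bs @ [b]) ! i) ((xs @ [x]) ! i)" if "i < length (bs @ [b])" for i
 using that xs x by (cases "i = length bs") (simp_all add: nth_append)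
 thus ?case using xs(1) by (intro exI[of _ "xs @ [x]"]) simp
qed simp

section \<open>Domination of boxes\<close>

text \<open>Gaussian elimination without division: with a pivot \<open>p\<close> for the coordinate
  \<open>l\<close>, the other vectors are combined with it crosswise, so that this coordinate
  vanishes.\<close>

lemma integer_relation:
 fixes k :: "'i => 'l => int"
 assumes "finite J"
 shows "finite I ==> card J < card I ==> EX r. (\<exists>i\<in>I. r i ~= 0) & (\<forall>l\<in>J. (\<Sum>i\<in>I. r i * k i l) = 0)"
 using assms
proof (induction J arbitrary: I k rule: finite_induct)
 case empty
 hence "I ~= {}" by auto
 thus ?case by (intro exI[of _ "%_. 1"]) auto
next
 case (insert l J)
 show ?case
 proof (cases "\<forall>i\<in>I. k i l = 0")
 case True
 have "card J < card I" using insert by simp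
 from insert.IH[OF insert.prems(1) this, of k] obtain r where
 r: "\<exists>i\<in>I. r i ~= 0" "\<forall>l\<in>J. (\<Sum>i\<in>I. r i * k i l) = 0" by blast
 moreover have "(\<Sum>i\<in>I. r i * k i l) = 0" using True by (intro sum.neutral) simp
 ultimately show ?thesis by (intro exI[of _ r]) simp
 next
 case False
 then obtain p where p: "p : I" "k p l ~= 0" by blast
 let ?I = "I - {p}"
 have "finite ?I" "card J < card ?I" using insert p by simp_all
 from insert.IH[OF this, of "%i m. k p l * k i m - k i l * k p m"] obtain r where
 r: "\<exists>i\<in>?I. r i ~= 0" "\<forall>m\<in>J. (\<Sum>i\<in>?I. r i * (k p l * k i m - k i l * k p m)) = 0" by blast
 define r' where "r' i = (if i = p then - (\<Sum>i\<in>?I. r i * k i l) else k p l * r i)" for i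
 have sum: "(\<Sum>i\<in>I. r' i * k i m) = (\<Sum>i\<in>?I. r i * (k p l * k i m - k i l * k p m))" for m
 proof -
 have "(\<Sum>i\<in>I. r' i * k i m) = r' p * k p m + (\<Sum>i\<in>?I. r' i * k i m)"
 using insert.prems(1) p(1) by (rule sum.remove)
 also have "(\<Sum>i\<in>?I. r' i * k i m) = (\<Sum>i\<in>?I. k p l * r i * k i m)"
 by (intro sum.cong) (auto simp: r'_def)
 finally show ?thesis
 by (simp add: r'_def right_diff_distrib sum_subtractf sum_distrib_right mult.assoc mult.left_commute)
 qed
 have "\<exists>i\<in>I. r' i ~= 0" using r(1) p(2) by (auto simp: r'_def)
 moreover have "(\<Sum>i\<in>I. r' i * k i m) = 0" if "m : insert l J" for m
 proof (cases "m = l")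
 case True
 thus ?thesis unfolding sum by (intro sum.neutral) (simp add: mult.commute)
 next
 case False
 thus ?thesis unfolding sum using r(2) that by simp
 qed
 ultimately show ?thesis by blast
 qed
qed

text \<open>Comparison of orders of magnitude: \<open>b\<close> is at most a standard multiple of
  \<open>b'\<close>. An infinite bound dominates everything and is dominated only by an infinite
  one.\<close>

definition dom :: "'a option => 'a option => bool" where
 "dom b b' \<longleftrightarrow> (ALL a'. b' = Some a' --> (EX a n. b = Some a & a <= n *. a'))"

definition decreasing :: "'a option list => bool" where
 "decreasing bs \<longleftrightarrow> (ALL i i'. i <= i' --> i' < length bs --> (ALL a. bs ! i = Some a --> (EX a'. bs ! i' = Some a' & a' <= a)))"

lemma not_dom_small: "~ dom b b' ==> EX a'. b' = Some a' & small a' b"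
 by (auto simp: dom_def small_def not_le)

lemma small_0: "small one b ==> small 0 b"
 unfolding small_def by (metis smul_0 smul_0_right)

lemma small_add:
 assumes "small c b" "small d b" shows "small (c + d) b"
 unfolding small_def
proof (intro allI impI)
 fix a n assume b: "b = Some a"
 have 1: "(2 * n) *. c < a" "(2 * n) *. d < a" using assms b by (auto simp: small_def)
 have "2 *. n *. (c + d) = (2 * n) *. c + (2 * n) *. d" by (simp add: smul_smul smul_add_right)
 also have "\<dots> < a + a" using 1 by (rule add_strict_mono)
 also have "a + a = 2 *. a" using smul_step[of 1 a] by simp
 finally show "n *. (c + d) < a" by simp
qed

lemma small_smul: "small c b ==> small (k *. c) b"
 unfolding small_def smul_smul by blast

lemma small_sum: "small one b ==> (!!i. i : I ==> small (f i) b) ==> small (sum f I) b"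
 by (induction I rule: infinite_finite_induct) (simp_all add: small_0 small_add)

text \<open>Suppose that at most \<open>i\<close> sides of the second box dominate side
  \<open>i\<close> of the first. The first \<open>i + 1\<close> points are rational affine
  combinations of \<open>ys\<close>, so some integral relation between them eliminates the
  coordinates on those sides. The other coordinates are bounded by parameters infinitesimal against
  \<open>bs ! i\<close>, and the last point of the relation comes too close to the span of its
  predecessors.\<close>

lemma generic_independent:
 assumes xs: "length xs = length bs" "!!i. i < length bs ==> generic (span (take i xs)) (bs ! i) (xs ! i)"
 and bs: "!!i. i < length bs ==> small one (bs ! i)" "decreasing bs"
 and ys: "length ys = length bs'" "!!l. l < length bs' ==> below (ys ! l) (bs' ! l)"
 and bs': "!!l a. l < length bs' ==> bs' ! l = Some a ==> a : A"
 and dcl: "!!i. i < length bs ==> xs ! i : dcl ys"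
 and i: "i < length bs"
 shows "i < card {l. l < length bs' & dom (bs ! i) (bs' ! l)}"
proof (rule ccontr)
 let ?J = "{l. l < length bs' & dom (bs ! i) (bs' ! l)}" and ?n = "length bs'"
 assume "~ i < card ?J"
 hence card: "card ?J < card {..i}" by simp
 have "EX d c k. 0 < d & c : A & d *. xs ! i' = c + (\<Sum>l<?n. k l *. ys ! l)" if "i' <= i" for i'
 proof -
 have "i' < length bs" using that i by simp
 from dcl[OF this] obtain d f where 1: "0 < d" "AF (length ys) f" "d *. xs ! i' = f ys" by (rule dclE)
 from 1(2) obtain k c where "c : A" "ALL zs. length zs = length ys --> f zs = c + (\<Sum>l<length ys. k l *. zs ! l)"
 unfolding AF_def by (elim exE conjE)
 thus ?thesis using 1 ys(1) by (intro exI[of _ d] exI[of _ c] exI[of _ k]) simp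
 qed
 hence "EX d c k. \<forall>i'\<le>i. 0 < d i' & c i' : A & d i' *. xs ! i' = c i' + (\<Sum>l<?n. k i' l *. ys ! l)" by metis
 then obtain d c k where dck: "\<forall>i'\<le>i. 0 < d i' & c i' : A & d i' *. xs ! i' = c i' + (\<Sum>l<?n. k i' l *. ys ! l)"
 by (elim exE)
 have "finite ?J" by simp
 from integer_relation[OF this _ card, of k] obtain r0 where
 r0: "\<exists>i'\<in>{..i}. r0 i' ~= 0" "\<forall>l\<in>?J. (\<Sum>i'\<in>{..i}. r0 i' * k i' l) = 0" by auto
 \<comment> \<open>The last index occurring in the relation, so that its point is compared with
   earlier ones only. The factor \<open>sgn (r0 p)\<close> in \<open>r\<close> then makes the
   coefficient at \<open>p\<close> positive.\<close>
 define p where "p = Max {i'. i' <= i & r0 i' ~= 0}"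
 have fin: "finite {i'. i' <= i & r0 i' ~= 0}" by simp
 have "p : {i'. i' <= i & r0 i' ~= 0}" unfolding p_def using r0(1) by (intro Max_in fin) auto
 hence p: "p <= i" "r0 p ~= 0" by auto
 have after: "r0 i' = 0" if "p < i'" "i' <= i" for i'
 proof (rule ccontr)
 assume "r0 i' ~= 0"
 hence "i' : {i'. i' <= i & r0 i' ~= 0}" using that(2) by simp
 from Max_ge[OF fin this] that(1) show False unfolding p_def by simp
 qed
 define r where "r i' = sgn (r0 p) * r0 i'" for i'
 have rp: "0 < r p" using p(2) by (simp add: r_def abs_sgn[symmetric] mult.commute)
 have r_after: "r i' = 0" if "p < i'" "i' <= i" for i' using after[OF that] by (simp add: r_def)
 have rJ: "(\<Sum>i'\<le>i. r i' * k i' l) = 0" if "l : ?J" for l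
 proof -
 have "(\<Sum>i'\<le>i. r i' * k i' l) = sgn (r0 p) * (\<Sum>i'\<le>i. r0 i' * k i' l)"
 by (simp add: r_def sum_distrib_left mult.assoc)
 thus ?thesis using bspec[OF r0(2) that] by simp
 qed
 let ?e = "%l. \<Sum>i'\<le>i. r i' * k i' l"
 have total: "(\<Sum>i'\<le>i. (r i' * d i') *. xs ! i') = (\<Sum>i'\<le>i. r i' *. c i') + (\<Sum>l<?n. ?e l *. ys ! l)"
 proof -
 have "(\<Sum>i'\<le>i. (r i' * d i') *. xs ! i') = (\<Sum>i'\<le>i. r i' *. c i' + (\<Sum>l<?n. (r i' * k i' l) *. ys ! l))"
 proof (rule sum.cong)
 fix i' assume "i' : {..i}"
 hence "d i' *. xs ! i' = c i' + (\<Sum>l<?n. k i' l *. ys ! l)" using dck by simp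
 hence "r i' *. d i' *. xs ! i' = r i' *. (c i' + (\<Sum>l<?n. k i' l *. ys ! l))" by (rule arg_cong)
 thus "(r i' * d i') *. xs ! i' = r i' *. c i' + (\<Sum>l<?n. (r i' * k i' l) *. ys ! l)"
 by (simp only: smul_smul smul_add_right smul_sum_right)
 qed simp
 also have "\<dots> = (\<Sum>i'\<le>i. r i' *. c i') + (\<Sum>l<?n. \<Sum>i'\<le>i. (r i' * k i' l) *. ys ! l)"
 unfolding sum.distrib by (subst sum.swap) (rule HOL.refl)
 finally show ?thesis by (simp only: smul_sum_left)
 qed
 have head: "(\<Sum>i'\<le>i. (r i' * d i') *. xs ! i') = (\<Sum>i'<p. (r i' * d i') *. xs ! i') + (r p * d p) *. xs ! p"
 proof -
 have "(\<Sum>i'\<le>i. (r i' * d i') *. xs ! i') = (\<Sum>i'\<in>{..p}. (r i' * d i') *. xs ! i')"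
 using p(1) r_after by (intro sum.mono_neutral_right) auto
 thus ?thesis by (simp add: lessThan_Suc_atMost[symmetric])
 qed
 define w where "w = (\<Sum>i'\<le>i. r i' *. c i') - (\<Sum>i'<p. (r i' * d i') *. xs ! i')"
 define E where "E = (\<Sum>l<?n. ?e l *. ys ! l)"
 have eq: "(r p * d p) *. xs ! p = w + E" using total head unfolding w_def E_def by (simp add: algebra_simps)
 \<comment> \<open>A bound for \<open>ys ! l\<close> that is infinitesimal against
   \<open>bs ! i\<close>; for the eliminated coordinates, whose coefficient vanishes, 0 serves as a
   default.\<close>
 define a where "a l = (if l : ?J then 0 else the (bs' ! l))" for l
 have a: "a l : A & small (a l) (bs ! i) & 0 <= a l & (l : ?J | 0 <= ys ! l & ys ! l <= a l)" if "l < ?n" for l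
 proof (cases "l : ?J")
 case True
 thus ?thesis using zero_in small_0[OF bs(1)[OF i]] by (simp add: a_def)
 next
 case False
 hence "~ dom (bs ! i) (bs' ! l)" using that by simp
 from not_dom_small[OF this] obtain a' where a': "bs' ! l = Some a'" "small a' (bs ! i)" by blast
 have "a l = a'" unfolding a_def if_not_P[OF False] a'(1) by simp
 moreover have "0 <= ys ! l" "ys ! l < a'" using ys(2)[OF that] a'(1) by (simp_all add: below_def)
 moreover from this have "0 <= a'" "ys ! l <= a'" by (meson order_le_less_trans less_imp_le)+
 ultimately show ?thesis using bs'[OF that a'(1)] a'(2) by simp
 qed
 define C where "C = (\<Sum>l<?n. \<bar>?e l\<bar> *. a l)"
 have CA: "C : A" unfolding C_def using a by (intro sum_in smul_in) simp
 have C0: "0 <= C" unfolding C_def using a by (intro sum_nonneg smul_nonneg) simp_all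
 have Csmall: "small C (bs ! i)" unfolding C_def using a by (intro small_sum bs(1) i small_smul) simp
 \<comment> \<open>As \<open>bs\<close> is decreasing, side \<open>p\<close> is at least as large as
   side \<open>i\<close>, and what is small against the latter is small against the former.\<close>
 have Cp: "small C (bs ! p)"
 unfolding small_def
 proof (intro allI impI)
 fix a n assume "bs ! p = Some a"
 then obtain a' where "bs ! i = Some a'" "a' <= a" using bs(2) p(1) i unfolding decreasing_def by blast
 thus "n *. C < a" using Csmall unfolding small_def by (meson less_le_trans)
 qed
 have El: "- (\<bar>?e l\<bar> *. a l) <= ?e l *. ys ! l & ?e l *. ys ! l <= \<bar>?e l\<bar> *. a l" if "l < ?n" for l
 proof (cases "l : ?J")
 case True
 thus ?thesis using rJ[OF True] by simp
 next
 case False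
 thus ?thesis using a[OF that] smul_abs_bound[of "ys ! l" "a l" "?e l"] by blast
 qed
 have CE: "- C <= E"
 proof -
 have "- C = (\<Sum>l<?n. - (\<bar>?e l\<bar> *. a l))" by (simp add: C_def sum_negf)
 also have "\<dots> <= E" unfolding E_def using El by (intro sum_mono) simp
 finally show ?thesis .
 qed
 have EC: "E <= C" unfolding E_def C_def using El by (intro sum_mono) simp
 have near: "w - C <= (r p * d p) *. xs ! p & (r p * d p) *. xs ! p <= w + C"
 unfolding eq using add_left_mono[OF CE, of w] add_left_mono[OF EC, of w] by simp
 have "0 < r p * d p" using rp dck p(1) by simp
 moreover have "w : span (take p xs)"
 proof -
 have "(\<Sum>i'\<le>i. r i' *. c i') : span (take p xs)"
 using dck A_subset_span by (intro span_sum span_smul) auto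
 moreover have "(\<Sum>i'<p. (r i' * d i') *. xs ! i') : span (take p xs)"
 proof (intro span_sum span_smul)
 fix i' assume "i' : {..<p}"
 hence "i' < length (take p xs)" "take p xs ! i' = xs ! i'" using p(1) i xs(1) by auto
 thus "xs ! i' : span (take p xs)" using span_nth[of i' "take p xs"] by simp
 qed
 ultimately have "(\<Sum>i'\<le>i. r i' *. c i') + - (\<Sum>i'<p. (r i' * d i') *. xs ! i') : span (take p xs)"
 by (intro span_add span_minus)
 thus ?thesis by (simp add: w_def)
 qed
 moreover have "generic (span (take p xs)) (bs ! p) (xs ! p)" using xs(2) p(1) i by simp
 ultimately show False using near CA C0 Cp unfolding generic_def by metis
qed

definition obox :: "'a option list => 'a list set" where
 "obox bs = {xs. length xs = length bs & (\<forall>i<length bs. below (xs ! i) (bs ! i))}"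

text \<open>A generic point of the box on the left shares its definable closure with a point of some
  box on the right. More than \<open>i\<close> sides of that box dominate side \<open>i\<close>; as
  its sides are listed in decreasing order, its own side \<open>i\<close> does.\<close>

theorem box_domination:
 assumes sat: "saturated (cardSuc kp) TYPE('a)" and kp: "Card_order kp" "|A| \<le>o kp"
 and bs: "\<forall>b\<in>set bs. small one b & (ALL a. b = Some a --> a : A)" "decreasing bs"
 and K: "K_eq A ({#obox bs#} + R) M"
 and M: "!!Y. Y :# M ==> EX bs'. bs' : B & Y = obox bs'"
 and B: "!!bs'. bs' : B ==> decreasing bs' & (\<forall>b\<in>set bs'. ALL a. b = Some a --> a : A)"
 shows "\<exists>bs'\<in>B. obox bs' :# M & length bs <= length bs' & (\<forall>i<length bs. dom (bs ! i) (bs' ! i))"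
proof -
 from generic_list_exists[OF sat kp bs(1)] obtain xs where xs: "length xs = length bs"
 "\<forall>i<length bs. generic (span (take i xs)) (bs ! i) (xs ! i)" by (elim exE conjE)
 have "xs : obox bs" using xs by (simp add: obox_def generic_def)
 hence "dcl xs : dcls ({#obox bs#} + R)" unfolding dcls_def by auto
 hence "dcl xs : dcls M" unfolding K_eq_dcls[OF K] .
 then obtain Y ys where Y: "Y :# M" "ys : Y" "dcl xs = dcl ys" unfolding dcls_def by blast
 from M[OF Y(1)] obtain bs' where bs': "bs' : B" "Y = obox bs'" by blast
 have ys: "length ys = length bs'" "!!l. l < length bs' ==> below (ys ! l) (bs' ! l)"
 using Y(2) bs'(2) by (auto simp: obox_def)
 have main: "i < length bs' & dom (bs ! i) (bs' ! i)" if i: "i < length bs" for i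
 proof -
 let ?J = "{l. l < length bs' & dom (bs ! i) (bs' ! l)}"
 have "i < card ?J"
 proof (rule generic_independent[OF xs(1) _ _ bs(2) ys _ _ i])
 show "generic (span (take i' xs)) (bs ! i') (xs ! i')" if "i' < length bs" for i' using xs(2) that by simp
 show "small one (bs ! i')" if "i' < length bs" for i' using bs(1) that by simp
 show "a : A" if "l < length bs'" "bs' ! l = Some a" for l a using B[OF bs'(1)] that nth_mem by blast
 show "xs ! i' : dcl ys" if "i' < length bs" for i' using dcl_nth[of i' xs] xs(1) Y(3) that by simp
 qed
 hence "~ ?J <= {..<i}" using card_mono[of "{..<i}" ?J] by auto
 then obtain l where "l : ?J" "l ~: {..<i}" by blast
 hence l: "i <= l" "l < length bs'" "dom (bs ! i) (bs' ! l)" by simp_all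
 have "dom (bs ! i) (bs' ! i)" unfolding dom_def
 proof (intro allI impI)
 fix a' assume "bs' ! i = Some a'"
 then obtain a'' where a'': "bs' ! l = Some a''" "a'' <= a'"
 using B[OF bs'(1)] l(1,2) unfolding decreasing_def by blast
 then obtain a n where an: "bs ! i = Some a" "a <= n *. a''" using l(3) unfolding dom_def by blast
 have "0 <= a''" using ys(2)[OF l(2)] a''(1) unfolding below_def by (meson le_less_trans less_imp_le)
 hence "n *. a'' <= \<bar>n\<bar> *. a''" by (intro smul_mono_left) simp_all
 moreover have "\<bar>n\<bar> *. a'' <= \<bar>n\<bar> *. a'" using a''(2) by (intro smul_mono) simp_all
 ultimately show "EX a n. bs ! i = Some a & a <= n *. a'" using an by (meson order_trans)
 qed
 thus ?thesis using l by simp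
 qed
 have "length bs <= length bs'"
 proof (rule ccontr)
 assume "~ length bs <= length bs'"
 thus False using main[of "length bs'"] by simp
 qed
 thus ?thesis using bs' Y(1) main by blast
qed

end

section \<open>Substitution in formulas, and specialization of parameters to the integers\<close>

definition jn :: "'a list => (nat => 'a) => nat => 'a" where
 "jn xs e i = (if i < length xs then xs ! i else e (i - length xs))"

lemma val_fv: "\<forall>i\<in>fv_tm t. e i = e' i ==> val e t = val e' t"
 by (induction t) simp_all

lemma sat_fv_Ball: "\<forall>i\<in>fv ph. e i = e' i ==> sat e ph = sat e' ph"
proof (induction ph arbitrary: e e')
 case (Eq t u)
 hence "val e t = val e' t" "val e u = val e' u" by (simp_all add: val_fv)
 thus ?case by (simp only: sat.simps)
next
 case (Less t u)
 hence "val e t = val e' t" "val e u = val e' u" by (simp_all add: val_fv)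
 thus ?case by (simp only: sat.simps)
next
 case (And ph ps)
 hence "\<forall>i\<in>fv ph. e i = e' i" "\<forall>i\<in>fv ps. e i = e' i" by simp_all
 thus ?case unfolding sat.simps by (simp only: And.IH)
next
 case (Ex ph)
 have "sat (case_nat x e) ph = sat (case_nat x e') ph" for x
 proof (rule Ex.IH, rule ballI)
 fix i assume "i : fv ph"
 thus "case_nat x e i = case_nat x e' i" using Ex.prems by (cases i) simp_all
 qed
 thus ?case by simp
next
 case (Not ph)
 hence "\<forall>i\<in>fv ph. e i = e' i" by simp
 thus ?case unfolding sat.simps by (simp only: Not.IH)
qed

lemma sat_fv: "(!!i. i : fv ph ==> e i = e' i) ==> sat e ph = sat e' ph"
 using sat_fv_Ball by blast

lemma fv_tm_map [simp]: "fv_tm (map_tm f t) = fv_tm t"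
 by (induction t) auto

lemma fv_map [simp]: "fv (map_fm f ph) = fv ph"
 by (induction ph) auto

lemma finite_fv_tm: "finite (fv_tm t)" and finite_params_tm: "finite (params_tm t)"
 by (induction t) auto

lemma finite_fv: "finite (fv ph)"
proof (induction ph)
 case (Ex ph)
 have "{i. Suc i : fv ph} = Suc -` fv ph" by auto
 thus ?case using Ex finite_vimageI[of "fv ph" Suc] by simp
qed (auto simp: finite_fv_tm)

lemma fv_bound: "EX n. fv ph <= {..<n}"
proof -
 have "fv ph <= {..<Suc (Max (fv ph))}" using Max_ge[OF finite_fv] by (auto simp: less_Suc_eq_le)
 thus ?thesis by blast
qed

lemma finite_params: "finite (params ph)"
 by (induction ph) (auto simp: finite_params_tm)

text \<open>Simultaneous renaming of variables and replacement of some parameters by variables.\<close>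

primrec sub_tm :: "(nat => nat) => ('b => 'c + nat) => 'b tm => 'c tm" where
 "sub_tm rh h (Var i) = Var (rh i)"
| "sub_tm rh h (Par c) = case_sum Par Var (h c)"
| "sub_tm rh h Zero = Zero"
| "sub_tm rh h (Add t u) = Add (sub_tm rh h t) (sub_tm rh h u)"
| "sub_tm rh h (Neg t) = Neg (sub_tm rh h t)"

primrec sub :: "(nat => nat) => ('b => 'c + nat) => 'b fm => 'c fm" where
 "sub rh h (Eq t u) = Eq (sub_tm rh h t) (sub_tm rh h u)"
| "sub rh h (Less t u) = Less (sub_tm rh h t) (sub_tm rh h u)"
| "sub rh h (Not ph) = Not (sub rh h ph)"
| "sub rh h (And ph ps) = And (sub rh h ph) (sub rh h ps)"
| "sub rh h (Ex ph) = Ex (sub (case_nat 0 (Suc o rh)) (map_sum id Suc o h) ph)"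

lemma val_sub: "val e (sub_tm rh h t) = val (e o rh) (map_tm (case_sum id e o h) t)"
 by (induction t) (auto split: sum.split)

lemma sat_sub: "sat e (sub rh h ph) = sat (e o rh) (map_fm (case_sum id e o h) ph)"
proof (induction ph arbitrary: e rh h)
 case (Ex ph)
 have "case_nat x e o case_nat 0 (Suc o rh) = case_nat x (e o rh)" for x
 by (rule ext) (simp split: nat.split)
 moreover have "case_sum id (case_nat x e) o (map_sum id Suc o h) = case_sum id e o h" for x
 by (rule ext) (simp split: sum.split add: case_sum_map_sum)
 ultimately show ?case unfolding sub.simps sat.simps fm.map Ex.IH by (simp only:)
qed (simp_all add: val_sub)

lemma map_sub_tm: "map_tm f (sub_tm rh h t) = sub_tm rh (map_sum f id o h) t"
 by (induction t) (auto split: sum.split)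

lemma map_sub: "map_fm f (sub rh h ph) = sub rh (map_sum f id o h) ph"
proof (induction ph arbitrary: rh h)
 case (Ex ph)
 have "map_sum f id o (map_sum id Suc o h) = map_sum id Suc o (map_sum f id o h)"
 by (rule ext) (simp add: sum.map_comp)
 thus ?case unfolding sub.simps fm.map Ex.IH by (simp only:)
qed (simp_all add: map_sub_tm)

lemma sat_ren:
 fixes e :: "nat => 's::linordered_ab_group_add"
 shows "sat e (map_fm f (sub rh Inl ph)) = sat (e o rh) (map_fm f ph)"
proof -
 have "case_sum id e o (map_sum f id o Inl) = f" by (rule ext) simp
 thus ?thesis unfolding map_sub sat_sub by (simp only:)
qed

lemma map_Exs: "map_fm f ((Ex ^^ n) ph) = (Ex ^^ n) (map_fm f ph)"
 by (induction n) auto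

lemma sat_Exs: "sat e ((Ex ^^ n) ph) \<longleftrightarrow> (EX xs. length xs = n & sat (jn xs e) ph)"
proof (induction n arbitrary: e)
 case 0
 have "jn [] e = e" by (rule ext) (simp add: jn_def)
 thus ?case by simp
next
 case (Suc n)
 have jn: "jn xs (case_nat t e) = jn (xs @ [t]) e" for xs t
 by (rule ext) (auto simp: jn_def nth_append split: nat.split intro!: arg_cong[of _ _ e])
 have "sat e ((Ex ^^ Suc n) ph) \<longleftrightarrow> (EX t xs. length xs = n & sat (jn (xs @ [t]) e) ph)"
 by (simp add: Suc.IH jn)
 also have "\<dots> \<longleftrightarrow> (EX xs. length xs = Suc n & sat (jn xs e) ph)"
 by (metis length_append_singleton length_Suc_conv_rev)
 finally show ?case .
qed

lemma sat_jn: "fv ph <= {..<length xs} ==> sat (jn xs e) ph = sat ((!) xs) ph"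
 by (rule sat_fv) (auto simp: jn_def)

lemma sat_list: "fv ph <= {..<n} ==> sat e ph = sat ((!) (map e [0..<n])) ph"
 by (rule sat_fv) auto

text \<open>\<open>P\<close> is a consequence of the validity of a single formula, itself valid in
  the given group, after its parameters are mapped to integers by \<open>sg\<close>. Such properties
  are closed under finite conjunction, so all facts used in one computation can be realized by the
  same \<open>sg\<close>.\<close>

definition Ev :: "(('z::linordered_ab_group_add => int) => bool) => bool" where
 "Ev P \<longleftrightarrow> (EX ps. (ALL e. sat e ps) & (ALL sg. (ALL e. sat e (map_fm sg ps)) --> P sg))"

lemma Ev_I: "(!!e. sat e ps) ==> (!!sg. (!!e. sat e (map_fm sg ps)) ==> P sg) ==> Ev P"
 unfolding Ev_def by blast

lemma Ev_mono: "Ev P ==> (!!sg. P sg ==> Q sg) ==> Ev Q"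
 unfolding Ev_def by meson

lemma Ev_conj: assumes "Ev P" "Ev Q" shows "Ev (%sg. P sg & Q sg)"
proof -
 obtain ps ch where "ALL e. sat e ps" "ALL sg. (ALL e. sat e (map_fm sg ps)) --> P sg"
 "ALL e. sat e ch" "ALL sg. (ALL e. sat e (map_fm sg ch)) --> Q sg"
 using assms unfolding Ev_def by (elim exE conjE)
 thus ?thesis by (intro Ev_I[of "And ps ch"]) simp_all
qed

lemma Ev_True: "Ev (%sg. True)"
 by (intro Ev_I[of "Eq Zero Zero"]) simp_all

lemma Ev_Ball: "finite I ==> (!!i. i : I ==> Ev (P i)) ==> Ev (%sg. \<forall>i\<in>I. P i sg)"
proof (induction I rule: finite_induct)
 case empty
 thus ?case using Ev_True by simp
next
 case (insert i I)
 hence "Ev (%sg. P i sg & (\<forall>i\<in>I. P i sg))" by (intro Ev_conj) auto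
 thus ?case by simp
qed

lemma Ev_add: "Ev (%sg. sg (a + b) = sg a + sg b)"
 by (intro Ev_I[of "Eq (Par (a + b)) (Add (Par a) (Par b))"]) simp_all

lemma Ev_uminus: "Ev (%sg. sg (- a) = - sg a)"
 by (intro Ev_I[of "Eq (Par (- a)) (Neg (Par a))"]) simp_all

lemma Ev_zero: "Ev (%sg. sg 0 = 0)"
 by (intro Ev_I[of "Eq (Par 0) Zero"]) simp_all

lemma Ev_nonneg: "0 <= a ==> Ev (%sg. 0 <= sg a)"
 by (intro Ev_I[of "Not (Less (Par a) Zero)"]) simp_all

lemma Ev_smul_nat: "Ev (%sg. sg (int n *. a) = int n * sg a)"
proof (induction n)
 case 0
 thus ?case using Ev_zero by simp
next
 case (Suc n)
 have "int (Suc n) *. a = int n *. a + a" by (simp add: smul_add_left add.commute)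
 hence "Ev (%sg. sg (int (Suc n) *. a) = sg (int n *. a) + sg a)" using Ev_add[of "int n *. a" a] by simp
 from Ev_mono[OF Ev_conj[OF this Suc]] show ?case by (simp add: algebra_simps)
qed

lemma Ev_smul: "Ev (%sg. sg (k *. a) = k * sg a)"
proof (cases k)
 case (nonneg n)
 thus ?thesis using Ev_smul_nat by simp
next
 case (neg n)
 have "k *. a = - (int (Suc n) *. a)" unfolding neg smul_minus_left ..
 hence "Ev (%sg. sg (k *. a) = - sg (int (Suc n) *. a))" using Ev_uminus[of "int (Suc n) *. a"] by (simp only:)
 from Ev_conj[OF this Ev_smul_nat[of "Suc n" a]] show ?thesis
 by (rule Ev_mono) (simp only: neg mult_minus_left)
qed

lemma Ev_sum: "finite I ==> Ev (%sg. sg (\<Sum>i\<in>I. k i *. a i) = (\<Sum>i\<in>I. k i * sg (a i)))"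
proof (induction I rule: finite_induct)
 case empty
 thus ?case using Ev_zero by simp
next
 case (insert i I)
 have "Ev (%sg. sg (k i *. a i + (\<Sum>i\<in>I. k i *. a i)) = sg (k i *. a i) + sg (\<Sum>i\<in>I. k i *. a i))" by (rule Ev_add)
 from Ev_mono[OF Ev_conj[OF this Ev_conj[OF insert.IH Ev_smul[of "k i" "a i"]]]]
 show ?case using insert.hyps by simp
qed

lemma Ev_one:
 assumes "zgroup u" shows "Ev (%sg. sg u = 1)"
proof (rule Ev_I)
 let ?ps = "And (Less Zero (Par u)) (Not (And (Less Zero (Var 0)) (Less (Var 0) (Par u))))"
 show "sat e ?ps" for e
 proof -
 have "~ (0 < e 0 & e 0 < u)" using zgroup.one_least[OF assms, of "e 0"] by (meson not_le)
 thus ?thesis using zgroup.one_pos[OF assms] by simp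
 qed
 fix sg :: "'a => int" assume *: "!!e. sat e (map_fm sg ?ps)"
 show "sg u = 1" using *[of "%_. 1"] by auto
qed

text \<open>The parameters become variables behind the \<open>v\<close> universally quantified ones.
  In this way the validity of a formula turns into a parameter-free existential sentence about its
  parameters.\<close>

lemma sat_Exs_params:
 fixes ps :: "'z fm" and e :: "nat => 's::linordered_ab_group_add"
 assumes v: "fv ps <= {..<v}" and ix: "\<forall>c\<in>params ps. ix c < n"
 shows "sat e ((Ex ^^ n) (Not ((Ex ^^ v) (Not (sub id (%c. Inr (v + ix c)) ps))))) \<longleftrightarrow>
 (\<exists>as :: 's list. length as = n & (ALL xs. length xs = v --> sat ((!) xs) (map_fm (%c. as ! ix c) ps)))"
proof -
 have eq: "sat (jn xs (jn as e)) (sub id (%c. Inr (v + ix c)) ps) = sat ((!) xs) (map_fm (%c. as ! ix c) ps)"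
 if "length xs = v" "length as = n" for xs as
 proof -
 have "map_fm (case_sum id (jn xs (jn as e)) o (%c. Inr (v + ix c))) ps = map_fm (%c. as ! ix c) ps"
 proof (rule fm.map_cong0)
 fix c assume "c : params ps"
 hence "ix c < n" using ix by blast
 thus "(case_sum id (jn xs (jn as e)) o (%c. Inr (v + ix c))) c = as ! ix c"
 using that by (simp add: jn_def)
 qed
 hence "sat (jn xs (jn as e)) (sub id (%c. Inr (v + ix c)) ps) =
 sat (jn xs (jn as e)) (map_fm (%c. as ! ix c) ps)" by (simp add: sat_sub)
 also have "\<dots> = sat ((!) xs) (map_fm (%c. as ! ix c) ps)" by (rule sat_jn) (use v that in simp)
 finally show ?thesis .
 qed
 have "(length as = n & (ALL xs. length xs = v --> sat (jn xs (jn as e)) (sub id (%c. Inr (v + ix c)) ps))) =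
 (length as = n & (ALL xs. length xs = v --> sat ((!) xs) (map_fm (%c. as ! ix c) ps)))" for as
 using eq[of _ as] by blast
 thus ?thesis unfolding sat_Exs sat.simps not_ex not_not de_Morgan_conj imp_conv_disj[symmetric]
 by (simp only: simp_thms)
qed

text \<open>Every true sentence is satisfied by suitable integral values of its parameters.\<close>

lemma Ev_ex:
 fixes \<iota> :: "int => 'z::linordered_ab_group_add" and P :: "('z => int) => bool"
 assumes \<iota>: "elementary_embedding \<iota>" and "Ev P"
 shows "EX sg. P sg"
proof -
 obtain ps where ps: "ALL e. sat e ps" "ALL sg. (ALL e. sat e (map_fm sg ps)) --> P sg"
 using assms(2) unfolding Ev_def by (elim exE conjE)
 obtain v where v: "fv ps <= {..<v}" using fv_bound[of ps] by blast
 obtain cs where cs: "set cs = params ps" "distinct cs" using finite_distinct_list[OF finite_params[of ps]] by blast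
 define ix where "ix c = (if c : set cs then (SOME i. i < length cs & cs ! i = c) else 0)" for c
 have ix: "ix c < length cs & cs ! ix c = c" if "c : set cs" for c
 proof -
 have "EX i. i < length cs & cs ! i = c" using that by (simp add: in_set_conv_nth)
 from someI_ex[OF this] that show ?thesis unfolding ix_def by simp
 qed
 \<comment> \<open>As \<open>ch\<close> has no parameters, its image under the embedding is the same
   sentence, and its truth passes to the integers.\<close>
 define ch where "ch = (Ex ^^ length cs) (Not ((Ex ^^ v) (Not (sub id (%c. Inr (v + ix c)) ps :: int fm))))"
 have map: "map_fm \<iota> ch = (Ex ^^ length cs) (Not ((Ex ^^ v) (Not (sub id (%c. Inr (v + ix c)) ps :: 'z fm))))"
 unfolding ch_def by (simp add: map_Exs map_sub comp_def)
 note gen = sat_Exs_params[OF v, of ix "length cs"]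
 have ixp: "\<forall>c\<in>params ps. ix c < length cs" using ix cs(1) by blast
 have "sat (\<iota> o (%_. 0)) (map_fm \<iota> ch)" unfolding map gen[OF ixp]
 proof (intro exI conjI allI impI)
 have "map_fm (%c. cs ! ix c) ps = map_fm id ps" by (rule fm.map_cong0) (use ix cs(1) in auto)
 thus "sat ((!) xs) (map_fm (%c. cs ! ix c) ps)" for xs using ps(1) by (simp add: fm.map_id)
 qed simp
 hence "sat (%_. 0) ch" using \<iota> unfolding elementary_embedding_def by blast
 then obtain as :: "int list" where as: "ALL xs. length xs = v --> sat ((!) xs) (map_fm (%c. as ! ix c) ps)"
 unfolding ch_def gen[OF ixp] by (elim exE conjE)
 have "sat e (map_fm (%c. as ! ix c) ps)" for e
 using as[rule_format, of "map e [0..<v]"] sat_list[of "map_fm (%c. as ! ix c) ps" v e] v by simp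
 thus ?thesis using ps(2) by blast
qed

section \<open>Counting the points of specialized sets\<close>

definition ecard :: "'b set => enat" where
 "ecard X = (if finite X then enat (card X) else \<infinity>)"

lemma ecard_le: "inj_on f X ==> f ` X <= Y ==> ecard X <= ecard Y"
 unfolding ecard_def by (auto dest: inj_on_finite card_inj_on_le)

lemma ecard_Un: "X Int Y = {} ==> ecard (X Un Y) = ecard X + ecard Y"
 unfolding ecard_def by (auto simp: card_Un_disjoint)

text \<open>The interpretation \<open>h\<close> of the parameters is kept variable:
  \<open>h = j\<close> gives the original definable set, an integral \<open>h\<close> its
  specialization.\<close>

definition sols :: "('z => 's::linordered_ab_group_add) => nat => 'z fm => 's list set" where
 "sols h n ph = {xs. length xs = n & sat ((!) xs) (map_fm h ph)}"

text \<open>The long formula says that the relation \<open>gm\<close> is total. As the equivalence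
  holds for every interpretation, its validity for \<open>j\<close> yields the same statement about
  integral specializations.\<close>

lemma sols_total_iff:
 fixes h :: "'z => 's::linordered_ab_group_add"
 assumes "fv ph <= {..<n}" "fv ph' <= {..<n'}" "fv gm <= {..<n + n'}"
 shows "(ALL e. sat e (map_fm h (Not (And ph (Not ((Ex ^^ n') (And ph' (sub (%i. if i < n then n' + i else i - n) Inl gm)))))))) \<longleftrightarrow>
 (\<forall>xs\<in>sols h n ph. \<exists>ys\<in>sols h n' ph'. xs @ ys : sols h (n + n') gm)"
proof -
 have gm: "sat (jn ys e o (%i. if i < n then n' + i else i - n)) (map_fm h gm) =
 sat ((!) (map e [0..<n] @ ys)) (map_fm h gm)" if "length ys = n'" for ys e
 by (rule sat_fv) (use assms(3) that in \<open>auto simp: jn_def nth_append dest!: subsetD\<close>)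
 have ph': "sat (jn ys e) (map_fm h ph') = sat ((!) ys) (map_fm h ph')" if "length ys = n'" for ys e
 by (rule sat_jn) (use that assms(2) in simp)
 have ph: "sat e (map_fm h ph) = sat ((!) (map e [0..<n])) (map_fm h ph)" for e
 by (rule sat_list) (use assms(1) in simp)
 let ?Q = "%xs. sat ((!) xs) (map_fm h ph) --> (EX ys. length ys = n' & sat ((!) ys) (map_fm h ph') &
 sat ((!) (xs @ ys)) (map_fm h gm))"
 have "sat e (map_fm h (Not (And ph (Not ((Ex ^^ n') (And ph' (sub (%i. if i < n then n' + i else i - n) Inl gm))))))) =
 ?Q (map e [0..<n])" for e
 using gm[of _ e] ph'[of _ e] ph[of e] by (auto simp: map_Exs sat_Exs sat_ren)
 moreover have "(ALL e. ?Q (map e [0..<n])) = (ALL xs. length xs = n --> ?Q xs)"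
 proof
 assume *: "ALL e. ?Q (map e [0..<n])"
 show "ALL xs. length xs = n --> ?Q xs"
 proof (rule allI, rule impI)
 fix xs :: "'s list" assume "length xs = n"
 hence "map ((!) xs) [0..<n] = xs" using map_nth by blast
 with spec[OF *, of "(!) xs"] show "?Q xs" by (simp only:)
 qed
 qed simp
 ultimately show ?thesis unfolding sols_def by auto
qed

lemma sols_inj_iff:
 fixes h :: "'z => 's::linordered_ab_group_add"
 assumes "fv gm <= {..<n + n'}" "i < n"
 shows "(ALL e. sat e (map_fm h (Not (And (And (sub (%i. if i < n then i else n + i) Inl gm) (sub (%i. n + i) Inl gm))
 (Not (Eq (Var i) (Var (n + i)))))))) \<longleftrightarrow>
 (ALL xs xs' ys. length xs = n --> length xs' = n --> length ys = n' --> xs @ ys : sols h (n + n') gm -->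
 xs' @ ys : sols h (n + n') gm --> xs ! i = xs' ! i)" (is "?L \<longleftrightarrow> ?R")
proof
 have s: "sat e (map_fm h (Not (And (And (sub (%i. if i < n then i else n + i) Inl gm) (sub (%i. n + i) Inl gm))
 (Not (Eq (Var i) (Var (n + i))))))) \<longleftrightarrow>
 (sat (e o (%i. if i < n then i else n + i)) (map_fm h gm) --> sat (e o (%i. n + i)) (map_fm h gm) --> e i = e (n + i))" for e
 by (auto simp: sat_ren)
 {
 assume L: ?L
 show ?R
 proof (intro allI impI)
 fix xs xs' ys :: "'s list"
 assume len: "length xs = n" "length xs' = n" "length ys = n'"
 and mem: "xs @ ys : sols h (n + n') gm" "xs' @ ys : sols h (n + n') gm"
 let ?e = "(!) (xs @ xs' @ ys)"
 have "sat (?e o (%i. if i < n then i else n + i)) (map_fm h gm) = sat ((!) (xs @ ys)) (map_fm h gm)"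
 by (rule sat_fv) (use len in \<open>auto simp: nth_append\<close>)
 moreover have "sat (?e o (%i. n + i)) (map_fm h gm) = sat ((!) (xs' @ ys)) (map_fm h gm)"
 by (rule sat_fv) (use len in \<open>auto simp: nth_append\<close>)
 ultimately have "?e i = ?e (n + i)" using s[of ?e] L mem unfolding sols_def by blast
 thus "xs ! i = xs' ! i" using len assms(2) by (simp add: nth_append)
 qed
 next
 assume R: ?R
 show ?L unfolding s
 proof (intro allI impI)
 fix e assume e: "sat (e o (%i. if i < n then i else n + i)) (map_fm h gm)" "sat (e o (%i. n + i)) (map_fm h gm)"
 let ?xs = "map e [0..<n]" and ?xs' = "map (%i. e (n + i)) [0..<n]" and ?ys = "map (%i. e (n + n + i)) [0..<n']"
 have "sat (e o (%i. if i < n then i else n + i)) (map_fm h gm) = sat ((!) (?xs @ ?ys)) (map_fm h gm)"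
 by (rule sat_fv) (use assms(1) in \<open>auto simp: nth_append add.assoc dest!: subsetD\<close>)
 moreover have "sat (e o (%i. n + i)) (map_fm h gm) = sat ((!) (?xs' @ ?ys)) (map_fm h gm)"
 by (rule sat_fv) (use assms(1) in \<open>auto simp: nth_append add.assoc dest!: subsetD\<close>)
 ultimately have "?xs @ ?ys : sols h (n + n') gm" "?xs' @ ?ys : sols h (n + n') gm"
 using e by (simp_all add: sols_def)
 hence "?xs ! i = ?xs' ! i" by (intro R[rule_format, of ?xs ?xs' ?ys]) simp_all
 thus "e i = e (n + i)" using assms(2) by simp
 qed
 }
qed

text \<open>The formula expressing that \<open>0 <= x\<^sub>i < a\<^sub>i\<close> for all \<open>i\<close>.\<close>

primrec box_fm :: "'z list => 'z fm" where
 "box_fm [] = Eq Zero Zero"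
| "box_fm (a # as) = And (And (Not (Less (Var 0) Zero)) (Less (Var 0) (Par a))) (sub Suc Inl (box_fm as))"

lemma sat_box_fm:
 "length xs = length as ==> sat ((!) xs) (map_fm h (box_fm as)) = list_all2 (%x a. 0 <= x & x < h a) xs as"
proof (induction as arbitrary: xs)
 case (Cons a as)
 then obtain x ys where xs: "xs = x # ys" by (cases xs) auto
 have "(!) xs o Suc = (!) ys" by (rule ext) (simp add: xs)
 thus ?case using Cons by (simp add: xs sat_ren not_less)
qed simp

lemma fv_sub_Suc: "fv ph <= {..<n} ==> fv (sub Suc Inl ph :: 'c fm) <= {..<Suc n}"
proof -
 have tm: "fv_tm (sub_tm rh Inl t :: 'c tm) = rh ` fv_tm t" for rh and t :: "'c tm"
 by (induction t) auto
 have "fv (sub rh Inl ph :: 'c fm) <= rh ` fv ph" for rh and ph :: "'c fm"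
 proof (induction ph arbitrary: rh)
 case (Ex ph)
 have eq: "map_sum id Suc o Inl = (Inl :: 'c => 'c + nat)" by (rule ext) simp
 have "Suc i : fv (sub (case_nat 0 (Suc o rh)) Inl ph) ==> i : rh ` {i. Suc i : fv ph}" for i
 using Ex.IH[of "case_nat 0 (Suc o rh)"] by (auto split: nat.splits)
 thus ?case by (auto simp: eq)
 next
 case (And ph ps)
 from And.IH(1)[of rh] And.IH(2)[of rh] show ?case by auto
 qed (auto simp: tm)
 thus "fv (sub Suc Inl ph :: 'c fm) <= {..<Suc n}" if "fv ph <= {..<n}" for ph :: "'c fm" using that by fastforce
qed

lemma fv_box_fm: "fv (box_fm as) <= {..<length as}"
 by (induction as) (simp_all add: fv_sub_Suc)

lemma card_list_all2:
 "finite {xs. list_all2 (%x a. 0 <= x & x < f a) xs as} &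
 card {xs. list_all2 (%x a. 0 <= (x :: int) & x < f a) xs as} = (\<Prod>a\<in>#mset as. nat (f a))"
proof (induction as)
 case (Cons a as)
 let ?S = "{xs. list_all2 (%x a. 0 <= x & x < f a) xs as}"
 have "{xs. list_all2 (%x a. 0 <= x & x < f a) xs (a # as)} = (%(x, xs). x # xs) ` ({0..<f a} \<times> ?S)"
 by (auto simp: list_all2_Cons2)
 moreover have "inj_on (%(x, xs). x # xs) ({0..<f a} \<times> ?S)" by (auto simp: inj_on_def)
 ultimately show ?case using Cons by (simp add: card_image card_cartesian_product)
qed simp

section \<open>From equalities of classes to equalities of integral counts\<close>

locale group_extension = zgroup_params one "range j"
 for one :: "'m::linordered_ab_group_add" and j :: "'z::linordered_ab_group_add => 'm" +
 fixes \<iota> :: "int => 'z"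
 assumes j: "elementary_embedding j" and \<iota>: "elementary_embedding \<iota>" and one_eq: "one = j (\<iota> 1)"
 and Z: "zgroup_params (\<iota> 1) (range \<iota>)"
begin

abbreviation "Z \<equiv> range j"

lemma Ev_transfer:
 assumes "!!e. sat e (map_fm j ps)" "!!sg. (ALL e. sat e (map_fm sg ps)) ==> P sg"
 shows "Ev P"
proof (rule Ev_I)
 show "sat e ps" for e using assms(1)[of "j o e"] j unfolding elementary_embedding_def by blast
qed (rule assms(2), blast)

text \<open>The parameters of the formula are elements of \<open>'z\<close>, not their images under
  \<open>j\<close>: these are the elements that \<open>sg\<close> specializes.\<close>

definition code :: "nat => 'z fm => 'm list set => bool" where
 "code n ph X \<longleftrightarrow> fv ph <= {..<n} & X = sols j n ph"

lemma code_exists: assumes "definable_in Z n X" shows "EX ph. code n ph X"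
proof -
 obtain ph where ph: "params ph <= Z" "fv ph <= {..<n}" "X = {xs. length xs = n & sat ((!) xs) ph}"
 using assms unfolding definable_in_def by blast
 have "map_fm (j o inv_into UNIV j) ph = map_fm id ph"
 by (rule fm.map_cong0) (use ph(1) in \<open>auto simp: f_inv_into_f\<close>)
 hence "map_fm j (map_fm (inv_into UNIV j) ph) = ph" by (simp add: fm.map_comp fm.map_id)
 hence "code n (map_fm (inv_into UNIV j) ph) X" using ph(2,3) unfolding code_def sols_def by simp
 thus ?thesis by blast
qed

text \<open>The graph specializes to a relation that is still total and injective, and choosing
  values of this relation gives an injection between the specialized sets.\<close>

lemma Ev_count_le:
 assumes X: "code n ph X" and Y: "code n' ph' Y" and G: "code (n + n') gm G"
 and total: "!!xs. xs : X ==> \<exists>ys\<in>Y. xs @ ys : G"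
 and inj: "!!xs xs' ys. length xs = n ==> length xs' = n ==> xs @ ys : G ==> xs' @ ys : G ==> xs = xs'"
 shows "Ev (%sg. ecard (sols sg n ph) <= ecard (sols sg n' ph'))"
proof -
 have fv: "fv ph <= {..<n}" "fv ph' <= {..<n'}" "fv gm <= {..<n + n'}"
 and eqs: "X = sols j n ph" "Y = sols j n' ph'" "G = sols j (n + n') gm"
 using X Y G unfolding code_def by blast+
 let ?T = "%sg :: 'z => int. \<forall>xs\<in>sols sg n ph. \<exists>ys\<in>sols sg n' ph'. xs @ ys : sols sg (n + n') gm"
 let ?I = "%i sg. \<forall>xs xs' ys :: int list. length xs = n --> length xs' = n --> length ys = n' -->
 xs @ ys : sols sg (n + n') gm --> xs' @ ys : sols sg (n + n') gm --> xs ! i = xs' ! i"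
 have "Ev ?T"
 proof (rule Ev_transfer)
 have "\<forall>xs\<in>sols j n ph. \<exists>ys\<in>sols j n' ph'. xs @ ys : sols j (n + n') gm" using total eqs by simp
 thus "sat e (map_fm j (Not (And ph (Not ((Ex ^^ n') (And ph' (sub (%i. if i < n then n' + i else i - n) Inl gm)))))))" for e
 unfolding sols_total_iff[OF fv, symmetric] by blast
 qed (simp only: sols_total_iff[OF fv])
 moreover have "Ev (%sg. \<forall>i\<in>{..<n}. ?I i sg)"
 proof (rule Ev_Ball)
 fix i assume "i : {..<n}"
 hence i: "i < n" by simp
 show "Ev (?I i)"
 proof (rule Ev_transfer)
 have "ALL xs xs' ys. length xs = n --> length xs' = n --> length ys = n' -->
 xs @ ys : sols j (n + n') gm --> xs' @ ys : sols j (n + n') gm --> xs ! i = xs' ! i"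
 using inj unfolding eqs by metis
 thus "sat e (map_fm j (Not (And (And (sub (%i. if i < n then i else n + i) Inl gm) (sub (%i. n + i) Inl gm))
 (Not (Eq (Var i) (Var (n + i)))))))" for e
 unfolding sols_inj_iff[OF fv(3) i, symmetric] by blast
 qed (simp only: sols_inj_iff[OF fv(3) i])
 qed simp
 ultimately have "Ev (%sg. ?T sg & (\<forall>i\<in>{..<n}. ?I i sg))" by (rule Ev_conj)
 thus ?thesis
 proof (rule Ev_mono)
 fix sg assume *: "?T sg & (\<forall>i\<in>{..<n}. ?I i sg)"
 then obtain g where g: "!!xs. xs : sols sg n ph ==> g xs : sols sg n' ph' & xs @ g xs : sols sg (n + n') gm"
 by metis
 have "inj_on g (sols sg n ph)"
 proof (rule inj_onI)
 fix xs xs' assume xs: "xs : sols sg n ph" "xs' : sols sg n ph" "g xs = g xs'"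
 have len: "length xs = n" "length xs' = n" "length (g xs) = n'" using xs g[OF xs(1)] by (simp_all add: sols_def)
 have G: "xs @ g xs : sols sg (n + n') gm" "xs' @ g xs : sols sg (n + n') gm"
 using g[OF xs(1)] g[OF xs(2)] unfolding xs(3) by blast+
 show "xs = xs'"
 proof (rule nth_equalityI)
 show "xs ! i = xs' ! i" if "i < length xs" for i using * len G that by blast
 qed (simp add: len)
 qed
 thus "ecard (sols sg n ph) <= ecard (sols sg n' ph')" by (rule ecard_le) (use g in blast)
 qed
qed

lemma Ev_count_eq:
 assumes X: "code n ph X" "definable_in Z n X" and Y: "code n' ph' Y" "definable_in Z n' Y" and bij: "definable_bij Z X Y"
 shows "Ev (%sg. ecard (sols sg n ph) = ecard (sols sg n' ph'))"
proof -
 obtain f where f: "bij_betw f X Y" "definable Z {xs @ f xs | xs. xs : X}"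
 using bij unfolding definable_bij_def by blast
 let ?G = "{xs @ f xs | xs. xs : X}"
 have len: "length xs = n & length (f xs) = n' & f xs : Y" if "xs : X" for xs
 using that definable_in_length[OF X(2)] definable_in_length[OF Y(2)] f(1) by (auto simp: bij_betw_def)
 have G: "definable_in Z (n + n') ?G"
 proof (cases "X = {}")
 case True
 thus ?thesis using definable_in_empty by simp
 next
 case False
 then obtain xs where "xs : X" by blast
 moreover obtain l where l: "definable_in Z l ?G" using f(2) unfolding definable_def by blast
 ultimately have "length (xs @ f xs) = l" using definable_in_length[OF l] by blast
 thus ?thesis using l len[OF \<open>xs : X\<close>] by simp
 qed
 let ?S = "%zs. drop n zs @ take n zs"
 have "AM (n + n') (n' + n) ?S"
 using AM_append[OF AM_drop[of n "n + n'"] AM_take[of n "n + n'"]] by simp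
 from definable_in_image[OF G this] have G': "definable_in Z (n' + n) (?S ` ?G)" .
 have swap: "?S ` ?G = {f xs @ xs | xs. xs : X}"
 proof -
 have "?S (xs @ f xs) = f xs @ xs" if "xs : X" for xs using len[OF that] by simp
 thus ?thesis by (auto simp: image_def)
 qed
 obtain gm where gm: "code (n + n') gm ?G" using code_exists[OF G] by blast
 obtain gm' where gm': "code (n' + n) gm' {f xs @ xs | xs. xs : X}" using code_exists[OF G'] unfolding swap by blast
 have inj: "xs = xs'" if "xs : X" "xs' : X" "f xs = f xs'" for xs xs'
 using f(1) that by (auto simp: bij_betw_def inj_on_def)
 have "Ev (%sg. ecard (sols sg n ph) <= ecard (sols sg n' ph'))"
 proof (rule Ev_count_le[OF X(1) Y(1) gm])
 show "\<exists>ys\<in>Y. xs @ ys : ?G" if "xs : X" for xs using that len[OF that] by blast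
 fix xs xs' ys assume a: "length xs = n" "length xs' = n" "xs @ ys : ?G" "xs' @ ys : ?G"
 from a(3) obtain zs where "xs @ ys = zs @ f zs" "zs : X" by blast
 moreover from a(4) obtain zs' where "xs' @ ys = zs' @ f zs'" "zs' : X" by blast
 ultimately show "xs = xs'" using inj[of zs zs'] a(1,2) len[of zs] len[of zs'] by simp
 qed
 moreover have "Ev (%sg. ecard (sols sg n' ph') <= ecard (sols sg n ph))"
 proof (rule Ev_count_le[OF Y(1) X(1) gm'])
 show "\<exists>xs\<in>X. ys @ xs : {f xs @ xs | xs. xs : X}" if y: "ys : Y" for ys
 proof -
 obtain xs where "xs : X" "ys = f xs" using f(1) y unfolding bij_betw_def by blast
 thus ?thesis by blast
 qed
 fix xs xs' ys assume a: "length xs = n'" "length xs' = n'" "xs @ ys : {f xs @ xs | xs. xs : X}"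
 "xs' @ ys : {f xs @ xs | xs. xs : X}"
 from a(3) obtain zs where "xs @ ys = f zs @ zs" "zs : X" by blast
 moreover from a(4) obtain zs' where "xs' @ ys = f zs' @ zs'" "zs' : X" by blast
 ultimately show "xs = xs'" using a(1,2) len[of zs] len[of zs'] by simp
 qed
 ultimately have "Ev (%sg. ecard (sols sg n ph) <= ecard (sols sg n' ph') & ecard (sols sg n' ph') <= ecard (sols sg n ph))"
 by (rule Ev_conj)
 thus ?thesis by (rule Ev_mono) (elim conjE, rule order.antisym)
qed

text \<open>Two codes of one set may specialize to different sets. By the identity bijection their
  counts agree in the sense of \<open>Ev\<close>, so an arbitrary code may be chosen.\<close>

definition cnt :: "('z => int) => 'm list set => enat" where
 "cnt sg X = (let (n, ph) = SOME (n, ph). definable_in Z n X & code n ph X in ecard (sols sg n ph))"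

lemma cnt_code:
 assumes "code n ph X" "definable_in Z n X"
 shows "Ev (%sg. cnt sg X = ecard (sols sg n ph))"
proof -
 let ?P = "%x. case x of (n, ph) => definable_in Z n X & code n ph X"
 obtain n' ph' where c: "(SOME x. ?P x) = (n', ph')" by (cases "SOME x. ?P x")
 have "?P (n, ph)" using assms by simp
 hence "?P (SOME x. ?P x)" by (rule someI)
 hence P: "definable_in Z n' X" "code n' ph' X" unfolding c by simp_all
 have "definable_bij Z X X" unfolding definable_bij_def
 proof (intro exI[of _ "%xs. xs"] conjI)
 have "definable_in Z (n + n) ((%xs. xs @ xs) ` X)"
 by (rule definable_in_image[OF assms(2) AM_append[OF AM_id AM_id]])
 thus "definable Z {xs @ xs | xs. xs : X}" unfolding Setcompr_eq_image by (rule definable_inI)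
 qed (simp add: bij_betw_def)
 from Ev_count_eq[OF P(2,1) assms this] show ?thesis unfolding cnt_def c by simp
qed

text \<open>Induction on the derivation: each rule contributes facts in the sense of
  \<open>Ev\<close>, and finitely many of them are combined by conjunction.\<close>

lemma K_eq_Ev: "K_eq Z M M' ==> Ev (%sg. (\<Sum>X\<in>#M. cnt sg X) = (\<Sum>X\<in>#M'. cnt sg X))"
proof (induction rule: K_eq.induct)
 case (refl M)
 thus ?case using Ev_True by simp
next
 case (sym M M')
 from sym.IH show ?case by (rule Ev_mono) simp
next
 case (trans M M' M'')
 from Ev_conj[OF trans.IH] show ?case by (rule Ev_mono) simp
next
 case (add M M' P P')
 from Ev_conj[OF add.IH] show ?case by (rule Ev_mono) simp
next
 case empty
 have "code 0 (Not (Eq Zero Zero)) {}" by (simp add: code_def sols_def)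
 from cnt_code[OF this definable_in_empty] show ?case
 by (rule Ev_mono) (simp add: sols_def ecard_def zero_enat_def)
next
 case (union n X1 X2)
 obtain ph1 ph2 where c: "code n ph1 X1" "code n ph2 X2" using code_exists union.hyps(1,2) by meson
 let ?ph = "Not (And (Not ph1) (Not ph2))"
 have u: "sols h n ?ph = sols h n ph1 Un sols h n ph2" for h :: "'z => 's::linordered_ab_group_add"
 by (auto simp: sols_def)
 have "code n ?ph (X1 Un X2)" using c unfolding code_def u by simp
 note e = cnt_code[OF this definable_in_Un[OF union.hyps(1,2)]] cnt_code[OF c(1) union.hyps(1)]
 cnt_code[OF c(2) union.hyps(2)]
 have "Ev (%sg :: 'z => int. sols sg n ph1 Int sols sg n ph2 = {})"
 proof (rule Ev_transfer)
 show "sat e (map_fm j (Not (And ph1 ph2)))" for e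
 proof -
 have "sat e (map_fm j ph1) = (map e [0..<n] : X1)" "sat e (map_fm j ph2) = (map e [0..<n] : X2)"
 using c sat_list[of "map_fm j ph1" n e] sat_list[of "map_fm j ph2" n e] by (simp_all add: code_def sols_def)
 thus ?thesis using union.hyps(3) by auto
 qed
 qed (auto simp: sols_def)
 from Ev_conj[OF Ev_conj[OF this e(1)] Ev_conj[OF e(2,3)]] show ?case
 by (rule Ev_mono) (simp add: u ecard_Un)
next
 case (bij X1 X2)
 obtain n1 n2 where n: "definable_in Z n1 X1" "definable_in Z n2 X2" using bij.hyps unfolding definable_def by blast
 obtain ph1 ph2 where c: "code n1 ph1 X1" "code n2 ph2 X2" using code_exists n by meson
 from Ev_conj[OF Ev_count_eq[OF c(1) n(1) c(2) n(2) bij.hyps(3)] Ev_conj[OF cnt_code[OF c(1) n(1)] cnt_code[OF c(2) n(2)]]]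
 show ?case by (rule Ev_mono) simp
qed

abbreviation "v \<equiv> init_interval j"

primrec unfin :: "'b extended => 'b" where
 "unfin (Fin a) = a" | "unfin Pinf = undefined" | "unfin Minf = undefined"

lemma definable_v: "g : N_inf ==> definable_in Z 1 (v g)"
proof -
 assume "g : N_inf"
 have D0: "D 1 (%xs. 0 <= xs ! 0)" by (intro D_le AF_intros) simp
 have v: "v Pinf = {xs. length xs = 1 & 0 <= xs ! 0}"
 "v (Fin a) = {xs. length xs = 1 & (0 <= xs ! 0 & xs ! 0 < j a)}" for a
 by (auto simp: length_Suc_conv)
 have "definable_in Z 1 (v (Fin a))" for a
 unfolding v by (intro definable_in_Collect D_conj D0 D_less AF_intros) simp_all
 moreover have "definable_in Z 1 (v Pinf)" unfolding v by (intro definable_in_Collect D0)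
 ultimately show ?thesis using \<open>g : N_inf\<close> by (auto simp: N_inf_def N_def)
qed

lemma box_list_v:
 "box_list v (map Fin as) = {xs. list_all2 (%x a. 0 <= x & x < j a) xs as}"
proof (induction as)
 case (Cons a as)
 have sp: "set_prod (v (Fin a)) S = {x # xs | x xs. 0 <= x & x < j a & xs : S}" for S
 proof (intro subset_antisym subsetI)
 fix zs assume "zs : set_prod (v (Fin a)) S"
 thus "zs : {x # xs | x xs. 0 <= x & x < j a & xs : S}" by (auto elim!: set_prodE)
 next
 fix zs assume "zs : {x # xs | x xs. 0 <= x & x < j a & xs : S}"
 then obtain x xs where "zs = [x] @ xs" "[x] : v (Fin a)" "xs : S" by auto
 thus "zs : set_prod (v (Fin a)) S" by (simp only: set_prodI)
 qed
 have "set_prod (v (Fin a)) {xs. list_all2 (%x a. 0 <= x & x < j a) xs as} =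
 {xs. list_all2 (%x a. 0 <= x & x < j a) xs (a # as)}"
 unfolding sp by (auto simp: list_all2_Cons2)
 thus ?case using Cons by simp
qed auto

lemma cnt_box:
 assumes "set_mset m <= N"
 shows "Ev (%sg. cnt sg (box v m) = enat (\<Prod>g\<in>#m. nat (sg (unfin g))))"
proof -
 obtain gs where gs: "mset gs = m" "box v m = box_list v gs" by (rule box_eq)
 have "map Fin (map unfin gs) = gs"
 by (rule map_idI[of gs "Fin o unfin", unfolded map_map[symmetric]]) (use assms gs(1) in \<open>auto simp: N_def\<close>)
 then obtain as where as: "gs = map Fin as" by metis
 have X: "box v m = {xs. list_all2 (%x a. 0 <= x & x < j a) xs as}" unfolding gs(2) as by (rule box_list_v)
 have sols: "sols h (length as) (box_fm as) = {xs. list_all2 (%x a. 0 <= x & x < h a) xs as}"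
 for h :: "'z => 's::linordered_ab_group_add"
 proof (rule Set.set_eqI)
 show "xs : sols h (length as) (box_fm as) \<longleftrightarrow> xs : {xs. list_all2 (%x a. 0 <= x & x < h a) xs as}" for xs
 by (cases "length xs = length as") (auto simp: sols_def sat_box_fm dest: list_all2_lengthD)
 qed
 have c: "code (length as) (box_fm as) (box v m)" unfolding code_def X sols using fv_box_fm by blast
 have "definable Z (box v m)"
 by (rule definable_box) (use assms definable_v definable_inI in \<open>auto simp: N_inf_def\<close>)
 have "definable_in Z (length as) (box v m)"
 proof (cases "box v m = {}")
 case False
 then obtain xs where xs: "xs : box v m" by blast
 obtain l where l: "definable_in Z l (box v m)" using \<open>definable Z (box v m)\<close> unfolding definable_def by blast
 have "length xs = length as" using xs unfolding X by (auto dest: list_all2_lengthD)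
 thus ?thesis using l definable_in_length[OF l xs] by simp
 qed (use definable_in_empty in simp)
 from cnt_code[OF c this] show ?thesis
 proof (rule Ev_mono)
 fix sg assume *: "cnt sg (box v m) = ecard (sols sg (length as) (box_fm as))"
 let ?S = "{xs. list_all2 (%x a. 0 <= x & x < sg a) xs as}"
 have "card ?S = (\<Prod>a\<in>#mset as. nat (sg a))" by (rule card_list_all2[THEN conjunct2])
 moreover have "(\<Prod>g\<in>#m. nat (sg (unfin g))) = (\<Prod>a\<in>#mset as. nat (sg a))"
 unfolding gs(1)[symmetric] as by (simp add: image_mset.compositionality comp_def)
 ultimately show "cnt sg (box v m) = enat (\<Prod>g\<in>#m. nat (sg (unfin g)))"
 using * card_list_all2[THEN conjunct1, of sg as] unfolding sols ecard_def by simp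
 qed
qed

definition value_at :: "('z => int) => 'z extended multiset multiset => nat" where
 "value_at sg Q = (\<Sum>m\<in>#Q. \<Prod>g\<in>#m. nat (sg (unfin g)))"

lemma Ev_value_at:
 assumes "K_eq Z (ev v (poly_of Q)) (ev v (poly_of Q'))" "\<forall>m\<in>#Q. set_mset m <= N" "\<forall>m\<in>#Q'. set_mset m <= N"
 shows "Ev (%sg. value_at sg Q = value_at sg Q')"
proof -
 have cnt: "Ev (%sg. (\<Sum>X\<in>#ev v (poly_of Q). cnt sg X) = enat (value_at sg Q))" if "\<forall>m\<in>#Q. set_mset m <= N" for Q
 using that
 proof (induction Q)
 case empty
 thus ?case using Ev_True by (simp add: value_at_def zero_enat_def)
 next
 case (add m Q)
 have "Ev (%sg. cnt sg (box v m) = enat (\<Prod>g\<in>#m. nat (sg (unfin g))))" using add.prems by (intro cnt_box) simp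
 moreover have "Ev (%sg. (\<Sum>X\<in>#ev v (poly_of Q). cnt sg X) = enat (value_at sg Q))" using add by simp
 ultimately show ?case by (rule Ev_mono[OF Ev_conj]) (simp add: ev_poly_of value_at_def)
 qed
 from Ev_conj[OF K_eq_Ev[OF assms(1)] Ev_conj[OF cnt[OF assms(2)] cnt[OF assms(3)]]]
 show ?thesis by (rule Ev_mono) (metis enat.inject)
qed

end

section \<open>Independent positive generators by a Euclidean algorithm\<close>

lemma wf_induct_lex3:
 fixes f1 f2 f3 :: "'b => nat"
 assumes "!!x. (!!y. f1 y < f1 x | f1 y = f1 x & (f2 y < f2 x | f2 y = f2 x & f3 y < f3 x) ==> P y) ==> P x"
 shows "P x"
proof (induction x rule: wf_induct_rule[OF wf_measures[of "[f1, f2, f3]"]])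
 case (1 x)
 show ?case by (rule assms, rule 1) simp
qed

context zgroup
begin

text \<open>Index 0 is reserved for \<open>one\<close>, which has to stay among the generators
  because it specializes to 1.\<close>

definition frame :: "nat set => (nat => 'a) => bool" where
 "frame I g \<longleftrightarrow> finite I & 0 : I & g 0 = one & (\<forall>i\<in>I. 0 < g i)"

definition cone :: "nat set => (nat => 'a) => 'a set" where
 "cone I g = {f. \<exists>k :: nat => nat. f = (\<Sum>i\<in>I. int (k i) *. g i)}"

text \<open>Subtracting generator \<open>a\<close> from generator \<open>b\<close> is compensated by
  adding the coefficient of \<open>b\<close> to that of \<open>a\<close>.\<close>

lemma sum_exchange:
 fixes k :: "nat => int" and g :: "nat => 'a"
 assumes "finite I" "a : I" "b : I" "a ~= b"
 shows "(\<Sum>i\<in>I. (k(a := k a + k b)) i *. (g(b := g b - g a)) i) = (\<Sum>i\<in>I. k i *. g i)"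
proof -
 have I: "I = insert a (insert b (I - {a, b}))" using assms by auto
 have sp: "sum f I = f a + (f b + sum f (I - {a, b}))" for f :: "nat => 'a"
 by (subst I) (use assms in simp)
 have rest: "(\<Sum>i\<in>I - {a, b}. (k(a := k a + k b)) i *. (g(b := g b - g a)) i) = (\<Sum>i\<in>I - {a, b}. k i *. g i)"
 by (intro sum.cong) auto
 show ?thesis
 unfolding sp[of "%i. (k(a := k a + k b)) i *. (g(b := g b - g a)) i"] sp[of "%i. k i *. g i"] rest
 using assms(4) by (simp add: smul_add_left smul_diff_right algebra_simps)
qed

lemma cone_exchange:
 assumes "finite I" "a : I" "b : I" "a ~= b"
 shows "cone I g <= cone I (g(b := g b - g a))"
proof
 fix f assume "f : cone I g"
 then obtain k :: "nat => nat" where k: "f = (\<Sum>i\<in>I. int (k i) *. g i)" unfolding cone_def by blast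
 let ?k = "k(a := k a + k b)"
 have "(\<Sum>i\<in>I. int (?k i) *. (g(b := g b - g a)) i) =
 (\<Sum>i\<in>I. ((%i. int (k i))(a := int (k a) + int (k b))) i *. (g(b := g b - g a)) i)"
 by (intro sum.cong) auto
 also have "\<dots> = f" unfolding k by (rule sum_exchange[OF assms, where k = "%i. int (k i)"])
 finally have "f = (\<Sum>i\<in>I. int (?k i) *. (g(b := g b - g a)) i)" by (rule HOL.sym)
 thus "f : cone I (g(b := g b - g a))" unfolding cone_def by blast
qed

text \<open>The larger of two generators is never \<open>one\<close>, the least positive element, so
  the distinguished generator is not altered.\<close>

lemma frame_exchange:
 assumes "frame I g" "a : I" "b : I" "g a < g b"
 shows "frame I (g(b := g b - g a))"
proof -
 have "one <= g a" using assms by (intro one_least) (simp add: frame_def)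
 have "b ~= 0"
 proof
 assume "b = 0"
 hence "g a < one" using assms(1,4) by (simp add: frame_def)
 with \<open>one <= g a\<close> show False by simp
 qed
 thus ?thesis using assms by (auto simp: frame_def)
qed

text \<open>
 A relation between the generators allows to remove one of them: as in the Euclidean algorithm,
 a generator is subtracted from a bigger one which occurs in the relation with the other sign.
\<close>

lemma frame_reduce:
 assumes "frame I g" "(\<Sum>i\<in>I. k i *. g i) = 0" "\<exists>i\<in>I. k i ~= 0"
 shows "EX I' g'. frame I' g' & card I' < card I & cone I g <= cone I' g'"
proof -
 define mx where "mx k = Max ((%i. nat \<bar>k i :: int\<bar>) ` I)" for k
 define top where "top k = {i\<in>I. nat \<bar>k i\<bar> = mx k}" for k
 define neg where "neg k = {i\<in>I. k i < (0 :: int)}" for k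
 \<comment> \<open>Last component of the termination measure: the number of negative coefficients if
   the maximal absolute value is attained with positive sign. Otherwise it exceeds all such numbers,
   so that changing all signs counts as progress.\<close>
 define tm where "tm k = (if \<exists>i\<in>I. k i = int (mx k) then card (neg k) else Suc (card I))" for k
 have fin: "finite I" using assms(1) by (simp add: frame_def)
 have mx_ge: "nat \<bar>k i\<bar> <= mx k" if "i : I" for k i unfolding mx_def using fin that by (intro Max_ge) auto
 have mx_le: "mx k <= m" if "!!i. i : I ==> nat \<bar>k i\<bar> <= m" "I ~= {}" for k m
 unfolding mx_def using fin that by (intro Max.boundedI) auto
 have mx_in: "\<exists>i\<in>I. nat \<bar>k i\<bar> = mx k" if "I ~= {}" for k
 proof -
 have "mx k : (%i. nat \<bar>k i\<bar>) ` I" unfolding mx_def using fin that by (intro Max_in) auto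
 then obtain i where "mx k = nat \<bar>k i\<bar>" "i : I" by (rule imageE)
 thus ?thesis by auto
 qed
 have I0: "I ~= {}" using assms(3) by blast
 let ?P = "%x. case x of (g, k) => frame I g --> (\<Sum>i\<in>I. k i *. g i) = 0 --> (\<exists>i\<in>I. k i ~= 0) -->
 (EX I' g'. frame I' g' & card I' < card I & cone I g <= cone I' g')"
 have "?P (g, k)"
 proof (rule wf_induct_lex3[of "%x. mx (snd x)" "%x. card (top (snd x))" "%x. tm (snd x)" ?P])
 fix x :: "(nat => 'a) \<times> (nat => int)"
 assume IH0: "!!y. mx (snd y) < mx (snd x) | mx (snd y) = mx (snd x) & (card (top (snd y)) < card (top (snd x)) \<or>
 card (top (snd y)) = card (top (snd x)) & tm (snd y) < tm (snd x)) ==> ?P y"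
 obtain g k where x: "x = (g, k)" by (cases x)
 have IH: "EX I' g''. frame I' g'' & card I' < card I & cone I g' <= cone I' g''"
 if "mx k' < mx k | mx k' = mx k & (card (top k') < card (top k) | card (top k') = card (top k) & tm k' < tm k)"
 "frame I g'" "(\<Sum>i\<in>I. k' i *. g' i) = 0" "\<exists>i\<in>I. k' i ~= 0" for g' k'
 using IH0[of "(g', k')"] that unfolding x by simp
 show "?P x" unfolding x prod.case
 proof (intro impI)
 assume fr: "frame I g" and rel: "(\<Sum>i\<in>I. k i *. g i) = 0" and nz: "\<exists>i\<in>I. k i ~= 0"
 have mx_pos: "0 < mx k"
 proof -
 obtain i where "i : I" "k i ~= 0" using nz by blast
 thus ?thesis using mx_ge[of i k] by linarith
 qed
 show "EX I' g'. frame I' g' & card I' < card I & cone I g <= cone I' g'"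
 proof (cases "\<exists>i\<in>I. k i = int (mx k)")
 case False
 let ?k = "%i. - k i"
 have mx: "mx ?k = mx k" unfolding mx_def by simp
 have top: "top ?k = top k" unfolding top_def mx by simp
 obtain i where "i : I" "nat \<bar>k i\<bar> = mx k" using mx_in[OF I0] by blast
 hence "?k i = int (mx ?k)" using False unfolding mx by auto
 hence "\<exists>i\<in>I. ?k i = int (mx ?k)" using \<open>i : I\<close> by blast
 hence "tm ?k = card (neg ?k)" unfolding tm_def by (rule if_P)
 also have "\<dots> <= card I" unfolding neg_def using fin by (intro card_mono) auto
 also have "\<dots> < tm k" unfolding tm_def using False by simp
 finally show ?thesis using mx top fr rel nz by (intro IH[of ?k]) (simp_all add: sum_negf)
 next
 case True
 then obtain i where i: "i : I" "k i = int (mx k)" by blast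
 have "\<exists>j\<in>I. k j < 0"
 proof (rule ccontr)
 assume "~ ?thesis"
 hence "0 <= k l *. g l" if "l : I" for l using fr that by (intro smul_nonneg) (auto simp: frame_def not_less less_imp_le)
 hence "\<forall>l\<in>I. k l *. g l = 0" using rel sum_nonneg_eq_0_iff[OF fin, of "%l. k l *. g l"] by blast
 hence "k i *. g i = 0" using i by blast
 moreover have "0 < k i *. g i" using i mx_pos fr by (intro smul_pos) (auto simp: frame_def)
 ultimately show False by simp
 qed
 then obtain j where j: "j : I" "k j < 0" by blast
 have ij: "i ~= j" using i j by auto
 have kj: "- int (mx k) <= k j" using mx_ge[OF j(1), of k] by linarith
 consider "g i = g j" | "g i < g j" | "g j < g i" by fastforce
 thus ?thesis
 proof cases
 case 1
 \<comment> \<open>Of two equal generators one is dropped and its coefficients are passed to the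
   other; the dropped one is chosen with an index different from 0.\<close>
 obtain d c where dc: "d : I" "c : I" "d ~= c" "d ~= 0" "g d = g c"
 using i(1) j(1) ij 1 by (metis)
 have I: "sum f I = f c + (f d + sum f (I - {c, d}))" "sum f (I - {d}) = f c + sum f (I - {c, d})" for f :: "nat => 'a"
 proof -
 have *: "I = insert c (insert d (I - {c, d}))" "I - {d} = insert c (I - {c, d})" using dc by auto
 show "sum f I = f c + (f d + sum f (I - {c, d}))" by (subst *(1)) (use dc fin in simp)
 show "sum f (I - {d}) = f c + sum f (I - {c, d})" by (subst *(2)) (use dc fin in simp)
 qed
 have "cone I g <= cone (I - {d}) g"
 proof
 fix f assume "f : cone I g"
 then obtain n :: "nat => nat" where n: "f = (\<Sum>i\<in>I. int (n i) *. g i)" unfolding cone_def by blast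
 have rest: "(\<Sum>i\<in>I - {c, d}. int ((n(c := n c + n d)) i) *. g i) = (\<Sum>i\<in>I - {c, d}. int (n i) *. g i)"
 by (intro sum.cong) auto
 have "f = (\<Sum>i\<in>I - {d}. int ((n(c := n c + n d)) i) *. g i)"
 unfolding n I rest by (simp add: dc(5) smul_add_left add.assoc)
 thus "f : cone (I - {d}) g" unfolding cone_def by blast
 qed
 moreover have "frame (I - {d}) g" using fr dc by (auto simp: frame_def)
 moreover have "card (I - {d}) < card I" using dc(1) fin by (rule card_Diff1_less[rotated])
 ultimately show ?thesis by blast
 next
 case 2
 \<comment> \<open>The maximal coefficient at \<open>i\<close> drops to a value in
   \<open>[0, mx k)\<close>: either the maximum decreases or fewer positions attain it.\<close>
 let ?k = "k(i := k i + k j)" and ?g = "g(j := g j - g i)"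
 have ki: "0 <= ?k i" "?k i < int (mx k)" using kj j i by auto
 have le: "mx ?k <= mx k"
 proof (rule mx_le[OF _ I0])
 show "nat \<bar>?k l\<bar> <= mx k" if "l : I" for l
 using mx_ge[OF that, of k] ki by (cases "l = i") auto
 qed
 have "card (top ?k) < card (top k)" if "mx ?k = mx k"
 proof (rule psubset_card_mono)
 show "finite (top k)" unfolding top_def using fin by simp
 have "i : top k" using i unfolding top_def by simp
 moreover have "i ~: top ?k" using ki unfolding top_def that by auto
 moreover have "top ?k <= top k"
 proof
 fix l assume "l : top ?k"
 moreover from this \<open>i ~: top ?k\<close> have "l ~= i" by blast
 ultimately show "l : top k" unfolding top_def that by simp
 qed
 ultimately show "top ?k \<subset> top k" by blast
 qed
 hence "mx ?k < mx k | mx ?k = mx k & card (top ?k) < card (top k)" using le by linarith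
 moreover have "frame I ?g" using fr i(1) j(1) 2 by (rule frame_exchange)
 moreover have "(\<Sum>i\<in>I. ?k i *. ?g i) = 0" using sum_exchange[OF fin i(1) j(1) ij, of k g] rel by simp
 moreover have "\<exists>i\<in>I. ?k i ~= 0" using j ij by (intro bexI[of _ j]) auto
 ultimately have "EX I' g'. frame I' g' & card I' < card I & cone I ?g <= cone I' g'" by (intro IH[of ?k]) blast+
 thus ?thesis using cone_exchange[OF fin i(1) j(1) ij, of g] by (meson order_trans)
 next
 case 3
 \<comment> \<open>The maximum at \<open>i\<close> is kept, and the negative coefficient at
   \<open>j\<close> becomes nonnegative. The number of negative coefficients decreases, while no new
   position attains the maximum.\<close>
 let ?k = "k(j := k j + k i)" and ?g = "g(i := g i - g j)"
 have kj': "0 <= ?k j" "?k j < int (mx k)" using kj j i by auto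
 have ki: "?k i = int (mx k)" using i ij by simp
 have le: "nat \<bar>?k l\<bar> <= mx k" if "l : I" for l using mx_ge[OF that, of k] kj' by (cases "l = j") auto
 have mx: "mx ?k = mx k"
 proof (rule order.antisym)
 show "mx ?k <= mx k" by (rule mx_le[OF le I0])
 show "mx k <= mx ?k" using mx_ge[OF i(1), of ?k] ki by simp
 qed
 have "top ?k <= top k"
 proof
 fix l assume l: "l : top ?k"
 have "l ~= j"
 proof
 assume "l = j"
 hence "nat \<bar>?k j\<bar> = mx k" using l unfolding top_def mx by blast
 thus False using kj' by linarith
 qed
 thus "l : top k" using l unfolding top_def mx by simp
 qed
 hence "card (top ?k) <= card (top k)" using fin unfolding top_def by (intro card_mono) auto
 moreover have "card (neg ?k) < card (neg k)"
 proof (rule psubset_card_mono)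
 show "finite (neg k)" unfolding neg_def using fin by simp
 have "j : neg k" "j ~: neg ?k" using j kj' unfolding neg_def by auto
 moreover have "neg ?k <= neg k"
 proof
 fix l assume "l : neg ?k"
 moreover from this \<open>j ~: neg ?k\<close> have "l ~= j" by blast
 ultimately show "l : neg k" unfolding neg_def by simp
 qed
 ultimately show "neg ?k \<subset> neg k" by blast
 qed
 moreover have "tm ?k = card (neg ?k)"
 proof -
 have "\<exists>i\<in>I. ?k i = int (mx ?k)" unfolding mx using ki i(1) by blast
 thus ?thesis unfolding tm_def by (rule if_P)
 qed
 moreover have "tm k = card (neg k)" unfolding tm_def using True by simp
 ultimately have "card (top ?k) < card (top k) | card (top ?k) = card (top k) & tm ?k < tm k" by linarith
 moreover have "frame I ?g" using fr j(1) i(1) 3 by (rule frame_exchange)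
 moreover have "(\<Sum>i\<in>I. ?k i *. ?g i) = 0" using sum_exchange[OF fin j(1) i(1), of k g] ij rel by simp
 moreover have "\<exists>i\<in>I. ?k i ~= 0" using ki mx_pos i(1) by (intro bexI[of _ i]) auto
 ultimately have "EX I' g'. frame I' g' & card I' < card I & cone I ?g <= cone I' g'"
 using mx by (intro IH[of ?k]) blast+
 thus ?thesis using cone_exchange[OF fin j(1) i(1) ij[symmetric], of g] by (meson order_trans)
 qed
 qed
 qed
 qed
 thus ?thesis using assms by simp
qed

lemma independent_frame:
 assumes "frame I g"
 shows "EX I' g'. frame I' g' & cone I g <= cone I' g' & (ALL k. (\<Sum>i\<in>I'. k i *. g' i) = 0 --> (\<forall>i\<in>I'. k i = 0))"
 using assms
proof (induction "card I" arbitrary: I g rule: less_induct)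
 case less
 show ?case
 proof (cases "ALL k. (\<Sum>i\<in>I. k i *. g i) = 0 --> (\<forall>i\<in>I. k i = 0)")
 case True
 thus ?thesis using less.prems by blast
 next
 case False
 then obtain k where "(\<Sum>i\<in>I. k i *. g i) = 0" "\<exists>i\<in>I. k i ~= 0" by blast
 from frame_reduce[OF less.prems this] obtain I' g' where
 "frame I' g'" "card I' < card I" "cone I g <= cone I' g'" by (elim exE conjE)
 with less.hyps[OF this(2,1)] show ?thesis by (meson order_trans)
 qed
qed

text \<open>The frame formed by \<open>one\<close> and the positive members of \<open>F\<close> is
  reduced until no relation is left; along the way its cone only grows.\<close>

lemma basis_exists:
 assumes "finite F" "\<forall>f\<in>F. 0 <= f"
 shows "EX I g. frame I g & F <= cone I g & (ALL k. (\<Sum>i\<in>I. k i *. g i) = 0 --> (\<forall>i\<in>I. k i = 0))"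
proof -
 obtain fs where fs: "set fs = {f\<in>F. 0 < f}" using finite_list[of "{f\<in>F. 0 < f}"] assms(1) by auto
 let ?I = "{..length fs}" and ?g = "case_nat one (%i. fs ! i)"
 have "0 < fs ! i" if "i < length fs" for i using fs nth_mem[OF that] by blast
 hence "frame ?I ?g" unfolding frame_def using one_pos by (auto split: nat.split)
 moreover have "F <= cone ?I ?g"
 proof
 fix f assume f: "f : F"
 show "f : cone ?I ?g"
 proof (cases "f = 0")
 case True
 thus ?thesis unfolding cone_def by (intro CollectI exI[of _ "%_. 0"]) simp
 next
 case False
 hence "f : set fs" using f assms(2) fs by (auto simp: order.strict_iff_order)
 then obtain i where i: "i < length fs" "fs ! i = f" by (auto simp: in_set_conv_nth)
 have "(\<Sum>l\<in>?I. int (if l = Suc i then 1 else 0) *. ?g l) = (\<Sum>l\<in>?I. if l = Suc i then ?g l else 0)"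
 by (intro sum.cong) auto
 also have "\<dots> = f" using i by simp
 finally show ?thesis unfolding cone_def by (intro CollectI exI) (rule HOL.sym)
 qed
 qed
 ultimately show ?thesis using independent_frame[of ?I ?g] by (meson order_trans)
qed

end

section \<open>Polynomial identities from values at finitely many points\<close>

lemma weight_exists:
 fixes S :: "'b multiset set"
 assumes "finite B" "finite S" "\<forall>m\<in>S. set_mset m <= B"
 shows "\<exists>w :: 'b => nat. inj_on (%m. \<Sum>b\<in>#m. w b) S & (ALL b. 0 < w b)"
 using assms
proof (induction B arbitrary: S rule: finite_induct)
 case empty
 hence "\<forall>m\<in>S. m = {#}" by simp
 thus ?case by (intro exI[of _ "%_. 1"]) (auto simp: inj_on_def)
next
 case (insert a B)
 let ?r = "filter_mset (%b. b ~= a)"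
 have "\<forall>m\<in>?r ` S. set_mset m <= B" using insert.prems(2) by auto
 from insert.IH[OF _ this] insert.prems(1) obtain w :: "'b => nat" where
 w: "inj_on (%m. \<Sum>b\<in>#m. w b) (?r ` S)" "ALL b. 0 < w b" by auto
 \<comment> \<open>The weight of the new variable exceeds the weights of all monomials that occur in
   the old ones, so its exponent is read off by division with remainder, as in a positional
   system.\<close>
 define R where "R = Suc (\<Sum>m\<in>?r ` S. \<Sum>b\<in>#m. w b)"
 have R: "(\<Sum>b\<in>#?r m. w b) < R" if "m : S" for m
 unfolding R_def using member_le_sum[of "?r m" "?r ` S" "%m. \<Sum>b\<in>#m. w b"] that insert.prems(1) by (simp add: less_Suc_eq_le)
 let ?w = "w(a := R)"
 have split: "(\<Sum>b\<in>#m. ?w b) = (\<Sum>b\<in>#?r m. w b) + count m a * R" for m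
 by (induction m) auto
 have "inj_on (%m. \<Sum>b\<in>#m. ?w b) S"
 proof (rule inj_onI)
 fix m m' assume m: "m : S" "m' : S" "(\<Sum>b\<in>#m. ?w b) = (\<Sum>b\<in>#m'. ?w b)"
 have eq: "(\<Sum>b\<in>#?r m. w b) + count m a * R = (\<Sum>b\<in>#?r m'. w b) + count m' a * R" using m(3) unfolding split .
 have "((\<Sum>b\<in>#?r m. w b) + count m a * R) mod R = (\<Sum>b\<in>#?r m. w b)"
 "((\<Sum>b\<in>#?r m'. w b) + count m' a * R) mod R = (\<Sum>b\<in>#?r m'. w b)" using R m(1,2) by simp_all
 hence 1: "(\<Sum>b\<in>#?r m. w b) = (\<Sum>b\<in>#?r m'. w b)" using eq by simp
 hence "count m a * R = count m' a * R" using eq by simp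
 moreover have "R ~= 0" by (simp add: R_def)
 ultimately have c: "count m a = count m' a" by simp
 have r: "?r m = ?r m'" using inj_onD[OF w(1) 1] m(1,2) by simp
 show "m = m'"
 proof (rule multiset_eqI)
 fix x
 show "count m x = count m' x"
 proof (cases "x = a")
 case False
 have "count (?r m) x = count (?r m') x" unfolding r ..
 thus ?thesis using False by simp
 qed (simp add: c)
 qed
 qed
 moreover have "ALL b. 0 < ?w b" using w(2) by (simp add: R_def)
 ultimately show ?case by blast
qed

lemma sum_mset_count:
 fixes f :: "'b => 'c::comm_semiring_1"
 shows "finite S ==> set_mset Q <= S ==> (\<Sum>m\<in>#Q. f m) = (\<Sum>m\<in>S. of_nat (count Q m) * f m)"
proof (induction Q)
 case (add x Q)
 have "(\<Sum>m\<in>S. of_nat (count (add_mset x Q) m) * f m) =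
 (\<Sum>m\<in>S. (if m = x then f m else 0) + of_nat (count Q m) * f m)"
 by (intro sum.cong) (auto simp: algebra_simps)
 also have "\<dots> = f x + (\<Sum>m\<in>S. of_nat (count Q m) * f m)" using add.prems by (simp add: sum.distrib)
 finally show ?case using add by simp
qed simp

text \<open>Substituting \<open>y\<^sub>b + M x\<^bsup>w(b)\<^esup>\<close> for the variables separates the monomials by their degree in \<open>x\<close>.\<close>

lemma grid_identity:
 fixes Q Q' :: "'b multiset multiset"
 shows "\<exists>(w :: 'b => nat) L :: nat. \<forall>(y :: 'b => int) M. M ~= 0 -->
 (\<forall>x\<in>{..L}. (\<Sum>m\<in>#Q. \<Prod>b\<in>#m. y b + M * int x ^ w b) = (\<Sum>m\<in>#Q'. \<Prod>b\<in>#m. y b + M * int x ^ w b)) --> Q = Q'"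
proof -
 let ?S = "set_mset Q Un set_mset Q'"
 let ?B = "\<Union>m\<in>?S. set_mset m"
 have "finite ?B" by simp
 from weight_exists[OF this, of ?S] obtain w :: "'b => nat" where
 w: "inj_on (%m. \<Sum>b\<in>#m. w b) ?S" "ALL b. 0 < w b" by auto
 let ?d = "%m. \<Sum>b\<in>#m. w b"
 define L where "L = (\<Sum>m\<in>?S. ?d m)"
 have L: "?d m <= L" if "m : ?S" for m unfolding L_def by (rule member_le_sum) (use that in auto)
 show ?thesis
 proof (intro exI allI impI)
 fix y :: "'b => int" and M :: int
 assume M: "M ~= 0" and eq: "\<forall>x\<in>{..L}. (\<Sum>m\<in>#Q. \<Prod>b\<in>#m. y b + M * int x ^ w b) = (\<Sum>m\<in>#Q'. \<Prod>b\<in>#m. y b + M * int x ^ w b)"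
 let ?f = "%b. [:y b:] + monom M (w b)"
 let ?p = "%m. \<Prod>b\<in>#m. ?f b"
 have f: "degree (?f b) = w b & ?f b ~= 0" for b
 proof -
 have "degree (?f b) = degree (monom M (w b))"
 by (rule degree_add_eq_right) (use w(2) M in \<open>simp add: degree_monom_eq\<close>)
 hence "degree (?f b) = w b" using M by (simp add: degree_monom_eq)
 moreover from this have "?f b ~= 0" using w(2) by (metis degree_0 less_numeral_extra(3))
 ultimately show ?thesis by blast
 qed
 have p: "degree (?p m) = ?d m & ?p m ~= 0" for m
 proof (induction m)
 case (add b m)
 have "degree (?f b * ?p m) = degree (?f b) + degree (?p m)" using f[of b] add by (intro degree_mult_eq) blast+
 moreover have "?f b * ?p m ~= 0" using f[of b] add by (simp only: mult_eq_0_iff) blast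
 ultimately show ?case using f[of b] add by simp
 qed simp
 have evalp: "poly (?p m) x = (\<Prod>b\<in>#m. y b + M * x ^ w b)" for m x
 by (induction m) (simp_all add: poly_monom)
 have evalP: "poly (\<Sum>m\<in>#R. ?p m) x = (\<Sum>m\<in>#R. \<Prod>b\<in>#m. y b + M * x ^ w b)" for R x
 by (induction R) (simp_all add: evalp)
 have degP: "degree (\<Sum>m\<in>#R. ?p m) <= L" if "set_mset R <= ?S" for R using that
 proof (induction R)
 case (add m R)
 thus ?case using p[of m] L[of m] by (auto intro!: degree_add_le)
 qed simp
 have PQ: "(\<Sum>m\<in>#Q. ?p m) = (\<Sum>m\<in>#Q'. ?p m)"
 proof (rule poly_eqI_degree[of "int ` {..L}"])
 show "poly (\<Sum>m\<in>#Q. ?p m) x = poly (\<Sum>m\<in>#Q'. ?p m) x" if "x : int ` {..L}" for x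
 using eq that unfolding evalP by blast
 have "card (int ` {..L}) = Suc L" by (simp add: card_image)
 thus "degree (\<Sum>m\<in>#Q. ?p m) < card (int ` {..L})" "degree (\<Sum>m\<in>#Q'. ?p m) < card (int ` {..L})"
 using degP[of Q] degP[of Q'] by simp_all
 qed
 show "Q = Q'"
 proof (rule ccontr)
 assume "Q ~= Q'"
 then obtain m1 where m1: "count Q m1 ~= count Q' m1" by (meson multiset_eqI)
 \<comment> \<open>Among the monomials with different multiplicities one of largest degree is
   singled out; the others have strictly smaller degree and do not contribute to the coefficient at
   that degree.\<close>
 define T where "T = {m\<in>?S. count Q m ~= count Q' m}"
 have "m1 : ?S"
 proof (rule ccontr)
 assume "m1 ~: ?S"
 hence "count Q m1 = 0" "count Q' m1 = 0" by (simp_all add: not_in_iff)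
 thus False using m1 by simp
 qed
 hence T: "finite T" "m1 : T" using m1 unfolding T_def by simp_all
 have "Max (?d ` T) : ?d ` T" using T by (intro Max_in) auto
 then obtain m0 where m0: "m0 : T" "Max (?d ` T) = ?d m0" by (rule imageE)
 have m0': "?d m <= ?d m0" if "m : T" for m unfolding m0(2)[symmetric] using T(1) that by (intro Max_ge) auto
 have "coeff (?p m) (?d m0) = 0" if "m : T" "m ~= m0" for m
 proof -
 have "?d m ~= ?d m0" using inj_onD[OF w(1), of m m0] that m0(1) unfolding T_def by blast
 hence "?d m < ?d m0" using m0'[OF that(1)] by linarith
 thus ?thesis using p[of m] by (simp add: coeff_eq_0)
 qed
 hence c: "of_nat (count Q m) * coeff (?p m) (?d m0) = of_nat (count Q' m) * coeff (?p m) (?d m0)"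
 if "m : ?S - {m0}" for m using that unfolding T_def by (cases "count Q m = count Q' m") auto
 have m0S: "m0 : ?S" using m0(1) unfolding T_def by blast
 have cP: "coeff (\<Sum>m\<in>#R. ?p m) (?d m0) = (\<Sum>m\<in>?S. of_nat (count R m) * coeff (?p m) (?d m0))" if "set_mset R <= ?S" for R
 proof -
 have "coeff (\<Sum>m\<in>#R. ?p m) (?d m0) = (\<Sum>m\<in>#R. coeff (?p m) (?d m0))" by (induction R) simp_all
 thus ?thesis using sum_mset_count[of ?S R] that by simp
 qed
 have fS: "finite ?S" by simp
 have "(\<Sum>m\<in>?S. of_nat (count Q m) * coeff (?p m) (?d m0)) = (\<Sum>m\<in>?S. of_nat (count Q' m) * coeff (?p m) (?d m0))"
 using cP[of Q] cP[of Q'] PQ by simp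
 hence "of_nat (count Q m0) * coeff (?p m0) (?d m0) = of_nat (count Q' m0) * coeff (?p m0) (?d m0)"
 unfolding sum.remove[OF fS m0S] using sum.cong[OF HOL.refl c, of "?S - {m0}"] by simp
 moreover have "coeff (?p m0) (?d m0) ~= 0" using p[of m0] by (metis leading_coeff_0_iff)
 ultimately have "count Q m0 = count Q' m0" by simp
 thus False using m0(1) unfolding T_def by blast
 qed
 qed
qed

section \<open>Integral translations of the parameters of a valid formula\<close>

context zgroup_params
begin

lemma AF_val_map:
 "fv_tm t <= {..<n} ==> \<forall>f\<in>params_tm t. AF n (G f) ==> AF n (%zs. val ((!) zs) (map_tm (%f. G f zs) t))"
 by (induction t) (simp_all add: AF_intros)

lemma D_sat_map:
 "fv ph <= {..<n} ==> \<forall>f\<in>params ph. AF n (G f) ==> D n (%zs. sat ((!) zs) (map_fm (%f. G f zs) ph))"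
proof (induction ph arbitrary: n G)
 case (Eq t u)
 thus ?case by (simp add: D_eq AF_val_map)
next
 case (Less t u)
 thus ?case by (simp add: D_less AF_val_map)
next
 case (Not ph)
 have "D n (%zs. sat ((!) zs) (map_fm (%f. G f zs) ph))" by (rule Not.IH) (use Not.prems in simp_all)
 thus ?case by (simp add: D_not)
next
 case (And ph ps)
 have "D n (%zs. sat ((!) zs) (map_fm (%f. G f zs) ph))" by (rule And.IH(1)) (use And.prems in simp_all)
 moreover have "D n (%zs. sat ((!) zs) (map_fm (%f. G f zs) ps))" by (rule And.IH(2)) (use And.prems in simp_all)
 ultimately show ?case by (simp add: D_conj)
next
 case (Ex ph)
 have "D (Suc n) (%zs. sat ((!) zs) (map_fm (%f. G f (tl zs)) ph))"
 proof (rule Ex.IH)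
 show "fv ph <= {..<Suc n}"
 proof
 fix i assume "i : fv ph"
 thus "i : {..<Suc n}" using Ex.prems(1) by (cases i) auto
 qed
 show "\<forall>f\<in>params ph. AF (Suc n) (%zs. G f (tl zs))"
 using Ex.prems(2) by (auto intro!: AF_comp[OF _ AM_tl])
 qed
 from D_Ex[OF this] have "D n (%e. EX t. sat ((!) (t # e)) (map_fm (%f. G f (tl (t # e))) ph))" .
 moreover have "case_nat t ((!) e) = (!) (t # e)" for t and e :: "'a list"
 by (rule ext) (simp split: nat.split)
 ultimately show ?case by simp
qed

text \<open>Quantifier elimination applied to the parameters themselves: when they vary as affine
  functions of \<open>xs\<close>, validity of the formula is a Presburger condition on
  \<open>xs\<close>.\<close>

lemma D_true:
 assumes "\<forall>f\<in>params ps. AF n (G f)"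
 shows "D n (%xs. ALL e. sat e (map_fm (%f. G f xs) ps))"
proof -
 obtain v where v: "fv ps <= {..<v}" using fv_bound[of ps] by blast
 have "AF (v + n) (%zs. G f (drop v zs))" if "f : params ps" for f
 using AF_comp[OF bspec[OF assms that], of "v + n" "drop v"] AM_drop[of v "v + n"] by simp
 hence "D (v + n) (%zs. sat ((!) zs) (map_fm (%f. G f (drop v zs)) ps))"
 using v by (intro D_sat_map) auto
 from D_not[OF D_Ex_list[OF D_not[OF this]]]
 have D: "D n (%e. ~ (EX ys. length ys = v & ~ sat ((!) (ys @ e)) (map_fm (%f. G f (drop v (ys @ e))) ps)))" .
 have "(~ (EX ys. length ys = v & ~ sat ((!) (ys @ xs)) (map_fm (%f. G f (drop v (ys @ xs))) ps))) =
 (ALL e. sat e (map_fm (%f. G f xs) ps))" for xs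
 proof -
 have 1: "sat ((!) (ys @ xs)) (map_fm (%f. G f (drop v (ys @ xs))) ps) = sat ((!) ys) (map_fm (%f. G f xs) ps)"
 if "length ys = v" for ys
 proof -
 have "drop v (ys @ xs) = xs" using that by simp
 moreover have "sat ((!) (ys @ xs)) (map_fm (%f. G f xs) ps) = sat ((!) ys) (map_fm (%f. G f xs) ps)"
 by (rule sat_fv) (use v that in \<open>auto simp: nth_append dest!: subsetD\<close>)
 ultimately show ?thesis by (simp only:)
 qed
 have 2: "sat e (map_fm (%f. G f xs) ps) = sat ((!) (map e [0..<v])) (map_fm (%f. G f xs) ps)" for e
 by (rule sat_list) (use v in simp)
 have "(ALL e. sat e (map_fm (%f. G f xs) ps)) \<longleftrightarrow> (ALL ys. length ys = v --> sat ((!) ys) (map_fm (%f. G f xs) ps))"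
 proof
 assume *: "ALL ys. length ys = v --> sat ((!) ys) (map_fm (%f. G f xs) ps)"
 show "ALL e. sat e (map_fm (%f. G f xs) ps)"
 proof
 show "sat e (map_fm (%f. G f xs) ps)" for e using spec[OF *, of "map e [0..<v]"] unfolding 2[of e] by simp
 qed
 qed blast
 thus ?thesis using 1 by blast
 qed
 thus ?thesis using D by (simp only:)
qed

text \<open>A literal with integral constants does not change under a suitable integral translation of
 independent arguments: a combination of them which is not an integer is not comparable to one.\<close>

lemma LT_shift:
 assumes A: "\<forall>c\<in>A. EX r. c = r *. one" and l: "LT n l"
 shows "\<exists>M>0. \<forall>(xs :: 'a list) M' e. length xs = n --> (ALL r c. (\<Sum>i<n. r i *. xs ! i) = c *. one --> (\<forall>i<n. r i = 0)) --> M dvd M' -->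
 l (map (%i. xs ! i + (M' * e i) *. one) [0..<n]) = l xs"
proof -
 obtain f where f: "AF n f" "l = (%xs. 0 <= f xs) | (\<exists>M>0. l = (%xs. mdvd M (f xs)))" using l unfolding LT_def by blast
 obtain k c0 where k: "c0 : A" "ALL xs. length xs = n --> f xs = c0 + (\<Sum>i<n. k i *. xs ! i)" using f(1) unfolding AF_def by blast
 obtain c where c: "c0 = c *. one" using bspec[OF A k(1)] by blast
 have shift: "f (map (%i. xs ! i + (M' * e i) *. one) [0..<n]) = f xs + (M' * (\<Sum>i<n. k i * e i)) *. one"
 if "length xs = n" for xs :: "'a list" and M' e
 proof -
 have "f (map (%i. xs ! i + (M' * e i) *. one) [0..<n]) = c0 + (\<Sum>i<n. k i *. xs ! i + (k i * (M' * e i)) *. one)"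
 using k(2) by (simp add: smul_add_right smul_smul)
 also have "(\<Sum>i<n. k i * (M' * e i)) = M' * (\<Sum>i<n. k i * e i)" by (simp add: sum_distrib_left mult.left_commute)
 hence "c0 + (\<Sum>i<n. k i *. xs ! i + (k i * (M' * e i)) *. one) = f xs + (M' * (\<Sum>i<n. k i * e i)) *. one"
 using k(2) that by (simp add: sum.distrib smul_sum_left[symmetric])
 finally show ?thesis .
 qed
 from f(2) show ?thesis
 proof (elim disjE exE conjE)
 assume le: "l = (%xs. 0 <= f xs)"
 show ?thesis
 proof (intro exI[of _ 1] conjI allI impI)
 fix xs :: "'a list" and M' e
 assume xs: "length xs = n" and ind: "ALL r c. (\<Sum>i<n. r i *. xs ! i) = c *. one --> (\<forall>i<n. r i = 0)"
 let ?m = "M' * (\<Sum>i<n. k i * e i)"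
 show "l (map (%i. xs ! i + (M' * e i) *. one) [0..<n]) = l xs"
 proof (cases "\<forall>i<n. k i = 0")
 case True
 hence "(\<Sum>i<n. k i * e i) = 0" by simp
 hence "f (map (%i. xs ! i + (M' * e i) *. one) [0..<n]) = f xs" unfolding shift[OF xs] by simp
 thus ?thesis unfolding le by simp
 next
 case False
 have no: "f xs ~= r *. one" for r
 proof
 assume "f xs = r *. one"
 hence "(\<Sum>i<n. k i *. xs ! i) = (r - c) *. one" using k(2) xs unfolding c by (simp add: smul_diff_left algebra_simps)
 thus False using ind False by blast
 qed
 have no1: "~ (0 <= x & x < r *. one)" if "!!r. x ~= r *. one" for x r
 using bounded_multiple_of_one[of x r] that by blast
 have a: "~ (0 <= f xs & f xs < (- ?m) *. one)" by (rule no1) (rule no)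
 have b: "~ (0 <= f xs + ?m *. one & f xs + ?m *. one < ?m *. one)"
 proof (rule no1)
 show "f xs + ?m *. one ~= r *. one" for r
 using no[of "r - ?m"] by (simp add: smul_diff_left) (metis add_diff_cancel_right')
 qed
 have "f xs < (- ?m) *. one \<longleftrightarrow> f xs + ?m *. one < 0"
 using less_diff_eq[of "f xs" 0 "?m *. one"] by simp
 thus ?thesis using a b unfolding le shift[OF xs] by (auto simp: not_less not_le)
 qed
 qed simp
 next
 fix M :: int assume M: "0 < M" and l: "l = (%xs. mdvd M (f xs))"
 show ?thesis
 proof (intro exI[of _ M] conjI allI impI)
 fix xs :: "'a list" and M' e
 assume xs: "length xs = n" and M': "M dvd M'"
 obtain q where q: "M' = M * q" using M' by (elim dvdE)
 have "mdvd M ((M' * (\<Sum>i<n. k i * e i)) *. one)"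
 unfolding q mult.assoc smul_smul[symmetric] by (rule mdvd_smul_self)
 thus "l (map (%i. xs ! i + (M' * e i) *. one) [0..<n]) = l xs"
 unfolding l shift[OF xs] by (intro mdvd_cong) simp
 qed (rule M)
 qed
qed

text \<open>Only finitely many literals are involved, and the product of the integers belonging to
  them serves as a common \<open>M\<close>.\<close>

lemma D_shift:
 assumes A: "\<forall>c\<in>A. EX r. c = r *. one" and P: "D n P"
 shows "\<exists>M>0. \<forall>(xs :: 'a list) e. length xs = n --> (ALL r c. (\<Sum>i<n. r i *. xs ! i) = c *. one --> (\<forall>i<n. r i = 0)) -->
 P xs --> P (map (%i. xs ! i + (M * e i) *. one) [0..<n])"
proof -
 let ?ind = "%xs :: 'a list. ALL r c. (\<Sum>i<n. r i *. xs ! i) = c *. one --> (\<forall>i<n. r i = 0)"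
 let ?sh = "%(xs :: 'a list) (M :: int) e. map (%i. xs ! i + (M * e i) *. one) [0..<n]"
 obtain L where L: "finite L" "\<forall>l\<in>L. LT n l"
 "!!xs ys. length xs = n ==> length ys = n ==> \<forall>l\<in>L. l xs = l ys ==> P xs = P ys" using D_E[OF P] by metis
 have "\<forall>l\<in>L. \<exists>M>0. \<forall>(xs :: 'a list) M' e. length xs = n --> ?ind xs --> M dvd M' --> l (?sh xs M' e) = l xs"
 using LT_shift[OF A] L(2) by blast
 then obtain Mf where Mf: "\<forall>l\<in>L. Mf l > 0 & (\<forall>(xs :: 'a list) M' e. length xs = n --> ?ind xs --> Mf l dvd M' --> l (?sh xs M' e) = l xs)"
 by (rule bchoice[THEN exE])
 let ?M = "\<Prod>l\<in>L. Mf l"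
 have dvd: "Mf l dvd ?M" if "l : L" for l using L(1) that by (rule dvd_prodI)
 show ?thesis
 proof (intro exI[of _ ?M] conjI allI impI)
 show "0 < ?M" using Mf by (intro prod_pos) blast
 fix xs :: "'a list" and e assume xs: "length xs = n" "?ind xs" "P xs"
 have "l xs = l (?sh xs ?M e)" if l: "l : L" for l
 using bspec[OF Mf l] xs(1,2) dvd[OF l] by blast
 hence "\<forall>l\<in>L. l xs = l (?sh xs ?M e)" by blast
 hence "P xs = P (?sh xs ?M e)" using xs(1) by (intro L(3)) simp_all
 thus "P (?sh xs ?M e)" using xs(3) by simp
 qed
qed

end

section \<open>Elementary embeddings, and numerical values of polynomials\<close>

lemma
 assumes "elementary_embedding h"
 shows elementary_add: "h (a + b) = h a + h b" and elementary_zero: "h 0 = 0"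
 and elementary_less: "h a < h b \<longleftrightarrow> a < b"
proof -
 have el: "sat e ph = sat (h o e) (map_fm h ph)" for e ph using assms unfolding elementary_embedding_def by blast
 show "h (a + b) = h a + h b"
 using el[of "case_nat (a + b) (case_nat a (%_. b))" "Eq (Var 0) (Add (Var 1) (Var 2))"] by (simp add: numeral_2_eq_2)
 show "h 0 = 0" using el[of "%_. 0" "Eq (Var 0) Zero"] by simp
 show "h a < h b \<longleftrightarrow> a < b" using el[of "case_nat a (%_. b)" "Less (Var 0) (Var 1)"] by simp
qed

lemma elementary_uminus: assumes "elementary_embedding h" shows "h (- a) = - h a"
 using elementary_add[OF assms, of a "- a"] elementary_zero[OF assms] by (simp add: eq_neg_iff_add_eq_0 add.commute)

lemma elementary_smul: assumes "elementary_embedding h" shows "h (k *. a) = k *. h a"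
proof -
 have nat: "h (int n *. a) = int n *. h a" for n
 by (induction n) (simp_all add: elementary_zero[OF assms] elementary_add[OF assms] smul_add_left)
 show ?thesis
 proof (cases k)
 case (nonneg n)
 thus ?thesis using nat by simp
 next
 case (neg n)
 show ?thesis unfolding neg smul_minus_left elementary_uminus[OF assms] nat by (rule HOL.refl)
 qed
qed

definition evl :: "('g => nat) => 'g sym_poly => nat" where
 "evl al p = (\<Sum>m\<in>#Abs_multiset (lookup p). \<Prod>g\<in>#m. al g)"

lemma evl_poly_of: "evl al (poly_of Q) = (\<Sum>m\<in>#Q. \<Prod>g\<in>#m. al g)"
proof -
 have "lookup (poly_of Q) = count Q" by (rule ext) (rule lookup_poly_of)
 thus ?thesis by (simp add: evl_def count_inverse)
qed

lemma evl_add: "evl al (p + q) = evl al p + evl al q"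
proof -
 obtain Q Q' where "p = poly_of Q" "q = poly_of Q'" using poly_of_surj by metis
 thus ?thesis by (simp add: poly_of_add[symmetric] evl_poly_of)
qed

lemma evl_mult: "evl al (p * q) = evl al p * evl al q"
proof -
 obtain Q Q' where pq: "p = poly_of Q" "q = poly_of Q'" using poly_of_surj by metis
 have "(\<Sum>x\<in>#image_mset ((+) m) Q'. \<Prod>g\<in>#x. al g) = (\<Prod>g\<in>#m. al g) * (\<Sum>x\<in>#Q'. \<Prod>g\<in>#x. al g)" for m
 by (induction Q') (simp_all add: algebra_simps)
 hence "(\<Sum>x\<in>#(\<Sum>m\<in>#Q. image_mset ((+) m) Q'). \<Prod>g\<in>#x. al g) =
 (\<Sum>m\<in>#Q. \<Prod>g\<in>#m. al g) * (\<Sum>x\<in>#Q'. \<Prod>g\<in>#x. al g)"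
 by (induction Q) (simp_all add: algebra_simps)
 thus ?thesis unfolding pq poly_of_mult evl_poly_of .
qed

lemma evl_0 [simp]: "evl al 0 = 0" and evl_1 [simp]: "evl al 1 = 1" and evl_symb [simp]: "evl al (symb g) = al g"
 unfolding poly_of_empty[symmetric] poly_of_unit[symmetric] symb_poly_of evl_poly_of by simp_all

lemma evl_of_nat: "evl al (of_nat n) = n"
 by (induction n) (simp_all add: evl_add)

lemma evl_sum: "evl al (\<Sum>i\<in>I. q i) = (\<Sum>i\<in>I. evl al (q i))"
 by (induction I rule: infinite_finite_induct) (simp_all add: evl_add)

lemma int_evl:
 assumes "\<forall>m\<in>#Q. \<forall>b\<in>#m. int (al b) = h b"
 shows "int (\<Sum>m\<in>#Q. \<Prod>b\<in>#m. al b) = (\<Sum>m\<in>#Q. \<Prod>b\<in>#m. h b)"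
 using assms
proof (induction Q)
 case (add m Q)
 have "\<forall>b\<in>#m. int (al b) = h b" using add.prems by simp
 hence "int (\<Prod>b\<in>#m. al b) = (\<Prod>b\<in>#m. h b)" by (induction m) simp_all
 thus ?case using add by simp
qed simp

lemma sym_polys_of_nat: "of_nat n : sym_polys G"
 by (induction n) (simp_all add: sym_polys_add)

lemma sym_polys_sum: "(!!i. i : I ==> q i : sym_polys G) ==> (\<Sum>i\<in>I. q i) : sym_polys G"
 by (induction I rule: infinite_finite_induct) (simp_all add: sym_polys_add)

section \<open>Injectivity on bounded sets\<close>

context group_extension
begin

abbreviation emb :: "nat => 'z extended" where "emb \<equiv> %n. Fin (\<iota> (int n))"

lemma Fin_in_N: "0 <= a ==> Fin a : N"
 by (simp add: N_def)

lemma sym_eq_multiple: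
 assumes "0 <= a" "sym_eq N emb (symb (Fin a)) q"
 shows "sym_eq N emb (symb (Fin (int n *. a))) (of_nat n * q)"
proof (induction n)
 case 0
 show ?case using sym_eq.symb_zero[of N emb] by (simp add: zero_extended_def)
next
 case (Suc n)
 have eq: "Fin (int (Suc n) *. a) = Fin (int n *. a) + Fin a" by (simp add: smul_add_left add.commute)
 have eq': "of_nat (Suc n) * q = of_nat n * q + q" by (simp add: algebra_simps)
 have "sym_eq N emb (symb (Fin (int n *. a)) + symb (Fin a)) (symb (Fin (int n *. a) + Fin a))"
 using assms(1) by (intro sym_eq.symb_add Fin_in_N smul_nonneg) simp_all
 from sym_eq.trans[OF sym_eq.sym[OF this] sym_eq.add[OF Suc assms(2)]] show ?case unfolding eq eq' .
qed

text \<open>Additivity makes the symbol of a natural combination the same combination of symbols;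
  the generator at index 0 is the unit and becomes the number 1.\<close>

lemma sym_eq_combination:
 assumes "finite I" "0 : I" "g 0 = \<iota> 1" "\<forall>i\<in>I. 0 <= g i" "J <= I"
 shows "sym_eq N emb (symb (Fin (\<Sum>i\<in>J. int (k i) *. g i))) (\<Sum>i\<in>J. of_nat (k i) * (if i = 0 then 1 else symb (Fin (g i))))"
 using finite_subset[OF assms(5,1)] assms(5)
proof (induction J rule: finite_induct)
 case empty
 show ?case using sym_eq.symb_zero[of N emb] by (simp add: zero_extended_def)
next
 case (insert i J)
 let ?q = "if i = 0 then 1 else symb (Fin (g i))"
 have gi: "0 <= g i" using insert.prems assms(4) by simp
 have "sym_eq N emb (symb (Fin (g i))) ?q"
 proof (cases "i = 0")
 case True
 thus ?thesis using sym_eq.symb_one[of N emb] assms(3) by simp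
 next
 case False
 thus ?thesis using gi by (simp add: sym_eq.refl sym_polys_symb Fin_in_N)
 qed
 from sym_eq_multiple[OF gi this, of "k i"]
 have 1: "sym_eq N emb (symb (Fin (int (k i) *. g i))) (of_nat (k i) * ?q)" .
 have 2: "sym_eq N emb (symb (Fin (\<Sum>i\<in>J. int (k i) *. g i))) (\<Sum>i\<in>J. of_nat (k i) * (if i = 0 then 1 else symb (Fin (g i))))"
 using insert by simp
 have "sym_eq N emb (symb (Fin (int (k i) *. g i)) + symb (Fin (\<Sum>i\<in>J. int (k i) *. g i)))
 (symb (Fin (int (k i) *. g i) + Fin (\<Sum>i\<in>J. int (k i) *. g i)))"
 using gi insert.prems assms(4) by (intro sym_eq.symb_add Fin_in_N smul_nonneg sum_nonneg) auto
 from sym_eq.trans[OF sym_eq.sym[OF this] sym_eq.add[OF 1 2]] show ?case using insert.hyps by simp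
qed

text \<open>A linear substitution of the basis for the generators in \<open>F\<close>. The last
  clause says that numerical evaluation is compatible with it, by which values of the original and
  of the rewritten polynomial are compared later.\<close>

lemma basis_polynomial:
 assumes I: "finite I" "0 : I" "g 0 = \<iota> 1" "\<forall>i\<in>I. 0 <= g i"
 and kn: "\<forall>f\<in>F. f = (\<Sum>i\<in>I. int (kn f i) *. g i)"
 and p: "p : sym_polys (Fin ` F)"
 shows "\<exists>p'\<in>sym_polys (Fin ` g ` (I - {0})). sym_eq N emb p p' &
 (ALL al al'. (\<forall>f\<in>F. al (Fin f) = kn f 0 + (\<Sum>i\<in>I - {0}. kn f i * al' (Fin (g i)))) --> evl al p = evl al' p')"
 using p
proof (induction rule: sym_polys_induct)
 case zero
 show ?case by (intro bexI[of _ 0]) (simp_all add: sym_eq.refl)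
next
 case one
 show ?case by (intro bexI[of _ 1]) (simp_all add: sym_eq.refl)
next
 case (add p q)
 let ?C = "%al al'. \<forall>f\<in>F. al (Fin f) = kn f 0 + (\<Sum>i\<in>I - {0}. kn f i * al' (Fin (g i)))"
 from add obtain p' q' where p': "p' : sym_polys (Fin ` g ` (I - {0}))" "sym_eq N emb p p'"
 "ALL al al'. ?C al al' --> evl al p = evl al' p'"
 and q': "q' : sym_polys (Fin ` g ` (I - {0}))" "sym_eq N emb q q'"
 "ALL al al'. ?C al al' --> evl al q = evl al' q'"
 by (elim bexE conjE)
 have "evl al (p + q) = evl al' (p' + q')" if "?C al al'" for al al'
 proof -
 have "evl al p = evl al' p'" "evl al q = evl al' q'" using p'(3) q'(3) that by blast+
 thus ?thesis by (simp add: evl_add)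
 qed
 thus ?case using sym_polys_add[OF p'(1) q'(1)] sym_eq.add[OF p'(2) q'(2)] by blast
next
 case (symb gg p)
 then obtain p' where p': "p' : sym_polys (Fin ` g ` (I - {0}))" "sym_eq N emb p p'"
 "ALL al al'. (\<forall>f\<in>F. al (Fin f) = kn f 0 + (\<Sum>i\<in>I - {0}. kn f i * al' (Fin (g i)))) --> evl al p = evl al' p'"
 by (elim bexE conjE)
 obtain f where f: "gg = Fin f" "f : F" using symb.hyps(1) by blast
 let ?q = "\<Sum>i\<in>I. of_nat (kn f i) * (if i = 0 then 1 else symb (Fin (g i)))"
 have q: "?q : sym_polys (Fin ` g ` (I - {0}))"
 by (intro sym_polys_sum sym_polys_mult sym_polys_of_nat) (auto intro!: sym_polys_symb)
 have eq: "sym_eq N emb (symb gg) ?q"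
 using sym_eq_combination[where k = "kn f", OF I subset_refl] unfolding bspec[OF kn f(2), symmetric] f(1) .
 have "evl al' ?q = kn f 0 + (\<Sum>i\<in>I - {0}. kn f i * al' (Fin (g i)))" for al'
 proof -
 have "evl al' ?q = (\<Sum>i\<in>I. kn f i * (if i = 0 then 1 else al' (Fin (g i))))"
 unfolding evl_sum evl_mult evl_of_nat by (intro sum.cong) auto
 also have "\<dots> = kn f 0 * 1 + (\<Sum>i\<in>I - {0}. kn f i * (if i = 0 then 1 else al' (Fin (g i))))"
 by (subst sum.remove[OF I(1,2)]) simp
 also have "(\<Sum>i\<in>I - {0}. kn f i * (if i = 0 then 1 else al' (Fin (g i)))) = (\<Sum>i\<in>I - {0}. kn f i * al' (Fin (g i)))"
 by (intro sum.cong) auto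
 finally show ?thesis by simp
 qed
 hence "evl al (symb gg * p) = evl al' (?q * p')"
 if "\<forall>f\<in>F. al (Fin f) = kn f 0 + (\<Sum>i\<in>I - {0}. kn f i * al' (Fin (g i)))" for al al'
 using p'(3) that f by (simp add: evl_mult)
 thus ?case using sym_polys_mult[OF q p'(1)] sym_eq.mult[OF eq p'(2)] by blast
qed

text \<open>Both polynomials are rewritten in basis elements independent over the integers. The
  valid formula that forces equal values stays valid when the basis elements other than the unit are
  translated by multiples of \<open>M\<close>. Specializing the translated parameters gives equal
  values of the rewritten polynomials on a grid, and so these polynomials coincide.\<close>

theorem bounded_injective:
 assumes "p : sym_polys N" "q : sym_polys N" "K_eq Z (ev v p) (ev v q)"
 shows "sym_eq N emb p q"
proof -
 interpret Z: zgroup_params "\<iota> 1" "range \<iota>" by (rule Z)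
 obtain Q Q' where Q: "p = poly_of Q" "\<forall>m\<in>#Q. set_mset m <= N" "q = poly_of Q'" "\<forall>m\<in>#Q'. set_mset m <= N"
 using assms(1,2) by (metis sym_polys_poly_of)
 from Ev_value_at[OF assms(3)[unfolded Q(1,3)] Q(2,4)] obtain ps where
 ps: "ALL e. sat e ps" "ALL sg. (ALL e. sat e (map_fm sg ps)) --> value_at sg Q = value_at sg Q'"
 unfolding Ev_def by (elim exE conjE)
 let ?V = "\<Union>m\<in>set_mset Q Un set_mset Q'. set_mset m"
 define F0 where "F0 = unfin ` ?V"
 have V: "?V <= N" using Q(2,4) by blast
 have F0: "finite F0" "\<forall>f\<in>F0. 0 <= f" unfolding F0_def using V by (auto simp: N_def)
 have "?V <= Fin ` F0"
 proof
 fix b assume b: "b : ?V"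
 then obtain a where "b = Fin a" using V by (auto simp: N_def)
 hence "b = Fin (unfin b)" by simp
 thus "b : Fin ` F0" using b unfolding F0_def by blast
 qed
 hence pq: "p : sym_polys (Fin ` F0)" "q : sym_polys (Fin ` F0)" unfolding Q(1,3) poly_of_in_sym_polys by blast+
 \<comment> \<open>Besides the generators in \<open>p\<close> and \<open>q\<close>, the absolute
   values of the parameters of \<open>ps\<close> are included, so that these too are integral
   combinations of the basis.\<close>
 define F where "F = F0 Un (%f. if 0 <= f then f else - f) ` params ps"
 have F: "finite F" "\<forall>f\<in>F. 0 <= f" unfolding F_def using F0 finite_params[of ps] by auto
 obtain I g where fr: "Z.frame I g" and FI: "F <= Z.cone I g" and ind: "ALL k. (\<Sum>i\<in>I. k i *. g i) = 0 --> (\<forall>i\<in>I. k i = 0)"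
 using Z.basis_exists[OF F] by (elim exE conjE)
 have I: "finite I" "0 : I" "g 0 = \<iota> 1" "\<forall>i\<in>I. 0 <= g i" using fr by (auto simp: Z.frame_def less_imp_le)
 have "\<forall>f\<in>F. \<exists>k :: nat => nat. f = (\<Sum>i\<in>I. int (k i) *. g i)" using FI unfolding Z.cone_def by blast
 then obtain kn :: "'z => nat => nat" where kn: "\<forall>f\<in>F. f = (\<Sum>i\<in>I. int (kn f i) *. g i)" by (rule bchoice[THEN exE])
 define k where "k f i = (if 0 <= f then int (kn f i) else - int (kn (- f) i))" for f i
 have kf: "f = (\<Sum>i\<in>I. k f i *. g i)" if "f : params ps" for f
 proof (cases "0 <= f")
 case True
 hence "f : F" unfolding F_def using that by force
 thus ?thesis using kn True unfolding k_def by simp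
 next
 case False
 hence "- f : F" unfolding F_def using that by force
 with kn have "- f = (\<Sum>i\<in>I. int (kn (- f) i) *. g i)" by (rule bspec)
 hence "f = - (\<Sum>i\<in>I. int (kn (- f) i) *. g i)" by (metis minus_minus)
 thus ?thesis using False unfolding k_def by (simp add: sum_negf)
 qed
 let ?J = "I - {0}"
 have kn0: "\<forall>f\<in>F0. f = (\<Sum>i\<in>I. int (kn f i) *. g i)" using kn unfolding F_def by blast
 from basis_polynomial[OF I kn0 pq(1)] obtain p' where p': "p' : sym_polys (Fin ` g ` ?J)" "sym_eq N emb p p'"
 "ALL al al'. (\<forall>f\<in>F0. al (Fin f) = kn f 0 + (\<Sum>i\<in>?J. kn f i * al' (Fin (g i)))) --> evl al p = evl al' p'"
 by (elim bexE conjE)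
 from basis_polynomial[OF I kn0 pq(2)] obtain q' where q': "q' : sym_polys (Fin ` g ` ?J)" "sym_eq N emb q q'"
 "ALL al al'. (\<forall>f\<in>F0. al (Fin f) = kn f 0 + (\<Sum>i\<in>?J. kn f i * al' (Fin (g i)))) --> evl al q = evl al' q'"
 by (elim bexE conjE)
 obtain R R' where R: "p' = poly_of R" "\<forall>m\<in>#R. set_mset m <= Fin ` g ` ?J" "q' = poly_of R'" "\<forall>m\<in>#R'. set_mset m <= Fin ` g ` ?J"
 using p'(1) q'(1) by (metis sym_polys_poly_of)
 obtain w :: "'z extended => nat" and L where grid: "\<forall>(y :: 'z extended => int) M. M ~= 0 -->
 (\<forall>x\<in>{..L}. (\<Sum>m\<in>#R. \<Prod>b\<in>#m. y b + M * int x ^ w b) = (\<Sum>m\<in>#R'. \<Prod>b\<in>#m. y b + M * int x ^ w b)) --> R = R'"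
 using grid_identity[of R R'] by (elim exE)
 obtain il where il: "set il = ?J" "distinct il" using finite_distinct_list[of ?J] I(1) by auto
 define n where "n = length il"
 have bij: "bij_betw ((!) il) {..<n} ?J" unfolding n_def using bij_betw_nth[OF il(2) HOL.refl il(1)[symmetric]] .
 have reidx: "(\<Sum>l<n. h (il ! l)) = (\<Sum>i\<in>?J. h i)" for h :: "nat => 'z" by (rule sum.reindex_bij_betw[OF bij])
 \<comment> \<open>The parameter \<open>f\<close> as an affine function of the basis elements other
   than the unit; at the basis itself it returns \<open>f\<close>.\<close>
 define G where "G f xs = k f 0 *. \<iota> 1 + (\<Sum>l<n. k f (il ! l) *. xs ! l)" for f xs
 let ?P = "%xs. ALL e. sat e (map_fm (%f. G f xs) ps)"
 have DP: "Z.D n ?P" by (rule Z.D_true) (auto simp: G_def intro!: Z.AF_intros)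
 have A: "\<forall>c\<in>range \<iota>. EX r. c = r *. \<iota> 1"
 proof
 fix c assume "c : range \<iota>"
 then obtain r where "c = \<iota> r" by (rule rangeE)
 hence "c = r *. \<iota> 1" using elementary_smul[OF \<iota>, of r 1] by simp
 thus "EX r. c = r *. \<iota> 1" by (rule exI)
 qed
 from Z.D_shift[OF A DP] obtain M where M: "0 < M"
 "ALL xs e. length xs = n --> (ALL r c. (\<Sum>i<n. r i *. xs ! i) = c *. \<iota> 1 --> (\<forall>i<n. r i = 0)) -->
 ?P xs --> ?P (map (%i. xs ! i + (M * e i) *. \<iota> 1) [0..<n])" by (elim exE conjE)
 let ?bs = "map g il"
 have len: "length ?bs = n" by (simp add: n_def)
 have nth: "?bs ! l = g (il ! l)" if "l < n" for l using that by (simp add: n_def)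
 have ind': "\<forall>l<n. r l = 0" if eq: "(\<Sum>l<n. r l *. ?bs ! l) = c *. \<iota> 1" for r c
 proof -
 let ?inv = "the_inv_into {..<n} ((!) il)"
 define k' where "k' i = (if i = 0 then - c else r (?inv i))" for i
 have inv: "?inv (il ! l) = l" if "l < n" for l using bij that by (auto simp: bij_betw_def the_inv_into_f_f)
 have ilJ: "il ! l : ?J" if "l < n" for l using bij that by (auto simp: bij_betw_def)
 hence k': "k' (il ! l) = r l" if "l < n" for l
 proof -
 have "il ! l ~= 0" using ilJ[OF that] by simp
 thus ?thesis using inv[OF that] by (simp add: k'_def)
 qed
 have "(\<Sum>i\<in>I. k' i *. g i) = k' 0 *. g 0 + (\<Sum>i\<in>?J. k' i *. g i)" by (rule sum.remove[OF I(1,2)])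
 also have "(\<Sum>i\<in>?J. k' i *. g i) = (\<Sum>l<n. k' (il ! l) *. g (il ! l))" by (rule reidx[symmetric])
 also have "\<dots> = (\<Sum>l<n. r l *. ?bs ! l)" by (intro sum.cong) (simp_all add: k' nth)
 finally have "(\<Sum>i\<in>I. k' i *. g i) = 0" unfolding eq I(3) by (simp add: k'_def)
 hence "\<forall>i\<in>I. k' i = 0" using ind by blast
 thus ?thesis using k' ilJ by (metis DiffD1)
 qed
 \<comment> \<open>Translating the basis elements changes only the constant coefficient of a
   parameter, by \<open>M\<close> times an integer depending on \<open>x\<close>.\<close>
 define c where "c x f i = (if i = 0 then k f 0 + M * (\<Sum>i\<in>?J. k f i * int x ^ w (Fin (g i))) else k f i)" for x :: nat and f i
 define ta where "ta x f = (\<Sum>i\<in>I. c x f i *. g i)" for x f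
 have Gsh: "G f (map (%l. ?bs ! l + (M * int x ^ w (Fin (g (il ! l)))) *. \<iota> 1) [0..<n]) = ta x f" for f x
 proof -
 have "(\<Sum>l<n. k f (il ! l) *. (map (%l. ?bs ! l + (M * int x ^ w (Fin (g (il ! l)))) *. \<iota> 1) [0..<n]) ! l) =
 (\<Sum>l<n. k f (il ! l) *. (g (il ! l) + (M * int x ^ w (Fin (g (il ! l)))) *. \<iota> 1))" by (intro sum.cong) (simp_all add: nth)
 also have "\<dots> = (\<Sum>i\<in>?J. k f i *. (g i + (M * int x ^ w (Fin (g i))) *. \<iota> 1))"
 by (rule reidx[of "%i. k f i *. (g i + (M * int x ^ w (Fin (g i))) *. \<iota> 1)"])
 also have "\<dots> = (\<Sum>i\<in>?J. k f i *. g i + (M * (k f i * int x ^ w (Fin (g i)))) *. \<iota> 1)"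
 by (intro sum.cong) (simp_all add: smul_add_right smul_smul mult.left_commute)
 also have "\<dots> = (\<Sum>i\<in>?J. k f i *. g i) + (M * (\<Sum>i\<in>?J. k f i * int x ^ w (Fin (g i)))) *. \<iota> 1"
 unfolding sum.distrib sum_distrib_left smul_sum_left ..
 finally have 1: "G f (map (%l. ?bs ! l + (M * int x ^ w (Fin (g (il ! l)))) *. \<iota> 1) [0..<n]) =
 k f 0 *. \<iota> 1 + ((\<Sum>i\<in>?J. k f i *. g i) + (M * (\<Sum>i\<in>?J. k f i * int x ^ w (Fin (g i)))) *. \<iota> 1)" unfolding G_def by simp
 have "(\<Sum>i\<in>?J. c x f i *. g i) = (\<Sum>i\<in>?J. k f i *. g i)" by (intro sum.cong) (auto simp: c_def)
 hence "ta x f = c x f 0 *. g 0 + (\<Sum>i\<in>?J. k f i *. g i)" unfolding ta_def sum.remove[OF I(1,2)] by simp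
 thus ?thesis unfolding 1 I(3) by (simp add: c_def smul_add_left add_ac)
 qed
 have "G f ?bs = f" if "f : params ps" for f
 proof -
 have "(\<Sum>l<n. k f (il ! l) *. ?bs ! l) = (\<Sum>l<n. k f (il ! l) *. g (il ! l))" by (intro sum.cong) (simp_all add: nth)
 hence "G f ?bs = k f 0 *. g 0 + (\<Sum>i\<in>?J. k f i *. g i)" unfolding G_def I(3) using reidx[of "%i. k f i *. g i"] by simp
 also have "\<dots> = (\<Sum>i\<in>I. k f i *. g i)" by (rule sum.remove[OF I(1,2), symmetric])
 finally show ?thesis using kf[OF that] by simp
 qed
 hence "map_fm (%f. G f ?bs) ps = map_fm id ps" by (intro fm.map_cong0) simp
 hence "?P ?bs" using ps(1) by (simp add: fm.map_id)
 hence "?P (map (%l. ?bs ! l + (M * e l) *. \<iota> 1) [0..<n])" for e using M(2) len ind' by blast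
 from this[of "%l. int x ^ w (Fin (g (il ! l)))" for x] have ta: "ALL e. sat e (map_fm (ta x) ps)" for x unfolding Gsh by simp
 have ea: "Ev (%sg. value_at (sg o ta x) Q = value_at (sg o ta x) Q')" for x
 proof (rule Ev_I)
 show "sat e (map_fm (ta x) ps)" for e using ta by blast
 show "value_at (sg o ta x) Q = value_at (sg o ta x) Q'" if "!!e. sat e (map_fm sg (map_fm (ta x) ps))" for sg
 using ps(2) that unfolding fm.map_comp by blast
 qed
 have eb: "Ev (%sg. \<forall>f\<in>F0. sg (ta x f) = (\<Sum>i\<in>I. c x f i * sg (g i)))" for x
 unfolding ta_def by (rule Ev_Ball[OF F0(1)]) (rule Ev_sum[OF I(1)])
 \<comment> \<open>One specialization has to serve all \<open>x\<close> in the finite range at once,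
   since the grid identity refers to a single \<open>y\<close>.\<close>
 have e1: "Ev (%sg. \<forall>x\<in>{..L}. value_at (sg o ta x) Q = value_at (sg o ta x) Q' &
 (\<forall>f\<in>F0. sg (ta x f) = (\<Sum>i\<in>I. c x f i * sg (g i))))" by (rule Ev_Ball[OF finite_atMost Ev_conj[OF ea eb]])
 have e2: "Ev (%sg. \<forall>i\<in>I. 0 <= sg (g i))" by (rule Ev_Ball[OF I(1)]) (use I(4) Ev_nonneg in blast)
 have e3: "Ev (%sg. sg (\<iota> 1) = 1)" by (rule Ev_one) (rule Z.zgroup_axioms)
 from Ev_ex[OF \<iota> Ev_conj[OF e1 Ev_conj[OF e2 e3]]] obtain sg where
 s1: "\<forall>x\<in>{..L}. value_at (sg o ta x) Q = value_at (sg o ta x) Q' &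
 (\<forall>f\<in>F0. sg (ta x f) = (\<Sum>i\<in>I. c x f i * sg (g i)))"
 and s2: "\<forall>i\<in>I. 0 <= sg (g i)" and s3: "sg (\<iota> 1) = 1" by (elim exE conjE)
 have sg1: "value_at (sg o ta x) Q = value_at (sg o ta x) Q'" if "x : {..L}" for x
 by (rule conjunct1[OF bspec[OF s1 that]])
 have sg2: "sg (ta x f) = (\<Sum>i\<in>I. c x f i * sg (g i))" if "x : {..L}" "f : F0" for x f
 by (rule bspec[OF conjunct2[OF bspec[OF s1 that(1)]] that(2)])
 have sg3: "0 <= sg (g i)" if "i : I" for i by (rule bspec[OF s2 that])
 \<comment> \<open>The grid is based at \<open>y b = sg (unfin b)\<close>, the specialized basis
   element; the summand with \<open>M\<close> comes from its translation.\<close>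
 have "R = R'"
 proof (rule grid[rule_format, of M "%b. sg (unfin b)"])
 show "M ~= 0" using M(1) by simp
 fix x assume x: "x : {..L}"
 define al where "al b = nat ((sg o ta x) (unfin b))" for b
 define al' where "al' b = nat (sg (unfin b) + M * int x ^ w b)" for b
 have al': "int (al' b) = sg (unfin b) + M * int x ^ w b" if "b : Fin ` g ` ?J" for b
 using that sg3 M(1) unfolding al'_def by (auto intro!: add_nonneg_nonneg)
 have "al (Fin f) = kn f 0 + (\<Sum>i\<in>?J. kn f i * al' (Fin (g i)))" if f: "f : F0" for f
 proof -
 have kfi: "k f i = int (kn f i)" for i using F0(2) f by (simp add: k_def)
 have "(sg o ta x) f = c x f 0 * sg (g 0) + (\<Sum>i\<in>?J. c x f i * sg (g i))"
 using sg2[OF x f] sum.remove[OF I(1,2), of "%i. c x f i * sg (g i)"] by simp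
 also have "(\<Sum>i\<in>?J. c x f i * sg (g i)) = (\<Sum>i\<in>?J. k f i * sg (g i))" by (intro sum.cong) (auto simp: c_def)
 also have "c x f 0 * sg (g 0) = k f 0 + (\<Sum>i\<in>?J. k f i * (M * int x ^ w (Fin (g i))))"
 unfolding c_def I(3) s3 by (simp add: sum_distrib_left mult.left_commute)
 finally have "(sg o ta x) f = k f 0 + (\<Sum>i\<in>?J. k f i * (sg (g i) + M * int x ^ w (Fin (g i))))"
 by (simp add: distrib_left sum.distrib)
 also have "(\<Sum>i\<in>?J. k f i * (sg (g i) + M * int x ^ w (Fin (g i)))) = (\<Sum>i\<in>?J. int (kn f i * al' (Fin (g i))))"
 by (intro sum.cong) (simp_all add: kfi al')
 finally have "(sg o ta x) f = int (kn f 0 + (\<Sum>i\<in>?J. kn f i * al' (Fin (g i))))" by (simp add: kfi)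
 thus ?thesis unfolding al_def unfin.simps by (simp only: nat_int)
 qed
 hence "evl al p = evl al' p'" "evl al q = evl al' q'" using p'(3) q'(3) by blast+
 moreover have "evl al p = evl al q" using sg1[OF x] unfolding Q(1,3) evl_poly_of value_at_def al_def .
 ultimately have "int (evl al' p') = int (evl al' q')" by simp
 moreover have "int (evl al' p') = (\<Sum>m\<in>#R. \<Prod>b\<in>#m. sg (unfin b) + M * int x ^ w b)"
 unfolding R(1) evl_poly_of by (rule int_evl) (use R(2) al' in blast)
 moreover have "int (evl al' q') = (\<Sum>m\<in>#R'. \<Prod>b\<in>#m. sg (unfin b) + M * int x ^ w b)"
 unfolding R(3) evl_poly_of by (rule int_evl) (use R(4) al' in blast)
 ultimately show "(\<Sum>m\<in>#R. \<Prod>b\<in>#m. sg (unfin b) + M * int x ^ w b) = (\<Sum>m\<in>#R'. \<Prod>b\<in>#m. sg (unfin b) + M * int x ^ w b)"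
 by simp
 qed
 hence "p' = q'" unfolding R(1,3) by simp
 with p'(2) q'(2) show ?thesis using sym_eq.trans sym_eq.sym by metis
qed

end

section \<open>Refinement of equalities of classes\<close>

context zgroup_params
begin

lemma definable_in_sub: "definable A a ==> a <= X ==> definable_in A n X ==> definable_in A n a"
proof (cases "a = {}")
 case False
 assume *: "definable A a" "a <= X" "definable_in A n X"
 from False obtain xs where xs: "xs : a" by blast
 obtain l where l: "definable_in A l a" using *(1) unfolding definable_def by blast
 have "l = n" by (rule definable_in_unique[OF l *(3) xs]) (use xs *(2) in blast)
 thus ?thesis using l by simp
qed (use definable_in_empty in simp)

lemma definable_bij_restrict:
 assumes f: "bij_betw f X Y" "definable A {xs @ f xs | xs. xs : X}" and X: "definable A X" and Y: "definable A Y"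
 and a: "definable A a" "a <= X"
 shows "definable A (f ` a) & K_eq A {#a#} {#f ` a#}"
proof (cases "a = {}")
 case True
 thus ?thesis using definable_empty by (simp add: K_eq.refl)
next
 case False
 then obtain z where z: "z : a" by blast
 obtain n n' where n: "definable_in A n X" "definable_in A n' Y" using X Y unfolding definable_def by blast
 have len: "length xs = n & length (f xs) = n' & f xs : Y" if "xs : X" for xs
 using that definable_in_length[OF n(1)] definable_in_length[OF n(2)] f(1) by (auto simp: bij_betw_def)
 let ?G = "{xs @ f xs | xs. xs : X}"
 obtain l where l: "definable_in A l ?G" using f(2) unfolding definable_def by blast
 have "z @ f z : ?G" using z a(2) by blast
 hence "length (z @ f z) = l" by (rule definable_in_length[OF l])
 hence G: "definable_in A (n + n') ?G" using l len[of z] z a(2) by auto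
 have "?G Int set_prod a Y = {xs @ f xs | xs. xs : a}"
 proof (intro subset_antisym subsetI)
 fix u assume u: "u : ?G Int set_prod a Y"
 then obtain xs where xs: "u = xs @ f xs" "xs : X" by blast
 from u obtain xs' ys where xs': "u = xs' @ ys" "xs' : a" by (auto elim: set_prodE)
 have "length xs' = length xs" using len[OF xs(2)] len[of xs'] xs'(2) a(2) by auto
 hence "xs = xs'" using xs(1) xs'(1) by simp
 thus "u : {xs @ f xs | xs. xs : a}" using xs(1) xs'(2) by blast
 next
 fix u assume "u : {xs @ f xs | xs. xs : a}"
 then obtain xs where xs: "u = xs @ f xs" "xs : a" by blast
 thus "u : ?G Int set_prod a Y" using a(2) len[of xs] set_prodI[of xs a "f xs" Y] by blast
 qed
 hence Ga: "definable_in A (n + n') {xs @ f xs | xs. xs : a}"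
 using definable_in_Int[OF G definable_in_set_prod[OF definable_in_sub[OF a n(1)] n(2)]] by simp
 have "drop n ` {xs @ f xs | xs. xs : a} = f ` a"
 proof -
 have "drop n (xs @ f xs) = f xs" if "xs : a" for xs using len[of xs] that a(2) by auto
 hence "(%xs. drop n (xs @ f xs)) ` a = f ` a" by (intro image_cong HOL.refl)
 thus ?thesis by (simp only: Setcompr_eq_image image_image)
 qed
 moreover have "definable_in A n' (drop n ` {xs @ f xs | xs. xs : a})"
 using definable_in_image[OF Ga AM_drop[of n "n + n'"]] by simp
 ultimately have fa: "definable A (f ` a)" using definable_inI by simp
 have "bij_betw f a (f ` a)" using f(1) a(2) by (meson bij_betw_subset bij_betw_imp_inj_on inj_on_imp_bij_betw inj_on_subset)
 hence "definable_bij A a (f ` a)" unfolding definable_bij_def using definable_inI[OF Ga] by blast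
 thus ?thesis using fa a(1) K_eq.bij by blast
qed

lemma definable_bij_sym:
 assumes f: "bij_betw f X Y" "definable A {xs @ f xs | xs. xs : X}" and X: "definable A X" and Y: "definable A Y"
 shows "definable A {ys @ inv_into X f ys | ys. ys : Y}"
proof (cases "X = {}")
 case True
 thus ?thesis using f(1) definable_empty by (simp add: bij_betw_def)
next
 case False
 then obtain z where z: "z : X" by blast
 obtain n where n: "definable_in A n X" using X unfolding definable_def by blast
 obtain n' where n': "definable_in A n' Y" using Y unfolding definable_def by blast
 have len: "length xs = n & length (f xs) = n'" if "xs : X" for xs
 using that definable_in_length[OF n] definable_in_length[OF n'] f(1) by (auto simp: bij_betw_def)
 let ?G = "{xs @ f xs | xs. xs : X}"
 obtain l where l: "definable_in A l ?G" using f(2) unfolding definable_def by blast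
 have "z @ f z : ?G" using z by blast
 hence "length (z @ f z) = l" by (rule definable_in_length[OF l])
 hence G: "definable_in A (n + n') ?G" using l len[OF z] by auto
 let ?S = "%zs. drop n zs @ take n zs"
 have "AM (n + n') (n' + n) ?S"
 using AM_append[OF AM_drop[of n "n + n'"] AM_take[of n "n + n'"]] by simp
 from definable_in_image[OF G this] have "definable A (?S ` ?G)" by (rule definable_inI)
 moreover have "?S ` ?G = {ys @ inv_into X f ys | ys. ys : Y}"
 proof -
 have S: "?S (xs @ f xs) = f xs @ inv_into X f (f xs)" if "xs : X" for xs
 using len[OF that] f(1) that by (simp add: bij_betw_def)
 have "?S ` ?G = (%xs. ?S (xs @ f xs)) ` X" by (simp only: Setcompr_eq_image image_image)
 also have "\<dots> = (%xs. f xs @ inv_into X f (f xs)) ` X" by (rule image_cong[OF HOL.refl S])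
 also have "\<dots> = (%ys. ys @ inv_into X f ys) ` (f ` X)" by (simp only: image_image)
 also have "f ` X = Y" using f(1) by (simp add: bij_betw_def)
 finally show ?thesis by (simp only: Setcompr_eq_image)
 qed
 ultimately show ?thesis by simp
qed

text \<open>The Grothendieck monoid is a refinement monoid: a splitting of the sets of one side into two
 definable pieces is transported to the other side.\<close>

definition splitting :: "('a list set \<times> 'a list set) multiset => bool" where
 "splitting P \<longleftrightarrow> (\<forall>(a, b)\<in>#P. definable A a & definable A b & a Int b = {} & definable A (a Un b))"

abbreviation joined :: "('a list set \<times> 'a list set) multiset => 'a list set multiset" where
 "joined P \<equiv> image_mset (%(a, b). a Un b) P"

definition transports :: "'a list set multiset => 'a list set multiset => bool" where
 "transports M M' \<longleftrightarrow> (ALL P. splitting P --> joined P = M -->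
 (EX P'. splitting P' & joined P' = M' & K_eq A (image_mset fst P) (image_mset fst P') &
 K_eq A (image_mset snd P) (image_mset snd P')))"

lemma splitting_add: "splitting (P + Q) \<longleftrightarrow> splitting P & splitting Q"
 unfolding splitting_def by auto

lemma splitting_single: "splitting {#(a, b)#} \<longleftrightarrow> definable A a & definable A b & a Int b = {} & definable A (a Un b)"
 unfolding splitting_def by simp

lemma splitting_refl:
 assumes "splitting P"
 shows "K_eq A (image_mset fst P) (image_mset fst P)" "K_eq A (image_mset snd P) (image_mset snd P)"
proof -
 have d: "definable A a & definable A b" if "(a, b) :# P" for a b
 using bspec[OF assms[unfolded splitting_def] that] by simp
 show "K_eq A (image_mset fst P) (image_mset fst P)" "K_eq A (image_mset snd P) (image_mset snd P)"
 by (rule K_eq.refl, use d in fastforce)+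
qed

lemma K_eq_pair: assumes "definable A a" "definable A b" "a Int b = {}" "definable A (a Un b)" shows "K_eq A {#a Un b#} {#a, b#}"
proof -
 obtain n where n: "definable_in A n (a Un b)" using assms(4) unfolding definable_def by blast
 show ?thesis
 by (rule K_eq.union[OF definable_in_sub[OF assms(1) _ n] definable_in_sub[OF assms(2) _ n] assms(3)]) blast+
qed

lemma K_eq_joined: "splitting P ==> K_eq A (joined P) (image_mset fst P + image_mset snd P)"
proof (induction P)
 case empty
 show ?case by (simp add: K_eq.refl)
next
 case (add x P)
 obtain a b where x: "x = (a, b)" by (cases x)
 have "splitting {#(a, b)#}" "splitting P" using add.prems unfolding x splitting_def by simp_all
 hence "K_eq A {#a Un b#} {#a, b#}" "K_eq A (joined P) (image_mset fst P + image_mset snd P)"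
 using add.IH by (auto simp: splitting_single intro: K_eq_pair)
 from K_eq.add[OF this] show ?case unfolding x by (simp add: add_mset_commute)
qed

lemma transports_singleI:
 assumes "!!a b. a Un b = X ==> splitting {#(a, b)#} ==> EX P'. splitting P' & joined P' = M' &
 K_eq A {#a#} (image_mset fst P') & K_eq A {#b#} (image_mset snd P')"
 shows "transports {#X#} M'"
 unfolding transports_def
proof (intro allI impI)
 fix P assume P: "splitting P" "joined P = {#X#}"
 hence "size P = 1" by (metis size_image_mset size_single)
 then obtain x where "P = {#x#}" using size_1_singleton_mset by blast
 then obtain a b where ab: "P = {#(a, b)#}" by (cases x) simp
 have "EX P'. splitting P' & joined P' = M' & K_eq A {#a#} (image_mset fst P') & K_eq A {#b#} (image_mset snd P')"
 by (rule assms) (use P ab in simp_all)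
 thus "EX P'. splitting P' & joined P' = M' & K_eq A (image_mset fst P) (image_mset fst P') &
 K_eq A (image_mset snd P) (image_mset snd P')" unfolding ab by simp
qed

lemma transports_trans: assumes "transports M M'" "transports M' M''" shows "transports M M''"
 unfolding transports_def
proof (intro allI impI)
 fix P assume "splitting P" "joined P = M"
 then obtain P' where P': "splitting P'" "joined P' = M'" "K_eq A (image_mset fst P) (image_mset fst P')"
 "K_eq A (image_mset snd P) (image_mset snd P')" using assms(1) unfolding transports_def by blast
 then obtain P'' where P'': "splitting P''" "joined P'' = M''" "K_eq A (image_mset fst P') (image_mset fst P'')"
 "K_eq A (image_mset snd P') (image_mset snd P'')" using assms(2) unfolding transports_def by blast
 show "EX P'. splitting P' & joined P' = M'' & K_eq A (image_mset fst P) (image_mset fst P') &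
 K_eq A (image_mset snd P) (image_mset snd P')"
 using P''(1,2) K_eq.trans[OF P'(3) P''(3)] K_eq.trans[OF P'(4) P''(4)] by blast
qed

lemma transports_add: assumes "transports M M'" "transports N1 N2" shows "transports (M + N1) (M' + N2)"
 unfolding transports_def
proof (intro allI impI)
 fix P assume P: "splitting P" "joined P = M + N1"
 from image_mset_eq_plusD[OF P(2)] obtain P1 P2 where P12: "P = P1 + P2" "M = joined P1" "N1 = joined P2" by blast
 have "splitting P1" "splitting P2" using P(1) unfolding P12(1) splitting_add by blast+
 then obtain Q1 Q2 where Q: "splitting Q1" "joined Q1 = M'" "K_eq A (image_mset fst P1) (image_mset fst Q1)"
 "K_eq A (image_mset snd P1) (image_mset snd Q1)" "splitting Q2" "joined Q2 = N2"
 "K_eq A (image_mset fst P2) (image_mset fst Q2)" "K_eq A (image_mset snd P2) (image_mset snd Q2)"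
 using assms P12(2,3) unfolding transports_def by metis
 show "EX P'. splitting P' & joined P' = M' + N2 & K_eq A (image_mset fst P) (image_mset fst P') &
 K_eq A (image_mset snd P) (image_mset snd P')"
 using Q(1,2,5,6) K_eq.add[OF Q(3,7)] K_eq.add[OF Q(4,8)]
 by (intro exI[of _ "Q1 + Q2"]) (simp add: splitting_add P12(1))
qed

lemma transports_bij:
 assumes f: "bij_betw f X Y" "definable A {xs @ f xs | xs. xs : X}" and X: "definable A X" and Y: "definable A Y"
 shows "transports {#X#} {#Y#}"
proof (rule transports_singleI)
 fix a b assume ab: "a Un b = X" "splitting {#(a, b)#}"
 have d: "definable A a" "definable A b" "a Int b = {}" using ab(2) unfolding splitting_single by blast+
 have 1: "definable A (f ` a) & K_eq A {#a#} {#f ` a#}" by (rule definable_bij_restrict[OF f X Y d(1)]) (use ab in blast)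
 have 2: "definable A (f ` b) & K_eq A {#b#} {#f ` b#}" by (rule definable_bij_restrict[OF f X Y d(2)]) (use ab in blast)
 have un: "f ` a Un f ` b = Y" using f(1) ab(1) unfolding bij_betw_def by blast
 have "inj_on f X" using f(1) by (simp add: bij_betw_def)
 hence "f ` a Int f ` b = f ` (a Int b)" using ab(1) by (intro inj_on_image_Int[symmetric]) auto
 hence "f ` a Int f ` b = {}" using d(3) by simp
 thus "EX P'. splitting P' & joined P' = {#Y#} & K_eq A {#a#} (image_mset fst P') & K_eq A {#b#} (image_mset snd P')"
 using 1 2 un Y by (intro exI[of _ "{#(f ` a, f ` b)#}"]) (simp add: splitting_single)
qed

text \<open>Both directions are proved together because the induction passes through symmetry. Along
  a bijection the pieces are mapped; from a union to its two summands they are intersected with the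
  summands, and in the other direction they are joined.\<close>

lemma K_eq_transports: "K_eq A M M' ==> transports M M' & transports M' M"
proof (induction rule: K_eq.induct)
 case (refl M)
 have "transports M M" unfolding transports_def using splitting_refl by blast
 thus ?case by blast
next
 case (sym M M')
 thus ?case by blast
next
 case (trans M M' M'')
 thus ?case using transports_trans by blast
next
 case (add M M' P P')
 thus ?case using transports_add by blast
next
 case empty
 have "transports {#{}#} {#}"
 proof (rule transports_singleI)
 fix a b :: "'a list set" assume "a Un b = {}"
 hence "a = {}" "b = {}" by blast+
 thus "EX P'. splitting P' & joined P' = {#} & K_eq A {#a#} (image_mset fst P') & K_eq A {#b#} (image_mset snd P')"
 by (intro exI[of _ "{#}"]) (simp add: splitting_def K_eq.empty)
 qed
 moreover have "transports {#} {#{}#}" unfolding transports_def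
 by (auto intro!: exI[of _ "{#({}, {})#}"] K_eq.sym[OF K_eq.empty] simp: splitting_single definable_empty)
 ultimately show ?case by blast
next
 case (union n X1 X2)
 have def1: "definable A X" if "definable_in A n X" for X using that by (rule definable_inI)
 have "transports {#X1 Un X2#} {#X1, X2#}"
 proof (rule transports_singleI)
 fix a b assume ab: "a Un b = X1 Un X2" "splitting {#(a, b)#}"
 have X12: "definable_in A n (X1 Un X2)" by (rule definable_in_Un[OF union.hyps(1,2)])
 have dab: "definable_in A n a" "definable_in A n b" "a Int b = {}"
 using ab(2) definable_in_sub[OF _ _ X12] unfolding splitting_single ab(1)[symmetric] by blast+
 let ?P = "{#(a Int X1, b Int X1), (a Int X2, b Int X2)#}"
 have K: "K_eq A {#c#} {#c Int X1, c Int X2#}" if "definable_in A n c" "c <= X1 Un X2" for c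
 proof -
 have "c = (c Int X1) Un (c Int X2)" using that(2) by blast
 moreover have "K_eq A {#(c Int X1) Un (c Int X2)#} {#c Int X1, c Int X2#}"
 by (rule K_eq.union[OF definable_in_Int[OF that(1) union.hyps(1)] definable_in_Int[OF that(1) union.hyps(2)]])
 (use union.hyps(3) in blast)
 ultimately show ?thesis by simp
 qed
 have un: "(a Int X1) Un (b Int X1) = X1" "(a Int X2) Un (b Int X2) = X2" using ab(1) by blast+
 have "splitting ?P" unfolding splitting_def using dab un union.hyps(1,2)
 by (auto intro!: def1 definable_in_Int)
 moreover have "joined ?P = {#X1, X2#}" using un by simp
 moreover have "K_eq A {#a#} (image_mset fst ?P)" "K_eq A {#b#} (image_mset snd ?P)"
 using K[OF dab(1)] K[OF dab(2)] ab(1) by auto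
 ultimately show "EX P'. splitting P' & joined P' = {#X1, X2#} & K_eq A {#a#} (image_mset fst P') & K_eq A {#b#} (image_mset snd P')"
 by blast
 qed
 moreover have "transports {#X1, X2#} {#X1 Un X2#}" unfolding transports_def
 proof (intro allI impI)
 fix P assume P: "splitting P" "joined P = {#X1, X2#}"
 have "joined P = {#X1#} + {#X2#}" using P(2) by simp
 from image_mset_eq_plusD[OF this] obtain P1 P2 where P12: "P = P1 + P2" "{#X1#} = joined P1" "{#X2#} = joined P2" by blast
 have "size P1 = 1" "size P2 = 1" using arg_cong[OF P12(2), of size] arg_cong[OF P12(3), of size] by simp_all
 then obtain x y where "P1 = {#x#}" "P2 = {#y#}" using size_1_singleton_mset by blast
 then obtain a b c d where abcd: "P1 = {#(a, b)#}" "P2 = {#(c, d)#}" by (cases x, cases y) simp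
 have X: "a Un b = X1" "c Un d = X2" using P12(2,3) abcd by simp_all
 have s: "splitting {#(a, b)#}" "splitting {#(c, d)#}" using P(1) unfolding P12(1) splitting_add abcd by blast+
 have D: "definable_in A n a" "definable_in A n b" "definable_in A n c" "definable_in A n d"
 using s definable_in_sub[OF _ _ union.hyps(1)] definable_in_sub[OF _ _ union.hyps(2)] X
 unfolding splitting_single by blast+
 have disj: "a Int b = {}" "c Int d = {}" using s unfolding splitting_single by blast+
 have "splitting {#(a Un c, b Un d)#}" unfolding splitting_single
 using D disj X union.hyps(3) by (auto intro!: def1 definable_in_Un)
 moreover have "joined {#(a Un c, b Un d)#} = {#X1 Un X2#}" using X by auto
 moreover have "K_eq A (image_mset fst P) {#a Un c#}" "K_eq A (image_mset snd P) {#b Un d#}"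
 proof -
 have "K_eq A {#a Un c#} {#a, c#}" by (rule K_eq.union[OF D(1,3)]) (use X union.hyps(3) in blast)
 moreover have "image_mset fst P = {#a, c#}" unfolding P12(1) abcd by (simp add: add_mset_commute)
 ultimately show "K_eq A (image_mset fst P) {#a Un c#}" by (simp only: K_eq.sym)
 have "K_eq A {#b Un d#} {#b, d#}" by (rule K_eq.union[OF D(2,4)]) (use X union.hyps(3) in blast)
 moreover have "image_mset snd P = {#b, d#}" unfolding P12(1) abcd by (simp add: add_mset_commute)
 ultimately show "K_eq A (image_mset snd P) {#b Un d#}" by (simp only: K_eq.sym)
 qed
 ultimately show "EX P'. splitting P' & joined P' = {#X1 Un X2#} & K_eq A (image_mset fst P) (image_mset fst P') &
 K_eq A (image_mset snd P) (image_mset snd P')" by (intro exI[of _ "{#(a Un c, b Un d)#}"]) simp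
 qed
 ultimately show ?case by blast
next
 case (bij X1 X2)
 obtain f where f: "bij_betw f X1 X2" "definable A {xs @ f xs | xs. xs : X1}"
 using bij.hyps(3) unfolding definable_bij_def by blast
 show ?case
 using transports_bij[OF f bij.hyps(1,2)]
 transports_bij[OF bij_betw_inv_into[OF f(1)] definable_bij_sym[OF f bij.hyps(1,2)] bij.hyps(2,1)] by blast
qed

text \<open>The pairs \<open>(X, {})\<close> for \<open>M1\<close> and \<open>({}, X)\<close> for
  \<open>M2\<close> form a splitting of the left-hand side that remembers the origin of each set.
  Its transport to the right-hand side is sorted according to \<open>M1'\<close> and
  \<open>M2'\<close>.\<close>

theorem K_eq_refine:
 assumes "K_eq A (M1 + M2) (M1' + M2')"
 shows "EX W11 W12 W21 W22. K_eq A M1 (W11 + W12) & K_eq A M2 (W21 + W22) &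
 K_eq A M1' (W11 + W21) & K_eq A M2' (W12 + W22)"
proof -
 have def: "\<forall>X\<in>#M1 + M2. definable A X" using K_eq_definable[OF assms] by blast
 let ?P = "image_mset (%X. (X, {})) M1 + image_mset (%X. ({}, X)) M2"
 have sp: "splitting ?P" unfolding splitting_def using def definable_empty by auto
 have jo: "joined ?P = M1 + M2" by (simp add: image_mset.compositionality comp_def)
 obtain P' where P': "splitting P'" "joined P' = M1' + M2'" "K_eq A (image_mset fst ?P) (image_mset fst P')"
 "K_eq A (image_mset snd ?P) (image_mset snd P')"
 using K_eq_transports[OF assms] sp jo unfolding transports_def by blast
 from image_mset_eq_plusD[OF P'(2)] obtain P1 P2 where P12: "P' = P1 + P2" "M1' = joined P1" "M2' = joined P2" by blast
 have s: "splitting P1" "splitting P2" using P'(1) unfolding P12(1) splitting_add by blast+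
 have empties: "K_eq A (image_mset (%X. {}) M) {#}" for M :: "'a list set multiset"
 proof (induction M)
 case (add X M)
 from K_eq.add[OF K_eq.empty add] show ?case by simp
 qed (simp add: K_eq.refl)
 have fst: "image_mset fst ?P = M1 + image_mset (%X. {}) M2" and snd: "image_mset snd ?P = image_mset (%X. {}) M1 + M2"
 by (simp_all add: image_mset.compositionality comp_def)
 have "K_eq A M1 M1" "K_eq A M2 M2" using def by (simp_all add: K_eq.refl)
 from K_eq.add[OF this(1) empties[of M2]] K_eq.add[OF empties[of M1] this(2)]
 have "K_eq A (image_mset fst ?P) M1" "K_eq A (image_mset snd ?P) M2" unfolding fst snd by simp_all
 hence "K_eq A M1 (image_mset fst P1 + image_mset fst P2)" "K_eq A M2 (image_mset snd P1 + image_mset snd P2)"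
 using P'(3,4) unfolding P12(1) image_mset_union by (blast intro: K_eq.trans K_eq.sym)+
 moreover have "K_eq A M1' (image_mset fst P1 + image_mset snd P1)" "K_eq A M2' (image_mset fst P2 + image_mset snd P2)"
 unfolding P12(2,3) by (rule K_eq_joined[OF s(1)], rule K_eq_joined[OF s(2)])
 ultimately show ?thesis by blast
qed

end

section \<open>Relations between intervals, and absorption by unbounded monomials\<close>

context group_extension
begin

lemma N_inf_cases: assumes "g : N_inf" obtains a where "g = Fin a" "0 <= a" | "g = Pinf"
 using assms by (auto simp: N_inf_def N_def)

lemma Fin_in: "0 <= a ==> Fin a : N_inf" and Pinf_in: "Pinf : N_inf"
 by (simp_all add: N_inf_def N_def)

lemma one_nonneg: "0 <= \<iota> 1"
 using elementary_less[OF \<iota>, of 0 1] by (simp add: elementary_zero[OF \<iota>])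

lemma N_inf_zero: "0 : N_inf" and N_inf_emb: "emb 1 : N_inf"
 using one_nonneg by (simp_all add: N_inf_def N_def zero_extended_def)

lemma N_inf_add: "g : N_inf ==> h : N_inf ==> g + h : N_inf"
 by (auto simp: N_inf_def N_def)

lemma j_le: "j a <= j b \<longleftrightarrow> a <= b"
 using elementary_less[OF j, of b a] by (simp add: not_less[symmetric])

lemma j_nonneg: "0 <= j a \<longleftrightarrow> 0 <= a"
 using j_le[of 0 a] by (simp add: elementary_zero[OF j])

lemma definable_gens: "\<forall>g\<in>N_inf. definable Z (v g)"
 using definable_v definable_inI by blast

lemma K_eq_images:
 assumes "definable_in Z 1 X" "definable_in Z 1 Y" "AM 1 1 F" "AM 1 1 G" "inj_on F X" "inj_on G Y"
 "F ` X Int G ` Y = {}" "F ` X Un G ` Y = W"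
 shows "K_eq Z {#X, Y#} {#W#}"
proof -
 have e: "{#U#} + {#V#} = {#U, V#}" for U V :: "'m list set" by (simp add: add_mset_commute)
 have 1: "K_eq Z {#X, Y#} {#F ` X, G ` Y#}"
 using K_eq.add[OF K_affine[OF assms(1,3,5)] K_affine[OF assms(2,4,6)]] unfolding e .
 have 2: "K_eq Z {#F ` X Un G ` Y#} {#F ` X, G ` Y#}"
 by (rule K_eq.union[OF definable_in_image[OF assms(1,3)] definable_in_image[OF assms(2,4)] assms(7)])
 show ?thesis using K_eq.trans[OF 1 K_eq.sym[OF 2]] unfolding assms(8) .
qed

lemma v_add_Fin:
 assumes "0 <= a" "g : N_inf"
 shows "K_eq Z {#v (Fin a), v g#} {#v (Fin a + g)#}"
proof (rule K_eq_images[where F = "%xs. xs" and G = "%xs. [xs ! 0 + j a]"])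
 have "AF 1 (%xs. xs ! 0 + j a)" by (intro AF_intros) simp_all
 from AM_Cons[OF this AM_Nil] show "AM 1 1 (%xs. [xs ! 0 + j a])" by simp
 have ja: "0 <= j a" using assms(1) j_nonneg by blast
 have vg: "xs : v g ==> EX x. xs = [x] & 0 <= x" for xs using assms(2) by (cases rule: N_inf_cases) auto
 show "inj_on (%xs. [xs ! 0 + j a]) (v g)"
 proof (rule inj_onI)
 fix xs ys assume a: "xs : v g" "ys : v g" "[xs ! 0 + j a] = [ys ! 0 + j a]"
 obtain x where "xs = [x]" using vg[OF a(1)] by blast
 moreover obtain y where "ys = [y]" using vg[OF a(2)] by blast
 ultimately show "xs = ys" using a(3) by simp
 qed
 show "(%xs. xs) ` v (Fin a) Int (%xs. [xs ! 0 + j a]) ` v g = {}"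
 proof (rule equals0I)
 fix u assume u: "u : (%xs. xs) ` v (Fin a) Int (%xs. [xs ! 0 + j a]) ` v g"
 then obtain x where x: "u = [x]" "x < j a" by auto
 from u obtain xs where xs: "xs : v g" "u = [xs ! 0 + j a]" by blast
 obtain y where y: "xs = [y]" "0 <= y" using vg[OF xs(1)] by blast
 have "x = y + j a" using x(1) xs(2) y(1) by simp
 thus False using x(2) y(2) by simp
 qed
 have img: "[y] : (%xs. [xs ! 0 + j a]) ` v g \<longleftrightarrow> [y - j a] : v g" for y
 proof
 assume "[y] : (%xs. [xs ! 0 + j a]) ` v g"
 then obtain xs where xs: "xs : v g" "y = xs ! 0 + j a" by auto
 obtain x where "xs = [x]" using vg[OF xs(1)] by blast
 thus "[y - j a] : v g" using xs by simp
 next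
 assume "[y - j a] : v g"
 thus "[y] : (%xs. [xs ! 0 + j a]) ` v g" by (intro image_eqI[of _ _ "[y - j a]"]) simp_all
 qed
 have mem: "[y] : v (Fin a) | [y - j a] : v g \<longleftrightarrow> [y] : v (Fin a + g)" for y
 using assms(2)
 proof (cases rule: N_inf_cases)
 case (1 b)
 have "0 <= j b" using 1(2) j_nonneg by blast
 hence "j a <= j a + j b" by simp
 moreover have "y - j a < j b \<longleftrightarrow> y < j a + j b" by (simp add: diff_less_eq add.commute)
 moreover have "y < j a ==> y < j a + j b" using \<open>j a <= j a + j b\<close> by (rule less_le_trans[rotated])
 moreover have "j a <= y ==> 0 <= y" using ja by (rule order_trans)
 ultimately show ?thesis
 by (cases "y < j a") (auto simp: 1 elementary_add[OF j] not_less)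
 next
 case 2
 have "j a <= y ==> 0 <= y" using ja by (rule order_trans)
 thus ?thesis by (cases "y < j a") (auto simp: 2 not_less)
 qed
 have len: "xs : v (Fin a + g) ==> EX y. xs = [y]" for xs using assms(2) by (cases rule: N_inf_cases) auto
 show "(%xs. xs) ` v (Fin a) Un (%xs. [xs ! 0 + j a]) ` v g = v (Fin a + g)"
 proof (intro subset_antisym subsetI)
 fix xs assume "xs : (%xs. xs) ` v (Fin a) Un (%xs. [xs ! 0 + j a]) ` v g"
 moreover from this obtain y where y: "xs = [y]" by auto
 ultimately show "xs : v (Fin a + g)" using mem[of y] img[of y] unfolding y by auto
 next
 fix xs assume xs: "xs : v (Fin a + g)"
 then obtain y where y: "xs = [y]" using len by blast
 show "xs : (%xs. xs) ` v (Fin a) Un (%xs. [xs ! 0 + j a]) ` v g" using xs mem[of y] img[of y] unfolding y by auto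
 qed
qed (rule definable_v[OF Fin_in[OF assms(1)]], rule definable_v[OF assms(2)], rule AM_id, simp add: inj_on_def)

text \<open>The even and the odd elements of the ray are two copies of it.\<close>

lemma v_add_Pinf: "K_eq Z {#v Pinf, v Pinf#} {#v Pinf#}"
proof (rule K_eq_images[where F = "%xs. [2 *. xs ! 0]" and G = "%xs. [2 *. xs ! 0 + one]"])
 have "AF 1 (%xs. 2 *. xs ! 0)" "AF 1 (%xs. 2 *. xs ! 0 + one)" by (intro AF_intros; simp)+
 from AM_Cons[OF this(1) AM_Nil] AM_Cons[OF this(2) AM_Nil]
 show "AM 1 1 (%xs. [2 *. xs ! 0])" "AM 1 1 (%xs. [2 *. xs ! 0 + one])" by simp_all
 have no: "2 *. x ~= 2 *. y + one" for x y
 proof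
 assume "2 *. x = 2 *. y + one"
 hence "1 *. one = 2 *. (x - y)" by (simp add: smul_diff_right algebra_simps)
 hence "mdvd 2 (1 *. one)" by (simp only: mdvd_smul_self)
 thus False using mdvd_one_iff[of 2 1] by simp
 qed
 show "(%xs. [2 *. xs ! 0]) ` v Pinf Int (%xs. [2 *. xs ! 0 + one]) ` v Pinf = {}" using no by auto
 show "(%xs. [2 *. xs ! 0]) ` v Pinf Un (%xs. [2 *. xs ! 0 + one]) ` v Pinf = v Pinf"
 proof (intro subset_antisym subsetI)
 fix xs assume "xs : (%xs. [2 *. xs ! 0]) ` v Pinf Un (%xs. [2 *. xs ! 0 + one]) ` v Pinf"
 then obtain x where x: "0 <= x" "xs = [2 *. x] | xs = [2 *. x + one]" by auto
 have 0: "0 <= 2 *. x" using x(1) by (intro smul_nonneg) simp_all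
 have "0 <= 2 *. x + one" by (rule add_nonneg_nonneg[OF 0 less_imp_le[OF one_pos]])
 with 0 x(2) show "xs : v Pinf" by auto
 next
 fix xs assume "xs : v Pinf"
 then obtain y where y: "xs = [y]" "0 <= y" by auto
 obtain z r where zr: "0 <= r" "r < 2" "y = 2 *. z + r *. one" using residue[of 2 y] by auto
 have "0 <= z"
 proof (rule ccontr)
 assume "~ 0 <= z"
 hence "z < 0" by (simp only: not_le)
 hence "z + one <= 0" using less_iff_add_one[of z 0] by blast
 hence le: "2 *. z + 2 *. one <= 0" using smul_mono[of 2 "z + one" 0] by (simp add: smul_add_right)
 have "r *. one < 2 *. one" using zr(2) by (simp only: smul_one_less)
 hence "y < 2 *. z + 2 *. one" unfolding zr(3) by (rule add_strict_left_mono)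
 from less_le_trans[OF this le] y(2) show False by (meson leD)
 qed
 hence "[z] : v Pinf" by simp
 moreover have "r = 0 | r = 1" using zr by linarith
 ultimately show "xs : (%xs. [2 *. xs ! 0]) ` v Pinf Un (%xs. [2 *. xs ! 0 + one]) ` v Pinf"
 using zr(3) unfolding y(1) by (auto intro: image_eqI[of _ _ "[z]"])
 qed
qed (rule definable_v[OF Pinf_in], rule definable_v[OF Pinf_in], auto simp: inj_on_def)

lemma v_add:
 assumes "g : N_inf" "h : N_inf" shows "K_eq Z {#v g, v h#} {#v (g + h)#}"
 using assms(1)
proof (cases rule: N_inf_cases)
 case (1 a)
 thus ?thesis using v_add_Fin assms(2) by simp
next
 case 2
 show ?thesis using assms(2)
 proof (cases rule: N_inf_cases)
 case (1 b)
 have "K_eq Z {#v h, v g#} {#v (h + g)#}" using v_add_Fin[OF 1(2) assms(1)] unfolding 1(1) .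
 thus ?thesis by (simp only: add_mset_commute[of "v h"] add.commute[of h])
 next
 case h: 2
 show ?thesis using v_add_Pinf unfolding 2 h by simp
 qed
qed

lemma v_zero: "K_eq Z {#v 0#} {#}"
proof -
 have "v 0 = {}" by (auto simp: zero_extended_def elementary_zero[OF j])
 thus ?thesis using K_eq.empty by simp
qed

lemma v_unit: "K_eq Z {#v (emb 1)#} {#{[]}#}"
proof -
 have "AM 0 1 (%xs. [0])" using AM_Cons[OF AF_const[OF zero_in] AM_Nil, of 0] by simp
 from K_affine[OF definable_in_unit this] have "K_eq Z {#{[]}#} {#{[0]}#}" by simp
 moreover have "v (emb 1) = {[0]}"
 proof -
 have "0 <= x & x < one \<longleftrightarrow> x = 0" for x
 using one_pos one_least[of x] by (metis antisym_conv2 leD order.refl)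
 thus ?thesis using one_eq by auto
 qed
 ultimately show ?thesis using K_eq.sym by simp
qed

lemma K_eq_ev: "sym_eq N_inf emb p q ==> K_eq Z (ev v p) (ev v q)"
 by (rule sym_eq_ev[of N_inf emb p q v, OF _ definable_gens N_inf_zero N_inf_emb N_inf_add v_add v_zero v_unit])

lemma carrier_N_inf: "sym_eq N_inf emb p q ==> p : sym_polys N_inf & q : sym_polys N_inf"
 by (rule sym_eq_carrier[of N_inf emb p q, OF _ N_inf_zero N_inf_emb N_inf_add])

lemma N_subset: "N <= N_inf"
 unfolding N_inf_def by (rule Un_upper1)

lemma sym_eq_N_inf: "sym_eq N emb p q ==> sym_eq N_inf emb p q"
proof (induction rule: sym_eq.induct)
 case (refl p)
 thus ?case using sym_polys_mono[OF N_subset] by (intro sym_eq.refl) blast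
next
 case (symb_add g g')
 thus ?case using N_subset by (intro sym_eq.symb_add) blast+
next
 case (trans p q r)
 from sym_eq.trans[OF trans.IH] show ?case .
next
 case (sym p q)
 from sym_eq.sym[OF sym.IH] show ?case .
next
 case (add p p' q q')
 from sym_eq.add[OF add.IH] show ?case .
next
 case (mult p p' q q')
 from sym_eq.mult[OF mult.IH] show ?case .
next
 case symb_zero
 show ?case by (rule sym_eq.symb_zero)
next
 case symb_one
 show ?case by (rule sym_eq.symb_one)
qed

text \<open>In the absence of cancellation this relation is the means of removing summands:
  \<open>x\<close> disappears next to \<open>y\<close>.\<close>

definition absorbs :: "'z extended sym_poly => 'z extended sym_poly => bool" where
 "absorbs y x \<longleftrightarrow> x : sym_polys N_inf & sym_eq N_inf emb (x + y) y"

abbreviation "E \<equiv> sym_eq N_inf emb"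
abbreviation "S \<equiv> sym_polys N_inf"

lemma absorbs_in: "absorbs y x ==> x : S & y : S"
 unfolding absorbs_def using carrier_N_inf by blast

lemma absorbs_trans: assumes "absorbs y x" "absorbs z y" shows "absorbs z x"
proof -
 have x: "x : S" and y: "E (x + y) y" "E (y + z) z" and z: "z : S" using assms absorbs_in unfolding absorbs_def by blast+
 have "E (x + z) (x + (y + z))" by (rule sym_eq.add[OF sym_eq.refl[OF x] sym_eq.sym[OF y(2)]])
 moreover have "E (x + (y + z)) (y + z)" using sym_eq.add[OF y(1) sym_eq.refl[OF z]] by (simp only: add.assoc)
 ultimately have "E (x + z) z" using sym_eq.trans[OF sym_eq.trans y(2)] by blast
 thus ?thesis unfolding absorbs_def using x by (rule conjI[rotated])
qed

lemma absorbs_mult: assumes "absorbs y x" "c : S" shows "absorbs (y * c) (x * c)"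
proof -
 have "E ((x + y) * c) (y * c)" using assms sym_eq.refl unfolding absorbs_def by (intro sym_eq.mult) blast+
 thus ?thesis using assms unfolding absorbs_def by (simp add: distrib_right sym_polys_mult)
qed

lemma absorbs_cong: assumes "absorbs y x" "E x x'" "E y y'" shows "absorbs y' x'"
proof -
 have "E (x' + y') (x + y)" by (rule sym_eq.add[OF sym_eq.sym[OF assms(2)] sym_eq.sym[OF assms(3)]])
 moreover have "E (x + y) y" using assms(1) unfolding absorbs_def by (rule conjunct2)
 ultimately have "E (x' + y') y'" by (rule sym_eq.trans[OF sym_eq.trans assms(3)])
 thus ?thesis unfolding absorbs_def using carrier_N_inf[OF assms(2)] by simp
qed

lemma absorbs_add: assumes "absorbs z x" "absorbs z y" shows "absorbs z (x + y)"
proof -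
 have x: "x : S" "y : S" "E (x + z) z" "E (y + z) z" using assms unfolding absorbs_def by blast+
 have "E (x + (y + z)) (x + z)" by (rule sym_eq.add[OF sym_eq.refl[OF x(1)] x(4)])
 hence "E (x + y + z) z" using sym_eq.trans[OF _ x(3)] by (simp only: add.assoc)
 thus ?thesis unfolding absorbs_def using x sym_polys_add by blast
qed

lemma absorbs_add_right: assumes "absorbs y x" "w : S" shows "absorbs (w + y) x"
proof -
 have "E (w + (x + y)) (w + y)" using assms sym_eq.refl unfolding absorbs_def by (intro sym_eq.add) blast+
 thus ?thesis using assms unfolding absorbs_def by (simp only: add.left_commute)
qed

abbreviation "P \<equiv> symb (Pinf :: 'z extended)"

lemma P_in: "P : S"
 by (rule sym_polys_symb[OF Pinf_in])

lemma absorbs_symb: assumes "g : N_inf" shows "absorbs P (symb g)"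
proof -
 have "g + Pinf = Pinf" using assms by (cases rule: N_inf_cases) simp_all
 thus ?thesis unfolding absorbs_def using sym_eq.symb_add[OF assms Pinf_in, of emb] sym_polys_symb[OF assms] by simp
qed

lemma absorbs_one: "absorbs P 1"
 by (rule absorbs_cong[OF absorbs_symb[OF N_inf_emb] sym_eq.symb_one sym_eq.refl[OF P_in]])

lemma P_multiple: "E (of_nat (Suc m) * P) P"
proof (induction m)
 case 0
 show ?case using sym_eq.refl[OF P_in] by simp
next
 case (Suc m)
 have PP: "E (P + P) P" using absorbs_symb[OF Pinf_in] unfolding absorbs_def by blast
 have "of_nat (Suc (Suc m)) * P = P + of_nat (Suc m) * P" by (simp add: algebra_simps)
 thus ?case using sym_eq.trans[OF sym_eq.add[OF sym_eq.refl[OF P_in] Suc] PP] by simp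
qed

text \<open>A positive natural multiple of \<open>P\<close> equals \<open>P\<close>, so
  \<open>P\<close> times the symbol of \<open>int m *. b\<close> equals \<open>P\<close> times the
  symbol of \<open>b\<close>. For large \<open>m\<close> the former symbol is the sum of the symbol
  of \<open>a\<close> and another one.\<close>

lemma absorbs_Fin:
 assumes a: "0 <= a" and b: "0 <= b" and ab: "a <= n *. b"
 shows "absorbs (P * symb (Fin b)) (P * symb (Fin a))"
proof -
 let ?m = "Suc (nat \<bar>n\<bar>)"
 have "n *. b <= int ?m *. b" using b by (intro smul_mono_left) auto
 hence z: "0 <= int ?m *. b - a" using ab by simp
 let ?z = "int ?m *. b - a"
 have sa: "symb (Fin a) : S" and sb: "symb (Fin b) : S" and sz: "symb (Fin ?z) : S"
 using a b z Fin_in by (blast intro: sym_polys_symb)+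
 have g: "Fin a + Fin z = Fin (a + z)" for z by simp
 have az: "a + ?z = int ?m *. b" by (subst add.commute) (rule diff_add_cancel)
 have 1: "E (symb (Fin a) + symb (Fin ?z)) (symb (Fin (int ?m *. b)))"
 using sym_eq.symb_add[OF Fin_in[OF a] Fin_in[OF z], of emb] unfolding g az .
 have "sym_eq N emb (symb (Fin b)) (symb (Fin b))" using b by (intro sym_eq.refl sym_polys_symb Fin_in_N)
 from sym_eq_N_inf[OF sym_eq_multiple[OF b this, of ?m]]
 have 2: "E (symb (Fin (int ?m *. b))) (of_nat ?m * symb (Fin b))" .
 have A: "E (P * (symb (Fin a) + symb (Fin ?z))) (P * (of_nat ?m * symb (Fin b)))"
 by (rule sym_eq.mult[OF sym_eq.refl[OF P_in] sym_eq.trans[OF 1 2]])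
 have e1: "P * (of_nat ?m * symb (Fin b)) = (of_nat ?m * P) * symb (Fin b)" by (simp only: ac_simps)
 have e2: "P * (symb (Fin a) + symb (Fin ?z)) = P * symb (Fin ?z) + P * symb (Fin a)"
 by (simp only: distrib_left add.commute)
 have "E ((of_nat ?m * P) * symb (Fin b)) (P * symb (Fin b))"
 by (rule sym_eq.mult[OF P_multiple sym_eq.refl[OF sb]])
 from sym_eq.trans[OF A[unfolded e1] this]
 have eq: "E (P * symb (Fin ?z) + P * symb (Fin a)) (P * symb (Fin b))" unfolding e2 .
 have "absorbs (P * symb (Fin a)) (P * symb (Fin a))" by (rule absorbs_mult[OF absorbs_symb[OF Pinf_in] sa])
 from absorbs_add_right[OF this sym_polys_mult[OF P_in sz]]
 show ?thesis by (rule absorbs_cong[OF _ sym_eq.refl[OF sym_polys_mult[OF P_in sa]] eq])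
qed

definition ob :: "'z extended => 'm option" where
 "ob g = (case g of Fin a => Some (j a) | _ => None)"

lemma ob_simps [simp]: "ob (Fin a) = Some (j a)" "ob Pinf = None"
 by (simp_all add: ob_def)

lemma absorbs_dom:
 assumes "g : N_inf" "h : N_inf" "dom (ob g) (ob h)" "c : S"
 shows "absorbs (P * (symb h * c)) (P * (symb g * c))"
proof -
 have "absorbs (P * symb h) (P * symb g)" using assms(2)
 proof (cases rule: N_inf_cases)
 case (1 b)
 obtain a n where an: "ob g = Some a" "a <= n *. j b" using assms(3) unfolding dom_def 1 by auto
 then obtain a' where a': "g = Fin a'" "a = j a'" "0 <= a'" using assms(1) by (elim N_inf_cases) auto
 have "j a' <= j (n *. b)" using an(2) unfolding a' elementary_smul[OF j] .
 thus ?thesis unfolding 1 a' by (intro absorbs_Fin[OF a'(3) 1(2), of n]) (simp only: j_le)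
 next
 case 2
 from absorbs_mult[OF absorbs_symb[OF assms(1)] P_in] show ?thesis unfolding 2 by (simp only: mult.commute)
 qed
 from absorbs_mult[OF this assms(4)] show ?thesis by (simp only: mult.assoc)
qed

text \<open>Generators larger than every standard integer. The other ones become natural numbers in
  the semiring, while generic points need sides against which \<open>one\<close> is small.\<close>

definition H :: "'z extended set" where
 "H = {Fin a | a. ALL n. n *. \<iota> 1 < a} Un {Pinf}"

lemma H_subset: "H <= N_inf"
proof
 fix g assume "g : H"
 thus "g : N_inf" unfolding H_def
 proof
 assume "g : {Fin a | a. ALL n. n *. \<iota> 1 < a}"
 then obtain a where a: "g = Fin a" "ALL n. n *. \<iota> 1 < a" by blast
 from a(2)[rule_format, of 0] show ?thesis unfolding a(1) by (intro Fin_in) simp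
 qed (simp add: Pinf_in)
qed

definition mono_list :: "'z extended list => 'z extended sym_poly" where
 "mono_list gs = prod_list (map symb gs)"

lemma mono_list_in: "set gs <= N_inf ==> mono_list gs : S"
 unfolding mono_list_def by (induction gs) (simp_all add: sym_polys_mult sym_polys_symb)

lemma mono_list: "mono_list gs = poly_of {#mset gs#}"
proof (induction gs)
 case (Cons g gs)
 thus ?case by (simp add: mono_list_def symb_poly_of poly_of_mult)
qed (simp add: mono_list_def poly_of_unit)

text \<open>Factors are exchanged one at a time with a spare factor \<open>P\<close> at hand, as
  domination yields absorption next to \<open>P\<close>. When \<open>gs\<close> is exhausted, the
  remaining factors of \<open>hs\<close> are compared with the unit, which they dominate as members
  of \<open>H\<close>.\<close>

lemma absorbs_P_mono:
 assumes "length gs <= length hs" "\<forall>i<length gs. dom (ob (gs ! i)) (ob (hs ! i))" "set gs <= N_inf" "set hs <= H"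
 shows "absorbs (P * mono_list hs) (P * mono_list gs)"
 using assms
proof (induction hs arbitrary: gs)
 case Nil
 thus ?case using absorbs_symb[OF Pinf_in] by (simp add: mono_list_def)
next
 case (Cons h hs)
 have h: "h : H" "h : N_inf" and hs: "set hs <= H" "mono_list hs : S" using Cons.prems(4) H_subset mono_list_in by auto
 show ?case
 proof (cases gs)
 case Nil
 have 1: "absorbs (P * mono_list hs) (P * mono_list [])" by (rule Cons.IH) (use hs in simp_all)
 have "absorbs (P * (symb h * mono_list hs)) (P * mono_list hs)"
 proof -
 have "dom (ob (emb 1)) (ob h)" using h(2)
 proof (cases rule: N_inf_cases)
 case (1 b)
 have "ALL n. n *. \<iota> 1 < b" using h(1) unfolding 1 H_def by auto
 hence "1 *. \<iota> 1 < b" by (rule spec)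
 hence "\<iota> 1 <= b" by simp
 hence "j (\<iota> 1) <= 1 *. j b" by (simp add: j_le)
 hence "EX n. j (\<iota> 1) <= n *. j b" by (rule exI)
 thus ?thesis unfolding dom_def 1 by simp
 qed (simp add: dom_def)
 note A = absorbs_dom[OF N_inf_emb h(2) this hs(2)]
 have B: "E (P * (symb (emb 1) * mono_list hs)) (P * (1 * mono_list hs))"
 by (rule sym_eq.mult[OF sym_eq.refl[OF P_in] sym_eq.mult[OF sym_eq.symb_one sym_eq.refl[OF hs(2)]]])
 have "P * (symb h * mono_list hs) : S" using absorbs_in[OF A] by blast
 from absorbs_cong[OF A B sym_eq.refl[OF this]] show ?thesis by (simp only: mult_1)
 qed
 from absorbs_trans[OF 1 this] show ?thesis unfolding Nil by (simp add: mono_list_def)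
 next
 case gs: (Cons g gs')
 have g: "g : N_inf" "set gs' <= N_inf" using Cons.prems(3) unfolding gs by auto
 have dom: "dom (ob g) (ob h)" "\<forall>i<length gs'. dom (ob (gs' ! i)) (ob (hs ! i))"
 using Cons.prems(2) unfolding gs by (auto simp: All_less_Suc2)
 have "absorbs (P * mono_list hs) (P * mono_list gs')"
 by (rule Cons.IH) (use Cons.prems dom(2) g(2) hs(1) in \<open>simp_all add: gs\<close>)
 note IH = this
 have e: "P * x * symb g = P * (symb g * x)" for x by (simp only: ac_simps)
 have 1: "absorbs (P * (symb g * mono_list hs)) (P * (symb g * mono_list gs'))"
 using absorbs_mult[OF IH sym_polys_symb[OF g(1)]] unfolding e .
 from absorbs_trans[OF 1 absorbs_dom[OF g(1) h(2) dom(1) hs(2)]] show ?thesis unfolding gs by (simp add: mono_list_def)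
 qed
qed

lemma absorbs_mono:
 assumes "length gs <= length (Pinf # hs)" "\<forall>i<length gs. dom (ob (gs ! i)) (ob ((Pinf # hs) ! i))" "set gs <= N_inf" "set hs <= H"
 shows "absorbs (mono_list (Pinf # hs)) (mono_list gs)"
proof (cases gs)
 case Nil
 have "absorbs (P * mono_list hs) (P * mono_list [])" by (rule absorbs_P_mono) (use assms(4) in simp_all)
 hence "absorbs (P * mono_list hs) P" by (simp add: mono_list_def)
 from absorbs_trans[OF absorbs_one this] show ?thesis unfolding Nil by (simp add: mono_list_def)
next
 case (Cons g gs')
 have g: "g : N_inf" "set gs' <= N_inf" using assms(3) unfolding Cons by auto
 have "absorbs (P * mono_list hs) (P * mono_list gs')"
 by (rule absorbs_P_mono) (use assms g(2) in \<open>auto simp: Cons All_less_Suc2\<close>)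
 from absorbs_trans[OF absorbs_mult[OF absorbs_symb[OF g(1)] mono_list_in[OF g(2)]] this]
 show ?thesis unfolding Cons by (simp add: mono_list_def)
qed

text \<open>A generator outside \<open>H\<close> is bounded by a standard integer, hence is one
  itself, and the relations of the semiring turn it into a natural number.\<close>

lemma normal_form: "p : S ==> \<exists>p'\<in>sym_polys H. E p p'"
proof (induction rule: sym_polys_induct)
 case zero
 show ?case by (rule bexI[of _ 0]) (simp_all add: sym_eq.refl)
next
 case one
 show ?case by (rule bexI[of _ 1]) (simp_all add: sym_eq.refl)
next
 case (add p q)
 then obtain p' q' where "p' : sym_polys H" "E p p'" "q' : sym_polys H" "E q q'" by (elim bexE)
 thus ?case by (intro bexI[of _ "p' + q'"] sym_eq.add sym_polys_add)
next
 case (symb g p)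
 have "\<exists>q\<in>sym_polys H. E (symb g) q"
 proof (cases "g : H")
 case True
 hence "symb g : sym_polys H" "symb g : S" using H_subset by (auto intro: sym_polys_symb)
 thus ?thesis using sym_eq.refl by (intro bexI[of _ "symb g"])
 next
 case False
 hence "g ~= Pinf" by (auto simp: H_def)
 then obtain a where a: "g = Fin a" "0 <= a" using symb.hyps(1) by (elim N_inf_cases) auto
 interpret Z: zgroup_params "\<iota> 1" "range \<iota>" by (rule Z)
 obtain n where "~ n *. \<iota> 1 < a" using False a(1) unfolding H_def by blast
 hence "a <= n *. \<iota> 1" by (simp only: not_less)
 also have "\<dots> < (n + 1) *. \<iota> 1" using Z.one_pos by (simp add: smul_add_left)
 finally have "a < (n + 1) *. \<iota> 1" .
 from Z.bounded_multiple_of_one[OF a(2) this] obtain r where r: "0 <= r" "a = r *. \<iota> 1" by blast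
 have "sym_eq N emb (symb (Fin (\<iota> 1))) 1" using sym_eq.symb_one[of N emb] by simp
 from sym_eq_N_inf[OF sym_eq_multiple[OF one_nonneg this, of "nat r"]]
 have "E (symb g) (of_nat (nat r))" using r a(1) by simp
 thus ?thesis using sym_polys_of_nat by blast
 qed
 then obtain q where q: "q : sym_polys H" "E (symb g) q" by (elim bexE)
 obtain p' where p': "p' : sym_polys H" "E p p'" using symb.IH by (elim bexE)
 show ?case by (rule bexI[of _ "q * p'"]) (rule sym_eq.mult[OF q(2) p'(2)], rule sym_polys_mult[OF q(1) p'(1)])
qed

end

section \<open>Representation of classes, and injectivity in general\<close>

locale saturated_extension = group_extension one j \<iota>
 for one :: "'m::linordered_ab_group_add" and j :: "'z::linordered_ab_group_add => 'm" and \<iota> :: "int => 'z" +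
 fixes kp :: "'k rel"
 assumes saturated: "saturated (cardSuc kp) TYPE('m)" and kp: "Card_order kp" "|range j| \<le>o kp"
begin

lemma K_eq_image_mset: "\<forall>m\<in>#Q. K_eq Z {#f m#} {#g m#} ==> K_eq Z (image_mset f Q) (image_mset g Q)"
proof (induction Q)
 case (add m Q)
 have "K_eq Z {#f m#} {#g m#}" "K_eq Z (image_mset f Q) (image_mset g Q)" using add by simp_all
 from K_eq.add[OF this] show ?case by simp
qed (simp add: K_eq.refl)

text \<open>Decreasing order puts \<open>Pinf\<close> in front and makes the sides of the box
  decreasing, as the comparison of boxes requires.\<close>

definition lst :: "'z extended multiset => 'z extended list" where
 "lst m = rev (sorted_list_of_multiset m)"

lemma mset_lst [simp]: "mset (lst m) = m" and set_lst [simp]: "set (lst m) = set_mset m"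
 by (simp_all add: lst_def)

lemma box_list_obox: "set gs <= N_inf ==> box_list v gs = obox (map ob gs)"
proof (induction gs)
 case Nil
 show ?case by (auto simp: obox_def)
next
 case (Cons g gs)
 have vg: "v g = {[x] | x. below x (ob g)}" using Cons.prems by (auto simp: below_def elim: N_inf_cases)
 have o: "obox (map ob (g # gs)) = {x # xs | x xs. below x (ob g) & xs : obox (map ob gs)}"
 proof (intro subset_antisym subsetI)
 fix ys assume ys: "ys : obox (map ob (g # gs))"
 then obtain x xs where x: "ys = x # xs" by (cases ys) (auto simp: obox_def)
 have "\<forall>i<Suc (length gs). below ((x # xs) ! i) (map ob (g # gs) ! i)" using ys unfolding x obox_def by simp
 hence "below x (ob g)" "\<forall>i<length gs. below (xs ! i) (map ob gs ! i)" by (auto simp: All_less_Suc2)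
 thus "ys : {x # xs | x xs. below x (ob g) & xs : obox (map ob gs)}" using ys unfolding x obox_def by auto
 next
 fix ys assume "ys : {x # xs | x xs. below x (ob g) & xs : obox (map ob gs)}"
 thus "ys : obox (map ob (g # gs))" by (auto simp: obox_def All_less_Suc2)
 qed
 have "set_prod (v g) Y = {x # xs | x xs. below x (ob g) & xs : Y}" for Y
 proof (intro subset_antisym subsetI)
 fix ys assume "ys : set_prod (v g) Y"
 thus "ys : {x # xs | x xs. below x (ob g) & xs : Y}" unfolding vg by (auto elim!: set_prodE)
 next
 fix ys assume "ys : {x # xs | x xs. below x (ob g) & xs : Y}"
 then obtain x xs where "ys = [x] @ xs" "[x] : v g" "xs : Y" unfolding vg by auto
 thus "ys : set_prod (v g) Y" by (simp only: set_prodI)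
 qed
 thus ?case unfolding o using Cons by simp
qed

lemma decreasing_lst:
 assumes "set_mset m <= N_inf" shows "decreasing (map ob (lst m))"
 unfolding decreasing_def
proof (intro allI impI)
 fix i i' a assume i: "i <= i'" "i' < length (map ob (lst m))" "map ob (lst m) ! i = Some a"
 have le: "lst m ! i' <= lst m ! i"
 using i(1,2) by (intro sorted_rev_nth_mono) (simp_all add: lst_def)
 have "lst m ! i : set (lst m)" "lst m ! i' : set (lst m)" by (rule nth_mem, use i(1,2) in simp)+
 hence in_N: "lst m ! i : N_inf" "lst m ! i' : N_inf" using assms by auto
 obtain x where x: "lst m ! i = Fin x" "a = j x" using in_N(1) i by (elim N_inf_cases) auto
 obtain y where y: "lst m ! i' = Fin y" using in_N(2) le unfolding x(1) by (elim N_inf_cases) auto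
 have "y <= x" using le unfolding x y by simp
 thus "EX a'. map ob (lst m) ! i' = Some a' & a' <= a" using i(2) y x(2) j_le by auto
qed

lemma K_eq_obox:
 assumes "\<forall>m\<in>#Q. set_mset m <= N_inf"
 shows "K_eq Z (ev v (poly_of Q)) (image_mset (%m. obox (map ob (lst m))) Q)"
 unfolding ev_poly_of
proof (rule K_eq_image_mset, rule ballI)
 fix m assume "m :# Q"
 hence m: "set (lst m) <= N_inf" using assms by auto
 have "K_eq Z {#box v (mset (lst m))#} {#box_list v (lst m)#}"
 by (rule K_eq_box_list) (use m definable_gens in blast)
 thus "K_eq Z {#box v m#} {#obox (map ob (lst m))#}" unfolding box_list_obox[OF m] by simp
qed

text \<open>The summand \<open>R\<close> allows a mere part of the class on the right to be compared
  with it. Membership in \<open>H\<close> makes \<open>one\<close> small against every side, which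
  provides generic points.\<close>

lemma monomial_domination:
 assumes Q: "\<forall>m\<in>#Q. set_mset m <= H" and Q': "\<forall>m\<in>#Q'. set_mset m <= N_inf"
 and K: "K_eq Z (ev v (poly_of Q) + R) (ev v (poly_of Q'))" and m: "m :# Q"
 shows "\<exists>m'\<in>#Q'. length (lst m) <= length (lst m') & (\<forall>i<length (lst m). dom (ob (lst m ! i)) (ob (lst m' ! i)))"
proof -
 let ?o = "%m. obox (map ob (lst m))"
 obtain Q0 where Q0: "Q = add_mset m Q0" using m by (meson mset_add)
 have QN: "\<forall>m\<in>#Q. set_mset m <= N_inf" using Q H_subset by blast
 have R: "K_eq Z R R" using K_eq_definable[OF K] by (intro K_eq.refl) auto
 have K': "K_eq Z (image_mset ?o Q + R) (image_mset ?o Q')"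
 by (rule K_eq.trans[OF K_eq.sym[OF K_eq.add[OF K_eq_obox[OF QN] R]] K_eq.trans[OF K K_eq_obox[OF Q']]])
 have K'': "K_eq Z ({#?o m#} + (image_mset ?o Q0 + R)) (image_mset ?o Q')" using K' unfolding Q0 by simp
 have A: "\<forall>b\<in>set (map ob gs). ALL a. b = Some a --> a : Z" for gs
 by (auto simp: ob_def split: extended.splits)
 have "\<exists>bs'\<in>(%m. map ob (lst m)) ` set_mset Q'. obox bs' :# image_mset ?o Q' & length (map ob (lst m)) <= length bs' &
 (\<forall>i<length (map ob (lst m)). dom (map ob (lst m) ! i) (bs' ! i))"
 proof (rule box_domination[OF saturated kp _ _ K''])
 show "\<forall>b\<in>set (map ob (lst m)). small one b & (ALL a. b = Some a --> a : Z)"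
 proof
 fix b assume b: "b : set (map ob (lst m))"
 then obtain g where g: "b = ob g" "g :# m" by auto
 hence "g : H" using Q m by blast
 hence "small one b" unfolding H_def
 proof
 assume "g : {Fin a | a. ALL n. n *. \<iota> 1 < a}"
 then obtain a where a: "g = Fin a" "ALL n. n *. \<iota> 1 < a" by blast
 have "n *. one < j a" for n using a(2) elementary_less[OF j, of "n *. \<iota> 1" a] unfolding one_eq elementary_smul[OF j] by simp
 thus ?thesis unfolding g(1) a(1) small_def by simp
 qed (simp add: g(1) small_def)
 thus "small one b & (ALL a. b = Some a --> a : Z)" using A b by blast
 qed
 show "decreasing (map ob (lst m))" by (rule decreasing_lst) (use QN m in blast)
 show "EX bs'. bs' : (%m. map ob (lst m)) ` set_mset Q' & Y = obox bs'" if "Y :# image_mset ?o Q'" for Y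
 using that by auto
 show "decreasing bs' & (\<forall>b\<in>set bs'. ALL a. b = Some a --> a : Z)" if bs': "bs' : (%m. map ob (lst m)) ` set_mset Q'" for bs'
 proof -
 obtain m' where "m' :# Q'" "bs' = map ob (lst m')" using bs' by blast
 thus ?thesis using decreasing_lst[of m'] Q' A by blast
 qed
 qed
 then obtain m' where m': "m' :# Q'" "length (lst m) <= length (lst m')"
 "\<forall>i<length (lst m). dom (map ob (lst m) ! i) (map ob (lst m') ! i)" by auto
 have "dom (ob (lst m ! i)) (ob (lst m' ! i))" if "i < length (lst m)" for i using m'(2,3) that by simp
 thus ?thesis using m'(1,2) by blast
qed

definition inf_part :: "'z extended multiset multiset => 'z extended multiset multiset" where
 "inf_part Q = filter_mset (%m. Pinf :# m) Q"

definition fin_part :: "'z extended multiset multiset => 'z extended multiset multiset" where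
 "fin_part Q = filter_mset (%m. Pinf \<notin># m) Q"

lemma parts: "Q = fin_part Q + inf_part Q"
 unfolding fin_part_def inf_part_def by (simp add: add.commute)

lemma lst_Pinf: assumes "Pinf :# m" shows "EX hs. lst m = Pinf # hs"
proof -
 have P: "Pinf : set (lst m)" using assms by simp
 then obtain h hs where h: "lst m = h # hs" by (cases "lst m") (simp_all del: set_lst)
 from P obtain i where i: "i < length (lst m)" "lst m ! i = Pinf" by (auto simp del: set_lst simp add: in_set_conv_nth)
 have "lst m ! i <= lst m ! 0" using i(1) by (intro sorted_rev_nth_mono) (simp_all add: lst_def)
 hence "Pinf <= lst m ! 0" unfolding i(2) .
 hence "Pinf <= h" unfolding h by simp
 hence "h = Pinf" by (cases h) simp_all
 thus ?thesis using h by blast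
qed

lemma absorbs_poly:
 assumes "\<forall>m\<in>#Q. \<exists>m'\<in>#Q'. absorbs (poly_of {#m'#}) (poly_of {#m#})" "\<forall>m\<in>#Q'. set_mset m <= N_inf"
 shows "absorbs (poly_of Q') (poly_of Q)"
 using assms(1)
proof (induction Q)
 case empty
 have "poly_of Q' : S" using assms(2) by (simp add: poly_of_in_sym_polys)
 thus ?case by (simp add: absorbs_def sym_eq.refl)
next
 case (add m Q)
 obtain m' where m': "m' :# Q'" "absorbs (poly_of {#m'#}) (poly_of {#m#})" using add.prems by auto
 obtain Q0 where Q0: "Q' = add_mset m' Q0" using m'(1) by (meson mset_add)
 have "poly_of Q0 : S" using assms(2) unfolding Q0 by (simp add: poly_of_in_sym_polys)
 from absorbs_add_right[OF m'(2) this] have "absorbs (poly_of Q') (poly_of {#m#})"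
 unfolding Q0 by (simp add: poly_of_add[symmetric])
 moreover have "absorbs (poly_of Q') (poly_of Q)" using add by simp
 ultimately have "absorbs (poly_of Q') (poly_of {#m#} + poly_of Q)" by (rule absorbs_add)
 thus ?case by (simp add: poly_of_add[symmetric])
qed

text \<open>A monomial with an infinite factor is dominated only by monomials with an infinite
  factor. So the dominating monomials lie in the infinite part of \<open>Q'\<close>, where
  domination implies absorption.\<close>

lemma absorbs_inf_part:
 assumes Q: "\<forall>m\<in>#Q. set_mset m <= H" and Q': "\<forall>m\<in>#Q'. set_mset m <= H"
 and K: "K_eq Z (ev v (poly_of Q) + R) (ev v (poly_of Q'))" and inf: "\<forall>m\<in>#Q. Pinf :# m | (\<forall>m\<in>#Q'. Pinf :# m)"
 shows "absorbs (poly_of (inf_part Q')) (poly_of Q)"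
proof (rule absorbs_poly)
 have Q'N: "\<forall>m\<in>#Q'. set_mset m <= N_inf" and QN: "\<forall>m\<in>#Q. set_mset m <= N_inf" using Q Q' H_subset by blast+
 thus "\<forall>m\<in>#inf_part Q'. set_mset m <= N_inf" by (simp add: inf_part_def)
 show "\<forall>m\<in>#Q. \<exists>m'\<in>#inf_part Q'. absorbs (poly_of {#m'#}) (poly_of {#m#})"
 proof
 fix m assume m: "m :# Q"
 obtain m' where m': "m' :# Q'" "length (lst m) <= length (lst m')"
 "\<forall>i<length (lst m). dom (ob (lst m ! i)) (ob (lst m' ! i))"
 using monomial_domination[OF Q Q'N K m] by blast
 have P: "Pinf :# m'"
 proof (cases "\<forall>m\<in>#Q'. Pinf :# m")
 case False
 hence "Pinf :# m" using inf m by blast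
 then obtain hs where hs: "lst m = Pinf # hs" using lst_Pinf by blast
 have "dom None (ob (lst m' ! 0))" using m'(3)[rule_format, of 0] unfolding hs by simp
 hence no: "ob (lst m' ! 0) = None" unfolding dom_def by (cases "ob (lst m' ! 0)") auto
 have "0 < length (lst m')" using m'(2) unfolding hs list.size by linarith
 hence "lst m' ! 0 : set (lst m')" by (rule nth_mem)
 hence mem: "lst m' ! 0 :# m'" by simp
 hence "lst m' ! 0 : N_inf" using Q'N m'(1) by blast
 hence "lst m' ! 0 = Pinf" using no by (cases rule: N_inf_cases) auto
 thus ?thesis using mem by simp
 qed (use m'(1) in blast)
 then obtain hs where hs: "lst m' = Pinf # hs" using lst_Pinf by blast
 have sub: "set (lst m') <= H" using Q' m'(1) by auto
 have "absorbs (mono_list (Pinf # hs)) (mono_list (lst m))"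
 by (rule absorbs_mono) (use m'(2,3) sub QN m in \<open>auto simp: hs\<close>)
 hence "absorbs (poly_of {#m'#}) (poly_of {#m#})" unfolding hs[symmetric] mono_list by simp
 thus "\<exists>m'\<in>#inf_part Q'. absorbs (poly_of {#m'#}) (poly_of {#m#})" using m'(1) P by (auto simp: inf_part_def)
 qed
qed

lemma ray_eq: "v Pinf = ray"
 by (simp add: ray_def)

lemma ivl_eq: "v (Fin a) = ivl (j a)"
 by (auto simp: ivl_def)

lemma Rep_ivl: assumes "c : Z" "0 <= c" shows "Rep v N {#ivl c#}"
proof -
 obtain a where a: "c = j a" using assms(1) by blast
 hence "Fin a : N" using assms(2) j_nonneg by (simp add: Fin_in_N)
 moreover from this have "definable Z (v (Fin a))" using definable_gens N_subset by blast
 ultimately show ?thesis unfolding a ivl_eq[symmetric] by (rule Rep_gen)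
qed

lemma represent: "\<forall>X\<in>#M. definable Z X ==> Rep v N_inf M"
proof (induction M)
 case (add X M)
 have "Rep v N_inf {#X#}"
 proof (rule definable_Rep[OF definable_gens])
 show "Rep v N_inf {#ivl c#}" if "c : Z" "0 <= c" for c by (rule Rep_mono[OF Rep_ivl[OF that] N_subset])
 show "Rep v N_inf {#ray#}" unfolding ray_eq[symmetric] by (rule Rep_gen[OF Pinf_in]) (use definable_gens Pinf_in in blast)
 qed (use add.prems in simp)
 from Rep_add[OF this add.IH] add.prems show ?case by simp
qed (rule Rep_empty)

lemma represent_bounded: "\<forall>X\<in>#M. definable Z X & bounded_set X ==> Rep v N M"
proof (induction M)
 case (add X M)
 have "Rep v N {#X#}"
 by (rule bounded_Rep) (use definable_gens N_subset Rep_ivl add.prems in auto)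
 from Rep_add[OF this add.IH] add.prems show ?case by simp
qed (rule Rep_empty)

lemma represent_H:
 assumes "\<forall>X\<in>#M. definable Z X"
 obtains Q where "\<forall>m\<in>#Q. set_mset m <= H" "K_eq Z M (ev v (poly_of Q))"
proof -
 obtain p where p: "p : S" "K_eq Z M (ev v p)" using represent[OF assms] unfolding Rep_def by blast
 obtain p' where p': "p' : sym_polys H" "E p p'" using normal_form[OF p(1)] by blast
 obtain Q where Q: "p' = poly_of Q" "\<forall>m\<in>#Q. set_mset m <= H" using sym_polys_poly_of[OF p'(1)] by blast
 show thesis by (rule that[OF Q(2)]) (use K_eq.trans[OF p(2) K_eq_ev[OF p'(2)]] Q(1) in simp)
qed

text \<open>The leading factor of a monomial that dominates an infinite one would be infinite as
  well, which no factor in \<open>N\<close> is.\<close>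

lemma no_Pinf:
 assumes Q: "\<forall>m\<in>#Q. set_mset m <= H" and Q': "\<forall>m\<in>#Q'. set_mset m <= N"
 and K: "K_eq Z (ev v (poly_of Q) + R) (ev v (poly_of Q'))"
 shows "\<forall>m\<in>#Q. set_mset m <= N"
proof
 fix m assume m: "m :# Q"
 have "Pinf \<notin># m"
 proof
 assume "Pinf :# m"
 then obtain hs where hs: "lst m = Pinf # hs" using lst_Pinf by blast
 have Q'N: "\<forall>m\<in>#Q'. set_mset m <= N_inf" using Q' N_subset by blast
 obtain m' where m': "m' :# Q'" "length (lst m) <= length (lst m')"
 "\<forall>i<length (lst m). dom (ob (lst m ! i)) (ob (lst m' ! i))"
 using monomial_domination[OF Q Q'N K m] by blast
 have "dom None (ob (lst m' ! 0))" using m'(3)[rule_format, of 0] unfolding hs by simp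
 hence no: "ob (lst m' ! 0) = None" unfolding dom_def by (cases "ob (lst m' ! 0)") auto
 have "0 < length (lst m')" using m'(2) unfolding hs list.size by linarith
 hence "lst m' ! 0 : set (lst m')" by (rule nth_mem)
 hence "lst m' ! 0 : N" using Q' m'(1) by auto
 thus False using no by (auto simp: N_def)
 qed
 moreover have "set_mset m <= N_inf" using Q m H_subset by blast
 ultimately show "set_mset m <= N" unfolding N_inf_def by auto
qed

text \<open>Refinement shows that the finite parts differ only by pieces which also occur inside an
  infinite part, and an infinite part absorbs its finite pieces. The two infinite parts absorb each
  other and are therefore equal.\<close>

theorem injective:
 assumes "p : S" "q : S" "K_eq Z (ev v p) (ev v q)"
 shows "E p q"
proof -
 obtain p' q' where pq': "p' : sym_polys H" "E p p'" "q' : sym_polys H" "E q q'" using normal_form assms(1,2) by metis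
 obtain Q where Q: "p' = poly_of Q" "\<forall>m\<in>#Q. set_mset m <= H" using sym_polys_poly_of[OF pq'(1)] by blast
 obtain Q' where Q': "q' = poly_of Q'" "\<forall>m\<in>#Q'. set_mset m <= H" using sym_polys_poly_of[OF pq'(3)] by blast
 let ?F = "fin_part Q" and ?I = "inf_part Q" and ?F' = "fin_part Q'" and ?I' = "inf_part Q'"
 have K: "K_eq Z (ev v (poly_of Q)) (ev v (poly_of Q'))"
 using K_eq.trans[OF K_eq.sym[OF K_eq_ev[OF pq'(2)]] K_eq.trans[OF assms(3) K_eq_ev[OF pq'(4)]]] unfolding Q(1) Q'(1) .
 have HF: "\<forall>m\<in>#?F. set_mset m <= H" "\<forall>m\<in>#?I. set_mset m <= H" "\<forall>m\<in>#?F'. set_mset m <= H" "\<forall>m\<in>#?I'. set_mset m <= H"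
 using Q(2) Q'(2) by (simp_all add: fin_part_def inf_part_def)
 have NF: "\<forall>m\<in>#?F. set_mset m <= N" "\<forall>m\<in>#?F'. set_mset m <= N"
 using HF(1,3) H_subset unfolding N_inf_def fin_part_def by (fastforce, fastforce)
 have ii: "inf_part (inf_part M) = inf_part M" for M by (rule multiset_eqI) (simp add: inf_part_def)
 have all_inf: "\<forall>m\<in>#inf_part M. Pinf :# m" for M by (simp add: inf_part_def)
 have evQ: "ev v (poly_of Q) = ev v (poly_of ?F) + ev v (poly_of ?I)"
 by (subst parts[of Q]) (simp add: poly_of_add ev_add)
 have evQ': "ev v (poly_of Q') = ev v (poly_of ?F') + ev v (poly_of ?I')"
 by (subst parts[of Q']) (simp add: poly_of_add ev_add)
 have "K_eq Z (ev v (poly_of ?I) + ev v (poly_of ?F)) (ev v (poly_of Q'))" using K unfolding evQ by (simp only: add.commute)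
 from absorbs_inf_part[OF HF(2) Q'(2) this] have aI: "absorbs (poly_of ?I') (poly_of ?I)" using all_inf by blast
 have "K_eq Z (ev v (poly_of ?I') + ev v (poly_of ?F')) (ev v (poly_of Q))" using K_eq.sym[OF K] unfolding evQ' by (simp only: add.commute)
 from absorbs_inf_part[OF HF(4) Q(2) this] have aI': "absorbs (poly_of ?I) (poly_of ?I')" using all_inf by blast
 have EI: "E (poly_of ?I) (poly_of ?I')"
 proof -
 have 1: "E (poly_of ?I + poly_of ?I') (poly_of ?I')" using aI unfolding absorbs_def by blast
 have 2: "E (poly_of ?I' + poly_of ?I) (poly_of ?I)" using aI' unfolding absorbs_def by blast
 show ?thesis using sym_eq.trans[OF sym_eq.sym[OF 2]] 1 by (simp only: add.commute)
 qed
 \<comment> \<open>\<open>W11\<close> is common to both finite parts; \<open>W12\<close> lies in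
   \<open>?F\<close> and \<open>?I'\<close>, and \<open>W21\<close> in \<open>?I\<close> and
   \<open>?F'\<close>.\<close>
 obtain W11 W12 W21 W22 where W: "K_eq Z (ev v (poly_of ?F)) (W11 + W12)" "K_eq Z (ev v (poly_of ?I)) (W21 + W22)"
 "K_eq Z (ev v (poly_of ?F')) (W11 + W21)" "K_eq Z (ev v (poly_of ?I')) (W12 + W22)"
 using K_eq_refine[OF K[unfolded evQ evQ']] by blast
 have d: "\<forall>X\<in>#W11. definable Z X" "\<forall>X\<in>#W12. definable Z X" "\<forall>X\<in>#W21. definable Z X" "\<forall>X\<in>#W22. definable Z X"
 using K_eq_definable[OF W(1)] K_eq_definable[OF W(2)] by auto
 obtain B where B: "\<forall>m\<in>#B. set_mset m <= H" "K_eq Z W11 (ev v (poly_of B))" by (rule represent_H[OF d(1)])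
 obtain C where C: "\<forall>m\<in>#C. set_mset m <= H" "K_eq Z W12 (ev v (poly_of C))" by (rule represent_H[OF d(2)])
 obtain C' where C': "\<forall>m\<in>#C'. set_mset m <= H" "K_eq Z W21 (ev v (poly_of C'))" by (rule represent_H[OF d(3)])
 have r: "K_eq Z W22 W22" using d(4) by (rule K_eq.refl)
 have KF: "K_eq Z (ev v (poly_of ?F)) (ev v (poly_of B) + ev v (poly_of C))" by (rule K_eq.trans[OF W(1) K_eq.add[OF B(2) C(2)]])
 have KF': "K_eq Z (ev v (poly_of ?F')) (ev v (poly_of B) + ev v (poly_of C'))" by (rule K_eq.trans[OF W(3) K_eq.add[OF B(2) C'(2)]])
 have KI: "K_eq Z (ev v (poly_of C') + W22) (ev v (poly_of ?I))" by (rule K_eq.sym[OF K_eq.trans[OF W(2) K_eq.add[OF C'(2) r]]])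
 have KI': "K_eq Z (ev v (poly_of C) + W22) (ev v (poly_of ?I'))" by (rule K_eq.sym[OF K_eq.trans[OF W(4) K_eq.add[OF C(2) r]]])
 \<comment> \<open>Parts of bounded classes are represented without infinite factors, so the bounded
   case applies to the two equalities for the finite parts.\<close>
 have BN: "\<forall>m\<in>#B. set_mset m <= N" by (rule no_Pinf[OF B(1) NF(1) K_eq.sym[OF KF]])
 have CN: "\<forall>m\<in>#C. set_mset m <= N" by (rule no_Pinf[OF C(1) NF(1), of "ev v (poly_of B)"]) (use K_eq.sym[OF KF] in \<open>simp only: add.commute\<close>)
 have CN': "\<forall>m\<in>#C'. set_mset m <= N" by (rule no_Pinf[OF C'(1) NF(2), of "ev v (poly_of B)"]) (use K_eq.sym[OF KF'] in \<open>simp only: add.commute\<close>)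
 have EF: "E (poly_of ?F) (poly_of B + poly_of C)"
 by (rule sym_eq_N_inf, rule bounded_injective)
 (use NF BN CN KF in \<open>simp_all add: ev_add poly_of_in_sym_polys sym_polys_add\<close>)
 have EF': "E (poly_of ?F') (poly_of B + poly_of C')"
 by (rule sym_eq_N_inf, rule bounded_injective)
 (use NF BN CN' KF' in \<open>simp_all add: ev_add poly_of_in_sym_polys sym_polys_add\<close>)
 have aC: "absorbs (poly_of ?I') (poly_of C)" using absorbs_inf_part[OF C(1) HF(4) KI'] all_inf unfolding ii by blast
 have aC': "absorbs (poly_of ?I) (poly_of C')" using absorbs_inf_part[OF C'(1) HF(2) KI] all_inf unfolding ii by blast
 have BS: "poly_of B : S" using BN N_subset by (auto simp: poly_of_in_sym_polys)
 \<comment> \<open>The discrepancy \<open>D\<close> of the finite part vanishes next to the infinite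
   part; what is left is \<open>B\<close> plus the infinite part, for both sides.\<close>
 have key: "E (poly_of F + poly_of I) (poly_of B + poly_of J)"
 if "E (poly_of F) (poly_of B + poly_of D)" "E (poly_of I) (poly_of J)" "absorbs (poly_of J) (poly_of D)" for F I D J
 proof -
 have "E (poly_of F + poly_of I) (poly_of B + (poly_of D + poly_of J))"
 using sym_eq.add[OF that(1,2)] by (simp only: add.assoc)
 moreover have "E (poly_of B + (poly_of D + poly_of J)) (poly_of B + poly_of J)"
 using that(3) unfolding absorbs_def by (intro sym_eq.add sym_eq.refl BS) blast
 ultimately show ?thesis by (rule sym_eq.trans)
 qed
 have "absorbs (poly_of ?I') (poly_of C')" by (rule absorbs_cong[OF aC' sym_eq.refl EI]) (use absorbs_in[OF aC'] in blast)
 moreover have "E (poly_of ?I') (poly_of ?I')" using EI sym_eq.sym sym_eq.trans by blast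
 ultimately have "E (poly_of Q) (poly_of B + poly_of ?I')" "E (poly_of Q') (poly_of B + poly_of ?I')"
 using key[OF EF EI aC] key[OF EF'] parts[of Q] parts[of Q'] by (metis poly_of_add)+
 hence "E p' q'" unfolding Q(1) Q'(1) using sym_eq.trans sym_eq.sym by blast
 thus ?thesis using pq'(2,4) sym_eq.trans sym_eq.sym by metis
qed

end

section \<open>Passage to the quotient semirings\<close>

lemma UN_UN_const:
 assumes "x : A" "y : B" "!!x y. x : A ==> y : B ==> f x y = c"
 shows "(\<Union>x\<in>A. \<Union>y\<in>B. f x y) = c"
proof -
 have "(\<Union>x\<in>A. \<Union>y\<in>B. f x y) = (\<Union>x\<in>A. \<Union>y\<in>B. c)"
 by (rule SUP_cong[OF HOL.refl], rule SUP_cong[OF HOL.refl], rule assms(3))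
 also have "\<dots> = c" using assms(1,2) by auto
 finally show ?thesis .
qed

lemma UN_const:
 assumes "x : A" "!!x. x : A ==> f x = c" shows "(\<Union>x\<in>A. f x) = c"
proof -
 have "(\<Union>x\<in>A. f x) = (\<Union>x\<in>A. c)" by (rule SUP_cong[OF HOL.refl], rule assms(2))
 also have "\<dots> = c" using assms(1) by auto
 finally show ?thesis .
qed

lemma sym_class_eq: assumes "sym_eq G s p q" shows "sym_class G s p = sym_class G s q"
 unfolding sym_class_def
 by (intro Collect_cong iffI) (rule sym_eq.trans[OF sym_eq.sym[OF assms]], assumption, rule sym_eq.trans[OF assms], assumption)

lemma sym_class_self: "p : sym_polys G ==> p : sym_class G s p"
 unfolding sym_class_def by (simp add: sym_eq.refl)

lemma K_class_eq: assumes "K_eq A M M'" shows "K_class A M = K_class A M'"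
 unfolding K_class_def
 by (intro Collect_cong iffI) (rule K_eq.trans[OF K_eq.sym[OF assms]], assumption, rule K_eq.trans[OF assms], assumption)

lemma K_class_self: "\<forall>X\<in>#M. definable A X ==> M : K_class A M"
 unfolding K_class_def by (simp add: K_eq.refl)

lemma K_class_eqD: assumes "K_class A M = K_class A M'" "\<forall>X\<in>#M. definable A X" shows "K_eq A M' M"
 using K_class_self[OF assms(2), unfolded assms(1)] by (simp add: K_class_def)

lemma Sym_mult:
 assumes "p : sym_polys G" "q : sym_polys G"
 shows "sym_class G s p \<otimes>\<^bsub>Sym G s\<^esub> sym_class G s q = sym_class G s (p * q)"
proof -
 have "(\<Union>p'\<in>sym_class G s p. \<Union>q'\<in>sym_class G s q. sym_class G s (p' * q')) = sym_class G s (p * q)"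
 proof (rule UN_UN_const[OF sym_class_self[OF assms(1)] sym_class_self[OF assms(2)]])
 fix p' q' assume "p' : sym_class G s p" "q' : sym_class G s q"
 hence "sym_eq G s p p'" "sym_eq G s q q'" unfolding sym_class_def by simp_all
 from sym_class_eq[OF sym_eq.sym[OF sym_eq.mult[OF this]]] show "sym_class G s (p' * q') = sym_class G s (p * q)" .
 qed
 thus ?thesis by (simp add: Sym_def)
qed

lemma Sym_add:
 assumes "p : sym_polys G" "q : sym_polys G"
 shows "sym_class G s p \<oplus>\<^bsub>Sym G s\<^esub> sym_class G s q = sym_class G s (p + q)"
proof -
 have "(\<Union>p'\<in>sym_class G s p. \<Union>q'\<in>sym_class G s q. sym_class G s (p' + q')) = sym_class G s (p + q)"
 proof (rule UN_UN_const[OF sym_class_self[OF assms(1)] sym_class_self[OF assms(2)]])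
 fix p' q' assume "p' : sym_class G s p" "q' : sym_class G s q"
 hence "sym_eq G s p p'" "sym_eq G s q q'" unfolding sym_class_def by simp_all
 from sym_class_eq[OF sym_eq.sym[OF sym_eq.add[OF this]]] show "sym_class G s (p' + q') = sym_class G s (p + q)" .
 qed
 thus ?thesis by (simp add: Sym_def)
qed

lemma Sym_simps: "carrier (Sym G s) = sym_class G s ` sym_polys G" "\<one>\<^bsub>Sym G s\<^esub> = sym_class G s 1" "\<zero>\<^bsub>Sym G s\<^esub> = sym_class G s 0"
 by (simp_all add: Sym_def)

context zgroup_params
begin

lemma K_mult:
 assumes "\<forall>X\<in>#M. definable A X" "\<forall>X\<in>#M'. definable A X"
 shows "K_class A M \<otimes>\<^bsub>K A\<^esub> K_class A M' = K_class A (mset_prod M M')"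
proof -
 have "(\<Union>L\<in>K_class A M. \<Union>L'\<in>K_class A M'. K_class A (mset_prod L L')) = K_class A (mset_prod M M')"
 proof (rule UN_UN_const[OF K_class_self[OF assms(1)] K_class_self[OF assms(2)]])
 fix L L' assume "L : K_class A M" "L' : K_class A M'"
 hence "K_eq A M L" "K_eq A M' L'" unfolding K_class_def by simp_all
 from K_class_eq[OF K_eq.sym[OF K_eq_prod[OF this]]] show "K_class A (mset_prod L L') = K_class A (mset_prod M M')" .
 qed
 thus ?thesis by (simp add: K_def)
qed

lemma K_add:
 assumes "\<forall>X\<in>#M. definable A X" "\<forall>X\<in>#M'. definable A X"
 shows "K_class A M \<oplus>\<^bsub>K A\<^esub> K_class A M' = K_class A (M + M')"
proof -
 have "(\<Union>L\<in>K_class A M. \<Union>L'\<in>K_class A M'. K_class A (L + L')) = K_class A (M + M')"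
 proof (rule UN_UN_const[OF K_class_self[OF assms(1)] K_class_self[OF assms(2)]])
 fix L L' assume "L : K_class A M" "L' : K_class A M'"
 hence "K_eq A M L" "K_eq A M' L'" unfolding K_class_def by simp_all
 from K_class_eq[OF K_eq.sym[OF K_eq.add[OF this]]] show "K_class A (L + L') = K_class A (M + M')" .
 qed
 thus ?thesis by (simp add: K_def)
qed

end

context saturated_extension
begin

lemma definable_ev_N_inf: "p : S ==> \<forall>X\<in>#ev v p. definable Z X"
 using definable_gens by (rule definable_ev[rotated])

text \<open>The target \<open>T\<close> stands for \<open>K Z\<close> or \<open>K_b Z\<close>, which
  share their operations and differ in the carrier only.\<close>

lemma hom_evaluation:
 fixes T :: "'m list set multiset set ring"
 assumes G: "G <= N_inf" and h: "!!p. p : sym_polys G ==> h (sym_class G emb p) = K_class Z (ev v p)"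
 and T: "!!p. p : sym_polys G ==> K_class Z (ev v p) : carrier T"
 "!!x y. x \<otimes>\<^bsub>T\<^esub> y = x \<otimes>\<^bsub>K Z\<^esub> y" "!!x y. x \<oplus>\<^bsub>T\<^esub> y = x \<oplus>\<^bsub>K Z\<^esub> y"
 "\<one>\<^bsub>T\<^esub> = K_class Z {#{[]}#}" "\<zero>\<^bsub>T\<^esub> = K_class Z {#}"
 shows "h : semiring_hom (Sym G emb) T"
proof -
 have sub: "p : S" if "p : sym_polys G" for p using that sym_polys_mono[OF G] by blast
 have mult: "h (sym_class G emb p \<otimes>\<^bsub>Sym G emb\<^esub> sym_class G emb q) = h (sym_class G emb p) \<otimes>\<^bsub>T\<^esub> h (sym_class G emb q)"
 and add: "h (sym_class G emb p \<oplus>\<^bsub>Sym G emb\<^esub> sym_class G emb q) = h (sym_class G emb p) \<oplus>\<^bsub>T\<^esub> h (sym_class G emb q)"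
 if p: "p : sym_polys G" and q: "q : sym_polys G" for p q
 proof -
 note d = definable_ev_N_inf[OF sub[OF p]] definable_ev_N_inf[OF sub[OF q]]
 have "h (sym_class G emb p \<otimes>\<^bsub>Sym G emb\<^esub> sym_class G emb q) = K_class Z (ev v (p * q))"
 unfolding Sym_mult[OF p q] by (rule h[OF sym_polys_mult[OF p q]])
 also have "\<dots> = K_class Z (mset_prod (ev v p) (ev v q))"
 by (rule K_class_eq[OF K_eq_ev_mult[OF sub[OF p] sub[OF q] definable_gens]])
 finally show "h (sym_class G emb p \<otimes>\<^bsub>Sym G emb\<^esub> sym_class G emb q) = h (sym_class G emb p) \<otimes>\<^bsub>T\<^esub> h (sym_class G emb q)"
 unfolding h[OF p] h[OF q] T(2) K_mult[OF d] .
 have "h (sym_class G emb p \<oplus>\<^bsub>Sym G emb\<^esub> sym_class G emb q) = K_class Z (ev v (p + q))"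
 unfolding Sym_add[OF p q] by (rule h[OF sym_polys_add[OF p q]])
 thus "h (sym_class G emb p \<oplus>\<^bsub>Sym G emb\<^esub> sym_class G emb q) = h (sym_class G emb p) \<oplus>\<^bsub>T\<^esub> h (sym_class G emb q)"
 unfolding h[OF p] h[OF q] T(3) K_add[OF d] ev_add .
 qed
 have "h : carrier (Sym G emb) \<rightarrow> carrier T" unfolding Sym_simps using h T(1) by auto
 moreover have "h (x \<otimes>\<^bsub>Sym G emb\<^esub> y) = h x \<otimes>\<^bsub>T\<^esub> h y & h (x \<oplus>\<^bsub>Sym G emb\<^esub> y) = h x \<oplus>\<^bsub>T\<^esub> h y"
 if xy: "x : carrier (Sym G emb)" "y : carrier (Sym G emb)" for x y
 proof -
 obtain p where p: "x = sym_class G emb p" "p : sym_polys G" using xy(1) unfolding Sym_simps by (rule imageE)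
 obtain q where q: "y = sym_class G emb q" "q : sym_polys G" using xy(2) unfolding Sym_simps by (rule imageE)
 show ?thesis unfolding p(1) q(1) using mult[OF p(2) q(2)] add[OF p(2) q(2)] by (rule conjI)
 qed
 moreover have "h \<one>\<^bsub>Sym G emb\<^esub> = \<one>\<^bsub>T\<^esub>" unfolding Sym_simps T(4) h[OF sym_polys_1] ev_1 ..
 moreover have "h \<zero>\<^bsub>Sym G emb\<^esub> = \<zero>\<^bsub>T\<^esub>" unfolding Sym_simps T(5) h[OF sym_polys_0] ev_0 ..
 ultimately show ?thesis unfolding semiring_hom_def ring_hom_def by blast
qed

definition Phi :: "'z extended sym_poly set => 'm list set multiset set" where
 "Phi C = (\<Union>p\<in>C. K_class Z (ev v p))"

lemma Phi_class: assumes "p : S" shows "Phi (sym_class N_inf emb p) = K_class Z (ev v p)"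
 unfolding Phi_def
proof (rule UN_const[OF sym_class_self[OF assms]])
 fix q assume "q : sym_class N_inf emb p"
 hence "E p q" unfolding sym_class_def by simp
 from K_class_eq[OF K_eq.sym[OF K_eq_ev[OF this]]] show "K_class Z (ev v q) = K_class Z (ev v p)" .
qed

lemma Phi_hom: "Phi : semiring_hom (Sym N_inf emb) (K Z)"
proof (rule hom_evaluation[OF subset_refl Phi_class])
 show "K_class Z (ev v p) : carrier (K Z)" if "p : S" for p
 using definable_ev_N_inf[OF that] unfolding K_def by auto
qed (simp_all add: K_def)

lemma Phi_iso: "Phi : semiring_iso (Sym N_inf emb) (K Z)"
proof -
 have "inj_on Phi (carrier (Sym N_inf emb))"
 proof (rule inj_onI)
 fix x y assume xy: "x : carrier (Sym N_inf emb)" "y : carrier (Sym N_inf emb)" "Phi x = Phi y"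
 obtain p where p: "x = sym_class N_inf emb p" "p : S" using xy(1) unfolding Sym_simps by (rule imageE)
 obtain q where q: "y = sym_class N_inf emb q" "q : S" using xy(2) unfolding Sym_simps by (rule imageE)
 have "K_class Z (ev v p) = K_class Z (ev v q)" using xy(3) unfolding p(1) q(1) Phi_class[OF p(2)] Phi_class[OF q(2)] .
 from K_class_eqD[OF this definable_ev_N_inf[OF p(2)]] have "K_eq Z (ev v q) (ev v p)" .
 from sym_class_eq[OF injective[OF q(2) p(2) this]] show "x = y" unfolding p(1) q(1) by (rule HOL.sym)
 qed
 moreover have "Phi ` carrier (Sym N_inf emb) = carrier (K Z)"
 proof (intro subset_antisym subsetI)
 fix x assume "x : Phi ` carrier (Sym N_inf emb)"
 thus "x : carrier (K Z)" using Phi_hom unfolding semiring_hom_def ring_hom_def by blast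
 next
 fix x assume "x : carrier (K Z)"
 then obtain M where M: "x = K_class Z M" "\<forall>X\<in>#M. definable Z X" unfolding K_def by auto
 obtain p where p: "p : S" "K_eq Z M (ev v p)" using represent[OF M(2)] unfolding Rep_def by (elim bexE)
 have "x = Phi (sym_class N_inf emb p)" unfolding M(1) Phi_class[OF p(1)] by (rule K_class_eq[OF p(2)])
 thus "x : Phi ` carrier (Sym N_inf emb)" unfolding Sym_simps using p(1) by blast
 qed
 ultimately show ?thesis using Phi_hom unfolding semiring_iso_def bij_betw_def by blast
qed

lemma Phi_symb: assumes "a : N_inf" shows "Phi (sym_class N_inf emb (symb a)) = K_class Z {#v a#}"
 unfolding Phi_class[OF sym_polys_symb[OF assms]] ev_symb ..

lemma Phi_unique:
 assumes hom: "\<Psi> : semiring_hom (Sym N_inf emb) (K Z)"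
 and gen: "\<forall>a\<in>N_inf. \<Psi> (sym_class N_inf emb (symb a)) = K_class Z {#v a#}"
 and C: "C : carrier (Sym N_inf emb)"
 shows "\<Psi> C = Phi C"
proof -
 let ?c = "sym_class N_inf emb"
 have Psi: "\<Psi> (x \<otimes>\<^bsub>Sym N_inf emb\<^esub> y) = \<Psi> x \<otimes>\<^bsub>K Z\<^esub> \<Psi> y" "\<Psi> (x \<oplus>\<^bsub>Sym N_inf emb\<^esub> y) = \<Psi> x \<oplus>\<^bsub>K Z\<^esub> \<Psi> y"
 if "x : carrier (Sym N_inf emb)" "y : carrier (Sym N_inf emb)" for x y
 using hom that unfolding semiring_hom_def ring_hom_def by blast+
 have Ph: "Phi (x \<otimes>\<^bsub>Sym N_inf emb\<^esub> y) = Phi x \<otimes>\<^bsub>K Z\<^esub> Phi y" "Phi (x \<oplus>\<^bsub>Sym N_inf emb\<^esub> y) = Phi x \<oplus>\<^bsub>K Z\<^esub> Phi y"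
 if "x : carrier (Sym N_inf emb)" "y : carrier (Sym N_inf emb)" for x y
 using Phi_hom that unfolding semiring_hom_def ring_hom_def by blast+
 have c: "?c p : carrier (Sym N_inf emb)" if "p : S" for p using that unfolding Sym_simps by blast
 have "\<Psi> (?c p) = Phi (?c p)" if "p : S" for p
 using that
 proof (induction rule: sym_polys_induct)
 case zero
 show ?case using hom Phi_hom unfolding semiring_hom_def Sym_simps by simp
 next
 case one
 show ?case using hom Phi_hom unfolding semiring_hom_def ring_hom_def Sym_simps by simp
 next
 case (add p q)
 show ?case unfolding Sym_add[OF add.hyps(1,2), symmetric] Psi(2)[OF c[OF add.hyps(1)] c[OF add.hyps(2)]]
 Ph(2)[OF c[OF add.hyps(1)] c[OF add.hyps(2)]] add.IH ..
 next
 case (symb g p)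
 have g: "symb g : S" by (rule sym_polys_symb[OF symb.hyps(1)])
 show ?case unfolding Sym_mult[OF g symb.hyps(2), symmetric] Psi(1)[OF c[OF g] c[OF symb.hyps(2)]]
 Ph(1)[OF c[OF g] c[OF symb.hyps(2)]] symb.IH bspec[OF gen symb.hyps(1)] Phi_symb[OF symb.hyps(1)] ..
 qed
 thus ?thesis using C unfolding Sym_simps by blast
qed

lemma bounded_box: assumes "set_mset m <= N" shows "bounded_set (box v m)"
proof -
 obtain gs where gs: "mset gs = m" "box v m = box_list v gs" by (rule box_eq)
 have "set gs <= N" using assms unfolding gs(1)[symmetric] by simp
 hence "\<exists>c\<ge>0. \<forall>xs\<in>box_list v gs. \<forall>x\<in>set xs. 0 <= x & x < c"
 proof (induction gs)
 case Nil
 show ?case by auto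
 next
 case (Cons g gs)
 then obtain c where c: "0 <= c" "\<forall>xs\<in>box_list v gs. \<forall>x\<in>set xs. 0 <= x & x < c" by auto
 obtain a where a: "g = Fin a" using Cons.prems by (auto simp: N_def)
 have "\<forall>xs\<in>box_list v (g # gs). \<forall>x\<in>set xs. 0 <= x & x < max c (j a)"
 proof (intro ballI)
 fix xs x assume "xs : box_list v (g # gs)" "x : set xs"
 then obtain y ys where "xs = [y] @ ys" "0 <= y" "y < j a" "ys : box_list v gs"
 unfolding a box_list_simps by (auto elim!: set_prodE)
 thus "0 <= x & x < max c (j a)" using \<open>x : set xs\<close> c(2) by (auto simp: less_max_iff_disj)
 qed
 thus ?case using c(1) by (intro exI[of _ "max c (j a)"]) (simp add: le_max_iff_disj)
 qed
 then obtain c where c: "0 <= c" "\<forall>xs\<in>box v m. \<forall>x\<in>set xs. 0 <= x & x < c" unfolding gs(2) by blast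
 have "- c <= x" if "0 <= x" for x using c(1) that by (meson neg_le_0_iff_le order_trans)
 thus ?thesis unfolding bounded_set_def using c by blast
qed

lemma bounded_ev: assumes "p : sym_polys N" shows "\<forall>X\<in>#ev v p. definable Z X & bounded_set X"
proof -
 obtain Q where Q: "p = poly_of Q" "\<forall>m\<in>#Q. set_mset m <= N" using sym_polys_poly_of[OF assms] by blast
 have "p : S" using assms sym_polys_mono[OF N_subset] by blast
 from definable_ev_N_inf[OF this] show ?thesis using bounded_box Q(2) unfolding Q(1) ev_poly_of by auto
qed

lemma Phi_incl_class: assumes "p : sym_polys N"
 shows "Phi (sym_incl N_inf emb (sym_class N emb p)) = K_class Z (ev v p)"
proof -
 have "sym_incl N_inf emb (sym_class N emb p) = sym_class N_inf emb p" unfolding sym_incl_def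
 proof (rule UN_const[OF sym_class_self[OF assms]])
 fix q assume "q : sym_class N emb p"
 hence "sym_eq N emb p q" unfolding sym_class_def by simp
 from sym_class_eq[OF sym_eq.sym[OF sym_eq_N_inf[OF this]]] show "sym_class N_inf emb q = sym_class N_inf emb p" .
 qed
 moreover have "p : S" using assms sym_polys_mono[OF N_subset] by blast
 ultimately show ?thesis by (simp only: Phi_class)
qed

lemma carrier_K_b: "carrier (K_b Z) = K_class Z ` {M. \<forall>X\<in>#M. definable Z X & bounded_set X}"
 by (simp add: K_b_def)

lemma Phi_bounded_iso: "(%C. Phi (sym_incl N_inf emb C)) : semiring_iso (Sym N emb) (K_b Z)" (is "?h : _")
proof -
 have hom: "?h : semiring_hom (Sym N emb) (K_b Z)"
 proof (rule hom_evaluation[OF N_subset Phi_incl_class])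
 show "K_class Z (ev v p) : carrier (K_b Z)" if "p : sym_polys N" for p
 using bounded_ev[OF that] unfolding carrier_K_b by blast
 qed (simp_all add: K_b_def K_def)
 have "inj_on ?h (carrier (Sym N emb))"
 proof (rule inj_onI)
 fix x y assume xy: "x : carrier (Sym N emb)" "y : carrier (Sym N emb)" "?h x = ?h y"
 obtain p where p: "x = sym_class N emb p" "p : sym_polys N" using xy(1) unfolding Sym_simps by (rule imageE)
 obtain q where q: "y = sym_class N emb q" "q : sym_polys N" using xy(2) unfolding Sym_simps by (rule imageE)
 have "K_class Z (ev v p) = K_class Z (ev v q)" using xy(3) unfolding p(1) q(1) Phi_incl_class[OF p(2)] Phi_incl_class[OF q(2)] .
 moreover have "\<forall>X\<in>#ev v p. definable Z X" using bounded_ev[OF p(2)] by blast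
 ultimately have "K_eq Z (ev v q) (ev v p)" by (rule K_class_eqD)
 from sym_class_eq[OF bounded_injective[OF q(2) p(2) this]] show "x = y" unfolding p(1) q(1) by (rule HOL.sym)
 qed
 moreover have "?h ` carrier (Sym N emb) = carrier (K_b Z)"
 proof (intro subset_antisym subsetI)
 fix x assume "x : ?h ` carrier (Sym N emb)"
 thus "x : carrier (K_b Z)" using hom unfolding semiring_hom_def ring_hom_def by blast
 next
 fix x assume "x : carrier (K_b Z)"
 then obtain M where M: "x = K_class Z M" "\<forall>X\<in>#M. definable Z X & bounded_set X" unfolding carrier_K_b by blast
 obtain p where p: "p : sym_polys N" "K_eq Z M (ev v p)" using represent_bounded[OF M(2)] unfolding Rep_def by (elim bexE)
 have "x = ?h (sym_class N emb p)" unfolding M(1) Phi_incl_class[OF p(1)] by (rule K_class_eq[OF p(2)])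
 thus "x : ?h ` carrier (Sym N emb)" unfolding Sym_simps using p(1) by blast
 qed
 ultimately show ?thesis using hom unfolding semiring_iso_def bij_betw_def by blast
qed

end

section \<open>The Z-group axioms for elementary extensions of the integers\<close>

primrec rept :: "nat => 'c tm => 'c tm" where
 "rept 0 t = Zero"
| "rept (Suc n) t = Add (rept n t) t"

lemma val_rept: "val e (rept n t) = int n *. val e t"
 by (induction n) (simp_all add: smul_add_left add.commute)

lemma map_rept: "map_tm f (rept n t) = rept n (map_tm f t)"
 by (induction n) simp_all

lemma elementary_sat: "elementary_embedding h ==> sat (h o e) (map_fm h ph) = sat e ph"
 unfolding elementary_embedding_def by blast

text \<open>Each axiom, for a fixed divisor \<open>n\<close>, is a sentence with the parameter 1
  that holds in the integers; multiples are written out as repeated sums.\<close>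

lemma elementary_zgroup:
 assumes "elementary_embedding (h :: int => 'b::linordered_ab_group_add)"
 shows "zgroup (h 1)"
proof
 show "0 < h 1" using elementary_less[OF assms, of 0 1] by (simp add: elementary_zero[OF assms])
next
 fix x :: 'b assume x: "0 < x"
 let ?ph = "Not (Ex (And (Less Zero (Var 0)) (Less (Var 0) (Par (1 :: int)))))"
 have "sat (%_. 0) ?ph" by simp
 hence "sat (h o (%_. 0)) (map_fm h ?ph)" by (simp only: elementary_sat[OF assms])
 hence "ALL x. x <= 0 | h 1 <= x" by (auto simp: not_less)
 thus "h 1 <= x" using x by (meson leD)
next
 fix n :: int and x :: 'b assume n: "0 < n"
 let ?ph = "Not (Ex (Not (Ex (And (Not (Less (Var 1) (rept (nat n) (Var 0))))
 (Less (Var 1) (Add (rept (nat n) (Var 0)) (rept (nat n) (Par (1 :: int)))))))))"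
 have "EX y. n * y <= z & z < n * y + n" for z :: int
 proof (intro exI conjI)
 have z: "z = n * (z div n) + z mod n" by simp
 show "n * (z div n) <= z" using pos_mod_sign[OF n, of z] z by linarith
 show "z < n * (z div n) + n" using pos_mod_bound[OF n, of z] z by linarith
 qed
 hence "sat (%_. 0) ?ph" using n by (simp add: val_rept not_less)
 hence "sat (h o (%_. 0)) (map_fm h ?ph)" by (simp only: elementary_sat[OF assms])
 hence "ALL x. EX y. n *. y <= x & ~ n *. y + n *. h 1 <= x" using n by (simp add: val_rept map_rept not_less)
 hence "ALL x. EX y. n *. y <= x & x < n *. y + n *. h 1" by (simp only: not_le simp_thms)
 thus "EX y. n *. y <= x & x < n *. y + n *. h 1" by (rule spec)
qed

text \<open>For purity, \<open>d *. t = h a\<close> with \<open>a = d *. y + r *. u\<close> makes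
  \<open>d\<close> divide the remainder \<open>r\<close>, so that \<open>r = 0\<close> and
  \<open>t = h y\<close>.\<close>

lemma zgroup_params_range:
 assumes h: "elementary_embedding h" and u: "zgroup u" "zgroup (h u)"
 shows "zgroup_params (h u) (range h)"
proof (rule zgroup_params.intro[OF u(2)], rule zgroup_params_axioms.intro)
 show "h u : range h" by simp
 show "a - b : range h" if "a : range h" "b : range h" for a b
 proof -
 obtain x y where xy: "a = h x" "b = h y" using \<open>a : range h\<close> \<open>b : range h\<close> by (elim rangeE)
 have "h (x + - y) = a - b" unfolding elementary_add[OF h] elementary_uminus[OF h] xy by simp
 thus ?thesis by (metis rangeI)
 qed
 show "t : range h" if "0 < d" "d *. t : range h" for d t
 proof -
 obtain a where a: "d *. t = h a" using \<open>d *. t : range h\<close> by (elim rangeE)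
 obtain y r where yr: "0 <= r" "r < d" "a = d *. y + r *. u" using zgroup.residue[OF u(1) \<open>0 < d\<close>, of a] by (elim exE conjE)
 have eq: "d *. t = d *. h y + r *. h u" unfolding a yr(3) elementary_add[OF h] elementary_smul[OF h] ..
 hence "r *. h u = d *. (t - h y)" by (simp add: smul_diff_right)
 hence "mdvd d (r *. h u)" by (simp only: mdvd_smul_self)
 hence "d dvd r" using zgroup.mdvd_one_iff[OF u(2) \<open>0 < d\<close>] by blast
 hence "r = 0" using yr(1,2) zdvd_not_zless[of r d] by linarith
 hence "d *. t = d *. h y" using eq by simp
 hence "t = h y" using \<open>0 < d\<close> by simp
 thus ?thesis by simp
 qed
qed

lemma elementary_comp:
 assumes "elementary_embedding f" "elementary_embedding g" shows "elementary_embedding (g o f)"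
 unfolding elementary_embedding_def
proof (intro allI)
 fix ph e
 have "sat e ph = sat (f o e) (map_fm f ph)" by (simp only: elementary_sat[OF assms(1)])
 also have "\<dots> = sat (g o (f o e)) (map_fm g (map_fm f ph))" by (simp only: elementary_sat[OF assms(2)])
 finally show "sat e ph = sat ((g o f) o e) (map_fm (g o f) ph)" by (simp only: fm.map_comp comp_assoc)
qed

lemma elementary_id: "elementary_embedding id"
 unfolding elementary_embedding_def by (simp add: fm.map_id)

lemma saturated_extension_intro:
 assumes \<iota>: "elementary_embedding \<iota>" and j: "elementary_embedding (j :: 'z::linordered_ab_group_add => 'm::linordered_ab_group_add)"
 and kp: "Card_order kp" "|UNIV :: 'z set| \<le>o kp" and sat: "saturated (cardSuc kp) TYPE('m)"
 shows "saturated_extension (j (\<iota> 1)) j \<iota> kp"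
proof -
 have z1: "zgroup (1 :: int)" using elementary_zgroup[OF elementary_id] by simp
 have z2: "zgroup (\<iota> 1)" by (rule elementary_zgroup[OF \<iota>])
 have z3: "zgroup (j (\<iota> 1))" using elementary_zgroup[OF elementary_comp[OF \<iota> j]] by simp
 have "group_extension (j (\<iota> 1)) j \<iota>"
 by (intro group_extension.intro group_extension_axioms.intro zgroup_params_range[OF j z2 z3]
 zgroup_params_range[OF \<iota> z1 z2] \<iota> j HOL.refl)
 moreover have "|range j| \<le>o kp" by (rule ordLeq_transitive[OF card_of_image kp(2)])
 ultimately show ?thesis using sat kp(1) by (intro saturated_extension.intro saturated_extension_axioms.intro)
qed

theorem theorem2p15:
  fixes \<iota> :: "int \<Rightarrow> 'z::linordered_ab_group_add"
    and j :: "'z \<Rightarrow> 'm::linordered_ab_group_add"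
    and \<kappa> :: "'k rel"
    and s :: "nat \<Rightarrow> 'z extended"
    and Z :: "'m set"
  assumes Z_group: "elementary_embedding \<iota>"
    and extension: "elementary_embedding j"
    and cardinal: "Card_order \<kappa>" "|UNIV :: 'z set| \<le>o \<kappa>"
    and saturation: "saturated (cardSuc \<kappa>) TYPE('m)"
  defines "s \<equiv> \<lambda>n. Fin (\<iota> (int n))"
    and "Z \<equiv> range j"
  shows "\<exists>\<Phi>.
    \<Phi> \<in> semiring_hom (Sym N_inf s) (K Z) \<and>
    (\<forall>a\<in>N_inf. \<Phi> (sym_class N_inf s (symb a)) = K_class Z {#init_interval j a#}) \<and>
    (\<forall>\<Psi> \<in> semiring_hom (Sym N_inf s) (K Z).
       (\<forall>a\<in>N_inf. \<Psi> (sym_class N_inf s (symb a)) = K_class Z {#init_interval j a#}) \<longrightarrow>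
       (\<forall>C \<in> carrier (Sym N_inf s). \<Psi> C = \<Phi> C)) \<and>
    \<Phi> \<in> semiring_iso (Sym N_inf s) (K Z) \<and>
    (\<lambda>C. \<Phi> (sym_incl N_inf s C)) \<in> semiring_iso (Sym N s) (K_b Z)"
proof -
  interpret ext: saturated_extension "j (\<iota> 1)" j \<iota> \<kappa>
    by (rule saturated_extension_intro[OF Z_group extension cardinal saturation])
  show ?thesis unfolding s_def Z_def
    using ext.Phi_hom ext.Phi_symb ext.Phi_unique ext.Phi_iso ext.Phi_bounded_iso
    by (intro exI[of _ ext.Phi] conjI ballI impI)
qed

end
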